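(* Let $\Omega\subset\mathbb{R}^n$ be an open set, let $q>1$, $\Lambda>0$ and $f\in L^q(\Omega)$. For $\varepsilon>0$ and $u\in L^q(\Omega)$ let $$K_\varepsilon(u,\Omega)=\varepsilon^{n-1}\sup_{\mathcal G_\varepsilon}\sum_{Q'\in\mathcal G_\varepsilon}⨍_{Q'}\Big|u(x)-⨍_{Q'}u\Big|\,dx,\qquad F_\varepsilon(u,\Omega)=K_\varepsilon(u,\Omega)+\Lambda\int_\Omega|f-u|^q\,dx,$$ where $⨍$ denotes the integral average and the supremum is over all families $\mathcal G_\varepsilon$ of pairwise disjoint cubes $Q'\subset\Omega$ of side length $\varepsilon$ with arbitrary orientation. For $u\in L^q(\Omega)\cap BV(\Omega)$ let $$F(u,\Omega)=\frac14|Du|(\Omega)+\Lambda\int_\Omega|f-u|^q\,dx .$$ Then for every $\varepsilon>0$ there exists a unique $u_\varepsilon\in L^q(\Omega)$ such that $$F_\varepsilon(u_\varepsilon,\Omega)=\min_{u\in L^q(\Omega)}F_\varepsilon(u,\Omega).$$ Moreover, if $u_0$ is the unique minimizer of $F(\cdot,\Omega)$ in $L^q(\Omega)\cap BV(\Omega)$, then as $\varepsilon\to0$ $$u_\varepsilon\to u_0\ \text{ in }L^q(\Omega)\qquad\text{and}\qquad F_\varepsilon(u_\varepsilon,\Omega)\to F(u_0,\Omega).$$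
   Context: $BV(\Omega)$ is the space of $u\in L^1(\Omega)$ with finite total variation $|Du|(\Omega)$. The functionals $K_\varepsilon$ and $F_\varepsilon$ take values in $[0,+\infty]$; the supremum over families is $0$ if no cube of side $\varepsilon$ is contained in $\Omega$. *)

theory Defs
  imports "HOL-Analysis.Analysis"
begin

text \<open>
  Elements of \<open>L\<^sup>q(S)\<close> and \<open>BV(S)\<close> are represented by functions on the whole
  space, of which only the values on \<open>S\<close> matter; identity of elements is equality almost
  everywhere on \<open>S\<close>.
\<close>

definition Lq :: "real \<Rightarrow> (real^'n) set \<Rightarrow> (real^'n \<Rightarrow> real) set" where
  "Lq q S = {u. u \<in> borel_measurable (lebesgue_on S) \<and>
                integrable (lebesgue_on S) (\<lambda>x. \<bar>u x\<bar> powr q)}"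

definition Lq_norm :: "real \<Rightarrow> (real^'n) set \<Rightarrow> (real^'n \<Rightarrow> real) \<Rightarrow> real" where
  "Lq_norm q S u = (LINT x|lebesgue_on S. \<bar>u x\<bar> powr q) powr (1 / q)"

definition average :: "(real^'n) set \<Rightarrow> (real^'n \<Rightarrow> real) \<Rightarrow> real" where
  "average Q u = (LINT x|lebesgue_on Q. u x) / measure lebesgue Q"

text \<open>Cubes are open.\<close>

definition cubes :: "real \<Rightarrow> (real^'n) set set" where
  "cubes \<epsilon> = {(\<lambda>x. a + R x) ` box 0 (\<chi> i. \<epsilon>) | a (R :: real^'n \<Rightarrow> real^'n).
               orthogonal_transformation R}"

definition cube_families :: "real \<Rightarrow> (real^'n) set \<Rightarrow> (real^'n) set set set" where
  "cube_families \<epsilon> S =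
    {\<G>. \<G> \<subseteq> cubes \<epsilon> \<and> (\<forall>Q\<in>\<G>. Q \<subseteq> S) \<and> pairwise disjnt \<G>}"

text \<open>
  Families may be infinite; a sum of \<^typ>\<open>ennreal\<close> values over a family always exists
  and is the supremum of the finite partial sums.
\<close>

definition K_fun :: "real \<Rightarrow> (real^'n) set \<Rightarrow> (real^'n \<Rightarrow> real) \<Rightarrow> ennreal" where
  "K_fun \<epsilon> S u =
    ennreal (\<epsilon> ^ (CARD('n) - 1)) *
    (SUP \<G>\<in>cube_families \<epsilon> S.
       \<Sum>\<^sub>\<infinity>Q\<in>\<G>. ennreal (average Q (\<lambda>x. \<bar>u x - average Q u\<bar>)))"

definition fidelity ::
  "real \<Rightarrow> real \<Rightarrow> (real^'n \<Rightarrow> real) \<Rightarrow> (real^'n) set \<Rightarrow> (real^'n \<Rightarrow> real) \<Rightarrow> ennreal" where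
  "fidelity q \<Lambda> f S u =
    ennreal \<Lambda> * (\<integral>\<^sup>+x. ennreal (\<bar>f x - u x\<bar> powr q) \<partial>lebesgue_on S)"

definition F_eps ::
  "real \<Rightarrow> real \<Rightarrow> (real^'n \<Rightarrow> real) \<Rightarrow> real \<Rightarrow> (real^'n) set \<Rightarrow> (real^'n \<Rightarrow> real) \<Rightarrow> ennreal" where
  "F_eps q \<Lambda> f \<epsilon> S u = K_fun \<epsilon> S u + fidelity q \<Lambda> f S u"

definition C1_vector_field :: "(real^'n \<Rightarrow> real^'n) \<Rightarrow> bool" where
  "C1_vector_field \<phi> \<longleftrightarrow>
    (\<exists>\<phi>' :: real^'n \<Rightarrow> (real^'n) \<Rightarrow>\<^sub>L (real^'n).
       (\<forall>x. (\<phi> has_derivative blinfun_apply (\<phi>' x)) (at x)) \<and> continuous_on UNIV \<phi>')"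

definition divergence :: "(real^'n \<Rightarrow> real^'n) \<Rightarrow> real^'n \<Rightarrow> real" where
  "divergence \<phi> x = trace (jacobian \<phi> (at x))"

definition test_fields :: "(real^'n) set \<Rightarrow> (real^'n \<Rightarrow> real^'n) set" where
  "test_fields S =
    {\<phi>. C1_vector_field \<phi> \<and> compact (closure {x. \<phi> x \<noteq> 0}) \<and> closure {x. \<phi> x \<noteq> 0} \<subseteq> S \<and>
        (\<forall>x. norm (\<phi> x) \<le> 1)}"

text \<open>
  The total variation \<open>|Du|(S)\<close> in its dual form. Negative integrals are sent to \<open>0\<close> by
  \<^const>\<open>ennreal\<close>, which does not affect the supremum as the zero field is admissible.
\<close>

definition total_variation :: "(real^'n) set \<Rightarrow> (real^'n \<Rightarrow> real) \<Rightarrow> ennreal" where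
  "total_variation S u =
    (SUP \<phi>\<in>test_fields S. ennreal (LINT x|lebesgue_on S. u x * divergence \<phi> x))"

definition BV :: "(real^'n) set \<Rightarrow> (real^'n \<Rightarrow> real) set" where
  "BV S = {u. integrable (lebesgue_on S) u \<and> total_variation S u < \<infinity>}"

definition F_lim ::
  "real \<Rightarrow> real \<Rightarrow> (real^'n \<Rightarrow> real) \<Rightarrow> (real^'n) set \<Rightarrow> (real^'n \<Rightarrow> real) \<Rightarrow> ennreal" where
  "F_lim q \<Lambda> f S u = ennreal (1 / 4) * total_variation S u + fidelity q \<Lambda> f S u"

definition unique_minimizer ::
  "(real^'n) set \<Rightarrow> ((real^'n \<Rightarrow> real) \<Rightarrow> ennreal) \<Rightarrow> (real^'n \<Rightarrow> real) set \<Rightarrow> (real^'n \<Rightarrow> real) \<Rightarrow> bool"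
where
  "unique_minimizer S F X u \<longleftrightarrow>
    is_arg_min F (\<lambda>v. v \<in> X) u \<and>
    (\<forall>v. is_arg_min F (\<lambda>v. v \<in> X) v \<longrightarrow> (AE x in lebesgue_on S. v x = u x))"

end

theory Submission
  imports Defs
begin

text \<open>
  Existence and uniqueness of the minimizers follow from the uniform convexity of the fidelity
  term: by a quantitative midpoint inequality, near-minimizers of a midpoint convex functional plus
  the fidelity term are close in $L^q$.

  The same inequality, together with a minimax argument reducing the supremum defining $|Du|$ to
  finitely many test fields, gives convergence of the minimizers from two bounds. \<^emph>\<open>Lower bound:\<close>
  up to a small error $\frac14\int u\,\mathrm{div}\,\phi$ is the pairing of $\phi$ with the
  gradient of a mollification of $u$; on small cubes with a face orthogonal to $\phi$, testing the
  oscillation with the sign of the coordinate in the direction of $\phi$ recovers a quarter of this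
  pairing, uniformly for $u$ in bounded sets of $L^q$. \<^emph>\<open>Upper bound:\<close> replace $u$ by a
  mollification on a compact set carrying almost all of $|Du|$; there the first order Taylor
  expansion bounds the mean oscillation on a cube by a quarter of the gradient (the mean of
  $|p\cdot x|$ over a unit cube is at most $|p|/4$), and outside the Poincare inequality bounds it
  by the small remaining variation.
\<close>

text \<open>For a single test field the lower bound holds only once \<epsilon> is small enough, and
  only finitely many such conditions can be imposed together; hence the supremum over all fields has
  to be exhausted by finite families. No weak compactness enters: the infima over growing finite
  families increase to a finite limit, so near-minimizers along them have small energy gaps, and
  uniform convexity turns these into convergence in norm. In the lower bound the cubes are oriented
  by the field and not by the gradient of \<open>u\<close>. The tiling is then the same for all
  \<open>u\<close>, whence the uniformity. The oscillation of a mollification is controlled by that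
  of \<open>u\<close> because translated families of cubes compete in the same supremum. The limit
  problem is posed on functions that are also integrable, whereas the minimax yields a competitor in
  L^q only. On a set of infinite measure the two differ; a soft threshold, which cuts off small
  values and does not increase the variation, bridges the gap.\<close>

abbreviation "L1 \<equiv> integrable lborel"

abbreviation "borel_fun \<equiv> borel_measurable borel"

abbreviation "orth \<equiv> orthogonal_transformation"

section \<open>Uniform convexity of the q-th power\<close>

lemma powr_tangent_strict:
 fixes t q :: real
 assumes "q > 1" "t >= 0" "t ~= 1"
 shows "1 + q * (t - 1) < t powr q"
proof -
 have D: "((%z. z powr q) has_real_derivative q * z powr (q - 1)) (at z)" if "z > 0" for z
 using that by (rule has_real_derivative_powr)
 \<comment> \<open>The derivative is available only at positive points, so 0 stands apart. Elsewhere
   the slope \<open>q * z powr (q - 1)\<close> is below \<open>q\<close> to the left of 1 and above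
   it to the right.\<close>
 consider "t = 0" | "0 < t" "t < 1" | "t > 1" using assms by linarith
 thus ?thesis
 proof cases
 case 1 thus ?thesis using assms by simp
 next
 case 2
 obtain z where z: "t < z" "z < 1" "1 powr q - t powr q = (1 - t) * (q * z powr (q - 1))"
  using MVT2[of t 1 "%z. z powr q" "%z. q * z powr (q - 1)"] D 2 by (metis order_less_le_trans)
 have "z powr (q - 1) < 1 powr (q - 1)" using z 2 assms by (intro powr_less_mono2) auto
 hence "(1 - t) * (q * z powr (q - 1)) < (1 - t) * q" using 2 assms by (simp only: powr_one_eq_one) simp
 thus ?thesis using z by (simp add: algebra_simps)
 next
 case 3
 obtain z where z: "1 < z" "z < t" "t powr q - 1 powr q = (t - 1) * (q * z powr (q - 1))"
  using MVT2[of 1 t "%z. z powr q" "%z. q * z powr (q - 1)"] D 3 by (metis less_numeral_extra(1) order_less_le_trans)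
 have "1 < z powr (q - 1)" using z 3 assms by (simp add: gr_one_powr)
 hence "(t - 1) * q < (t - 1) * (q * z powr (q - 1))" using 3 assms by simp
 thus ?thesis using z by (simp add: algebra_simps)
 qed
qed

text \<open>Homogeneity: the supporting line at 1, taken at \<open>t / s\<close> and multiplied by
  \<open>s powr q\<close>, is the supporting line at \<open>s\<close>. For \<open>s = 0\<close> the
  left-hand side is 0, since \<open>0 powr r = 0\<close>.\<close>

lemma powr_tangent:
 fixes t s q :: real
 assumes "q > 1" "t >= 0" "s >= 0"
 shows "s powr q + q * s powr (q - 1) * (t - s) <= t powr q"
proof (cases "s = 0")
 case True thus ?thesis using assms by simp
next
 case False
 hence s: "s > 0" using assms by simp
 have "1 + q * (t / s - 1) <= (t / s) powr q"
 proof (cases "t / s = 1")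
 case True thus ?thesis using s by simp
 next
 case False
 thus ?thesis using powr_tangent_strict[of q "t / s"] assms s by simp
 qed
 hence "s powr q * (1 + q * (t / s - 1)) <= s powr q * (t / s) powr q"
 by (intro mult_left_mono) auto
 also have "... = t powr q" using s assms by (simp add: powr_divide)
 also have "s powr q * (1 + q * (t / s - 1)) = s powr q + q * s powr (q - 1) * (t - s)"
 using s by (simp add: field_simps powr_diff)
 finally show ?thesis .
qed

lemma powr_add_le:
 fixes a b q :: real
 assumes "q > 1"
 shows "\<bar>a + b\<bar> powr q <= 2 powr q * (\<bar>a\<bar> powr q + \<bar>b\<bar> powr q)"
proof -
 have "\<bar>a + b\<bar> powr q <= (2 * max \<bar>a\<bar> \<bar>b\<bar>) powr q" using assms by (intro powr_mono2) auto
 also have "... = 2 powr q * (max \<bar>a\<bar> \<bar>b\<bar>) powr q" by (simp add: powr_mult)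
 also have "(max \<bar>a\<bar> \<bar>b\<bar>) powr q <= \<bar>a\<bar> powr q + \<bar>b\<bar> powr q" by (simp add: max_def)
 finally show ?thesis by simp
qed

text \<open>Replaces Hoelder's inequality: values below \<eta> are bounded by \<eta>, larger ones by
  a multiple of their power. Integrated over a set of finite measure it controls the L1 size, with
  \<eta> free to be chosen.\<close>

lemma abs_le_powr:
 fixes t \<eta> q :: real
 assumes "q > 1" "\<eta> > 0"
 shows "\<bar>t\<bar> <= \<eta> + \<eta> powr (1 - q) * \<bar>t\<bar> powr q"
proof (cases "\<bar>t\<bar> <= \<eta>")
 case True thus ?thesis by (simp add: add_increasing2)
next
 case False
 hence "\<eta> powr (q - 1) <= \<bar>t\<bar> powr (q - 1)" using assms by (intro powr_mono2) auto
 hence "1 <= \<eta> powr (1 - q) * \<bar>t\<bar> powr (q - 1)"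
 using assms by (simp add: powr_minus_divide[of \<eta> "q - 1", simplified] pos_le_divide_eq)
 hence "\<bar>t\<bar> * 1 <= \<bar>t\<bar> * (\<eta> powr (1 - q) * \<bar>t\<bar> powr (q - 1))" by (intro mult_left_mono) auto
 also have "... = \<eta> powr (1 - q) * \<bar>t\<bar> powr q" using False assms by (simp add: powr_diff)
 finally show ?thesis using assms by linarith
qed

definition midpoint_gap :: "real => real => real => real" where
 "midpoint_gap q a b = (\<bar>a\<bar> powr q + \<bar>b\<bar> powr q) / 2 - \<bar>(a + b) / 2\<bar> powr q"

text \<open>Both \<open>\<bar>a\<bar>\<close> and \<open>\<bar>b\<bar>\<close> are compared with the
  supporting line at their mean \<open>m\<close>. The linear terms cancel in the sum, and
  \<open>\<bar>(a + b) / 2\<bar> \<le> m\<close>. If the absolute values agree, then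
  \<open>b = - a\<close> and the midpoint is 0.\<close>

lemma midpoint_gap_pos:
 assumes "q > 1" "a ~= b"
 shows "midpoint_gap q a b > 0"
proof -
 define m where "m = (\<bar>a\<bar> + \<bar>b\<bar>) / 2"
 have m: "m > 0" using assms by (auto simp: m_def)
 have ab: "\<bar>(a + b) / 2\<bar> <= m" by (simp add: m_def)
 show ?thesis
 proof (cases "\<bar>a\<bar> = \<bar>b\<bar>")
 case True
 hence "a + b = 0" "b ~= 0" using assms by (auto simp: abs_if split: if_splits)
 thus ?thesis using True by (simp add: midpoint_gap_def)
 next
 case False
 have "\<bar>a\<bar> / m ~= 1" "\<bar>b\<bar> / m ~= 1" using False m by (auto simp: m_def field_simps)
 hence "1 + q * (\<bar>a\<bar> / m - 1) < (\<bar>a\<bar> / m) powr q" "1 + q * (\<bar>b\<bar> / m - 1) < (\<bar>b\<bar> / m) powr q"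
  using powr_tangent_strict[of q] m assms by auto
 hence "2 + q * (\<bar>a\<bar> / m + \<bar>b\<bar> / m - 2) < (\<bar>a\<bar> / m) powr q + (\<bar>b\<bar> / m) powr q"
  by (simp add: algebra_simps)
 moreover have "\<bar>a\<bar> / m + \<bar>b\<bar> / m - 2 = 0" using m
  by (simp add: add_divide_distrib[symmetric], simp add: field_simps m_def)
 ultimately have "2 < (\<bar>a\<bar> powr q + \<bar>b\<bar> powr q) / m powr q"
  using m by (simp add: powr_divide add_divide_distrib)
 hence "2 * m powr q < \<bar>a\<bar> powr q + \<bar>b\<bar> powr q" using m by (simp add: field_simps)
 moreover have "\<bar>(a + b) / 2\<bar> powr q <= m powr q" using ab assms by (intro powr_mono2) auto
 ultimately show ?thesis by (simp add: midpoint_gap_def)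
 qed
qed

lemma midpoint_gap_nonneg: "q > 1 ==> midpoint_gap q a b >= 0"
 by (cases "a = b") (auto simp: midpoint_gap_pos less_imp_le, simp add: midpoint_gap_def)

lemma midpoint_gap_scale: "m >= 0 ==> midpoint_gap q (m * a) (m * b) = m powr q * midpoint_gap q a b"
proof -
 assume m: "m >= 0"
 have "(m * a + m * b) / 2 = m * ((a + b) / 2)" by (simp add: algebra_simps)
 thus ?thesis using m
 by (simp only: midpoint_gap_def abs_mult powr_mult abs_of_nonneg) (simp add: algebra_simps)
qed

text \<open>Uniform convexity for every q > 1 by compactness, in place of Clarkson's inequalities.
  Both sides are homogeneous of degree q, so pairs of maximum 1 suffice. \<open>S\<close> collects
  those where the \<eta> term does not exceed the left-hand side. On the diagonal this would force
  \<eta> <= 0, so the continuous gap has a positive minimum \<mu> on the compact set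
  \<open>S\<close>, while \<open>2 powr q\<close> bounds the left-hand side.\<close>

lemma powr_diff_le_midpoint_gap:
 fixes q \<eta> :: real
 assumes q: "q > 1" and "\<eta> > 0"
 obtains C where "C > 0"
 "!!a b. \<bar>a - b\<bar> powr q <= \<eta> * (\<bar>a\<bar> powr q + \<bar>b\<bar> powr q) + C * midpoint_gap q a b"
proof -
 define S where "S = {p :: real \<times> real. max \<bar>fst p\<bar> \<bar>snd p\<bar> = 1 &
  \<eta> * (\<bar>fst p\<bar> powr q + \<bar>snd p\<bar> powr q) <= \<bar>fst p - snd p\<bar> powr q}"
 have ct: "continuous_on UNIV (%x. \<bar>g x\<bar> powr q)" if "continuous_on UNIV g"
 for g :: "real \<times> real => real"
 using q that by (intro continuous_on_powr' continuous_intros) auto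
 have "S <= cball 0 2"
 proof
 fix p assume "p : S"
 hence "\<bar>fst p\<bar> <= 1" "\<bar>snd p\<bar> <= 1" by (auto simp: S_def)
 thus "p : cball 0 2" using norm_Pair_le[of "fst p" "snd p"] by simp
 qed
 hence "bounded S" using bounded_subset by blast
 moreover have "closed S" unfolding S_def
 by (intro closed_Collect_conj closed_Collect_eq closed_Collect_le continuous_intros ct)
 ultimately have cS: "compact S" by (simp add: compact_eq_bounded_closed)
 have contD: "continuous_on S (%p. midpoint_gap q (fst p) (snd p))"
 unfolding midpoint_gap_def
 by (rule continuous_on_subset[OF _ subset_UNIV]) (intro continuous_on_diff continuous_on_divide continuous_on_add ct continuous_on_const
  continuous_on_fst continuous_on_snd continuous_on_id, auto)
 obtain \<mu> where \<mu>: "\<mu> > 0" "!!p. p : S ==> \<mu> <= midpoint_gap q (fst p) (snd p)"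
 proof (cases "S = {}")
 case True thus ?thesis using that[of 1] by simp
 next
 case False
 obtain p where p: "p : S" "\<forall>p'\<in>S. midpoint_gap q (fst p) (snd p) <= midpoint_gap q (fst p') (snd p')"
  using continuous_attains_inf[OF cS False contD] by blast
 have "fst p ~= snd p"
 proof
  assume "fst p = snd p"
  hence "\<bar>snd p\<bar> = 1" "\<eta> * (2 * \<bar>snd p\<bar> powr q) <= 0" using p by (auto simp: S_def)
  thus False using \<open>\<eta> > 0\<close> by simp
 qed
 thus ?thesis using that[of "midpoint_gap q (fst p) (snd p)"] p midpoint_gap_pos[OF q] by auto
 qed
 show ?thesis
 proof (rule that[of "2 powr q / \<mu>"])
 show "2 powr q / \<mu> > 0" using \<mu> by simp
 fix a b :: real
 define m where "m = max \<bar>a\<bar> \<bar>b\<bar>"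
 show "\<bar>a - b\<bar> powr q <= \<eta> * (\<bar>a\<bar> powr q + \<bar>b\<bar> powr q) + 2 powr q / \<mu> * midpoint_gap q a b"
 proof (cases "m = 0")
  case True hence "a = 0" "b = 0" by (auto simp: m_def max_def split: if_splits)
  thus ?thesis by (simp add: midpoint_gap_def)
 next
  case False
  hence m: "m > 0" by (auto simp: m_def max_def split: if_splits)
  define a' b' where "a' = a / m" and "b' = b / m"
  have ab: "a = m * a'" "b = m * b'" using m by (auto simp: a'_def b'_def)
  have mx: "max \<bar>a'\<bar> \<bar>b'\<bar> = 1" using m by (auto simp: a'_def b'_def m_def max_def)
  have main: "\<bar>a' - b'\<bar> powr q <= \<eta> * (\<bar>a'\<bar> powr q + \<bar>b'\<bar> powr q) + 2 powr q / \<mu> * midpoint_gap q a' b'"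
  proof (cases "(a', b') : S")
  case True
  have "\<bar>a' - b'\<bar> powr q <= 2 powr q" using mx q by (intro powr_mono2) (auto simp: max_def split: if_splits)
  also have "... <= 2 powr q / \<mu> * midpoint_gap q a' b'"
   using \<mu>(2)[OF True] \<mu>(1) by (simp add: field_simps)
  finally show ?thesis using \<open>\<eta> > 0\<close> by (simp add: add_increasing)
  next
  case False
  hence "\<bar>a' - b'\<bar> powr q <= \<eta> * (\<bar>a'\<bar> powr q + \<bar>b'\<bar> powr q)" using mx by (auto simp: S_def)
  thus ?thesis using midpoint_gap_nonneg[OF q, of a' b'] \<mu>(1)
   by (intro add_increasing2) auto
  qed
  have "\<bar>a - b\<bar> powr q = m powr q * \<bar>a' - b'\<bar> powr q"
  using m by (simp add: ab right_diff_distrib[symmetric] abs_mult powr_mult)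
  also have "... <= m powr q * (\<eta> * (\<bar>a'\<bar> powr q + \<bar>b'\<bar> powr q) + 2 powr q / \<mu> * midpoint_gap q a' b')"
  by (intro mult_left_mono main) auto
  also have "... = \<eta> * (\<bar>a\<bar> powr q + \<bar>b\<bar> powr q) + 2 powr q / \<mu> * midpoint_gap q a b"
  using m unfolding ab
  by (simp add: midpoint_gap_scale abs_mult powr_mult) (simp add: algebra_simps)
  finally show ?thesis .
 qed
 qed
qed

section \<open>The space L^q over an arbitrary measure\<close>

definition Lp :: "real => 'a measure => ('a => real) set" where
 "Lp q M = {u. u : borel_measurable M & integrable M (%x. \<bar>u x\<bar> powr q)}"

definition Lpow :: "real => 'a measure => ('a => real) => real" where
 "Lpow q M u = (LINT x|M. \<bar>u x\<bar> powr q)"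

lemma Lpow_nonneg [simp]: "Lpow q M u >= 0"
 by (simp add: Lpow_def)

lemma Lp_measurable [measurable_dest]: "u : Lp q M ==> u : borel_measurable M"
 by (simp add: Lp_def)

lemma Lp_integrable: "u : Lp q M ==> integrable M (%x. \<bar>u x\<bar> powr q)"
 by (simp add: Lp_def)

lemma nn_integral_Lp: "u : Lp q M ==> (\<integral>\<^sup>+x. ennreal (\<bar>u x\<bar> powr q) \<partial>M) = ennreal (Lpow q M u)"
 unfolding Lpow_def by (intro nn_integral_eq_integral Lp_integrable) auto

lemma Lp_iff_nn:
 "u : Lp q M \<longleftrightarrow> u : borel_measurable M & (\<integral>\<^sup>+x. ennreal (\<bar>u x\<bar> powr q) \<partial>M) < \<infinity>"
 by (auto simp: Lp_def integrable_iff_bounded)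

lemma Lp_zero [simp]: "(%x. 0) : Lp q M" by (simp add: Lp_def)

lemma Lp_add:
 assumes "q > 1" "u : Lp q M" "v : Lp q M"
 shows "(%x. u x + v x) : Lp q M"
proof -
 have [measurable]: "u : borel_measurable M" "v : borel_measurable M" using assms by (auto simp: Lp_def)
 have "integrable M (%x. \<bar>u x + v x\<bar> powr q)"
 by (rule Bochner_Integration.integrable_bound[where f="%x. 2 powr q * (\<bar>u x\<bar> powr q + \<bar>v x\<bar> powr q)"])
  (use assms in \<open>auto simp: Lp_def powr_add_le\<close>)
 thus ?thesis by (simp add: Lp_def)
qed

lemma Lp_cmult:
 assumes "u : Lp q M" shows "(%x. c * u x) : Lp q M"
 using assms by (auto simp: Lp_def abs_mult powr_mult)

lemma Lp_diff:
 assumes "q > 1" "u : Lp q M" "v : Lp q M"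
 shows "(%x. u x - v x) : Lp q M"
 using Lp_add[OF assms(1,2) Lp_cmult[OF assms(3), of "-1"]] by simp

lemma Lp_mid:
 assumes "q > 1" "u : Lp q M" "v : Lp q M"
 shows "(%x. (u x + v x) / 2) : Lp q M"
 using Lp_cmult[OF Lp_add[OF assms], of "1/2"] by simp

lemma Lpow_add_le:
 assumes "q > 1" "u : Lp q M" "v : Lp q M"
 shows "Lpow q M (%x. u x + v x) <= 2 powr q * (Lpow q M u + Lpow q M v)"
proof -
 have "Lpow q M (%x. u x + v x) <= (LINT x|M. 2 powr q * (\<bar>u x\<bar> powr q + \<bar>v x\<bar> powr q))"
 unfolding Lpow_def
 by (intro integral_mono Lp_integrable Lp_add assms powr_add_le integrable_mult_right Bochner_Integration.integrable_add)
 also have "... = 2 powr q * (Lpow q M u + Lpow q M v)"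
 using assms by (simp add: Lpow_def Lp_integrable)
 finally show ?thesis .
qed

lemma Lpow_diff_le:
 assumes "q > 1" "u : Lp q M" "v : Lp q M"
 shows "Lpow q M (%x. u x - v x) <= 2 powr q * (Lpow q M u + Lpow q M v)"
 using Lpow_add_le[OF assms(1,2) Lp_cmult[OF assms(3), of "-1"]] by (simp add: Lpow_def)

lemma Lpow_diff_commute: "Lpow q M (%x. u x - v x) = Lpow q M (%x. v x - u x)"
 by (simp add: Lpow_def abs_minus_commute)

lemma Lpow_triangle:
 assumes "q > 1" "u : Lp q M" "v : Lp q M" "w : Lp q M"
 shows "Lpow q M (%x. u x - w x) <= 2 powr q * (Lpow q M (%x. u x - v x) + Lpow q M (%x. v x - w x))"
 using Lpow_add_le[OF assms(1) Lp_diff[OF assms(1,2,3)] Lp_diff[OF assms(1,3,4)]] by simp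

lemma Lpow_gap:
 assumes q: "q > 1" and u: "u : Lp q M" and v: "v : Lp q M"
 and C: "!!a b. \<bar>a - b\<bar> powr q <= \<eta> * (\<bar>a\<bar> powr q + \<bar>b\<bar> powr q) + C * midpoint_gap q a b"
 shows "Lpow q M (%x. u x - v x) <= \<eta> * (Lpow q M u + Lpow q M v)
  + C * ((Lpow q M u + Lpow q M v) / 2 - Lpow q M (%x. (u x + v x) / 2))"
proof -
 note ints = Lp_integrable[OF u] Lp_integrable[OF v] Lp_integrable[OF Lp_mid[OF q u v]]
 have "Lpow q M (%x. u x - v x) <= (LINT x|M. \<eta> * (\<bar>u x\<bar> powr q + \<bar>v x\<bar> powr q) + C * midpoint_gap q (u x) (v x))"
 unfolding Lpow_def
 using ints Lp_integrable[OF Lp_diff[OF q u v]]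
 by (intro integral_mono C) (auto simp: midpoint_gap_def)
 also have "... = \<eta> * (Lpow q M u + Lpow q M v)
  + C * ((Lpow q M u + Lpow q M v) / 2 - Lpow q M (%x. (u x + v x) / 2))"
 using ints by (simp add: Lpow_def midpoint_gap_def)
 finally show ?thesis .
qed

text \<open>Riesz-Fischer without a norm: \<open>Lpow\<close> obeys the triangle inequality only up
  to a factor, so sums of increments are not estimated in L^q. Instead the increments of a fast
  subsequence, weighted by \<open>2 ^ n\<close>, have summable q-th powers at almost every point,
  which bounds them by a geometric series.\<close>

lemma Lp_complete:
 fixes u :: "nat => 'a => real"
 assumes q: "q > 1" and u: "!!k. u k : Lp q M"
 and cau: "!!e. e > 0 ==> \<exists>K. \<forall>k\<ge>K. \<forall>l\<ge>K. Lpow q M (%x. u k x - u l x) < e"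
 obtains v where "v : Lp q M" "(%k. Lpow q M (%x. u k x - v x)) \<longlonglongrightarrow> 0"
proof -
 have meas [measurable]: "u k : borel_measurable M" for k using u by (simp add: Lp_def)
 \<comment> \<open>The factor \<open>(1 / 2 ^ k) powr q\<close> absorbs the weight
   \<open>2 ^ k\<close> of the increments and leaves the summable \<open>(1/2) ^ k\<close>.\<close>
 define e where "e k = (1/2) ^ k * (1 / 2 ^ k) powr q" for k :: nat
 have e: "e k > 0" for k by (simp add: e_def)
 obtain K where K: "!!n k l. k >= K n ==> l >= K n ==> Lpow q M (%x. u k x - u l x) < e n"
 using cau[OF e] by metis
 define r where "r = rec_nat (K 0) (%n m. Suc m + K (Suc n))"
 have rS: "r (Suc n) = Suc (r n) + K (Suc n)" for n by (simp add: r_def)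
 have r0: "r 0 = K 0" by (simp add: r_def)
 have sm: "strict_mono r" by (rule strict_monoI_Suc) (simp add: rS)
 have rK: "r n >= K n" for n by (cases n) (auto simp: r0 rS)
 define d where "d n x = u (r (Suc n)) x - u (r n) x" for n x
 have d [measurable]: "d n : borel_measurable M" for n unfolding d_def by measurable
 have dL: "d n : Lp q M" for n unfolding d_def by (intro Lp_diff q u)
 have dN: "Lpow q M (d n) < e n" for n
 unfolding d_def using rK[of n] rS[of n] by (intro K) auto
 have "(\<integral>\<^sup>+x. (\<Sum>n. ennreal (\<bar>2 ^ n * d n x\<bar> powr q)) \<partial>M) = (\<Sum>n. \<integral>\<^sup>+x. ennreal (\<bar>2 ^ n * d n x\<bar> powr q) \<partial>M)"
 by (intro nn_integral_suminf) measurable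
 also have "... <= (\<Sum>n. ennreal ((1/2) ^ n))"
 proof (intro suminf_le allI summableI)
 fix n :: nat
 have "(\<integral>\<^sup>+x. ennreal (\<bar>2 ^ n * d n x\<bar> powr q) \<partial>M) = ennreal (Lpow q M (%x. 2 ^ n * d n x))"
  by (intro nn_integral_Lp Lp_cmult dL)
 also have "Lpow q M (%x. 2 ^ n * d n x) = (2 ^ n) powr q * Lpow q M (d n)"
  by (simp add: Lpow_def abs_mult powr_mult)
 also have "... <= (2 ^ n) powr q * e n" using dN[of n] by (intro mult_left_mono) auto
 also have "... = (1/2) ^ n" by (simp add: e_def powr_divide)
 finally show "(\<integral>\<^sup>+x. ennreal (\<bar>2 ^ n * d n x\<bar> powr q) \<partial>M) <= ennreal ((1/2) ^ n)"
  by (simp add: ennreal_leI)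
 qed
 also have "... < \<infinity>" by (subst suminf_ennreal_eq[where x=2]) (use power_half_series geometric_sums[of "1/2::real"] in auto)
 finally have "AE x in M. (\<Sum>n. ennreal (\<bar>2 ^ n * d n x\<bar> powr q)) ~= \<infinity>"
 by (intro nn_integral_PInf_AE) auto
 hence AEconv: "AE x in M. convergent (%n. u (r n) x)"
 proof eventually_elim
 fix x assume fin: "(\<Sum>n. ennreal (\<bar>2 ^ n * d n x\<bar> powr q)) ~= \<infinity>"
 define S where "S = enn2real (\<Sum>n. ennreal (\<bar>2 ^ n * d n x\<bar> powr q))"
 have S: "(\<Sum>n. ennreal (\<bar>2 ^ n * d n x\<bar> powr q)) = ennreal S" "S >= 0"
  using fin by (auto simp: S_def less_top)
 have dle: "\<bar>d n x\<bar> <= (1/2) ^ n * S powr (1/q)" for n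
 proof -
  have "(\<Sum>n\<in>{n}. ennreal (\<bar>2 ^ n * d n x\<bar> powr q)) <= (\<Sum>n. ennreal (\<bar>2 ^ n * d n x\<bar> powr q))"
  by (rule sum_le_suminf) auto
  hence "\<bar>2 ^ n * d n x\<bar> powr q <= S" using S by simp
  hence "(\<bar>2 ^ n * d n x\<bar> powr q) powr (1/q) <= S powr (1/q)"
  using q by (intro powr_mono2) auto
  hence "2 ^ n * \<bar>d n x\<bar> <= S powr (1/q)" using q by (simp add: powr_powr abs_mult)
  thus ?thesis by (simp add: field_simps)
 qed
 have "summable (%n. d n x)"
  by (rule summable_comparison_test'[where g="%n. (1/2) ^ n * S powr (1/q)" and N=0])
   (use dle in \<open>auto intro!: summable_mult2 summable_geometric\<close>)
 hence "convergent (%n. \<Sum>i<n. d i x)" by (simp add: summable_iff_convergent)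
 moreover have "(\<Sum>i<n. d i x) = u (r n) x - u (r 0) x" for n
  by (simp add: d_def sum_lessThan_telescope[of "%i. u (r i) x"])
 ultimately have "convergent (%n. u (r n) x - u (r 0) x)" by simp
 from convergent_add[OF this convergent_const[of "u (r 0) x"]]
 show "convergent (%n. u (r n) x)" by simp
 qed
 define v where "v x = lim (%n. u (r n) x)" for x
 have v [measurable]: "v : borel_measurable M" unfolding v_def by measurable
 have AEl: "AE x in M. (%n. u (r n) x) \<longlonglongrightarrow> v x"
 using AEconv by eventually_elim (simp add: v_def convergent_LIMSEQ_iff)
 \<comment> \<open>Fatou's lemma along the subsequence turns the Cauchy estimate of the whole
   sequence into an estimate against the limit.\<close>
 have bnd: "(\<integral>\<^sup>+x. ennreal (\<bar>u k x - v x\<bar> powr q) \<partial>M) <= ennreal \<delta>"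
 if "\<delta> > 0" and L: "!!l. l >= L ==> Lpow q M (%x. u k x - u l x) < \<delta>" for k \<delta> L
 proof -
 have "(\<integral>\<^sup>+x. ennreal (\<bar>u k x - v x\<bar> powr q) \<partial>M) =
   (\<integral>\<^sup>+x. liminf (%n. ennreal (\<bar>u k x - u (r n) x\<bar> powr q)) \<partial>M)"
 proof (rule nn_integral_cong_AE, use AEl in eventually_elim)
  fix x assume "(%n. u (r n) x) \<longlonglongrightarrow> v x"
  hence "(%n. ennreal (\<bar>u k x - u (r n) x\<bar> powr q)) \<longlonglongrightarrow> ennreal (\<bar>u k x - v x\<bar> powr q)"
  using q by (intro tendsto_ennrealI tendsto_powr' tendsto_rabs tendsto_diff tendsto_const) auto
  thus "ennreal (\<bar>u k x - v x\<bar> powr q) = liminf (%n. ennreal (\<bar>u k x - u (r n) x\<bar> powr q))"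
  by (intro lim_imp_Liminf[symmetric]) auto
 qed
 also have "... <= liminf (%n. (\<integral>\<^sup>+x. ennreal (\<bar>u k x - u (r n) x\<bar> powr q) \<partial>M))"
  by (rule nn_integral_liminf) measurable
 also have "... <= ennreal \<delta>"
 proof -
  have "\<forall>\<^sub>F n in sequentially. (\<integral>\<^sup>+x. ennreal (\<bar>u k x - u (r n) x\<bar> powr q) \<partial>M) <= ennreal \<delta>"
  unfolding eventually_sequentially
  proof (intro exI allI impI)
  fix n assume "n >= L"
  hence "r n >= L" using strict_mono_imp_increasing[OF sm, of n] by linarith
  thus "(\<integral>\<^sup>+x. ennreal (\<bar>u k x - u (r n) x\<bar> powr q) \<partial>M) <= ennreal \<delta>"
   using L[of "r n"] by (subst nn_integral_Lp[OF Lp_diff[OF q u u]]) (simp add: ennreal_leI)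
  qed
  from Liminf_mono[OF this] show ?thesis by (simp add: Liminf_const)
 qed
 finally show ?thesis .
 qed
 have vL: "v : Lp q M"
 proof -
 obtain K where K: "\<forall>k\<ge>K. \<forall>l\<ge>K. Lpow q M (%x. u k x - u l x) < 1" using cau[of 1] by auto
 have "(\<integral>\<^sup>+x. ennreal (\<bar>u K x - v x\<bar> powr q) \<partial>M) <= ennreal 1"
  using K by (intro bnd[of _ K]) auto
 hence "(%x. u K x - v x) : Lp q M" unfolding Lp_iff_nn
  by (auto simp: less_top[symmetric] top_unique)
 from Lp_diff[OF q u this, of K] show ?thesis by simp
 qed
 show ?thesis
 proof (rule that[OF vL], rule LIMSEQ_I)
 fix e :: real assume e: "e > 0"
 obtain K where K: "\<forall>k\<ge>K. \<forall>l\<ge>K. Lpow q M (%x. u k x - u l x) < e/2" using cau[of "e/2"] e by auto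
 show "\<exists>no. \<forall>k\<ge>no. norm (Lpow q M (%x. u k x - v x) - 0) < e"
 proof (intro exI allI impI)
  fix k assume "k >= K"
  hence "(\<integral>\<^sup>+x. ennreal (\<bar>u k x - v x\<bar> powr q) \<partial>M) <= ennreal (e/2)"
  using K e by (intro bnd[of _ K]) auto
  hence "Lpow q M (%x. u k x - v x) <= e/2"
  using e by (simp add: nn_integral_Lp[OF Lp_diff[OF q u vL]])
  thus "norm (Lpow q M (%x. u k x - v x) - 0) < e" using e by simp
 qed
 qed
qed

text \<open>Convexity of the power at (1 - t) x + t y, with x = |a| / (1 - t) and y = |b| / t. The
  factor of |a|^q tends to 1 as t tends to 0; this serves in place of Minkowski's inequality where a
  factor \<open>2 powr q\<close> would lose too much.\<close>

lemma powr_add_weighted: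
 fixes a b q t :: real
 assumes q: "q > 1" and t: "0 < t" "t < 1"
 shows "\<bar>a + b\<bar> powr q <= (1 - t) powr (1 - q) * \<bar>a\<bar> powr q + t powr (1 - q) * \<bar>b\<bar> powr q"
proof -
 define x y s where "x = \<bar>a\<bar> / (1 - t)" and "y = \<bar>b\<bar> / t" and "s = (1 - t) * x + t * y"
 have xy: "x >= 0" "y >= 0" "s >= 0" using t by (auto simp: x_def y_def s_def)
 have s: "s = \<bar>a\<bar> + \<bar>b\<bar>" using t by (simp add: s_def x_def y_def)
 have "\<bar>a + b\<bar> powr q <= s powr q" using q s by (intro powr_mono2) auto
 also have "s powr q = (1 - t) * (s powr q + q * s powr (q - 1) * (x - s)) + t * (s powr q + q * s powr (q - 1) * (y - s))"
 unfolding s_def by (simp add: algebra_simps)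
 also have "... <= (1 - t) * x powr q + t * y powr q"
 using t xy by (intro add_mono mult_left_mono powr_tangent q) auto
 also have "(1 - t) * x powr q = (1 - t) powr (1 - q) * \<bar>a\<bar> powr q"
 using t by (simp add: x_def powr_divide powr_diff)
 also have "t * y powr q = t powr (1 - q) * \<bar>b\<bar> powr q"
 using t by (simp add: y_def powr_divide powr_diff)
 finally show ?thesis .
qed

lemma Lpow_add_weighted:
 assumes q: "q > 1" and t: "0 < t" "t < 1" and u: "u : Lp q M" and v: "v : Lp q M"
 shows "Lpow q M (%x. u x + v x) <= (1 - t) powr (1 - q) * Lpow q M u + t powr (1 - q) * Lpow q M v"
proof -
 have "Lpow q M (%x. u x + v x) <= (LINT x|M. (1 - t) powr (1 - q) * \<bar>u x\<bar> powr q + t powr (1 - q) * \<bar>v x\<bar> powr q)"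
 unfolding Lpow_def
 by (intro integral_mono Lp_integrable Lp_add u v q powr_add_weighted t integrable_mult_right Bochner_Integration.integrable_add)
 also have "... = (1 - t) powr (1 - q) * Lpow q M u + t powr (1 - q) * Lpow q M v"
 using u v by (simp add: Lpow_def Lp_integrable)
 finally show ?thesis .
qed

text \<open>The weighted inequality is used in both directions with one small \<open>t\<close>; the
  factor in front of the vanishing error is then possibly large, but fixed.\<close>

lemma Lpow_tendsto:
 assumes q: "q > 1" and f: "f : Lp q M" and u: "u : Lp q M" and U: "!!k. U k : Lp q M"
 and lim: "((%k. Lpow q M (%x. U k x - u x)) \<longlongrightarrow> 0) F"
 shows "((%k. Lpow q M (%x. f x - U k x)) \<longlongrightarrow> Lpow q M (%x. f x - u x)) F"
proof (rule tendstoI)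
 fix e :: real assume e: "e > 0"
 define A where "A = Lpow q M (%x. f x - u x)"
 \<comment> \<open>Measured against \<open>2 * A + 1\<close>, which eventually bounds both powers,
   so that the relative error \<kappa> costs at most e / 4.\<close>
 define \<kappa> where "\<kappa> = min 1 (e / (4 * (2 * A + 1)))"
 have A: "A >= 0" by (simp add: A_def)
 have \<kappa>: "\<kappa> > 0" "\<kappa> <= 1" using e A by (auto simp: \<kappa>_def)
 have "\<kappa> <= e / (4 * (2 * A + 1))" by (simp add: \<kappa>_def)
 hence \<kappa>3: "\<kappa> * (2 * A + 1) <= e / 4" using A by (simp add: pos_le_divide_eq algebra_simps)
 have "((%t. (1 - t) powr (1 - q)) \<longlongrightarrow> (1 - 0) powr (1 - q)) (at_right (0::real))"
 by (intro tendsto_intros) auto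
 hence "\<forall>\<^sub>F t in at_right 0. (1 - t) powr (1 - q) < 1 + \<kappa>"
 using \<kappa> by (intro order_tendstoD(2)) auto
 moreover have "\<forall>\<^sub>F t in at_right (0::real). 0 < t" by (simp add: eventually_at_right_less)
 moreover have "\<forall>\<^sub>F t in at_right (0::real). t < 1" by (rule order_tendstoD(2)[OF tendsto_ident_at]) auto
 ultimately have "\<forall>\<^sub>F t in at_right (0::real). (1 - t) powr (1 - q) < 1 + \<kappa> & 0 < t & t < 1" by eventually_elim auto
 then obtain t :: real where t: "(1 - t) powr (1 - q) < 1 + \<kappa>" "0 < t" "t < 1"
 using eventually_happens'[OF trivial_limit_at_right_real] by blast
 define d where "d = t powr (1 - q)"
 have d: "d >= 0" by (simp add: d_def)
 have "((%k. d * Lpow q M (%x. U k x - u x)) \<longlongrightarrow> d * 0) F" by (intro tendsto_intros lim)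
 hence "\<forall>\<^sub>F k in F. d * Lpow q M (%x. U k x - u x) < min (e / 4) 1"
 using e by (intro order_tendstoD(2)) auto
 thus "\<forall>\<^sub>F k in F. dist (Lpow q M (%x. f x - U k x)) (Lpow q M (%x. f x - u x)) < e"
 proof eventually_elim
 fix k assume k: "d * Lpow q M (%x. U k x - u x) < min (e / 4) 1"
 define B where "B = Lpow q M (%x. f x - U k x)"
 have B: "B >= 0" by (simp add: B_def)
 have "B <= (1 - t) powr (1 - q) * A + d * Lpow q M (%x. u x - U k x)"
  using Lpow_add_weighted[OF q t(2,3) Lp_diff[OF q f u] Lp_diff[OF q u U[of k]]] by (simp add: A_def B_def d_def)
 also have "(1 - t) powr (1 - q) * A <= (1 + \<kappa>) * A" using t A by (intro mult_right_mono) auto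
 finally have 1: "B <= (1 + \<kappa>) * A + d * Lpow q M (%x. U k x - u x)" by (simp add: Lpow_diff_commute[of q M u])
 have "A <= (1 - t) powr (1 - q) * B + d * Lpow q M (%x. U k x - u x)"
  using Lpow_add_weighted[OF q t(2,3) Lp_diff[OF q f U[of k]] Lp_diff[OF q U[of k] u]] by (simp add: A_def B_def d_def)
 also have "(1 - t) powr (1 - q) * B <= (1 + \<kappa>) * B" using t B by (intro mult_right_mono) auto
 finally have 2: "A <= (1 + \<kappa>) * B + d * Lpow q M (%x. U k x - u x)" by simp
 have "\<kappa> * A <= 1 * A" using \<kappa> A by (intro mult_right_mono) auto
 hence "B <= 2 * A + 1" using 1 k by (simp add: algebra_simps)
 hence "\<kappa> * B <= \<kappa> * (2 * A + 1)" using \<kappa> by (intro mult_left_mono) auto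
 moreover have "\<kappa> * A <= \<kappa> * (2 * A + 1)" using \<kappa> A by (intro mult_left_mono) auto
 ultimately have "\<bar>B - A\<bar> < e" using 1 2 k \<kappa>3 e by (simp add: algebra_simps abs_less_iff)
 thus "dist (Lpow q M (%x. f x - U k x)) (Lpow q M (%x. f x - u x)) < e"
  by (simp add: A_def B_def dist_real_def)
 qed
qed

section \<open>Minimizing a convex functional plus the fidelity term\<close>

definition fid :: "real => real => 'a measure => ('a => real) => ('a => real) => ennreal" where
 "fid q \<Lambda> M f u = ennreal \<Lambda> * (\<integral>\<^sup>+x. ennreal (\<bar>f x - u x\<bar> powr q) \<partial>M)"

lemma fid_Lpow:
 assumes "q > 1" "\<Lambda> > 0" "f : Lp q M" "u : Lp q M"
 shows "fid q \<Lambda> M f u = ennreal (\<Lambda> * Lpow q M (%x. f x - u x))"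
 unfolding fid_def using assms by (subst nn_integral_Lp[OF Lp_diff]) (auto simp: ennreal_mult)

text \<open>Written with a doubled left-hand side so that no division occurs in
  \<open>ennreal\<close>.\<close>

definition mid_convex :: "real => 'a measure => (('a => real) => ennreal) => bool" where
 "mid_convex q M P \<longleftrightarrow> (\<forall>u\<in>Lp q M. \<forall>v\<in>Lp q M. 2 * P (%x. (u x + v x) / 2) <= P u + P v)"

definition seq_lsc :: "real => 'a measure => (('a => real) => ennreal) => bool" where
 "seq_lsc q M P \<longleftrightarrow> (\<forall>U. \<forall>u\<in>Lp q M. (\<forall>k. U k : Lp q M) -->
  (%k::nat. Lpow q M (%x. U k x - u x)) \<longlonglongrightarrow> 0 --> P u <= liminf (%k. P (U k)))"

lemma ennreal_le_cases:
 assumes "(x::ennreal) <= ennreal y" obtains r where "x = ennreal r" "r >= 0"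
 using assms by (cases x) (auto simp: top_unique)

text \<open>The order of quantifiers is the point: \<kappa> depends only on \<open>q\<close>,
  \<open>\<Lambda>\<close>, \<open>s\<close> and \<open>e\<close>, not on the functional, the
  measure or \<open>f\<close>. It can therefore be applied along a whole sequence of
  functionals.\<close>

lemma near_minimizers_close:
 fixes q \<Lambda> s e :: real
 assumes q: "q > 1" and L: "\<Lambda> > 0" and s: "s >= 0" and e: "e > 0"
 obtains \<kappa> where "\<kappa> > 0" "!!P (M :: 'a measure) f u v. mid_convex q M P ==> f : Lp q M ==> u : Lp q M ==> v : Lp q M ==>
  P u + fid q \<Lambda> M f u <= ennreal (s + \<kappa>) ==> P v + fid q \<Lambda> M f v <= ennreal (s + \<kappa>) ==>
  ennreal (s - \<kappa>) <= P (%x. (u x + v x) / 2) + fid q \<Lambda> M f (%x. (u x + v x) / 2) ==>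
  Lpow q M (%x. u x - v x) < e"
proof -
 \<comment> \<open>Since \<Lambda> (Nu + Nv) turns out to be at most 2 (s + 1), this term
   contributes at most e / 4; \<kappa> below is chosen to do the same for the term with the factor
   \<open>C\<close>.\<close>
 define \<eta> where "\<eta> = \<Lambda> * e / (8 * (s + 1))"
 have \<eta>: "\<eta> > 0" using L e s by (simp add: \<eta>_def)
 obtain C where C: "C > 0" "!!a b. \<bar>a - b\<bar> powr q <= \<eta> * (\<bar>a\<bar> powr q + \<bar>b\<bar> powr q) + C * midpoint_gap q a b"
 using powr_diff_le_midpoint_gap[OF q \<eta>] by blast
 define \<kappa> where "\<kappa> = min 1 (\<Lambda> * e / (8 * C))"
 have \<kappa>: "\<kappa> > 0" "\<kappa> <= 1" "\<kappa> <= \<Lambda> * e / (8 * C)" using L e C by (auto simp: \<kappa>_def)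
 show ?thesis
 proof (rule that[OF \<kappa>(1)])
 fix P and M :: "'a measure" and f u v
 assume cvx: "mid_convex q M P" and f: "f : Lp q M" and u: "u : Lp q M" and v: "v : Lp q M"
  and Gu: "P u + fid q \<Lambda> M f u <= ennreal (s + \<kappa>)" and Gv: "P v + fid q \<Lambda> M f v <= ennreal (s + \<kappa>)"
  and Gm: "ennreal (s - \<kappa>) <= P (%x. (u x + v x) / 2) + fid q \<Lambda> M f (%x. (u x + v x) / 2)"
 define w where "w = (%x. (u x + v x) / 2)"
 have w: "w : Lp q M" unfolding w_def by (intro Lp_mid q u v)
 have "P u <= P u + fid q \<Lambda> M f u" "P v <= P v + fid q \<Lambda> M f v" by simp_all
 hence "P u <= ennreal (s + \<kappa>)" "P v <= ennreal (s + \<kappa>)" using Gu Gv by (meson order_trans)+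
 then obtain pu pv where pu: "P u = ennreal pu" "pu >= 0" and pv: "P v = ennreal pv" "pv >= 0"
  by (metis ennreal_le_cases)
 have cv: "2 * P w <= ennreal (pu + pv)" using cvx u v pu pv unfolding mid_convex_def w_def by (metis ennreal_plus)
 moreover have "P w <= 2 * P w" by (simp add: mult_2)
 ultimately obtain pw where pw: "P w = ennreal pw" "pw >= 0" by (metis ennreal_le_cases order_trans)
 have "ennreal (2 * pw) <= ennreal (pu + pv)" using cv pw by (simp add: ennreal_mult')
 hence cv': "2 * pw <= pu + pv" using pu pv by (simp add: ennreal_le_iff del: ennreal_plus)
 define Nu Nv Nw where "Nu = Lpow q M (%x. f x - u x)" and "Nv = Lpow q M (%x. f x - v x)"
  and "Nw = Lpow q M (%x. f x - w x)"
 have N: "Nu >= 0" "Nv >= 0" "Nw >= 0" by (auto simp: Nu_def Nv_def Nw_def)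
 have fids: "fid q \<Lambda> M f u = ennreal (\<Lambda> * Nu)" "fid q \<Lambda> M f v = ennreal (\<Lambda> * Nv)" "fid q \<Lambda> M f w = ennreal (\<Lambda> * Nw)"
  unfolding Nu_def Nv_def Nw_def by (intro fid_Lpow q L f u v w)+
 have "ennreal (pu + \<Lambda> * Nu) <= ennreal (s + \<kappa>)" using Gu N pu L fids by simp
 hence 1: "pu + \<Lambda> * Nu <= s + \<kappa>" using s \<kappa>(1) by (simp add: ennreal_le_iff del: ennreal_plus)
 have "ennreal (pv + \<Lambda> * Nv) <= ennreal (s + \<kappa>)" using Gv N pv L fids by simp
 hence 2: "pv + \<Lambda> * Nv <= s + \<kappa>" using s \<kappa>(1) by (simp add: ennreal_le_iff del: ennreal_plus)
 have "ennreal (s - \<kappa>) <= ennreal (pw + \<Lambda> * Nw)" using Gm N pw L fids by (simp add: w_def)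
 hence 3: "s - \<kappa> <= pw + \<Lambda> * Nw" using N pw L by (simp add: ennreal_le_iff del: ennreal_plus)
 \<comment> \<open>Midpoint convexity of \<open>P\<close> cancels the contribution of
   \<open>P\<close>: between the upper and the lower energy bounds only the midpoint defect of the
   fidelity term is left.\<close>
 have gap: "\<Lambda> * ((Nu + Nv) / 2 - Nw) <= 2 * \<kappa>"
  using 1 2 3 cv' by (simp add: algebra_simps)
 have "Lpow q M (%x. (f x - u x) - (f x - v x)) <= \<eta> * (Nu + Nv) + C * ((Nu + Nv) / 2 - Lpow q M (%x. ((f x - u x) + (f x - v x)) / 2))"
  unfolding Nu_def Nv_def by (rule Lpow_gap[OF q Lp_diff[OF q f u] Lp_diff[OF q f v] C(2)])
 also have "(%x. ((f x - u x) + (f x - v x)) / 2) = (%x. f x - w x)" by (auto simp: w_def field_simps)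
 also have "Lpow q M (%x. (f x - u x) - (f x - v x)) = Lpow q M (%x. u x - v x)"
  by (subst Lpow_diff_commute) simp
 finally have main: "Lpow q M (%x. u x - v x) <= \<eta> * (Nu + Nv) + C * ((Nu + Nv) / 2 - Nw)" by (simp add: Nw_def)
 have "\<Lambda> * (Nu + Nv) <= 2 * (s + 1)" using 1 2 pu pv \<kappa> by (simp add: algebra_simps)
 hence "(e / (8 * (s + 1))) * (\<Lambda> * (Nu + Nv)) <= (e / (8 * (s + 1))) * (2 * (s + 1))" using e s by (intro mult_left_mono) auto
 also have "(e / (8 * (s + 1))) * (2 * (s + 1)) = e / 4" using s by (simp add: field_simps)
 finally have A: "\<eta> * (Nu + Nv) <= e / 4" by (simp add: \<eta>_def mult.commute mult.left_commute)
 have "C * (\<Lambda> * ((Nu + Nv) / 2 - Nw)) <= C * (2 * \<kappa>)" using gap C by (intro mult_left_mono) auto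
 also have "... <= \<Lambda> * (e / 4)" using \<kappa>(3) C by (simp add: field_simps)
 finally have "\<Lambda> * (C * ((Nu + Nv) / 2 - Nw)) <= \<Lambda> * (e / 4)" by (simp add: algebra_simps)
 hence "C * ((Nu + Nv) / 2 - Nw) <= e / 4" using L by (simp only: mult_le_cancel_left_pos)
 thus "Lpow q M (%x. u x - v x) < e" using main A e by linarith
 qed
qed

text \<open>The fidelity term converges along the sequence, so the bound on the sum becomes a bound
  on \<open>P (U k)\<close> alone, to which lower semicontinuity applies. The subtraction is carried
  out on reals.\<close>

lemma lsc_with_fid:
 assumes q: "q > 1" and L: "\<Lambda> > 0" and f: "f : Lp q M" and u: "u : Lp q M" and U: "!!k. U k : Lp q M"
 and lsc: "seq_lsc q M P" and lim: "(%k. Lpow q M (%x. U k x - u x)) \<longlonglongrightarrow> 0"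
 and le: "!!k. P (U k) + fid q \<Lambda> M f (U k) <= ennreal (c k)" and c: "c \<longlonglongrightarrow> s"
 and c0: "!!k. c k >= 0"
 shows "P u + fid q \<Lambda> M f u <= ennreal s"
proof -
 define N where "N k = \<Lambda> * Lpow q M (%x. f x - U k x)" for k
 have N0: "N k >= 0" for k using L by (simp add: N_def)
 have fidk: "fid q \<Lambda> M f (U k) = ennreal (N k)" for k unfolding N_def by (intro fid_Lpow q L f U)
 have Nlim: "N \<longlonglongrightarrow> \<Lambda> * Lpow q M (%x. f x - u x)" unfolding N_def
 by (intro tendsto_intros Lpow_tendsto q f u U lim)
 have Pk: "P (U k) <= ennreal (c k - N k) & N k <= c k" for k
 proof -
 have "P (U k) <= P (U k) + fid q \<Lambda> M f (U k)" by simp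
 also have "... <= ennreal (c k)" by (rule le)
 finally obtain p where p: "P (U k) = ennreal p" "p >= 0" by (rule ennreal_le_cases)
 have "ennreal (p + N k) <= ennreal (c k)" using le[of k] p N0[of k] fidk[of k] by simp
 hence "p + N k <= c k" using c0 by (simp add: ennreal_le_iff)
 thus ?thesis using p by (auto intro!: ennreal_leI)
 qed
 have "P u <= liminf (%k. P (U k))" using lsc u U lim unfolding seq_lsc_def by blast
 also have "... <= liminf (%k. ennreal (c k - N k))" using Pk by (intro Liminf_mono) auto
 also have "... = ennreal (s - \<Lambda> * Lpow q M (%x. f x - u x))"
 by (intro lim_imp_Liminf tendsto_ennrealI tendsto_diff c Nlim) auto
 finally have "P u + fid q \<Lambda> M f u <= ennreal (s - \<Lambda> * Lpow q M (%x. f x - u x)) + ennreal (\<Lambda> * Lpow q M (%x. f x - u x))"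
 by (intro add_mono) (simp_all add: fid_Lpow q L f u)
 also have "... = ennreal s"
 proof -
 have "\<Lambda> * Lpow q M (%x. f x - u x) <= s" using Pk by (intro LIMSEQ_le[OF Nlim c]) auto
 thus ?thesis using L by (subst ennreal_plus[symmetric]) auto
 qed
 finally show ?thesis .
qed

lemma Lpow_zero_AE:
 assumes "u : Lp q M" "Lpow q M u = 0" shows "AE x in M. u x = 0"
proof -
 have "AE x in M. \<bar>u x\<bar> powr q = 0"
 using assms integral_nonneg_eq_0_iff_AE[OF Lp_integrable[OF assms(1)]] by (simp add: Lpow_def)
 thus ?thesis by eventually_elim auto
qed

lemma ennreal_le_all_inverse:
 assumes "!!e. e > 0 ==> (x::ennreal) <= y + ennreal e" shows "x <= y"
 by (rule ennreal_le_epsilon) (use assms in auto)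

text \<open>The direct method with norm convergence in place of compactness: the midpoint of two
  near-minimizers has at least the infimal energy, which makes any minimizing sequence
  Cauchy.\<close>

theorem convex_minimizer_exists:
 assumes q: "q > 1" and L: "\<Lambda> > 0" and f: "f : Lp q M"
 and cvx: "mid_convex q M P" and lsc: "seq_lsc q M P"
 and u0: "u0 : Lp q M" "P u0 < \<infinity>"
 obtains u where "u : Lp q M" "!!v. v : Lp q M ==> P u + fid q \<Lambda> M f u <= P v + fid q \<Lambda> M f v"
proof -
 define G where "G u = P u + fid q \<Lambda> M f u" for u
 define m where "m = (INF u\<in>Lp q M. G u)"
 have mle: "m <= G v" if "v : Lp q M" for v unfolding m_def using that by (rule INF_lower)
 have "G u0 < \<infinity>" unfolding G_def using u0 by (simp add: fid_Lpow q L f less_top)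
 hence "m < \<infinity>" using mle[OF u0(1)] by (simp add: order_le_less_trans)
 then obtain s where s: "m = ennreal s" "s >= 0" by (cases m) auto
 have "\<exists>u\<in>Lp q M. G u <= ennreal (s + 1 / real (Suc k))" for k
 proof -
 have "m < ennreal (s + 1 / real (Suc k))" using s by (simp add: ennreal_less_iff)
 thus ?thesis unfolding m_def INF_less_iff by (auto intro: less_imp_le)
 qed
 then obtain U where U: "!!k. U k : Lp q M" "!!k. G (U k) <= ennreal (s + 1 / real (Suc k))" by metis
 have "\<exists>K. \<forall>k\<ge>K. \<forall>l\<ge>K. Lpow q M (%x. U k x - U l x) < e" if e: "e > 0" for e
 proof -
 obtain \<kappa> where \<kappa>: "\<kappa> > 0" "!!P (M :: 'a measure) f u v. mid_convex q M P ==> f : Lp q M ==> u : Lp q M ==> v : Lp q M ==>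
  P u + fid q \<Lambda> M f u <= ennreal (s + \<kappa>) ==> P v + fid q \<Lambda> M f v <= ennreal (s + \<kappa>) ==>
  ennreal (s - \<kappa>) <= P (%x. (u x + v x) / 2) + fid q \<Lambda> M f (%x. (u x + v x) / 2) ==>
  Lpow q M (%x. u x - v x) < e"
  using near_minimizers_close[OF q L s(2) e] by blast
 obtain K where K: "1 / real (Suc K) < \<kappa>" using \<kappa>(1) nat_approx_posE by blast
 have le: "G (U k) <= ennreal (s + \<kappa>)" if "k >= K" for k
 proof -
  have "1 / real (Suc k) <= 1 / real (Suc K)" using that by (simp add: frac_le)
  thus ?thesis using K by (intro order_trans[OF U(2)] ennreal_leI) auto
 qed
 show ?thesis
 proof (intro exI allI impI)
  fix k l assume "k >= K" "l >= K"
  moreover have "ennreal (s - \<kappa>) <= G (%x. (U k x + U l x) / 2)"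
  using mle[OF Lp_mid[OF q U(1) U(1)], of k l] \<kappa>(1) s by (metis ennreal_leI diff_le_eq le_add_same_cancel1 less_imp_le order_trans)
  ultimately show "Lpow q M (%x. U k x - U l x) < e"
  using le unfolding G_def by (intro \<kappa>(2)[OF cvx f U(1) U(1)]) auto
 qed
 qed
 then obtain v where v: "v : Lp q M" "(%k. Lpow q M (%x. U k x - v x)) \<longlonglongrightarrow> 0"
 using Lp_complete[of q U M] q U(1) by blast
 have "P v + fid q \<Lambda> M f v <= ennreal s"
 proof (rule lsc_with_fid[OF q L f v(1) U(1) lsc v(2)])
 show "P (U k) + fid q \<Lambda> M f (U k) <= ennreal (s + 1 / real (Suc k))" for k using U(2) by (simp add: G_def)
 have "(%k. s + 1 / real (Suc k)) \<longlonglongrightarrow> s + 0" by (intro tendsto_intros LIMSEQ_Suc[OF lim_1_over_n])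
 thus "(%k. s + 1 / real (Suc k)) \<longlonglongrightarrow> s" by simp
 qed (use s in auto)
 thus ?thesis using that[OF v(1)] mle s unfolding G_def by (metis order_trans)
qed

theorem convex_minimizer_unique:
 assumes q: "q > 1" and L: "\<Lambda> > 0" and f: "f : Lp q M"
 and cvx: "mid_convex q M P" and u: "u : Lp q M" and v: "v : Lp q M" and fin: "P u < \<infinity>"
 and eq: "P v + fid q \<Lambda> M f v = P u + fid q \<Lambda> M f u"
 and min: "!!w. w : Lp q M ==> P u + fid q \<Lambda> M f u <= P w + fid q \<Lambda> M f w"
 shows "AE x in M. v x = u x"
proof -
 have "P u + fid q \<Lambda> M f u < \<infinity>" using fin by (simp add: fid_Lpow q L f u less_top)
 then obtain s where s: "P u + fid q \<Lambda> M f u = ennreal s" "s >= 0" by (cases "P u + fid q \<Lambda> M f u") auto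
 have "Lpow q M (%x. v x - u x) <= 0"
 proof (rule field_le_epsilon)
 fix e :: real assume e: "e > 0"
 obtain \<kappa> where \<kappa>: "\<kappa> > 0" "!!P (M :: 'a measure) f u v. mid_convex q M P ==> f : Lp q M ==> u : Lp q M ==> v : Lp q M ==>
  P u + fid q \<Lambda> M f u <= ennreal (s + \<kappa>) ==> P v + fid q \<Lambda> M f v <= ennreal (s + \<kappa>) ==>
  ennreal (s - \<kappa>) <= P (%x. (u x + v x) / 2) + fid q \<Lambda> M f (%x. (u x + v x) / 2) ==>
  Lpow q M (%x. u x - v x) < e"
  using near_minimizers_close[OF q L s(2) e] by blast
 have "ennreal s <= ennreal (s + \<kappa>)" "ennreal (s - \<kappa>) <= ennreal s" using \<kappa>(1) by (auto intro!: ennreal_leI)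
 hence "Lpow q M (%x. v x - u x) < e"
  using min[OF Lp_mid[OF q v u]] eq s by (intro \<kappa>(2)[OF cvx f v u]) (metis order_trans)+
 thus "Lpow q M (%x. v x - u x) <= 0 + e" by simp
 qed
 hence "Lpow q M (%x. v x - u x) = 0" by (simp add: antisym)
 from Lpow_zero_AE[OF Lp_diff[OF q v u] this] show ?thesis by eventually_elim simp
qed

section \<open>Suprema of linear functionals: minimax and convergence of minimizers\<close>

definition sup_lin :: "('i => ('a => real) => real) => 'i set => ('a => real) => ennreal" where
 "sup_lin J \<Phi> u = (SUP \<phi>\<in>\<Phi>. ennreal (J \<phi> u))"

text \<open>Negative reals are sent to 0, so addition survives only as an inequality.\<close>

lemma ennreal_plus_le: "ennreal (a + b) <= ennreal a + ennreal b"
proof -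
 have "ennreal (a + b) <= ennreal (max 0 a + max 0 b)" by (intro ennreal_leI) auto
 also have "... = ennreal (max 0 a) + ennreal (max 0 b)" by (intro ennreal_plus) auto
 also have "... = ennreal a + ennreal b" by (simp only: ennreal_max_0)
 finally show ?thesis .
qed

lemma sup_lin_mono: "\<Phi> <= \<Psi> ==> sup_lin J \<Phi> u <= sup_lin J \<Psi> u"
 unfolding sup_lin_def by (rule SUP_subset_mono) auto

lemma sup_lin_convex:
 assumes "!!\<phi> u v. \<phi> : \<Phi> ==> u : Lp q M ==> v : Lp q M ==> J \<phi> (%x. (u x + v x) / 2) = (J \<phi> u + J \<phi> v) / 2"
 shows "mid_convex q M (sup_lin J \<Phi>)"
 unfolding mid_convex_def
proof (intro ballI)
 fix u v assume uv: "u : Lp q M" "v : Lp q M"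
 have "2 * ennreal (J \<phi> (%x. (u x + v x) / 2)) <= sup_lin J \<Phi> u + sup_lin J \<Phi> v" if "\<phi> : \<Phi>" for \<phi>
 proof -
 have "2 * ennreal (J \<phi> (%x. (u x + v x) / 2)) = ennreal (J \<phi> u + J \<phi> v)"
  unfolding assms[OF that uv] using ennreal_mult'[of 2 "(J \<phi> u + J \<phi> v) / 2"]
  by (simp del: add_divide_distrib distrib_left_numeral add: ennreal_numeral[symmetric] flip: ennreal_numeral)
 also have "... <= ennreal (J \<phi> u) + ennreal (J \<phi> v)" by (rule ennreal_plus_le)
 also have "... <= sup_lin J \<Phi> u + sup_lin J \<Phi> v" unfolding sup_lin_def using that by (intro add_mono SUP_upper)
 finally show ?thesis .
 qed
 thus "2 * sup_lin J \<Phi> (%x. (u x + v x) / 2) <= sup_lin J \<Phi> u + sup_lin J \<Phi> v"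
 unfolding sup_lin_def[of J \<Phi> "%x. (u x + v x) / 2"]
 by (subst SUP_mult_left_ennreal) (rule SUP_least)
qed

lemma sup_lin_lsc:
 assumes "!!\<phi> u U. \<phi> : \<Phi> ==> u : Lp q M ==> (!!k::nat. U k : Lp q M) ==>
  (%k. Lpow q M (%x. U k x - u x)) \<longlonglongrightarrow> 0 ==> (%k. J \<phi> (U k)) \<longlonglongrightarrow> J \<phi> u"
 shows "seq_lsc q M (sup_lin J \<Phi>)"
 unfolding seq_lsc_def
proof (intro ballI allI impI)
 fix U u assume u: "u : Lp q M" and U: "\<forall>k. U k : Lp q M" "(%k::nat. Lpow q M (%x. U k x - u x)) \<longlonglongrightarrow> 0"
 show "sup_lin J \<Phi> u <= liminf (%k. sup_lin J \<Phi> (U k))"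
 unfolding sup_lin_def[of J \<Phi> u]
 proof (rule SUP_least)
 fix \<phi> assume \<phi>: "\<phi> : \<Phi>"
 have "(%k. ennreal (J \<phi> (U k))) \<longlonglongrightarrow> ennreal (J \<phi> u)" using \<phi> u U by (intro tendsto_ennrealI assms) auto
 hence "ennreal (J \<phi> u) = liminf (%k. ennreal (J \<phi> (U k)))" by (intro lim_imp_Liminf[symmetric]) auto
 also have "... <= liminf (%k. sup_lin J \<Phi> (U k))"
  unfolding sup_lin_def by (intro Liminf_mono always_eventually allI SUP_upper \<phi>)
 finally show "ennreal (J \<phi> u) <= liminf (%k. sup_lin J \<Phi> (U k))" .
 qed
qed

lemma exists_near_Inf:
 assumes "s >= 0" "(INF u\<in>A. (G u :: ennreal)) <= ennreal s" "e > 0"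
 shows "\<exists>u\<in>A. G u <= ennreal (s + e)"
proof -
 have "ennreal s < ennreal (s + e)" using assms by (simp add: ennreal_less_iff)
 hence "(INF u\<in>A. G u) < ennreal (s + e)" using assms(2) by (rule le_less_trans[rotated])
 thus ?thesis unfolding INF_less_iff by (auto intro: less_imp_le)
qed

text \<open>Exchanges infimum and supremum over finite families. Families that nearly attain the
  supremum are made increasing; a near-minimizer for a later family is one for each earlier family
  within its tolerance, so the near-minimizers form a Cauchy sequence. \<open>T\<close> may be
  uncountable: every single member is checked at the limit.\<close>

theorem sup_lin_minimax:
 fixes J :: "'i => ('a => real) => real"
 assumes q: "q > 1" and L: "\<Lambda> > 0" and f: "f : Lp q M" and T: "T ~= {}"
 and lin: "!!\<phi> u v. \<phi> : T ==> u : Lp q M ==> v : Lp q M ==> J \<phi> (%x. (u x + v x) / 2) = (J \<phi> u + J \<phi> v) / 2"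
 and cont: "!!\<phi> u U. \<phi> : T ==> u : Lp q M ==> (!!k::nat. U k : Lp q M) ==>
  (%k. Lpow q M (%x. U k x - u x)) \<longlonglongrightarrow> 0 ==> (%k. J \<phi> (U k)) \<longlonglongrightarrow> J \<phi> u"
 and s: "s >= 0" "(SUP \<Phi>\<in>{\<Phi>. finite \<Phi> & \<Phi> <= T}. INF u\<in>Lp q M. sup_lin J \<Phi> u + fid q \<Lambda> M f u) = ennreal s"
 obtains u where "u : Lp q M" "sup_lin J T u + fid q \<Lambda> M f u <= ennreal s"
proof -
 define G where "G \<Phi> u = sup_lin J \<Phi> u + fid q \<Lambda> M f u" for \<Phi> u
 define m where "m \<Phi> = (INF u\<in>Lp q M. G \<Phi> u)" for \<Phi>
 define Fin where "Fin = {\<Phi>. finite \<Phi> & \<Phi> <= T}"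
 have sup: "(SUP \<Phi>\<in>Fin. m \<Phi>) = ennreal s" using s unfolding Fin_def m_def G_def by simp
 have ms: "m \<Phi> <= ennreal s" if "\<Phi> : Fin" for \<Phi> using SUP_upper[OF that, of m] sup by simp
 have mG: "m \<Phi> <= G \<Phi> u" if "u : Lp q M" for u \<Phi> unfolding m_def using that by (rule INF_lower)
 have Gmono: "G \<Phi> u <= G \<Psi> u" if "\<Phi> <= \<Psi>" for \<Phi> \<Psi> u
 unfolding G_def by (intro add_mono sup_lin_mono that order_refl)
 have mmono: "m \<Phi> <= m \<Psi>" if "\<Phi> <= \<Psi>" for \<Phi> \<Psi>
 unfolding m_def by (intro INF_superset_mono Gmono that order_refl)
 have cvx: "mid_convex q M (sup_lin J \<Phi>)" if "\<Phi> : Fin" for \<Phi>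
 by (rule sup_lin_convex) (use that in \<open>auto simp: Fin_def subset_iff lin\<close>)
 have "\<exists>\<Phi>\<in>Fin. ennreal (s - 1 / real (Suc k)) <= m \<Phi>" for k
 proof (cases "s - 1 / real (Suc k) <= 0")
 case True thus ?thesis by (intro bexI[of _ "{}"]) (auto simp: Fin_def ennreal_neg)
 next
 case False
 hence "ennreal (s - 1 / real (Suc k)) < (SUP \<Phi>\<in>Fin. m \<Phi>)" unfolding sup by (simp add: ennreal_less_iff)
 thus ?thesis unfolding less_SUP_iff by (auto intro: less_imp_le)
 qed
 then obtain \<Phi>0 where \<Phi>0: "!!k. \<Phi>0 k : Fin" "!!k. ennreal (s - 1 / real (Suc k)) <= m (\<Phi>0 k)" by metis
 \<comment> \<open>Unions make the families increase while the infima stay close to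
   \<open>s\<close>.\<close>
 define \<Phi> where "\<Phi> k = (\<Union>i\<le>k. \<Phi>0 i)" for k
 have \<Phi>F: "\<Phi> k : Fin" for k using \<Phi>0(1) by (auto simp: \<Phi>_def Fin_def)
 have \<Phi>mono: "\<Phi> k <= \<Phi> l" if "k <= l" for k l using that by (force simp: \<Phi>_def)
 have \<Phi>m: "ennreal (s - 1 / real (Suc k)) <= m (\<Phi> k)" for k
 by (rule order_trans[OF \<Phi>0(2) mmono]) (auto simp: \<Phi>_def)
 have near: "\<exists>u\<in>Lp q M. G \<Psi> u <= ennreal (s + 1 / real (Suc k))" if "\<Psi> : Fin" for \<Psi> k
 by (rule exists_near_Inf[OF s(1)]) (use ms[OF that] in \<open>auto simp: m_def\<close>)
 obtain U where U: "!!k. U k : Lp q M" "!!k. G (\<Phi> k) (U k) <= ennreal (s + 1 / real (Suc k))"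
 using near[OF \<Phi>F, of k k for k] by metis
 have close: "\<exists>K. \<forall>k\<ge>K. \<forall>u\<in>Lp q M. \<forall>v\<in>Lp q M. G (\<Phi> k) u <= ennreal (s + 1 / real (Suc k)) -->
  G (\<Phi> k) v <= ennreal (s + 1 / real (Suc k)) --> Lpow q M (%x. u x - v x) < e" if e: "e > 0" for e
 proof -
 obtain \<kappa> where \<kappa>: "\<kappa> > 0" "!!P (M :: 'a measure) f u v. mid_convex q M P ==> f : Lp q M ==> u : Lp q M ==> v : Lp q M ==>
  P u + fid q \<Lambda> M f u <= ennreal (s + \<kappa>) ==> P v + fid q \<Lambda> M f v <= ennreal (s + \<kappa>) ==>
  ennreal (s - \<kappa>) <= P (%x. (u x + v x) / 2) + fid q \<Lambda> M f (%x. (u x + v x) / 2) ==>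
  Lpow q M (%x. u x - v x) < e"
  using near_minimizers_close[OF q L s(1) e] by blast
 obtain K where K: "1 / real (Suc K) < \<kappa>" using \<kappa>(1) nat_approx_posE by blast
 show ?thesis
 proof (intro exI allI impI ballI)
  fix k u v assume k: "k >= K" and u: "u : Lp q M" and v: "v : Lp q M"
  and Gu: "G (\<Phi> k) u <= ennreal (s + 1 / real (Suc k))" and Gv: "G (\<Phi> k) v <= ennreal (s + 1 / real (Suc k))"
  have "1 / real (Suc k) <= 1 / real (Suc K)" using k by (simp add: frac_le)
  hence k': "1 / real (Suc k) <= \<kappa>" using K by simp
  show "Lpow q M (%x. u x - v x) < e"
  proof (rule \<kappa>(2)[OF cvx[OF \<Phi>F[of k]] f u v])
  show "sup_lin J (\<Phi> k) u + fid q \<Lambda> M f u <= ennreal (s + \<kappa>)"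
   using Gu k' unfolding G_def by (elim order_trans) (intro ennreal_leI, simp)
  show "sup_lin J (\<Phi> k) v + fid q \<Lambda> M f v <= ennreal (s + \<kappa>)"
   using Gv k' unfolding G_def by (elim order_trans) (intro ennreal_leI, simp)
  have "ennreal (s - \<kappa>) <= ennreal (s - 1 / real (Suc k))" using k' by (intro ennreal_leI) simp
  also have "... <= m (\<Phi> k)" by (rule \<Phi>m)
  also have "... <= G (\<Phi> k) (%x. (u x + v x) / 2)" by (intro mG Lp_mid q u v)
  finally show "ennreal (s - \<kappa>) <= sup_lin J (\<Phi> k) (%x. (u x + v x) / 2) + fid q \<Lambda> M f (%x. (u x + v x) / 2)"
   unfolding G_def .
  qed
 qed
 qed
 have "\<exists>K. \<forall>k\<ge>K. \<forall>l\<ge>K. Lpow q M (%x. U k x - U l x) < e" if e: "e > 0" for e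
 proof -
 obtain K where K: "!!k u v. k >= K ==> u : Lp q M ==> v : Lp q M ==> G (\<Phi> k) u <= ennreal (s + 1 / real (Suc k)) ==>
  G (\<Phi> k) v <= ennreal (s + 1 / real (Suc k)) ==> Lpow q M (%x. u x - v x) < e"
  using close[OF e] by blast
 have *: "Lpow q M (%x. U k x - U l x) < e" if "k >= K" "l >= k" for k l
 proof (rule K[OF that(1) U(1) U(1) U(2)])
  have "1 / real (Suc l) <= 1 / real (Suc k)" using that by (simp add: frac_le)
  hence "ennreal (s + 1 / real (Suc l)) <= ennreal (s + 1 / real (Suc k))" by (intro ennreal_leI) simp
  thus "G (\<Phi> k) (U l) <= ennreal (s + 1 / real (Suc k))"
  using Gmono[OF \<Phi>mono[OF that(2)], of "U l"] U(2)[of l] by (meson order_trans)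
 qed
 show ?thesis
 proof (intro exI allI impI)
  fix k l assume "k >= K" "l >= K"
  thus "Lpow q M (%x. U k x - U l x) < e"
  using *[of k l] *[of l k] Lpow_diff_commute[of q M "U k" "U l"] by (cases "k <= l") auto
 qed
 qed
 then obtain v where v: "v : Lp q M" "(%k. Lpow q M (%x. U k x - v x)) \<longlonglongrightarrow> 0"
 using Lp_complete[of q U M] q U(1) by blast
 \<comment> \<open>\<phi> need not belong to any \<open>\<Phi> k\<close>. Near-minimizers
   \<open>V k\<close> for the family enlarged by \<phi> are also near-minimizers for
   \<open>\<Phi> k\<close>, hence have the same limit \<open>v\<close>, and semicontinuity carries
   their bound for \<phi> over to \<open>v\<close>.\<close>
 have one: "ennreal (J \<phi> v) + fid q \<Lambda> M f v <= ennreal s" if \<phi>: "\<phi> : T" for \<phi>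
 proof -
 have "insert \<phi> (\<Phi> k) : Fin" for k using \<Phi>F[of k] \<phi> by (auto simp: Fin_def)
 from near[OF this, of k k for k] obtain V where V: "!!k. V k : Lp q M" "!!k. G (insert \<phi> (\<Phi> k)) (V k) <= ennreal (s + 1 / real (Suc k))"
  by metis
 have VG: "G (\<Phi> k) (V k) <= ennreal (s + 1 / real (Suc k))" for k
  using V(2)[of k] Gmono[of "\<Phi> k" "insert \<phi> (\<Phi> k)" "V k"] by (meson order_trans subset_insertI)
 have UV: "(%k. Lpow q M (%x. V k x - U k x)) \<longlonglongrightarrow> 0"
 proof (rule LIMSEQ_I)
  fix e :: real assume e: "e > 0"
  then obtain K where K: "!!k u v. k >= K ==> u : Lp q M ==> v : Lp q M ==> G (\<Phi> k) u <= ennreal (s + 1 / real (Suc k)) ==>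
  G (\<Phi> k) v <= ennreal (s + 1 / real (Suc k)) ==> Lpow q M (%x. u x - v x) < e"
  using close[OF e] by blast
  show "\<exists>no. \<forall>n\<ge>no. norm (Lpow q M (%x. V n x - U n x) - 0) < e"
  using K[OF _ V(1) U(1) VG U(2)] by auto
 qed
 have lim: "(%k. Lpow q M (%x. V k x - v x)) \<longlonglongrightarrow> 0"
 proof (rule tendsto_sandwich[OF always_eventually always_eventually tendsto_const])
  show "(%k. 2 powr q * (Lpow q M (%x. V k x - U k x) + Lpow q M (%x. U k x - v x))) \<longlonglongrightarrow> 0"
  using tendsto_mult[OF tendsto_const tendsto_add[OF UV v(2)], of "2 powr q"] by simp
 qed (use Lpow_triangle[OF q V(1) U(1) v(1)] in auto)
 have "sup_lin J {\<phi>} v + fid q \<Lambda> M f v <= ennreal s"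
 proof (rule lsc_with_fid[OF q L f v(1) V(1) _ lim])
  show "seq_lsc q M (sup_lin J {\<phi>})" by (rule sup_lin_lsc) (use \<phi> in \<open>auto intro!: cont\<close>)
  show "sup_lin J {\<phi>} (V k) + fid q \<Lambda> M f (V k) <= ennreal (s + 1 / real (Suc k))" for k
  using order_trans[OF Gmono[of "{\<phi>}" "insert \<phi> (\<Phi> k)" "V k"] V(2)[of k]] by (simp add: G_def)
  have "(%k. s + 1 / real (Suc k)) \<longlonglongrightarrow> s + 0" by (intro tendsto_intros LIMSEQ_Suc[OF lim_1_over_n])
  thus "(%k. s + 1 / real (Suc k)) \<longlonglongrightarrow> s" by simp
 qed (use s in auto)
 thus ?thesis by (simp add: sup_lin_def)
 qed
 have "sup_lin J T v + fid q \<Lambda> M f v = (SUP \<phi>\<in>T. ennreal (J \<phi> v) + fid q \<Lambda> M f v)"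
 unfolding sup_lin_def by (rule ennreal_SUP_add_left[symmetric]) (use T in \<open>auto simp: fid_Lpow q L f v\<close>)
 also have "... <= ennreal s" by (intro SUP_least one)
 finally show ?thesis using that v(1) by blast
qed

text \<open>The hypotheses have the shape in which they can be proved: \<open>lower\<close> concerns
  one linear functional on bounded sets, \<open>upper\<close> asks for a competitor independent of
  \<open>\<e>\<close>, and \<open>dense\<close> leads from L^q back to the class \<open>X\<close> in
  which \<open>u0\<close> is minimal.\<close>

theorem minimizers_converge:
 fixes J :: "'i => ('a => real) => real" and K :: "real => ('a => real) => ennreal"
 assumes q: "q > 1" and L: "\<Lambda> > 0" and f: "f : Lp q M" and T: "T ~= {}"
 and lin: "!!\<phi> u v. \<phi> : T ==> u : Lp q M ==> v : Lp q M ==> J \<phi> (%x. (u x + v x) / 2) = (J \<phi> u + J \<phi> v) / 2"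
 and cont: "!!\<phi> u U. \<phi> : T ==> u : Lp q M ==> (!!k::nat. U k : Lp q M) ==>
  (%k. Lpow q M (%x. U k x - u x)) \<longlonglongrightarrow> 0 ==> (%k. J \<phi> (U k)) \<longlonglongrightarrow> J \<phi> u"
 and lower: "!!\<phi> R \<eta>. \<phi> : T ==> \<eta> > 0 ==> \<forall>\<^sub>F \<e> in at_right 0.
  \<forall>u\<in>Lp q M. Lpow q M u <= R --> ennreal (J \<phi> u) <= K \<e> u + ennreal \<eta>"
 and upper: "!!u \<eta>. u : Lp q M ==> sup_lin J T u < \<infinity> ==> \<eta> > 0 ==>
  \<exists>v\<in>Lp q M. Lpow q M (%x. v x - u x) < \<eta> & (\<forall>\<^sub>F \<e> in at_right 0. K \<e> v <= sup_lin J T u + ennreal \<eta>)"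
 and X: "X <= Lp q M" and dense: "!!u \<eta>. u : Lp q M ==> sup_lin J T u < \<infinity> ==> \<eta> > 0 ==>
  \<exists>v\<in>X. Lpow q M (%x. v x - u x) < \<eta> & sup_lin J T v <= sup_lin J T u"
 and K0: "!!\<e>. \<e> > 0 ==> K \<e> (%x. 0) = 0"
 and ue: "!!\<e>. \<e> > 0 ==> u \<e> : Lp q M"
  "!!\<e> v. \<e> > 0 ==> v : Lp q M ==> K \<e> (u \<e>) + fid q \<Lambda> M f (u \<e>) <= K \<e> v + fid q \<Lambda> M f v"
 and u0: "u0 : X" "sup_lin J T u0 < \<infinity>"
  "!!v. v : X ==> sup_lin J T u0 + fid q \<Lambda> M f u0 <= sup_lin J T v + fid q \<Lambda> M f v"
 shows "((%\<e>. Lpow q M (%x. u \<e> x - u0 x)) \<longlongrightarrow> 0) (at_right 0)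
  & ((%\<e>. K \<e> (u \<e>) + fid q \<Lambda> M f (u \<e>)) \<longlongrightarrow> sup_lin J T u0 + fid q \<Lambda> M f u0) (at_right 0)"
proof -
 define G where "G \<Phi> u = sup_lin J \<Phi> u + fid q \<Lambda> M f u" for \<Phi> u
 define m where "m \<Phi> = (INF u\<in>Lp q M. G \<Phi> u)" for \<Phi>
 define Fin where "Fin = {\<Phi>. finite \<Phi> & \<Phi> <= T}"
 define E where "E \<e> u = K \<e> u + fid q \<Lambda> M f u" for \<e> u
 have u0L: "u0 : Lp q M" using u0 X by auto
 have "G T u0 < \<infinity>" unfolding G_def using u0 by (simp add: fid_Lpow q L f u0L less_top)
 then obtain s where s: "G T u0 = ennreal s" "s >= 0" by (cases "G T u0") auto
 have mG: "m \<Phi> <= G \<Phi> u" if "u : Lp q M" for u \<Phi> unfolding m_def using that by (rule INF_lower)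
 have Gmono: "G \<Phi> u <= G \<Psi> u" if "\<Phi> <= \<Psi>" for \<Phi> \<Psi> u
 unfolding G_def by (intro add_mono sup_lin_mono that order_refl)
 have cvx: "mid_convex q M (sup_lin J \<Phi>)" if "\<Phi> : Fin" for \<Phi>
 by (rule sup_lin_convex) (use that in \<open>auto simp: Fin_def subset_iff lin\<close>)
 have approx: "\<exists>\<delta>>0. \<forall>w\<in>Lp q M. Lpow q M (%x. w x - v x) < \<delta> --> fid q \<Lambda> M f w <= fid q \<Lambda> M f v + ennreal \<eta>"
 if v: "v : Lp q M" and \<eta>: "\<eta> > 0" for v \<eta>
 proof (rule ccontr)
 assume "\<not> ?thesis"
 hence "\<exists>w\<in>Lp q M. Lpow q M (%x. w x - v x) < \<delta> & \<not> fid q \<Lambda> M f w <= fid q \<Lambda> M f v + ennreal \<eta>"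
  if "\<delta> > 0" for \<delta> using that by blast
 from this[of "1 / real (Suc k)" for k] have "\<forall>k::nat. \<exists>w\<in>Lp q M. Lpow q M (%x. w x - v x) < 1 / real (Suc k) & \<not> fid q \<Lambda> M f w <= fid q \<Lambda> M f v + ennreal \<eta>"
  by simp
 then obtain W where W: "!!k::nat. W k : Lp q M" "!!k. Lpow q M (%x. W k x - v x) < 1 / real (Suc k)"
  "!!k. \<not> fid q \<Lambda> M f (W k) <= fid q \<Lambda> M f v + ennreal \<eta>" by metis
 have "(%k. Lpow q M (%x. W k x - v x)) \<longlonglongrightarrow> 0"
  by (rule tendsto_sandwich[OF always_eventually always_eventually tendsto_const LIMSEQ_Suc[OF lim_1_over_n]])
   (use W(2) in \<open>auto intro: less_imp_le\<close>)
 hence "(%k. \<Lambda> * Lpow q M (%x. f x - W k x)) \<longlonglongrightarrow> \<Lambda> * Lpow q M (%x. f x - v x)"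
  by (intro tendsto_intros Lpow_tendsto q f v W)
 hence "\<forall>\<^sub>F k in sequentially. \<Lambda> * Lpow q M (%x. f x - W k x) < \<Lambda> * Lpow q M (%x. f x - v x) + \<eta>"
  using \<eta> by (intro order_tendstoD(2)) auto
 then obtain k where k: "\<Lambda> * Lpow q M (%x. f x - W k x) < \<Lambda> * Lpow q M (%x. f x - v x) + \<eta>"
  by (auto simp: eventually_sequentially)
 have "fid q \<Lambda> M f (W k) <= ennreal (\<Lambda> * Lpow q M (%x. f x - v x) + \<eta>)"
  unfolding fid_Lpow[OF q L f W(1)] using k by (intro ennreal_leI) simp
 thus False using W(3)[of k] L \<eta> by (simp add: fid_Lpow[OF q L f v])
 qed
 define S where "S = (SUP \<Phi>\<in>Fin. m \<Phi>)"
 have "S <= G T u0" unfolding S_def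
 proof (rule SUP_least)
 fix \<Phi> assume "\<Phi> : Fin"
 thus "m \<Phi> <= G T u0" using order_trans[OF mG[OF u0L] Gmono] by (auto simp: Fin_def)
 qed
 then obtain s' where s': "S = ennreal s'" "s' >= 0" using s by (metis ennreal_le_cases)
 obtain u' where u': "u' : Lp q M" "G T u' <= ennreal s'"
 using sup_lin_minimax[of q \<Lambda> f M T J s', OF q L f T lin cont s'(2)] s'(1)
 unfolding S_def m_def Fin_def G_def by blast
 \<comment> \<open>The minimax competitor \<open>u'\<close> is only in L^q. It is approximated
   within \<open>X\<close> without raising the supremum term, so the minimum over \<open>X\<close>
   does not exceed the minimax value.\<close>
 have "ennreal s <= ennreal s'"
 proof (rule ennreal_le_all_inverse)
 fix e :: real assume e: "e > 0"
 obtain \<delta> where \<delta>: "\<delta> > 0" "!!w. w\<in>Lp q M ==> Lpow q M (%x. w x - u' x) < \<delta> ==> fid q \<Lambda> M f w <= fid q \<Lambda> M f u' + ennreal e"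
  using approx[OF u'(1) e] by blast
 have "sup_lin J T u' <= G T u'" by (simp add: G_def)
 also have "... < \<infinity>" using u'(2) by (simp add: order_le_less_trans)
 finally have "sup_lin J T u' < \<infinity>" .
 then obtain v where v: "v : X" "Lpow q M (%x. v x - u' x) < \<delta>" "sup_lin J T v <= sup_lin J T u'"
  using dense[OF u'(1) _ \<delta>(1)] by blast
 have "ennreal s <= sup_lin J T v + fid q \<Lambda> M f v" using u0(3)[OF v(1)] s(1) by (simp add: G_def)
 also have "... <= sup_lin J T u' + (fid q \<Lambda> M f u' + ennreal e)"
  using v X by (intro add_mono \<delta>(2)) auto
 also have "... <= ennreal s' + ennreal e" using u'(2) by (simp add: G_def add.assoc[symmetric] add_right_mono)
 finally show "ennreal s <= ennreal s' + ennreal e" .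
 qed
 hence ss: "s <= s'" using s' by (simp add: ennreal_le_iff)
 have exF: "\<exists>\<Phi>\<in>Fin. ennreal (s - \<kappa>) <= m \<Phi>" if "\<kappa> > 0" for \<kappa>
 proof (cases "s - \<kappa> <= 0")
 case True thus ?thesis by (intro bexI[of _ "{}"]) (auto simp: Fin_def ennreal_neg)
 next
 case False
 hence "ennreal (s - \<kappa>) < (SUP \<Phi>\<in>Fin. m \<Phi>)" using s' ss that by (simp add: ennreal_less_iff S_def)
 thus ?thesis unfolding less_SUP_iff by (auto intro: less_imp_le)
 qed
 define R where "R = 2 powr q * (Lpow q M f + Lpow q M f)"
 have pos: "\<forall>\<^sub>F \<e> in at_right (0::real). \<e> > 0" by (simp add: eventually_at_right_less)
 \<comment> \<open>Comparison with the zero function, on which \<open>K\<close> vanishes, bounds the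
   minimizers in L^q uniformly in \<open>\<e>\<close>; this makes \<open>lower\<close> applicable to
   them.\<close>
 have bound: "Lpow q M (u \<e>) <= R" if e: "\<e> > 0" for \<e>
 proof -
 have "fid q \<Lambda> M f (u \<e>) <= fid q \<Lambda> M f (%x. 0)"
  using order_trans[OF _ ue(2)[OF e Lp_zero], of "fid q \<Lambda> M f (u \<e>)"] K0[OF e] by simp
 hence "\<Lambda> * Lpow q M (%x. f x - u \<e> x) <= \<Lambda> * Lpow q M f"
  using L by (simp add: fid_Lpow[OF q L f] ue(1)[OF e] ennreal_le_iff)
 hence "Lpow q M (%x. f x - u \<e> x) <= Lpow q M f" using L by simp
 hence "Lpow q M (%x. f x - (f x - u \<e> x)) <= 2 powr q * (Lpow q M f + Lpow q M f)"
  by (intro order_trans[OF Lpow_diff_le[OF q f Lp_diff[OF q f ue(1)[OF e]]]] mult_left_mono add_mono) auto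
 thus ?thesis by (simp add: R_def)
 qed
 have up: "\<forall>\<^sub>F \<e> in at_right 0. E \<e> (u \<e>) <= ennreal (s + \<kappa>)" if \<kappa>: "\<kappa> > 0" for \<kappa>
 proof -
 obtain \<delta> where \<delta>: "\<delta> > 0" "!!w. w\<in>Lp q M ==> Lpow q M (%x. w x - u0 x) < \<delta> ==> fid q \<Lambda> M f w <= fid q \<Lambda> M f u0 + ennreal (\<kappa>/2)"
  using approx[OF u0L, of "\<kappa>/2"] \<kappa> by auto
 obtain v where v: "v : Lp q M" "Lpow q M (%x. v x - u0 x) < min \<delta> (\<kappa>/2)"
  "\<forall>\<^sub>F \<e> in at_right 0. K \<e> v <= sup_lin J T u0 + ennreal (min \<delta> (\<kappa>/2))"
  using upper[OF u0L u0(2), of "min \<delta> (\<kappa>/2)"] \<delta> \<kappa> by auto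
 show ?thesis using v(3) pos
 proof eventually_elim
  fix \<e> :: real assume K: "K \<e> v <= sup_lin J T u0 + ennreal (min \<delta> (\<kappa>/2))" and e: "\<e> > 0"
  have "E \<e> (u \<e>) <= K \<e> v + fid q \<Lambda> M f v" unfolding E_def by (rule ue(2)[OF e v(1)])
  also have "... <= (sup_lin J T u0 + ennreal (\<kappa>/2)) + (fid q \<Lambda> M f u0 + ennreal (\<kappa>/2))"
  using v by (intro add_mono order_trans[OF K] \<delta>(2) order_refl ennreal_leI) auto
  also have "... = G T u0 + (ennreal (\<kappa>/2) + ennreal (\<kappa>/2))" by (simp add: G_def algebra_simps)
  also have "... = ennreal (s + \<kappa>)" using s \<kappa> by (simp add: ennreal_plus[symmetric] del: ennreal_plus)
  finally show "E \<e> (u \<e>) <= ennreal (s + \<kappa>)" .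
 qed
 qed
 \<comment> \<open>The family is finite, so one threshold for \<open>\<e>\<close> serves all its
   members.\<close>
 have low: "\<forall>\<^sub>F \<e> in at_right 0. G \<Phi> (u \<e>) <= E \<e> (u \<e>) + ennreal \<kappa>" if \<kappa>: "\<kappa> > 0" and \<Phi>: "\<Phi> : Fin" for \<Phi> \<kappa>
 proof -
 have "\<forall>\<^sub>F \<e> in at_right 0. \<forall>\<phi>\<in>\<Phi>. \<forall>u\<in>Lp q M. Lpow q M u <= R --> ennreal (J \<phi> u) <= K \<e> u + ennreal \<kappa>"
  using \<Phi> lower[OF _ \<kappa>] by (intro eventually_ball_finite) (auto simp: Fin_def)
 thus ?thesis using pos
 proof eventually_elim
  fix \<e> :: real assume *: "\<forall>\<phi>\<in>\<Phi>. \<forall>u\<in>Lp q M. Lpow q M u <= R --> ennreal (J \<phi> u) <= K \<e> u + ennreal \<kappa>" and e: "\<e> > 0"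
  have "sup_lin J \<Phi> (u \<e>) <= K \<e> (u \<e>) + ennreal \<kappa>" unfolding sup_lin_def
  using * ue(1)[OF e] bound[OF e] by (intro SUP_least) auto
  thus "G \<Phi> (u \<e>) <= E \<e> (u \<e>) + ennreal \<kappa>" unfolding G_def E_def
  using add_right_mono[of "sup_lin J \<Phi> (u \<e>)" "K \<e> (u \<e>) + ennreal \<kappa>" "fid q \<Lambda> M f (u \<e>)"]
  by (simp add: ac_simps)
 qed
 qed
 have Lp0: "((%\<e>. Lpow q M (%x. u \<e> x - u0 x)) \<longlongrightarrow> 0) (at_right 0)"
 proof (rule tendstoI)
 fix e :: real assume e: "e > 0"
 obtain \<kappa> where \<kappa>: "\<kappa> > 0" "!!P (M :: 'a measure) f u v. mid_convex q M P ==> f : Lp q M ==> u : Lp q M ==> v : Lp q M ==>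
  P u + fid q \<Lambda> M f u <= ennreal (s + \<kappa>) ==> P v + fid q \<Lambda> M f v <= ennreal (s + \<kappa>) ==>
  ennreal (s - \<kappa>) <= P (%x. (u x + v x) / 2) + fid q \<Lambda> M f (%x. (u x + v x) / 2) ==>
  Lpow q M (%x. u x - v x) < e"
  using near_minimizers_close[OF q L s(2) e] by blast
 obtain \<Phi> where \<Phi>: "\<Phi> : Fin" "ennreal (s - \<kappa>) <= m \<Phi>" using exF[OF \<kappa>(1)] by blast
 have k2: "\<kappa>/2 > 0" using \<kappa>(1) by simp
 show "\<forall>\<^sub>F \<e> in at_right 0. dist (Lpow q M (%x. u \<e> x - u0 x)) 0 < e"
  using up[OF k2] low[OF k2 \<Phi>(1)] pos
 proof eventually_elim
  fix \<e> :: real assume 1: "E \<e> (u \<e>) <= ennreal (s + \<kappa>/2)" and 2: "G \<Phi> (u \<e>) <= E \<e> (u \<e>) + ennreal (\<kappa>/2)" and e: "\<e> > 0"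
  \<comment> \<open>For one and the same finite family, \<open>u \<e>\<close> and \<open>u0\<close>
    are both near-minimizers, and the infimum of that family is almost \<open>s\<close>; so the two
    functions are close.\<close>
  have "Lpow q M (%x. u \<e> x - u0 x) < e"
  proof (rule \<kappa>(2)[OF cvx[OF \<Phi>(1)] f ue(1)[OF e] u0L])
  have "G \<Phi> (u \<e>) <= ennreal (s + \<kappa>/2) + ennreal (\<kappa>/2)" using 1 2 by (meson add_right_mono order_trans)
  also have "... = ennreal (s + \<kappa>)" using s \<kappa>(1) by (simp add: ennreal_plus[symmetric] del: ennreal_plus)
  finally show "sup_lin J \<Phi> (u \<e>) + fid q \<Lambda> M f (u \<e>) <= ennreal (s + \<kappa>)" by (simp add: G_def)
  have "G \<Phi> u0 <= G T u0" using \<Phi> by (intro Gmono) (auto simp: Fin_def)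
  also have "... <= ennreal (s + \<kappa>)" using s \<kappa>(1) by (simp add: ennreal_leI)
  finally show "sup_lin J \<Phi> u0 + fid q \<Lambda> M f u0 <= ennreal (s + \<kappa>)" by (simp add: G_def)
  show "ennreal (s - \<kappa>) <= sup_lin J \<Phi> (%x. (u \<e> x + u0 x) / 2) + fid q \<Lambda> M f (%x. (u \<e> x + u0 x) / 2)"
   using order_trans[OF \<Phi>(2) mG[OF Lp_mid[OF q ue(1)[OF e] u0L]]] by (simp add: G_def)
  qed
  thus "dist (Lpow q M (%x. u \<e> x - u0 x)) 0 < e" by simp
 qed
 qed
 have "((%\<e>. enn2real (E \<e> (u \<e>))) \<longlongrightarrow> s) (at_right 0)"
 proof (rule tendstoI)
 fix e :: real assume e: "e > 0"
 hence e4: "e/4 > 0" by simp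
 obtain \<Phi> where \<Phi>: "\<Phi> : Fin" "ennreal (s - e/4) <= m \<Phi>" using exF[OF e4] by blast
 show "\<forall>\<^sub>F \<e> in at_right 0. dist (enn2real (E \<e> (u \<e>))) s < e"
  using up[OF e4] low[OF e4 \<Phi>(1)] pos
 proof eventually_elim
  fix \<e> :: real assume 1: "E \<e> (u \<e>) <= ennreal (s + e/4)" and 2: "G \<Phi> (u \<e>) <= E \<e> (u \<e>) + ennreal (e/4)" and ep: "\<e> > 0"
  obtain r where r: "E \<e> (u \<e>) = ennreal r" "r >= 0" using 1 by (rule ennreal_le_cases)
  have "ennreal (s - e/4) <= ennreal (r + e/4)"
  using order_trans[OF \<Phi>(2) order_trans[OF mG[OF ue(1)[OF ep]] 2]] r e by simp
  hence "s - e/4 <= r + e/4" using r e by (simp add: ennreal_le_iff del: ennreal_plus)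
  moreover have "r <= s + e/4" using 1 r s e by (simp add: ennreal_le_iff del: ennreal_plus)
  ultimately show "dist (enn2real (E \<e> (u \<e>))) s < e" using r e by (simp add: dist_real_def abs_less_iff)
 qed
 qed
 hence "((%\<e>. ennreal (enn2real (E \<e> (u \<e>)))) \<longlongrightarrow> ennreal s) (at_right 0)" by (rule tendsto_ennrealI)
 moreover have "\<forall>\<^sub>F \<e> in at_right 0. ennreal (enn2real (E \<e> (u \<e>))) = E \<e> (u \<e>)"
 using up[of 1] by (rule eventually_mono) (auto elim: ennreal_le_cases)
 ultimately have "((%\<e>. E \<e> (u \<e>)) \<longlongrightarrow> ennreal s) (at_right 0)"
 using tendsto_cong by fast
 thus ?thesis using Lp0 s by (simp add: E_def G_def)
qed

section \<open>Invariance of Lebesgue measure under rigid motions\<close>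

lemma nn_integral_lborel_shift:
 fixes f :: "'a::euclidean_space => ennreal"
 assumes "f : borel_fun"
 shows "(\<integral>\<^sup>+x. f (c + x) \<partial>lborel) = (\<integral>\<^sup>+x. f x \<partial>lborel)"
 using nn_integral_distr[of "(+) c" lborel borel f] assms lborel_distr_plus[of c] by simp

lemma borel_measurable_orthogonal [measurable_dest]:
 fixes R :: "'a::euclidean_space => 'a"
 shows "orth R ==> R : borel_fun"
 by (intro borel_measurable_continuous_onI linear_continuous_on)
  (simp add: linear_conv_bounded_linear[symmetric] orthogonal_transformation_linear)

text \<open>
 Invariance under rotations follows from invariance under translations: integrate the translates
 of a function against the indicator of the unit ball, which is invariant, and exchange the order
 of integration.
\<close>

lemma lborel_distr_orthogonal:
 fixes R :: "'a::euclidean_space => 'a"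
 assumes R: "orth R"
 shows "distr lborel borel R = lborel"
proof (rule measure_eqI)
 note Rm [measurable] = borel_measurable_orthogonal[OF R]
 define S where "S = inv R"
 have S: "orth S" "!!y. R (S y) = y"
 using R by (auto simp: S_def orthogonal_transformation_inv orthogonal_transformation_surj surj_f_inv_f)
 have lin: "linear R" using R by (rule orthogonal_transformation_linear)
 define B where "B = ball (0::'a) 1"
 have B [measurable]: "B : sets borel" by (simp add: B_def)
 have "\<not> negligible B" unfolding B_def by (rule open_not_negligible) auto
 hence "B ~: null_sets lborel" by (auto simp: negligible_iff_null_sets dest: null_sets_completionI)
 hence B0: "emeasure lborel B ~= 0" "emeasure lborel B ~= top"
 using emeasure_bounded_finite[of B] by (auto simp: B_def null_sets_def)
 fix A :: "'a set" assume "A : sets (distr lborel borel R)"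
 hence A [measurable]: "A : sets borel" by simp
 have "emeasure lborel B * emeasure (distr lborel borel R) A =
  (\<integral>\<^sup>+y. indicator B y \<partial>lborel) * (\<integral>\<^sup>+x. indicator A (R x) \<partial>lborel)"
 proof -
 have "emeasure (distr lborel borel R) A = (\<integral>\<^sup>+x. indicator A x \<partial>distr lborel borel R)" by simp
 also have "... = (\<integral>\<^sup>+x. indicator A (R x) \<partial>lborel)" by (rule nn_integral_distr) auto
 finally show ?thesis by simp
 qed
 also have "... = (\<integral>\<^sup>+y. indicator B y * (\<integral>\<^sup>+x. indicator A (R x) \<partial>lborel) \<partial>lborel)"
 by (rule nn_integral_multc[symmetric]) simp
 also have "... = (\<integral>\<^sup>+y. \<integral>\<^sup>+x. indicator B y * indicator A (y + R x) \<partial>lborel \<partial>lborel)"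
 proof (rule nn_integral_cong)
 fix y
 have "(\<integral>\<^sup>+x. indicator A (R x) \<partial>lborel) = (\<integral>\<^sup>+x. indicator A (R (S y + x)) \<partial>lborel)"
  by (rule nn_integral_lborel_shift[symmetric]) measurable
 also have "... = (\<integral>\<^sup>+x. indicator A (y + R x) \<partial>lborel)" using S lin by (simp add: linear_add)
 finally show "indicator B y * (\<integral>\<^sup>+x. indicator A (R x) \<partial>lborel) = (\<integral>\<^sup>+x. indicator B y * indicator A (y + R x) \<partial>lborel)"
  by (simp add: nn_integral_cmult)
 qed
 also have "... = (\<integral>\<^sup>+x. \<integral>\<^sup>+y. indicator B y * indicator A (y + R x) \<partial>lborel \<partial>lborel)"
 by (rule lborel_pair.Fubini') measurable
 also have "... = (\<integral>\<^sup>+x. \<integral>\<^sup>+y. indicator B (y - R x) * indicator A y \<partial>lborel \<partial>lborel)"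
 proof (rule nn_integral_cong)
 fix x
 show "(\<integral>\<^sup>+y. indicator B y * indicator A (y + R x) \<partial>lborel) = (\<integral>\<^sup>+y. indicator B (y - R x) * indicator A y \<partial>lborel)"
  using nn_integral_lborel_shift[of "%y. indicator B y * indicator A (y + R x)" "- R x"] by simp
 qed
 also have "... = (\<integral>\<^sup>+y. \<integral>\<^sup>+x. indicator B (y - R x) * indicator A y \<partial>lborel \<partial>lborel)"
 by (rule lborel_pair.Fubini'[symmetric]) measurable
 also have "... = (\<integral>\<^sup>+y. emeasure lborel B * indicator A y \<partial>lborel)"
 proof (rule nn_integral_cong)
 fix y
 have "indicator B (y - R x) = (indicator B (- S y + x) :: ennreal)" for x
 proof -
  have "y - R x = R (S y - x)" using S lin by (simp add: linear_diff)
  hence "norm (y - R x) = norm (S y - x)" using orthogonal_transformation_norm[OF R] by simp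
  thus ?thesis by (simp add: B_def indicator_def norm_minus_commute)
 qed
 hence "(\<integral>\<^sup>+x. indicator B (y - R x) * indicator A y \<partial>lborel) = (\<integral>\<^sup>+x. indicator B (- S y + x) \<partial>lborel) * indicator A y"
  by (simp add: nn_integral_multc)
 also have "(\<integral>\<^sup>+x. indicator B (- S y + x) \<partial>lborel) = emeasure lborel B"
  by (subst nn_integral_lborel_shift) auto
 finally show "(\<integral>\<^sup>+x. indicator B (y - R x) * indicator A y \<partial>lborel) = emeasure lborel B * indicator A y" .
 qed
 also have "... = emeasure lborel B * emeasure lborel A" by (simp add: nn_integral_cmult)
 finally show "emeasure (distr lborel borel R) A = emeasure lborel A"
 using B0 by (simp add: ennreal_mult_cancel_left)
qed simp

lemma lborel_distr_rigid:
 fixes R :: "'a::euclidean_space => 'a"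
 assumes R: "orth R"
 shows "distr lborel borel (%x. a + R x) = lborel"
proof -
 note [measurable] = borel_measurable_orthogonal[OF R]
 have "distr lborel borel (%x. a + R x) = distr (distr lborel borel R) borel ((+) a)"
 by (subst distr_distr) (auto simp: comp_def)
 thus ?thesis by (simp add: lborel_distr_orthogonal[OF R] lborel_distr_plus)
qed

lemma nn_integral_rigid:
 fixes R :: "'a::euclidean_space => 'a"
 assumes R: "orth R" and f: "f : borel_fun"
 shows "(\<integral>\<^sup>+x. f (a + R x) \<partial>lborel) = (\<integral>\<^sup>+x. f x \<partial>lborel)"
proof -
 note [measurable] = borel_measurable_orthogonal[OF R] f
 show ?thesis using nn_integral_distr[of "%x. a + R x" lborel borel f] lborel_distr_rigid[OF R, of a] by simp
qed

lemma integral_rigid: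
 fixes R :: "'a::euclidean_space => 'a" and f :: "'a => 'b::{banach, second_countable_topology}"
 assumes R: "orth R" and f: "f : borel_fun"
 shows "(LINT x|lborel. f (a + R x)) = (LINT x|lborel. f x)"
 and "L1 (%x. f (a + R x)) \<longleftrightarrow> L1 f"
proof -
 note [measurable] = borel_measurable_orthogonal[OF R] f
 show "(LINT x|lborel. f (a + R x)) = (LINT x|lborel. f x)"
 using integral_distr[of "%x. a + R x" lborel borel f] lborel_distr_rigid[OF R, of a] by simp
 show "L1 (%x. f (a + R x)) \<longleftrightarrow> L1 f"
 using integrable_distr_eq[of "%x. a + R x" lborel borel f] lborel_distr_rigid[OF R, of a] by simp
qed

lemmas integral_shift = integral_rigid(1)[OF orthogonal_transformation_id]
lemmas integrable_shift = integral_rigid(2)[OF orthogonal_transformation_id]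
lemmas orthogonal_uminus = orthogonal_transformation_neg[THEN iffD2, OF orthogonal_transformation_id]
lemmas integral_reflect_shift = integral_rigid(1)[OF orthogonal_uminus]
lemmas integrable_reflect_shift = integral_rigid(2)[OF orthogonal_uminus]
lemmas nn_integral_reflect_shift = nn_integral_rigid[OF orthogonal_uminus]

section \<open>Cubes described by centre and rotation\<close>

definition cube0 :: "real => (real^'n) set" where
 "cube0 \<e> = box (\<chi> i. - \<e> / 2) (\<chi> i. \<e> / 2)"

lemma mem_cube0: "z : cube0 \<e> \<longleftrightarrow> (\<forall>i. \<bar>z $ i\<bar> < \<e> / 2)"
proof -
 have "(- \<e> / 2 < z $ i & z $ i < \<e> / 2) \<longleftrightarrow> \<bar>z $ i\<bar> < \<e> / 2" for i
 unfolding abs_less_iff by (auto simp: minus_less_iff)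
 thus ?thesis by (simp add: cube0_def mem_box_cart)
qed

lemma norm_cube0: "(z::real^'n) : cube0 \<e> ==> norm z <= real CARD('n) * \<e> / 2"
proof -
 assume z: "z : cube0 \<e>"
 have "norm z <= (\<Sum>i\<in>UNIV. \<bar>z $ i\<bar>)" by (rule norm_le_l1_cart)
 also have "... <= (\<Sum>i\<in>(UNIV::'n set). \<e> / 2)" using z by (intro sum_mono) (auto simp: mem_cube0 less_imp_le)
 finally show ?thesis by simp
qed

lemma cube0_meas [measurable]: "cube0 \<e> : sets borel" by (simp add: cube0_def)

lemma emeasure_cube0:
 assumes "\<e> > 0" shows "emeasure lborel (cube0 \<e> :: (real^'n) set) = ennreal (\<e> ^ CARD('n))"
proof -
 have "emeasure lborel (cube0 \<e> :: (real^'n) set) = (\<Prod>b\<in>Basis. ((\<chi> i. \<e> / 2) - (\<chi> i. - \<e> / 2) :: real^'n) \<bullet> b)"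
 unfolding cube0_def using assms by (intro emeasure_lborel_box) (auto simp: Basis_vec_def inner_axis)
 also have "(\<Prod>b\<in>Basis. ((\<chi> i. \<e> / 2) - (\<chi> i. - \<e> / 2) :: real^'n) \<bullet> b) = (\<Prod>b\<in>(Basis::(real^'n) set). \<e>)"
 by (intro prod.cong) (auto simp: Basis_vec_def inner_axis)
 finally show ?thesis by simp
qed

definition rcube :: "real^'n => (real^'n => real^'n) => real => (real^'n) set" where
 "rcube c R \<e> = (%z. c + R z) ` cube0 \<e>"

text \<open>The descriptions differ in the marked point: \<open>cubes\<close> starts from a corner,
  \<open>rcube\<close> from the centre, which is reached from the corner by \<open>R\<close> of half
  the diagonal. Around the centre, odd integrands cancel.\<close>

lemma cubes_rcube: "Q : cubes \<e> \<longleftrightarrow> (\<exists>c R. orth R & Q = rcube c R \<e>)"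
proof -
 have eq: "(%x. a + R x) ` box 0 (\<chi> i. \<e>) = rcube (a + R (\<chi> i. \<e> / 2)) R \<e>"
 if R: "orth R" for R :: "real^'n => real^'n" and a
 proof -
 have lin: "linear R" using R by (rule orthogonal_transformation_linear)
 have b: "box 0 (\<chi> i. \<e>) = (%z. (\<chi> i. \<e> / 2) + z) ` (cube0 \<e> :: (real^'n) set)"
 proof (intro set_eqI iffI)
  fix z :: "real^'n" assume "z : box 0 (\<chi> i. \<e>)"
  thus "z : (%z. (\<chi> i. \<e> / 2) + z) ` cube0 \<e>"
  by (intro image_eqI[of _ _ "z - (\<chi> i. \<e> / 2)"]) (auto simp: cube0_def mem_box_cart)
 next
  fix x :: "real^'n" assume "x : (%z. (\<chi> i. \<e> / 2) + z) ` cube0 \<e>"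
  then obtain z where z: "x = (\<chi> i. \<e> / 2) + z" "z : cube0 \<e>" by auto
  have "0 < x $ i & x $ i < \<e>" for i
  proof -
  have "\<bar>z $ i\<bar> < \<e> / 2" using z(2) mem_cube0 by blast
  hence "- (\<e> / 2) < z $ i" "z $ i < \<e> / 2" by (auto simp: abs_less_iff)
  moreover have "x $ i = \<e> / 2 + z $ i" by (simp add: z(1))
  ultimately show ?thesis by (intro conjI) linarith+
  qed
  thus "x : box 0 (\<chi> i. \<e>)" by (simp add: mem_box_cart)
 qed
 show ?thesis unfolding rcube_def b image_image using lin by (simp add: linear_add add.assoc)
 qed
 show ?thesis
 proof
 assume "Q : cubes \<e>"
 thus "\<exists>c R. orth R & Q = rcube c R \<e>" unfolding cubes_def using eq by blast
 next
 assume "\<exists>c R. orth R & Q = rcube c R \<e>"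
 then obtain c R where R: "orth R" "Q = rcube c R \<e>" by blast
 have "Q = (%x. (c - R (\<chi> i. \<e> / 2)) + R x) ` box 0 (\<chi> i. \<e>)" unfolding eq[OF R(1)] R(2) by simp
 thus "Q : cubes \<e>" unfolding cubes_def using R(1) by blast
 qed
qed

lemma rcube_indicator:
 assumes "orth R"
 shows "indicator (rcube c R \<e>) (c + R z) = (indicator (cube0 \<e>) z :: 'b::zero_neq_one)"
proof -
 have "c + R z : rcube c R \<e> \<longleftrightarrow> z : cube0 \<e>"
 using inj_image_mem_iff[OF orthogonal_transformation_inj[OF assms], of z "cube0 \<e>"] by (auto simp: rcube_def)
 thus ?thesis by (simp add: indicator_def)
qed

lemma rcube_open:
 assumes R: "orth R" shows "open (rcube c R \<e>)"
proof -
 have "open (R ` cube0 \<e>)"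
 by (intro open_surjective_linear_image) (use R in \<open>auto simp: cube0_def orthogonal_transformation_linear orthogonal_transformation_surj\<close>)
 hence "open ((+) c ` (R ` cube0 \<e>))" by (rule open_translation)
 thus ?thesis by (simp add: rcube_def image_image)
qed

lemma rcube_meas [measurable]: "orth R ==> rcube c R \<e> : sets borel"
 by (intro borel_open rcube_open)

lemma rcube_center_dist:
 fixes c :: "real^'n"
 assumes "orth R" "y : rcube c R \<e>"
 shows "norm (y - c) <= real CARD('n) * \<e> / 2"
proof -
 obtain z where "z : cube0 \<e>" "y = c + R z" using assms by (auto simp: rcube_def)
 thus ?thesis using norm_cube0[of z \<e>] by (simp add: orthogonal_transformation_norm[OF assms(1)])
qed

lemma rcube_center: "orth R ==> \<e> > 0 ==> c : rcube c R \<e>"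
 unfolding rcube_def by (rule image_eqI[of _ _ 0]) (auto simp: mem_cube0 orthogonal_transformation_linear linear_0)


lemma emeasure_rcube:
 fixes c :: "real^'n"
 assumes R: "orth R" and e: "\<e> > 0"
 shows "emeasure lborel (rcube c R \<e>) = ennreal (\<e> ^ CARD('n))"
proof -
 note [measurable] = rcube_meas[OF R]
 have "emeasure lborel (rcube c R \<e>) = (\<integral>\<^sup>+x. indicator (rcube c R \<e>) x \<partial>lborel)" by simp
 also have "... = (\<integral>\<^sup>+x. indicator (rcube c R \<e>) (c + R x) \<partial>lborel)" by (rule nn_integral_rigid[symmetric]) (use R in auto)
 also have "... = emeasure lborel (cube0 \<e> :: (real^'n) set)" by (simp add: rcube_indicator[OF R])
 finally show ?thesis using emeasure_cube0[OF e] by simp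
qed

lemma measure_rcube:
 fixes c :: "real^'n"
 assumes R: "orth R" and e: "\<e> > 0"
 shows "measure lborel (rcube c R \<e>) = \<e> ^ CARD('n)"
 using emeasure_rcube[OF assms] e by (simp add: measure_def)

lemma rcube_bounded: "orth R ==> bounded (rcube (c::real^'n) R \<e>)"
proof -
 assume R: "orth R"
 have "rcube c R \<e> <= cball c (real CARD('n) * \<e> / 2)"
 using rcube_center_dist[OF R] by (auto simp: dist_norm norm_minus_commute)
 thus ?thesis using bounded_cball bounded_subset by blast
qed

lemma rcube_translate: "(%x. z + x) ` rcube c R \<e> = rcube (z + c) R \<e>"
 by (simp add: rcube_def image_image add.assoc)

section \<open>Averages and mean oscillation\<close>

lemma measure_lebesgue_lborel: "A : sets borel ==> measure lebesgue A = measure lborel A"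
 by (simp add: measure_def)

lemma average_lborel:
 fixes u :: "real^'n => real"
 assumes [measurable]: "Q : sets borel" "u : borel_fun"
 shows "average Q u = (LINT x|lborel. indicator Q x * u x) / measure lborel Q"
proof -
 have "(LINT x|lebesgue_on Q. u x) = (LINT x|lebesgue. indicator Q x *\<^sub>R u x)"
 by (rule integral_restrict_space) simp
 also have "... = (LINT x|lborel. indicator Q x *\<^sub>R u x)" by (rule integral_completion) measurable
 finally show ?thesis by (simp add: average_def measure_lebesgue_lborel)
qed

definition mosc :: "(real^'n) set => (real^'n => real) => real" where
 "mosc Q u = average Q (%x. \<bar>u x - average Q u\<bar>)"

lemma average_nonneg: "(!!x. u x >= 0) ==> average Q u >= 0"
 by (simp add: average_def)

lemma mosc_nonneg [simp]: "mosc Q u >= 0"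
 unfolding mosc_def by (rule average_nonneg) simp

context
 fixes Q :: "(real^'n) set"
 assumes Q: "Q : lmeasurable" "measure lebesgue Q > 0"
begin

lemma finite_measure_lebesgue_on: "finite_measure (lebesgue_on Q)"
 using Q by (intro finite_measureI) (auto simp: emeasure_restrict_space fmeasurable_def)

interpretation Qm: finite_measure "lebesgue_on Q" by (rule finite_measure_lebesgue_on)

lemma average_const: "average Q (%x. c) = c"
 using Q by (simp add: average_def measure_restrict_space fmeasurable_def)

lemma average_add: "integrable (lebesgue_on Q) u ==> integrable (lebesgue_on Q) v ==>
 average Q (%x. u x + v x) = average Q u + average Q v"
 by (simp add: average_def add_divide_distrib)

lemma average_diff: "integrable (lebesgue_on Q) u ==> integrable (lebesgue_on Q) v ==>
 average Q (%x. u x - v x) = average Q u - average Q v"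
 by (simp add: average_def diff_divide_distrib)

lemma average_cmult: "average Q (%x. c * u x) = c * average Q u"
 by (simp add: average_def)

lemma average_mono: "integrable (lebesgue_on Q) u ==> integrable (lebesgue_on Q) v ==> (!!x. x : Q ==> u x <= v x) ==>
 average Q u <= average Q v"
 unfolding average_def using Q by (intro divide_right_mono integral_mono) auto

lemma average_abs: "integrable (lebesgue_on Q) u ==> \<bar>average Q u\<bar> <= average Q (%x. \<bar>u x\<bar>)"
 using average_mono[of u "%x. \<bar>u x\<bar>"] average_mono[of "%x. - 1 * u x" "%x. \<bar>u x\<bar>"] average_cmult[of "-1" u]
 by (auto simp: abs_le_iff)

lemma mosc_mid:
 assumes u: "integrable (lebesgue_on Q) u" and v: "integrable (lebesgue_on Q) v"
 shows "2 * mosc Q (%x. (u x + v x) / 2) <= mosc Q u + mosc Q v"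
proof -
 have a: "average Q (%x. (u x + v x) / 2) = (average Q u + average Q v) / 2"
 using average_cmult[of "1/2" "%x. u x + v x"] average_add[OF u v] by simp
 have "mosc Q (%x. (u x + v x) / 2) <= average Q (%x. 1/2 * (\<bar>u x - average Q u\<bar> + \<bar>v x - average Q v\<bar>))"
 unfolding mosc_def a
 proof (rule average_mono)
 fix x show "\<bar>(u x + v x) / 2 - (average Q u + average Q v) / 2\<bar> <= 1/2 * (\<bar>u x - average Q u\<bar> + \<bar>v x - average Q v\<bar>)"
  using abs_triangle_ineq[of "(u x - average Q u) / 2" "(v x - average Q v) / 2"] by (simp add: field_simps)
 qed (use u v in auto)
 also have "... = 1/2 * (mosc Q u + mosc Q v)"
 unfolding mosc_def average_cmult using u v by (subst average_add) auto
 finally show ?thesis by simp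
qed

text \<open>The mean distance enters twice: once through the functions and once through their
  averages.\<close>

lemma mosc_le:
 assumes u: "integrable (lebesgue_on Q) u" and v: "integrable (lebesgue_on Q) v"
 shows "mosc Q u <= mosc Q v + 2 * average Q (%x. \<bar>u x - v x\<bar>)"
proof -
 have ad: "\<bar>average Q v - average Q u\<bar> <= average Q (%x. \<bar>u x - v x\<bar>)"
 using average_abs[of "%x. u x - v x"] u v by (simp add: average_diff abs_minus_commute)
 have "mosc Q u <= average Q (%x. (\<bar>v x - average Q v\<bar> + \<bar>u x - v x\<bar>) + average Q (%x. \<bar>u x - v x\<bar>))"
 unfolding mosc_def using u v ad by (intro average_mono) auto
 also have "... = mosc Q v + 2 * average Q (%x. \<bar>u x - v x\<bar>)"
 using u v by (subst average_add, simp, simp, subst average_add) (auto simp: average_const mosc_def)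
 finally show ?thesis .
qed

lemma mosc_const: "mosc Q (%x. c) = 0"
 unfolding mosc_def average_const by (simp add: average_def)


text \<open>Constants do not oscillate and \<open>l\<close> has mean zero, so only the mean of |l|
  is left, up to twice the approximation error.\<close>

lemma mosc_affine_approx:
 assumes u: "integrable (lebesgue_on Q) u" and l: "integrable (lebesgue_on Q) l" and l0: "average Q l = 0"
 and d: "!!x. x : Q ==> \<bar>u x - c - l x\<bar> <= d"
 shows "mosc Q u <= average Q (%x. \<bar>l x\<bar>) + 2 * d"
proof -
 have i: "integrable (lebesgue_on Q) (%x. c + l x)" using l by auto
 have "average Q (%x. c + l x) = c" using l l0 by (simp add: average_add average_const)
 hence m: "mosc Q (%x. c + l x) = average Q (%x. \<bar>l x\<bar>)" by (simp add: mosc_def)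
 have "average Q (%x. \<bar>u x - (c + l x)\<bar>) <= average Q (%x. d)"
 using u i d by (intro average_mono) (auto simp: diff_diff_eq)
 thus ?thesis using mosc_le[OF u i] m by (simp add: average_const)
qed

text \<open>A weight of mean zero does not see the average of \<open>u\<close>, which may be
  subtracted before estimating. Bounds the oscillation from below by testing.\<close>

lemma mosc_dual:
 assumes u: "integrable (lebesgue_on Q) u" and s: "s : borel_measurable (lebesgue_on Q)" "!!x. \<bar>s x\<bar> <= 1"
 and s0: "(LINT x|lebesgue_on Q. s x) = 0"
 shows "(LINT x|lebesgue_on Q. u x * s x) <= measure lebesgue Q * mosc Q u"
proof -
 note [measurable] = s(1)
 have si: "integrable (lebesgue_on Q) s" using s by (intro Qm.integrable_const_bound[of _ 1]) auto
 have ui: "integrable (lebesgue_on Q) (%x. u x * s x)"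
 using u by (rule Bochner_Integration.integrable_bound) (use u s(2) in \<open>auto simp: abs_mult intro!: mult_left_le\<close>)
 have "(LINT x|lebesgue_on Q. u x * s x) = (LINT x|lebesgue_on Q. u x * s x - average Q u * s x)"
 using si ui s0 by simp
 also have "... <= (LINT x|lebesgue_on Q. \<bar>u x - average Q u\<bar>)"
 proof (rule integral_mono)
 fix x
 have "u x * s x - average Q u * s x = (u x - average Q u) * s x" by (simp add: algebra_simps)
 also have "... <= \<bar>u x - average Q u\<bar> * \<bar>s x\<bar>" by (metis abs_ge_self abs_mult)
 also have "... <= \<bar>u x - average Q u\<bar>" using s(2)[of x] by (intro mult_left_le) auto
 finally show "u x * s x - average Q u * s x <= \<bar>u x - average Q u\<bar>" .
 qed (use u si ui in auto)
 also have "... = measure lebesgue Q * mosc Q u" using Q by (simp add: mosc_def average_def)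
 finally show ?thesis .
qed

text \<open>On a set of finite measure \<open>abs_le_powr\<close> yields integrability and a bound
  for the average in which \<eta> is arbitrary; in this way convergence in L^q controls the
  oscillation on a fixed cube.\<close>

lemma Lp_integrable_on:
 assumes q: "q > 1" and S: "Q <= S" "S : sets lebesgue" and u: "u : Lp q (lebesgue_on S)"
 shows "integrable (lebesgue_on Q) u"
 and "\<eta> > 0 ==> average Q (%x. \<bar>u x\<bar>) <= \<eta> + \<eta> powr (1 - q) / measure lebesgue Q * Lpow q (lebesgue_on S) u"
proof -
 have Qs: "Q : sets lebesgue" using Q by auto
 have [measurable]: "u : borel_measurable (lebesgue_on Q)"
 using measurable_restrict_mono[OF _ S(1)] u by (auto simp: Lp_def)
 have iS: "integrable lebesgue (%x. indicator S x *\<^sub>R \<bar>u x\<bar> powr q)"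
 using Lp_integrable[OF u] S(2) integrable_restrict_space[of S lebesgue "%x. \<bar>u x\<bar> powr q"] by simp
 hence "integrable lebesgue (%x. indicator Q x *\<^sub>R (indicator S x *\<^sub>R \<bar>u x\<bar> powr q))"
 by (rule integrable_mult_indicator[OF Qs])
 moreover have ind: "indicator Q x *\<^sub>R (indicator S x *\<^sub>R \<bar>u x\<bar> powr q) = indicator Q x *\<^sub>R \<bar>u x\<bar> powr q" for x
 using S(1) by (auto simp: indicator_def)
 ultimately have iQ: "integrable lebesgue (%x. indicator Q x *\<^sub>R \<bar>u x\<bar> powr q)" by (simp only:)
 hence pQ: "integrable (lebesgue_on Q) (%x. \<bar>u x\<bar> powr q)"
 using Qs by (subst integrable_restrict_space) simp_all
 have le: "(LINT x|lebesgue_on Q. \<bar>u x\<bar> powr q) <= Lpow q (lebesgue_on S) u"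
 unfolding Lpow_def using Qs S iS iQ
 by (subst (1 2) integral_restrict_space) (auto intro!: integral_mono simp: indicator_def)
 show ui: "integrable (lebesgue_on Q) u"
 by (rule Bochner_Integration.integrable_bound[where f="%x. 1 + 1 * \<bar>u x\<bar> powr q"])
  (use pQ abs_le_powr[OF q, of 1] in auto)
 assume \<eta>: "\<eta> > 0"
 have "average Q (%x. \<bar>u x\<bar>) <= average Q (%x. \<eta> + \<eta> powr (1 - q) * \<bar>u x\<bar> powr q)"
 using ui pQ abs_le_powr[OF q \<eta>] by (intro average_mono) auto
 also have "... = \<eta> + \<eta> powr (1 - q) * average Q (%x. \<bar>u x\<bar> powr q)"
 using pQ by (subst average_add) (auto simp: average_const average_cmult)
 also have "average Q (%x. \<bar>u x\<bar> powr q) <= Lpow q (lebesgue_on S) u / measure lebesgue Q"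
 unfolding average_def by (intro divide_right_mono le) auto
 finally show "average Q (%x. \<bar>u x\<bar>) <= \<eta> + \<eta> powr (1 - q) / measure lebesgue Q * Lpow q (lebesgue_on S) u"
 by (simp add: mult_left_mono)
qed

end

lemma cube_lmeasurable:
 assumes "Q : cubes \<e>" "\<e> > 0"
 shows "Q : lmeasurable" "measure lebesgue Q = \<e> ^ CARD('n)" "measure lebesgue (Q :: (real^'n) set) > 0" "open Q"
proof -
 obtain c R where R: "orth R" "Q = rcube c R \<e>" using assms cubes_rcube by blast
 show op: "open Q" using R rcube_open by auto
 show "Q : lmeasurable" using R rcube_bounded[OF R(1)] op by (simp add: lmeasurable_open)
 show "measure lebesgue Q = \<e> ^ CARD('n)" using R op measure_rcube[OF R(1) assms(2)] by (simp add: measure_lebesgue_lborel)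
 thus "measure lebesgue Q > 0" using assms by simp
qed

section \<open>The functional \<open>K_fun\<close> and its minimizers\<close>

definition finite_families :: "real => (real^'n) set => (real^'n) set set set" where
 "finite_families \<e> S = {\<G>. finite \<G> & \<G> : cube_families \<e> S}"

text \<open>The sum over an infinite family is the supremum of its finite partial sums, and a
  subfamily of an admissible family is admissible. Convexity and semicontinuity can then be checked
  on finite sums.\<close>

lemma K_fun_finite:
 "K_fun \<e> S (u :: real^'n => real) = (SUP \<G>\<in>finite_families \<e> S. ennreal (\<e> ^ (CARD('n) - 1)) * (\<Sum>Q\<in>\<G>. ennreal (mosc Q u)))"
proof -
 have sub: "F : finite_families \<e> S" if "\<G> : cube_families \<e> S" "finite F" "F <= \<G>" for F \<G>
 using that by (auto simp: finite_families_def cube_families_def intro: pairwise_mono)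
 have "(SUP \<G>\<in>cube_families \<e> S. \<Sum>\<^sub>\<infinity>Q\<in>\<G>. ennreal (mosc Q u)) = (SUP \<G>\<in>finite_families \<e> S. \<Sum>Q\<in>\<G>. ennreal (mosc Q u))"
 proof (rule antisym)
 show "(SUP \<G>\<in>cube_families \<e> S. \<Sum>\<^sub>\<infinity>Q\<in>\<G>. ennreal (mosc Q u)) <= (SUP \<G>\<in>finite_families \<e> S. \<Sum>Q\<in>\<G>. ennreal (mosc Q u))"
 proof (rule SUP_least)
  fix \<G> assume "\<G> : cube_families \<e> S"
  thus "(\<Sum>\<^sub>\<infinity>Q\<in>\<G>. ennreal (mosc Q u)) <= (SUP \<G>\<in>finite_families \<e> S. \<Sum>Q\<in>\<G>. ennreal (mosc Q u))"
  by (subst nonneg_infsum_complete) (auto intro!: SUP_least SUP_upper sub)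
 qed
 show "(SUP \<G>\<in>finite_families \<e> S. \<Sum>Q\<in>\<G>. ennreal (mosc Q u)) <= (SUP \<G>\<in>cube_families \<e> S. \<Sum>\<^sub>\<infinity>Q\<in>\<G>. ennreal (mosc Q u))"
 proof (rule SUP_least)
  fix \<G> assume \<G>: "\<G> : finite_families \<e> S"
  hence "(\<Sum>Q\<in>\<G>. ennreal (mosc Q u)) = (\<Sum>\<^sub>\<infinity>Q\<in>\<G>. ennreal (mosc Q u))" by (simp add: finite_families_def)
  also have "... <= (SUP \<G>\<in>cube_families \<e> S. \<Sum>\<^sub>\<infinity>Q\<in>\<G>. ennreal (mosc Q u))"
  using \<G> by (intro SUP_upper) (simp add: finite_families_def)
  finally show "(\<Sum>Q\<in>\<G>. ennreal (mosc Q u)) <= (SUP \<G>\<in>cube_families \<e> S. \<Sum>\<^sub>\<infinity>Q\<in>\<G>. ennreal (mosc Q u))" .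
 qed
 qed
 thus ?thesis unfolding K_fun_def mosc_def[symmetric] by (simp add: SUP_mult_left_ennreal)
qed

lemma Lq_Lp: "Lq q S = Lp q (lebesgue_on S)"
 by (simp add: Lq_def Lp_def)

lemma family_cube:
 assumes "\<G> : finite_families \<e> S" "Q : \<G>" "\<e> > 0"
 shows "Q : lmeasurable" "measure lebesgue (Q::(real^'n) set) > 0" "Q <= S"
 using assms cube_lmeasurable[of Q \<e>] by (auto simp: finite_families_def cube_families_def)

lemma K_fun_convex:
 assumes q: "q > 1" and S: "S : sets lebesgue" and e: "\<e> > 0"
 shows "mid_convex q (lebesgue_on S) (K_fun \<e> S :: (real^'n => real) => ennreal)"
 unfolding mid_convex_def
proof (intro ballI)
 fix u v :: "real^'n => real" assume uv: "u : Lp q (lebesgue_on S)" "v : Lp q (lebesgue_on S)"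
 let ?c = "ennreal (\<e> ^ (CARD('n) - 1))"
 show "2 * K_fun \<e> S (%x. (u x + v x) / 2) <= K_fun \<e> S u + K_fun \<e> S v"
 unfolding K_fun_finite[of \<e> S "%x. (u x + v x) / 2"] SUP_mult_left_ennreal
 proof (rule SUP_least)
 fix \<G> :: "(real^'n) set set" assume \<G>: "\<G> : finite_families \<e> S"
 have "2 * (?c * (\<Sum>Q\<in>\<G>. ennreal (mosc Q (%x. (u x + v x) / 2)))) = ?c * (\<Sum>Q\<in>\<G>. 2 * ennreal (mosc Q (%x. (u x + v x) / 2)))"
  by (subst mult.left_commute) (subst sum_distrib_left, rule refl)
 also have "... <= ?c * (\<Sum>Q\<in>\<G>. ennreal (mosc Q u) + ennreal (mosc Q v))"
 proof (intro mult_left_mono sum_mono)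
  fix Q assume "Q : \<G>"
  note Q = family_cube[OF \<G> this e]
  have "2 * ennreal (mosc Q (%x. (u x + v x) / 2)) = ennreal (2 * mosc Q (%x. (u x + v x) / 2))" by (simp add: ennreal_mult')
  also have "... <= ennreal (mosc Q u + mosc Q v)"
  by (intro ennreal_leI mosc_mid Lp_integrable_on(1)[OF Q(1,2) q Q(3) S] Q uv)
  finally show "2 * ennreal (mosc Q (%x. (u x + v x) / 2)) <= ennreal (mosc Q u) + ennreal (mosc Q v)" by simp
 qed auto
 also have "... = ?c * (\<Sum>Q\<in>\<G>. ennreal (mosc Q u)) + ?c * (\<Sum>Q\<in>\<G>. ennreal (mosc Q v))"
  by (simp add: sum.distrib distrib_left)
 also have "... <= K_fun \<e> S u + K_fun \<e> S v"
  unfolding K_fun_finite using \<G> by (intro add_mono SUP_upper)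
 finally show "2 * (?c * (\<Sum>Q\<in>\<G>. ennreal (mosc Q (%x. (u x + v x) / 2)))) <= K_fun \<e> S u + K_fun \<e> S v" .
 qed
qed

lemma mosc_continuous:
 assumes q: "q > 1" and Q: "Q : lmeasurable" "measure lebesgue Q > 0" "Q <= S" and S: "S : sets lebesgue"
 and u: "u : Lp q (lebesgue_on S)" and U: "!!k::nat. U k : Lp q (lebesgue_on S)"
 and lim: "(%k. Lpow q (lebesgue_on S) (%x. U k x - u x)) \<longlonglongrightarrow> 0"
 shows "(%k. mosc Q (U k)) \<longlonglongrightarrow> mosc Q u"
proof (rule LIMSEQ_I)
 fix e :: real assume e: "e > 0"
 define \<eta> where "\<eta> = e / 4"
 have \<eta>: "\<eta> > 0" using e by (simp add: \<eta>_def)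
 have int: "integrable (lebesgue_on Q) w" if "w : Lp q (lebesgue_on S)" for w
 by (rule Lp_integrable_on(1)[OF Q(1,2) q Q(3) S that])
 let ?c = "\<eta> powr (1 - q) / measure lebesgue Q"
 have "(%k. ?c * Lpow q (lebesgue_on S) (%x. U k x - u x)) \<longlonglongrightarrow> ?c * 0" by (intro tendsto_intros lim)
 hence "\<forall>\<^sub>F k in sequentially. ?c * Lpow q (lebesgue_on S) (%x. U k x - u x) < \<eta>" using \<eta> by (intro order_tendstoD(2)) auto
 then obtain K where K: "!!k. k >= K ==> ?c * Lpow q (lebesgue_on S) (%x. U k x - u x) < \<eta>" by (auto simp: eventually_sequentially)
 show "\<exists>no. \<forall>n\<ge>no. norm (mosc Q (U n) - mosc Q u) < e"
 proof (intro exI allI impI)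
 fix k assume k: "k >= K"
 have a: "average Q (%x. \<bar>U k x - u x\<bar>) < 2 * \<eta>"
  using Lp_integrable_on(2)[OF Q(1,2) q Q(3) S Lp_diff[OF q U u] \<eta>, of k] K[OF k] by simp
 have b: "average Q (%x. \<bar>u x - U k x\<bar>) = average Q (%x. \<bar>U k x - u x\<bar>)" by (simp add: abs_minus_commute)
 show "norm (mosc Q (U k) - mosc Q u) < e"
  using mosc_le[OF Q(1,2) int[OF U] int[OF u], of k] mosc_le[OF Q(1,2) int[OF u] int[OF U], of k] a b
  by (simp add: \<eta>_def abs_less_iff)
 qed
qed

text \<open>For a finite family the sum of oscillations is continuous in L^q, and a supremum of
  continuous functionals is lower semicontinuous.\<close>

lemma K_fun_lsc:
 assumes q: "q > 1" and S: "S : sets lebesgue" and e: "\<e> > 0"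
 shows "seq_lsc q (lebesgue_on S) (K_fun \<e> S :: (real^'n => real) => ennreal)"
 unfolding seq_lsc_def
proof (intro ballI allI impI)
 fix U :: "nat => real^'n => real" and u
 assume u: "u : Lp q (lebesgue_on S)" and U: "\<forall>k. U k : Lp q (lebesgue_on S)" "(%k. Lpow q (lebesgue_on S) (%x. U k x - u x)) \<longlonglongrightarrow> 0"
 let ?c = "ennreal (\<e> ^ (CARD('n) - 1))"
 show "K_fun \<e> S u <= liminf (%k. K_fun \<e> S (U k))"
 unfolding K_fun_finite[of \<e> S u]
 proof (rule SUP_least)
 fix \<G> :: "(real^'n) set set" assume \<G>: "\<G> : finite_families \<e> S"
 have "(%k. ennreal (\<e> ^ (CARD('n) - 1) * (\<Sum>Q\<in>\<G>. mosc Q (U k)))) \<longlonglongrightarrow> ennreal (\<e> ^ (CARD('n) - 1) * (\<Sum>Q\<in>\<G>. mosc Q u))"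
 proof (intro tendsto_ennrealI tendsto_mult tendsto_const tendsto_sum)
  fix Q assume "Q : \<G>"
  from mosc_continuous[OF q family_cube[OF \<G> this e] S u] U show "(%k. mosc Q (U k)) \<longlonglongrightarrow> mosc Q u" by auto
 qed
 moreover have eq: "?c * (\<Sum>Q\<in>\<G>. ennreal (mosc Q w)) = ennreal (\<e> ^ (CARD('n) - 1) * (\<Sum>Q\<in>\<G>. mosc Q w))" for w
  using e by (simp add: ennreal_mult sum_nonneg)
 ultimately have "(%k. ?c * (\<Sum>Q\<in>\<G>. ennreal (mosc Q (U k)))) \<longlonglongrightarrow> ?c * (\<Sum>Q\<in>\<G>. ennreal (mosc Q u))" by simp
 hence "?c * (\<Sum>Q\<in>\<G>. ennreal (mosc Q u)) = liminf (%k. ?c * (\<Sum>Q\<in>\<G>. ennreal (mosc Q (U k))))"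
  by (intro lim_imp_Liminf[symmetric]) auto
 also have "... <= liminf (%k. K_fun \<e> S (U k))"
  unfolding K_fun_finite by (intro Liminf_mono always_eventually allI SUP_upper \<G>)
 finally show "?c * (\<Sum>Q\<in>\<G>. ennreal (mosc Q u)) <= liminf (%k. K_fun \<e> S (U k))" .
 qed
qed

lemma K_fun_zero: "\<e> > 0 ==> K_fun \<e> S (%x. 0 :: real) = 0"
proof -
 assume e: "\<e> > 0"
 have "mosc Q (%x. 0) = 0" if "\<G> : finite_families \<e> S" "Q : \<G>" for \<G> Q
 using mosc_const[OF family_cube(1,2)[OF that e]] .
 thus ?thesis unfolding K_fun_finite by (auto intro!: SUP_eqI simp: )
qed

theorem F_eps_minimizer:
 fixes f :: "real^'n => real"
 assumes S: "S : sets lebesgue" and q: "q > 1" and L: "\<Lambda> > 0" and f: "f : Lq q S" and e: "\<e> > 0"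
 shows "\<exists>u. unique_minimizer S (F_eps q \<Lambda> f \<e> S) (Lq q S) u"
proof -
 have F: "F_eps q \<Lambda> f \<e> S u = K_fun \<e> S u + fid q \<Lambda> (lebesgue_on S) f u" for u
 by (simp add: F_eps_def fidelity_def fid_def)
 note [simp] = Lq_Lp
 have fL: "f : Lp q (lebesgue_on S)" using f by simp
 have z: "(%x. 0) : Lp q (lebesgue_on S)" by simp
 obtain u where u: "u : Lp q (lebesgue_on S)"
  "!!v. v : Lp q (lebesgue_on S) ==> F_eps q \<Lambda> f \<e> S u <= F_eps q \<Lambda> f \<e> S v"
 using convex_minimizer_exists[OF q L fL K_fun_convex[OF q S e] K_fun_lsc[OF q S e] z]
 unfolding F by (auto simp: K_fun_zero[OF e])
 have "F_eps q \<Lambda> f \<e> S (%x. 0) < \<infinity>" unfolding F by (simp add: K_fun_zero[OF e] fid_Lpow q L fL less_top)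
 hence "F_eps q \<Lambda> f \<e> S u < \<infinity>" using u(2)[OF z] by (simp add: order_le_less_trans)
 moreover have "K_fun \<e> S u <= F_eps q \<Lambda> f \<e> S u" unfolding F by simp
 ultimately have fin: "K_fun \<e> S u < \<infinity>" by (simp add: order_le_less_trans)
 have am: "is_arg_min (F_eps q \<Lambda> f \<e> S) (%v. v : Lp q (lebesgue_on S)) u"
 using u by (auto simp: is_arg_min_def not_less[symmetric])
 have "AE x in lebesgue_on S. v x = u x" if v: "is_arg_min (F_eps q \<Lambda> f \<e> S) (%v. v : Lp q (lebesgue_on S)) v" for v
 proof (rule convex_minimizer_unique[OF q L fL K_fun_convex[OF q S e] u(1) _ fin])
 show vL: "v : Lp q (lebesgue_on S)" using v by (simp add: is_arg_min_def)
 have "\<not> F_eps q \<Lambda> f \<e> S u < F_eps q \<Lambda> f \<e> S v" using v u(1) by (auto simp: is_arg_min_def)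
 thus "K_fun \<e> S v + fid q \<Lambda> (lebesgue_on S) f v = K_fun \<e> S u + fid q \<Lambda> (lebesgue_on S) f u"
  using u(2)[OF vL] unfolding F by (simp add: antisym not_less)
 qed (use u(2) in \<open>simp add: F\<close>)
 thus ?thesis unfolding unique_minimizer_def using am by auto
qed

section \<open>The first absolute moment of a cube in a given direction\<close>

lemma antiderivative_exists_real:
 fixes f :: "real => real"
 assumes f: "continuous_on UNIV f"
 obtains F where "!!x. (F has_real_derivative f x) (at x)"
proof -
 define F where "F x = (if x >= 0 then integral {0..x} f else - integral {x..0} f)" for x
 have "(F has_real_derivative f x) (at x)" for x
 proof -
 define n where "n = \<bar>x\<bar> + 1"
 have int: "f integrable_on {a..b}" for a b
  by (rule integrable_continuous_real[OF continuous_on_subset[OF f]]) simp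
 have eq: "F y = integral {-n..y} f - integral {-n..0} f" if "y : {-n..n}" for y
 proof (cases "y >= 0")
  case True
  have "integral {-n..0} f + integral {0..y} f = integral {-n..y} f"
  using True by (intro Henstock_Kurzweil_Integration.integral_combine int) (auto simp: n_def)
  thus ?thesis using True by (simp add: F_def)
 next
  case False
  have "integral {-n..y} f + integral {y..0} f = integral {-n..0} f"
  using False that by (intro Henstock_Kurzweil_Integration.integral_combine int) auto
  thus ?thesis using False by (simp add: F_def)
 qed
 have "((%y. integral {-n..y} f) has_real_derivative f x) (at x within {-n..n})"
  by (rule integral_has_real_derivative[OF continuous_on_subset[OF f]]) (auto simp: n_def)
 hence "((%y. integral {-n..y} f) has_real_derivative f x) (at x)"
  by (subst (asm) at_within_interior) (auto simp: n_def)
 hence "((%y. integral {-n..y} f - integral {-n..0} f) has_real_derivative f x - 0) (at x)"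
  by (intro DERIV_diff DERIV_const)
 moreover have "\<forall>\<^sub>F y in nhds x. y : {-n<..<n}" by (intro eventually_nhds_in_open) (auto simp: n_def)
 ultimately show ?thesis
  by (subst DERIV_cong_ev[OF refl _ refl, where g="%y. integral {-n..y} f - integral {-n..0} f"])
   (auto elim!: eventually_mono intro!: eq)
 qed
 thus ?thesis using that by blast
qed

text \<open>An odd primitive that is nonnegative on the half line says that the integral of
  \<open>h\<close> over every interval [-r, r] is nonnegative. This is weaker than a sign of
  \<open>h\<close>, but it passes to averages over symmetric intervals and yields a sign at 0. It
  allows a comparison of |s| with a quadratic that fails pointwise.\<close>

definition nonneg_class :: "(real => real) => bool" where
 "nonneg_class h \<longleftrightarrow> continuous_on UNIV h & (\<exists>H. (\<forall>r. (H has_real_derivative h r) (at r)) &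
  (\<forall>r. H (- r) = - H r) & (\<forall>r\<ge>0. H r >= 0))"

definition avg1 :: "real => real => (real => real) => real => real" where
 "avg1 \<e> a h w = (LINT x|lborel. indicator {- \<e> / 2<..<\<e> / 2} x / \<e> * h (w + a * x))"

lemma avg1_0:
 assumes "\<e> > 0" shows "avg1 \<e> 0 h w = h w"
 using assms by (simp add: avg1_def)

lemma avg1_FTC:
 assumes e: "\<e> > 0" and H: "!!r. (H has_real_derivative h r) (at r)" and h: "continuous_on UNIV h" and b: "b > 0" and a: "\<bar>a\<bar> * \<e> = 2 * b"
 shows "avg1 \<e> a h w = (H (w + b) - H (w - b)) / (2 * b)"
proof -
 have a0: "a ~= 0" using a b by auto
 have "avg1 \<e> a h w = (LINT x|lborel. indicator {- \<e> / 2..\<e> / 2} x *\<^sub>R (h (w + a * x) / \<e>))"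
 unfolding avg1_def
 proof (rule integral_cong_AE)
 show "AE x in lborel. indicator {- \<e> / 2<..<\<e> / 2} x / \<e> * h (w + a * x) = indicator {- \<e> / 2..\<e> / 2} x *\<^sub>R (h (w + a * x) / \<e>)"
  using AE_lborel_singleton[of "- \<e> / 2"] AE_lborel_singleton[of "\<e> / 2"]
  by eventually_elim (auto simp: indicator_def)
 have [measurable]: "h : borel_fun" using h by (rule borel_measurable_continuous_onI)
 show "(%x. indicat_real {- \<e> / 2<..<\<e> / 2} x / \<e> * h (w + a * x)) : borel_measurable lborel" by measurable
 show "(%x. indicat_real {- \<e> / 2..\<e> / 2} x *\<^sub>R (h (w + a * x) / \<e>)) : borel_measurable lborel" by measurable
 qed
 also have "... = H (w + a * (\<e> / 2)) / (a * \<e>) - H (w + a * (- \<e> / 2)) / (a * \<e>)"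
 proof (rule integral_FTC_atLeastAtMost)
 fix x :: real
 have "((%x. H (w + a * x)) has_real_derivative h (w + a * x) * a) (at x)"
  by (rule DERIV_chain2[OF H]) (auto intro!: derivative_eq_intros)
 hence "((%x. H (w + a * x) / (a * \<e>)) has_real_derivative h (w + a * x) * a / (a * \<e>)) (at x)"
  by (rule DERIV_cdivide)
 hence "((%x. H (w + a * x) / (a * \<e>)) has_real_derivative h (w + a * x) / \<e>) (at x)" using a0 by simp
 thus "((%x. H (w + a * x) / (a * \<e>)) has_vector_derivative h (w + a * x) / \<e>) (at x within {- \<e> / 2..\<e> / 2})"
  unfolding has_real_derivative_iff_has_vector_derivative by (rule has_vector_derivative_at_within)
 next
 show "continuous_on {- \<e> / 2..\<e> / 2} (%x. h (w + a * x) / \<e>)"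
  using e by (intro continuous_intros continuous_on_compose2[OF h]) auto
 qed (use e in auto)
 also have "... = (H (w + b) - H (w - b)) / (2 * b)"
 proof (cases "a > 0")
 case True
 hence "a * \<e> = 2 * b" using a by simp
 hence "a * (\<e> / 2) = b" "a * (- \<e> / 2) = - b" "a * \<e> = 2 * b" by (auto simp: field_simps)
 thus ?thesis by (simp add: diff_divide_distrib)
 next
 case False
 hence "- (a * \<e>) = 2 * b" using a a0 by simp
 hence "a * (\<e> / 2) = - b" "a * (- \<e> / 2) = b" "a * \<e> = - (2 * b)" by (auto simp: field_simps)
 thus ?thesis by (simp add: diff_divide_distrib)
 qed
 finally show ?thesis .
qed

text \<open>With H the odd primitive of \<open>h\<close> and G a primitive of H, the average has the
  primitive (G(w + b) - G(w - b)) / (2 b). G is even and nondecreasing on the half line, and |r - b|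
  <= r + b for r >= 0, which gives the sign.\<close>

lemma nonneg_class_avg1:
 assumes h: "nonneg_class h" and e: "\<e> > 0" shows "nonneg_class (avg1 \<e> a h)"
proof (cases "a = 0")
 case True
 hence "avg1 \<e> a h = h" by (auto simp: avg1_0[OF e])
 thus ?thesis using h by simp
next
 case False
 define b where "b = \<bar>a\<bar> * \<e> / 2"
 have b: "b > 0" "\<bar>a\<bar> * \<e> = 2 * b" using False e by (auto simp: b_def)
 obtain H where hc: "continuous_on UNIV h" and H: "!!r. (H has_real_derivative h r) (at r)"
 and odd: "!!r. H (- r) = - H r" and nn: "!!r. r >= 0 ==> H r >= 0"
 using h unfolding nonneg_class_def by blast
 have Hc: "continuous_on UNIV H" using H by (meson DERIV_continuous continuous_at_imp_continuous_on)
 obtain G where G: "!!r. (G has_real_derivative H r) (at r)" using antiderivative_exists_real[OF Hc] by blast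
 have even: "G (- r) = G r" for r
 proof -
 have "((%r. G (- r) - G r) has_real_derivative H (- r) * (- 1) - H r) (at r)" for r
  by (intro DERIV_diff G DERIV_chain2[OF G]) (auto intro!: derivative_eq_intros)
 hence "((%r. G (- r) - G r) has_real_derivative 0) (at r)" for r by (simp add: odd)
 hence "(%r. G (- r) - G r) r = (%r. G (- r) - G r) 0" by (intro DERIV_isconst_all) auto
 thus ?thesis by simp
 qed
 have mono: "G x <= G y" if "0 <= x" "x <= y" for x y
 by (rule DERIV_nonneg_imp_nondecreasing[OF that(2)]) (use G nn that in fastforce)
 have eq: "avg1 \<e> a h w = (H (w + b) - H (w - b)) / (2 * b)" for w
 by (rule avg1_FTC[OF e H hc b])
 show ?thesis unfolding nonneg_class_def
 proof (intro conjI exI[of _ "%w. (G (w + b) - G (w - b)) / (2 * b)"] allI impI)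
 show "continuous_on UNIV (avg1 \<e> a h)" unfolding eq[abs_def]
  using b by (intro continuous_intros continuous_on_compose2[OF Hc]) auto
 fix r :: real
 have "((%w. (G (w + b) - G (w - b)) / (2 * b)) has_real_derivative (H (r + b) * 1 - H (r - b) * 1) / (2 * b)) (at r)"
  by (intro DERIV_cdivide DERIV_diff DERIV_chain2[OF G]) (auto intro!: derivative_eq_intros)
 thus "((%w. (G (w + b) - G (w - b)) / (2 * b)) has_real_derivative avg1 \<e> a h r) (at r)" by (simp add: eq)
 show "(G (- r + b) - G (- r - b)) / (2 * b) = - ((G (r + b) - G (r - b)) / (2 * b))"
  using even[of "r - b"] even[of "r + b"] by (simp add: minus_divide_left)
 assume "0 <= r"
 have "G (r - b) = G \<bar>r - b\<bar>" using even[of "r - b"] by (auto simp: abs_if)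
 also have "... <= G (r + b)" using \<open>0 <= r\<close> b by (intro mono) auto
 finally show "0 <= (G (r + b) - G (r - b)) / (2 * b)" using b by simp
 qed
qed

text \<open>An odd primitive vanishes at 0; a negative \<open>h 0\<close> would make it negative
  immediately to the right.\<close>

lemma nonneg_class_at_0:
 assumes "nonneg_class h" shows "h 0 >= 0"
proof (rule ccontr)
 assume n: "\<not> h 0 >= 0"
 obtain H where H: "!!r. (H has_real_derivative h r) (at r)"
 and odd: "!!r. H (- r) = - H r" and nn: "!!r. r >= 0 ==> H r >= 0"
 using assms unfolding nonneg_class_def by blast
 have "H 0 = 0" using odd[of 0] by simp
 moreover obtain d where "d > 0" "\<forall>x>0. x < d --> H (0 + x) < H 0"
 using DERIV_neg_dec_right[OF H[of 0]] n by auto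
 ultimately show False using nn[of "d/2"] by (metis add_0 field_sum_of_halves half_gt_zero_iff less_add_same_cancel1 less_imp_le not_le)
qed

text \<open>The expectation of \<open>h (w + \<Sum>i\<in>J. a i * X i)\<close> for independent
  uniform \<open>X i\<close>. The shift \<open>w\<close> allows one coordinate after another to be
  integrated out; with \<open>w = 0\<close> and all coordinates it is the mean of a function of p
  \<bullet> z over the cube.\<close>

definition avgJ :: "real => 'i set => ('i => real) => (real => real) => real => real" where
 "avgJ \<e> J a h w = (LINT x|(\<Pi>\<^sub>M i\<in>J. lborel). (\<Prod>i\<in>J. indicator {- \<e> / 2<..<\<e> / 2} (x i) / \<e>) * h (w + (\<Sum>i\<in>J. a i * x i)))"

interpretation lborel_product: product_sigma_finite "%_::'i. lborel :: real measure"
 by unfold_locales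

lemma avgJ_integrable:
 fixes h :: "real => real" and J :: "'i set"
 assumes J: "finite J" and e: "\<e> > 0" and h: "continuous_on UNIV h"
 shows "integrable (\<Pi>\<^sub>M i\<in>J. lborel) (%x. (\<Prod>i\<in>J. indicator {- \<e> / 2<..<\<e> / 2} (x i) / \<e>) * h (w + (\<Sum>i\<in>J. a i * x i)))"
proof -
 have hm [measurable]: "h : borel_fun" using h by (rule borel_measurable_continuous_onI)
 define B where "B = \<bar>w\<bar> + (\<Sum>i\<in>J. \<bar>a i\<bar> * (\<e> / 2))"
 have "compact (h ` {-B..B})" by (intro compact_continuous_image continuous_on_subset[OF h]) auto
 hence "bounded (h ` {-B..B})" by (rule compact_imp_bounded)
 then obtain C where C: "!!s. s : {-B..B} ==> \<bar>h s\<bar> <= C" unfolding bounded_iff by force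
 have int: "integrable (\<Pi>\<^sub>M i\<in>J. lborel) (%x. \<Prod>i\<in>J. indicator {- \<e> / 2<..<\<e> / 2} (x i) / \<e>)"
 using J e by (intro lborel_product.product_integrable_prod integrable_divide integrable_real_indicator)
  (auto simp: emeasure_lborel_Ioo)
 show ?thesis
 proof (rule Bochner_Integration.integrable_bound[OF integrable_mult_right[OF int, of "C"]])
 show "(%x. (\<Prod>i\<in>J. indicator {- \<e> / 2<..<\<e> / 2} (x i) / \<e>) * h (w + (\<Sum>i\<in>J. a i * x i))) : borel_measurable (\<Pi>\<^sub>M i\<in>J. lborel)"
  by measurable
 show "AE x in \<Pi>\<^sub>M i\<in>J. lborel. norm ((\<Prod>i\<in>J. indicator {- \<e> / 2<..<\<e> / 2} (x i) / \<e>) * h (w + (\<Sum>i\<in>J. a i * x i)))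
  <= norm (C * (\<Prod>i\<in>J. indicator {- \<e> / 2<..<\<e> / 2} (x i) / \<e>))"
 proof (rule AE_I2)
  fix x :: "'i => real"
  show "norm ((\<Prod>i\<in>J. indicator {- \<e> / 2<..<\<e> / 2} (x i) / \<e>) * h (w + (\<Sum>i\<in>J. a i * x i)))
  <= norm (C * (\<Prod>i\<in>J. indicator {- \<e> / 2<..<\<e> / 2} (x i) / \<e>))"
  proof (cases "\<forall>i\<in>J. x i : {- \<e> / 2<..<\<e> / 2}")
  case True
  have "\<bar>w + (\<Sum>i\<in>J. a i * x i)\<bar> <= \<bar>w\<bar> + (\<Sum>i\<in>J. \<bar>a i * x i\<bar>)"
   using sum_abs[of "%i. a i * x i" J] by linarith
  also have "... <= B" unfolding B_def abs_mult using True
   by (intro add_left_mono sum_mono mult_left_mono) (auto simp: abs_le_iff less_imp_le minus_le_iff)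
  finally have "\<bar>h (w + (\<Sum>i\<in>J. a i * x i))\<bar> <= C" by (intro C) (auto simp: abs_le_iff minus_le_iff)
  hence "\<bar>h (w + (\<Sum>i\<in>J. a i * x i))\<bar> <= \<bar>C\<bar>" by linarith
  thus ?thesis unfolding real_norm_def abs_mult by (subst mult.commute) (intro mult_right_mono, auto)
  next
  case False
  then obtain i where "i : J" "indicator {- \<e> / 2<..<\<e> / 2} (x i) / \<e> = (0 :: real)" by (auto simp: indicator_def)
  hence "(\<Prod>i\<in>J. indicator {- \<e> / 2<..<\<e> / 2} (x i) / \<e>) = (0 :: real)" using J by (intro prod_zero) blast+
  thus ?thesis by simp
  qed
 qed
 qed
qed

lemma avgJ_empty: "avgJ \<e> {} a h w = h w"
 by (simp add: avgJ_def PiM_empty lebesgue_integral_count_space_finite)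

lemma avg1_cont:
 assumes e: "\<e> > 0" and h: "continuous_on UNIV h" shows "continuous_on UNIV (avg1 \<e> a h)"
proof (cases "a = 0")
 case True
 hence "avg1 \<e> a h = h" by (auto simp: avg1_0[OF e])
 thus ?thesis using h by simp
next
 case False
 define b where "b = \<bar>a\<bar> * \<e> / 2"
 have b: "b > 0" "\<bar>a\<bar> * \<e> = 2 * b" using False e by (auto simp: b_def)
 obtain H where H: "!!r. (H has_real_derivative h r) (at r)" using antiderivative_exists_real[OF h] by blast
 have Hc: "continuous_on UNIV H" using H by (meson DERIV_continuous continuous_at_imp_continuous_on)
 show ?thesis unfolding avg1_FTC[OF e H h b, abs_def]
 using b by (intro continuous_intros continuous_on_compose2[OF Hc]) auto
qed

lemma avgJ_insert:
 assumes J: "finite J" "i ~: J" and e: "\<e> > 0" and h: "continuous_on UNIV h"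
 shows "avgJ \<e> (insert i J) a h w = avgJ \<e> J a (avg1 \<e> (a i) h) w"
proof -
 have "avgJ \<e> (insert i J) a h w = (LINT x|(\<Pi>\<^sub>M i\<in>J. lborel). LINT y|lborel.
  (\<Prod>j\<in>insert i J. indicator {- \<e> / 2<..<\<e> / 2} ((x(i := y)) j) / \<e>) * h (w + (\<Sum>j\<in>insert i J. a j * (x(i := y)) j)))"
 unfolding avgJ_def by (rule lborel_product.product_integral_insert[OF J avgJ_integrable]) (use J e h in auto)
 also have "... = avgJ \<e> J a (avg1 \<e> (a i) h) w"
 unfolding avgJ_def
 proof (rule Bochner_Integration.integral_cong[OF refl])
 fix x :: "'a => real"
 have p: "(\<Prod>j\<in>insert i J. indicator {- \<e> / 2<..<\<e> / 2} ((x(i := y)) j) / \<e>) =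
  (\<Prod>j\<in>J. indicator {- \<e> / 2<..<\<e> / 2} (x j) / \<e>) * (indicator {- \<e> / 2<..<\<e> / 2} y / \<e>)" for y
 proof -
  have "(\<Prod>j\<in>J. indicator {- \<e> / 2<..<\<e> / 2} ((x(i := y)) j) / \<e>) = (\<Prod>j\<in>J. indicator {- \<e> / 2<..<\<e> / 2} (x j) / \<e>)"
  using J by (intro prod.cong) auto
  thus ?thesis using J by (simp add: mult.commute)
 qed
 have s: "(\<Sum>j\<in>insert i J. a j * (x(i := y)) j) = (\<Sum>j\<in>J. a j * x j) + a i * y" for y
 proof -
  have "(\<Sum>j\<in>J. a j * (x(i := y)) j) = (\<Sum>j\<in>J. a j * x j)" using J by (intro sum.cong) auto
  thus ?thesis using J by simp
 qed
 show "(LINT y|lborel. (\<Prod>j\<in>insert i J. indicator {- \<e> / 2<..<\<e> / 2} ((x(i := y)) j) / \<e>) * h (w + (\<Sum>j\<in>insert i J. a j * (x(i := y)) j)))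
  = (\<Prod>i\<in>J. indicator {- \<e> / 2<..<\<e> / 2} (x i) / \<e>) * avg1 \<e> (a i) h (w + (\<Sum>i\<in>J. a i * x i))"
  unfolding p s avg1_def by (simp add: mult.assoc add.assoc)
 qed
 finally show ?thesis .
qed

lemma nonneg_class_avgJ:
 assumes "finite J" "\<e> > 0" "nonneg_class h" shows "nonneg_class (avgJ \<e> J a h)"
 using assms(1,3)
proof (induction J arbitrary: h rule: finite_induct)
 case empty
 thus ?case by (simp add: avgJ_empty[abs_def])
next
 case (insert i J)
 have "continuous_on UNIV h" using insert.prems by (simp add: nonneg_class_def)
 hence "avgJ \<e> (insert i J) a h = avgJ \<e> J a (avg1 \<e> (a i) h)" using avgJ_insert[OF insert(1,2) assms(2)] by auto
 thus ?case using insert.IH[OF nonneg_class_avg1[OF insert.prems assms(2)]] by simp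
qed

lemma avg1_square:
 assumes e: "\<e> > 0" shows "avg1 \<e> a (%s. s\<^sup>2 + d) w = w\<^sup>2 + (d + a\<^sup>2 * \<e>\<^sup>2 / 12)"
proof (cases "a = 0")
 case True thus ?thesis by (simp add: avg1_0[OF e])
next
 case False
 define b where "b = \<bar>a\<bar> * \<e> / 2"
 have b: "b > 0" "\<bar>a\<bar> * \<e> = 2 * b" using False e by (auto simp: b_def)
 have "avg1 \<e> a (%s. s\<^sup>2 + d) w = (((w + b) ^ 3 / 3 + d * (w + b)) - ((w - b) ^ 3 / 3 + d * (w - b))) / (2 * b)"
 by (rule avg1_FTC[OF e _ _ b, of "%s. s ^ 3 / 3 + d * s"]) (auto intro!: derivative_eq_intros continuous_intros)
 also have "... = (2 * b * (w\<^sup>2 + b\<^sup>2 / 3 + d)) / (2 * b)"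
 by (rule arg_cong[of _ _ "%t. t / (2 * b)"]) (simp add: power2_eq_square power3_eq_cube field_simps)
 also have "... = w\<^sup>2 + b\<^sup>2 / 3 + d" using b by simp
 also have "b\<^sup>2 / 3 = a\<^sup>2 * \<e>\<^sup>2 / 12" by (simp add: b_def power_mult_distrib power_divide)
 finally show ?thesis by simp
qed

text \<open>Each independent uniform coordinate adds its variance
  \<open>(a i)\<^sup>2 * \<e>\<^sup>2 / 12\<close> to the constant.\<close>

lemma avgJ_square:
 assumes "finite J" "\<e> > 0" shows "avgJ \<e> J a (%s. s\<^sup>2 + d) w = w\<^sup>2 + (d + (\<Sum>i\<in>J. (a i)\<^sup>2) * \<e>\<^sup>2 / 12)"
 using assms(1)
proof (induction J arbitrary: d rule: finite_induct)
 case empty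
 thus ?case by (simp add: avgJ_empty)
next
 case (insert i J)
 have "avgJ \<e> (insert i J) a (%s. s\<^sup>2 + d) w = avgJ \<e> J a (avg1 \<e> (a i) (%s. s\<^sup>2 + d)) w"
 by (rule avgJ_insert[OF insert(1,2) assms(2)]) (intro continuous_intros)
 also have "... = avgJ \<e> J a (%s. s\<^sup>2 + (d + (a i)\<^sup>2 * \<e>\<^sup>2 / 12)) w"
 by (simp add: avg1_square[OF assms(2), abs_def])
 also have "... = w\<^sup>2 + (d + (a i)\<^sup>2 * \<e>\<^sup>2 / 12 + (\<Sum>i\<in>J. (a i)\<^sup>2) * \<e>\<^sup>2 / 12)" by (rule insert.IH)
 finally show ?case using insert(1,2) by (simp add: algebra_simps add_divide_distrib)
qed

lemma DERIV_half_abs_square: "((%s. s * \<bar>s\<bar> / 2) has_real_derivative \<bar>x\<bar>) (at (x::real))"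
proof (cases "x = 0")
 case True
 have "((%h. (h * \<bar>h\<bar> / 2) / h) \<longlongrightarrow> 0) (at (0::real))"
 proof (rule Lim_transform_eventually)
 show "((%h. \<bar>h\<bar> / 2) \<longlongrightarrow> 0) (at (0::real))" by (auto intro!: tendsto_eq_intros)
 show "\<forall>\<^sub>F h in at (0::real). \<bar>h\<bar> / 2 = (h * \<bar>h\<bar> / 2) / h" by (auto simp: eventually_at intro!: exI[of _ 1])
 qed
 thus ?thesis using True by (simp add: DERIV_def)
next
 case False
 show ?thesis
 proof (cases "x > 0")
 case True
 have "((%s. s * s / 2) has_real_derivative x) (at x)" by (auto intro!: derivative_eq_intros)
 moreover have "\<forall>\<^sub>F y in nhds x. y : {0<..}" using True by (intro eventually_nhds_in_open) auto
 ultimately show ?thesis using True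
  by (subst DERIV_cong_ev[OF refl _ refl, where g="%s. s * s / 2"]) (auto elim!: eventually_mono)
 next
 case F: False
 have "((%s. - (s * s) / 2) has_real_derivative - x) (at x)" by (auto intro!: derivative_eq_intros)
 moreover have "\<forall>\<^sub>F y in nhds x. y : {..<0}" using F False by (intro eventually_nhds_in_open) auto
 ultimately show ?thesis using F False
  by (subst DERIV_cong_ev[OF refl _ refl, where g="%s. - (s * s) / 2"]) (auto elim!: eventually_mono)
 qed
qed

text \<open>On the half line the primitive is r / (2 c) times the square of r - c / 2; this
  determines the coefficients. The function itself is negative at |s| = c / 3, so only its integrals
  over symmetric intervals have a sign.\<close>

lemma nonneg_class_quadratic_abs:
 assumes c: "c > 0" shows "nonneg_class (%s. 3 / (2 * c) * s\<^sup>2 + c / 8 - \<bar>s\<bar>)"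
 unfolding nonneg_class_def
proof (intro conjI exI[of _ "%s. s ^ 3 / (2 * c) + c * s / 8 - s * \<bar>s\<bar> / 2"] allI impI)
 show "continuous_on UNIV (%s. 3 / (2 * c) * s\<^sup>2 + c / 8 - \<bar>s\<bar>)" by (intro continuous_intros)
 fix r :: real
 show "((%s. s ^ 3 / (2 * c) + c * s / 8 - s * \<bar>s\<bar> / 2) has_real_derivative 3 / (2 * c) * r\<^sup>2 + c / 8 - \<bar>r\<bar>) (at r)"
 by (rule DERIV_diff[OF _ DERIV_half_abs_square]) (use c in \<open>auto intro!: derivative_eq_intros simp: field_simps\<close>)
 show "(- r) ^ 3 / (2 * c) + c * - r / 8 - - r * \<bar>- r\<bar> / 2 = - (r ^ 3 / (2 * c) + c * r / 8 - r * \<bar>r\<bar> / 2)"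
 by (simp add: power3_eq_cube)
 assume r: "0 <= r"
 have "r ^ 3 / (2 * c) + c * r / 8 - r * r / 2 = r / (2 * c) * (r - c / 2)\<^sup>2"
 using c by (simp add: power3_eq_cube power2_eq_square field_simps)
 thus "0 <= r ^ 3 / (2 * c) + c * r / 8 - r * \<bar>r\<bar> / 2" using r c by simp
qed

text \<open>In the average at 0, |s| may be replaced by the quadratic, whose average needs only the
  second moment c^2 / 12: the result is c / 8 + c / 8.\<close>

lemma avgJ_abs_le:
 assumes J: "finite J" and e: "\<e> > 0"
 shows "avgJ \<e> J a abs 0 <= \<e> * sqrt (\<Sum>i\<in>J. (a i)\<^sup>2) / 4"
proof (cases "(\<Sum>i\<in>J. (a i)\<^sup>2) = 0")
 case True
 hence "a i = 0" if "i : J" for i using J that by (simp add: sum_nonneg_eq_0_iff)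
 thus ?thesis by (simp add: avgJ_def)
next
 case False
 define S where "S = (\<Sum>i\<in>J. (a i)\<^sup>2)"
 have S: "S > 0" using False by (simp add: S_def order_less_le sum_nonneg)
 \<comment> \<open>The length of the interval over which the sum would range if \<open>a\<close> had
   a single nonzero entry of the same Euclidean norm; in that case the bound is an equality.\<close>
 define c where "c = \<e> * sqrt S"
 have c: "c > 0" using S e by (simp add: c_def)
 have c2: "S * \<e>\<^sup>2 = c * c" using S by (simp add: c_def power2_eq_square)
 let ?P = "\<Pi>\<^sub>M i\<in>J. lborel"
 let ?i = "%x. (\<Prod>i\<in>J. indicator {- \<e> / 2<..<\<e> / 2} (x i) / \<e>)"
 let ?s = "%x. 0 + (\<Sum>i\<in>J. a i * x i)"
 have i1: "integrable ?P (%x. ?i x * \<bar>?s x\<bar>)"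
 using avgJ_integrable[OF J e continuous_on_rabs[OF continuous_on_id], of 0 a] by simp
 have i2: "integrable ?P (%x. ?i x * ((?s x)\<^sup>2 + c\<^sup>2 / 12))"
 by (rule avgJ_integrable[OF J e, of "%s. s\<^sup>2 + c\<^sup>2 / 12"]) (intro continuous_intros)
 have "0 <= avgJ \<e> J a (%s. 3 / (2 * c) * s\<^sup>2 + c / 8 - \<bar>s\<bar>) 0"
 by (intro nonneg_class_at_0 nonneg_class_avgJ nonneg_class_quadratic_abs J e c)
 also have "... = (LINT x|?P. 3 / (2 * c) * (?i x * ((?s x)\<^sup>2 + c\<^sup>2 / 12)) - ?i x * \<bar>?s x\<bar>)"
 unfolding avgJ_def
 proof (rule Bochner_Integration.integral_cong[OF refl])
 fix x
 have "c / 8 = 3 / (2 * c) * (c\<^sup>2 / 12)" using c by (simp add: power2_eq_square)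
 thus "?i x * (3 / (2 * c) * (?s x)\<^sup>2 + c / 8 - \<bar>?s x\<bar>) = 3 / (2 * c) * (?i x * ((?s x)\<^sup>2 + c\<^sup>2 / 12)) - ?i x * \<bar>?s x\<bar>"
  by (simp only: algebra_simps)
 qed
 also have "... = 3 / (2 * c) * avgJ \<e> J a (%s. s\<^sup>2 + c\<^sup>2 / 12) 0 - avgJ \<e> J a abs 0"
 using i1 i2 unfolding avgJ_def by simp
 also have "avgJ \<e> J a (%s. s\<^sup>2 + c\<^sup>2 / 12) 0 = c * c / 6"
 unfolding avgJ_square[OF J e] S_def[symmetric] c2 by (simp add: power2_eq_square)
 also have "3 / (2 * c) * (c * c / 6) = c / 4" using c by simp
 finally show ?thesis by (simp add: c_def S_def)
qed

lemma avgJ_zero: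
 assumes "finite J" "\<e> > 0" "continuous_on UNIV h" "!!i. i : J ==> a i = 0"
 shows "avgJ \<e> J a h w = h w"
 using assms(1,4)
proof (induction J rule: finite_induct)
 case empty
 thus ?case by (simp add: avgJ_empty)
next
 case (insert i J)
 have "avg1 \<e> (a i) h = h" using insert.prems avg1_0[OF assms(2)] by auto
 thus ?case using avgJ_insert[OF insert(1,2) assms(2,3)] insert by simp
qed

lemma cube0_integral:
 fixes p :: "real^'n"
 assumes e: "\<e> > 0" and h: "continuous_on UNIV h"
 shows "(LINT z|lborel. indicator (cube0 \<e>) z * h (p \<bullet> z)) = \<e> ^ CARD('n) * avgJ \<e> Basis (%b. p \<bullet> b) h 0"
proof -
 have [measurable]: "h : borel_fun" using h by (rule borel_measurable_continuous_onI)
 let ?g = "%f. \<Sum>b\<in>(Basis :: (real^'n) set). f b *\<^sub>R b"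
 have gm: "?g : measurable (\<Pi>\<^sub>M b\<in>(Basis :: (real^'n) set). lborel) borel" by measurable
 have "(LINT z|lborel. indicator (cube0 \<e>) z * h (p \<bullet> z)) =
  (LINT z|distr (\<Pi>\<^sub>M b\<in>(Basis :: (real^'n) set). lborel) borel ?g. indicator (cube0 \<e>) z * h (p \<bullet> z))"
 by (subst lborel_eq) (rule refl)
 also have "... = (LINT f|(\<Pi>\<^sub>M b\<in>(Basis :: (real^'n) set). lborel). indicator (cube0 \<e>) (?g f) * h (p \<bullet> ?g f))"
 by (rule integral_distr[OF gm]) measurable
 also have "... = (LINT f|(\<Pi>\<^sub>M b\<in>(Basis :: (real^'n) set). lborel). \<e> ^ CARD('n) *
  ((\<Prod>b\<in>Basis. indicator {- \<e> / 2<..<\<e> / 2} (f b) / \<e>) * h (0 + (\<Sum>b\<in>Basis. (p \<bullet> b) * f b))))"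
 proof (rule Bochner_Integration.integral_cong[OF refl])
 fix f :: "real^'n => real"
 have "?g f : cube0 \<e> \<longleftrightarrow> (\<forall>b\<in>Basis. f b : {- \<e> / 2<..<\<e> / 2})"
 proof -
  have gb: "?g f \<bullet> b = f b" if "b : Basis" for b using that by simp
  have cb: "(\<chi> i. c) \<bullet> b = c" if "b : Basis" for b :: "real^'n" and c using that by (auto simp: Basis_vec_def inner_axis)
  show ?thesis unfolding cube0_def mem_box using gb cb by simp
 qed
 hence "indicator (cube0 \<e>) (?g f) = (\<Prod>b\<in>Basis. indicator {- \<e> / 2<..<\<e> / 2} (f b) :: real)"
  by (auto simp: indicator_def intro!: prod_zero prod.neutral)
 moreover have "(\<Prod>b\<in>(Basis::(real^'n) set). indicator {- \<e> / 2<..<\<e> / 2} (f b) / \<e>) = (\<Prod>b\<in>(Basis::(real^'n) set). indicator {- \<e> / 2<..<\<e> / 2} (f b)) / \<e> ^ CARD('n)"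
  by (simp add: prod_dividef)
 moreover have "p \<bullet> ?g f = (\<Sum>b\<in>Basis. (p \<bullet> b) * f b)"
  by (simp add: inner_sum_right mult.commute)
 ultimately show "indicator (cube0 \<e>) (?g f) * h (p \<bullet> ?g f) = \<e> ^ CARD('n) *
  ((\<Prod>b\<in>Basis. indicator {- \<e> / 2<..<\<e> / 2} (f b) / \<e>) * h (0 + (\<Sum>b\<in>Basis. (p \<bullet> b) * f b)))"
  using e by simp
 qed
 also have "... = \<e> ^ CARD('n) * avgJ \<e> Basis (%b. p \<bullet> b) h 0" by (simp add: avgJ_def)
 finally show ?thesis .
qed

text \<open>
 The constant \<open>1 / 4\<close>: among all directions the first absolute moment of the cube is largest
 along an edge.
\<close>

lemma cube0_abs_inner_le:
 fixes p :: "real^'n"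
 assumes e: "\<e> > 0"
 shows "(LINT z|lborel. indicator (cube0 \<e>) z * \<bar>p \<bullet> z\<bar>) <= \<e> ^ CARD('n) * (\<e> * norm p / 4)"
proof -
 have "sqrt (\<Sum>b\<in>Basis. (p \<bullet> b)\<^sup>2) = norm p" by (simp add: norm_eq_sqrt_inner euclidean_inner[of p p] power2_eq_square)
 hence "avgJ \<e> Basis (%b. p \<bullet> b) abs 0 <= \<e> * norm p / 4"
 using avgJ_abs_le[OF finite_Basis e, of "%b. p \<bullet> b"] by simp
 thus ?thesis using cube0_integral[OF e continuous_on_rabs[OF continuous_on_id], of p] e by simp
qed

text \<open>The extremal case of the moment bound: once the other coordinates are integrated out,
  the mean of |x| over the centred interval of length \<open>\<e>\<close> remains, which is
  \<open>\<e> / 4\<close>.\<close>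

lemma cube0_abs_component:
 fixes k :: "'n::finite"
 assumes e: "\<e> > 0"
 shows "(LINT z|lborel. indicator (cube0 \<e>) (z::real^'n) * \<bar>z $ k\<bar>) = \<e> ^ CARD('n) * (\<e> / 4)"
proof -
 let ?e = "axis k 1 :: real^'n"
 have b: "?e : Basis" by (auto simp: Basis_vec_def)
 have B: "Basis = insert ?e (Basis - {?e})" using b by auto
 have ca: "continuous_on UNIV (abs :: real => real)" by (intro continuous_intros)
 have cav: "continuous_on UNIV (avg1 \<e> 1 abs)" by (rule avg1_cont[OF e ca])
 have one: "?e \<bullet> ?e = 1" using b by simp
 have "avgJ \<e> Basis (%b. ?e \<bullet> b) abs 0 = avgJ \<e> (Basis - {?e}) (%b. ?e \<bullet> b) (avg1 \<e> 1 abs) 0"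
 by (subst B, subst avgJ_insert) (use e ca one in auto)
 also have "... = avg1 \<e> 1 abs 0"
 by (rule avgJ_zero[OF _ e cav]) (use b in \<open>auto simp: inner_not_same_Basis\<close>)
 also have "... = ((0 + \<e> / 2) * \<bar>0 + \<e> / 2\<bar> / 2 - (0 - \<e> / 2) * \<bar>0 - \<e> / 2\<bar> / 2) / (2 * (\<e> / 2))"
 by (rule avg1_FTC[OF e DERIV_half_abs_square ca]) (use e in auto)
 also have "... = \<e> / 4" using e by (simp add: field_simps)
 finally have "avgJ \<e> Basis (%b. ?e \<bullet> b) abs 0 = \<e> / 4" .
 moreover have "?e \<bullet> z = z $ k" for z :: "real^'n" by (simp add: inner_axis')
 ultimately show ?thesis using cube0_integral[OF e ca, of ?e] by simp
qed

section \<open>Continuously differentiable maps and the divergence theorem\<close>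

definition has_C1 :: "(real^'n => 'b::real_normed_vector) => (real^'n => real^'n => 'b) => bool" where
 "has_C1 f D \<longleftrightarrow> (\<forall>x. (f has_derivative D x) (at x)) & (\<forall>h. continuous_on UNIV (%x. D x h))"

lemma has_C1D: "has_C1 f D ==> (f has_derivative D x) (at x)"
 "has_C1 f D ==> continuous_on UNIV (%x. D x h)"
 by (auto simp: has_C1_def)

lemma has_C1_continuous: "has_C1 f D ==> continuous_on S f"
 by (meson has_C1D(1) has_derivative_continuous continuous_at_imp_continuous_on)

text \<open>In finite dimension, continuity of every directional derivative amounts to continuity of
  the derivative in operator norm. The directional form is the one in which products and
  convolutions are easily checked.\<close>

lemma C1_vector_field_iff: "C1_vector_field (\<phi> :: real^'n => real^'n) \<longleftrightarrow> (\<exists>D. has_C1 \<phi> D)"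
proof
 assume "C1_vector_field \<phi>"
 then obtain \<phi>' :: "real^'n => (real^'n) \<Rightarrow>\<^sub>L (real^'n)" where
 "!!x. (\<phi> has_derivative blinfun_apply (\<phi>' x)) (at x)" "continuous_on UNIV \<phi>'"
 unfolding C1_vector_field_def by blast
 hence "has_C1 \<phi> (%x. blinfun_apply (\<phi>' x))" by (auto simp: has_C1_def intro!: continuous_intros)
 thus "\<exists>D. has_C1 \<phi> D" by blast
next
 assume "\<exists>D. has_C1 \<phi> D"
 then obtain D where D: "has_C1 \<phi> D" by blast
 have bl: "bounded_linear (D x)" for x using has_C1D(1)[OF D] by (rule has_derivative_bounded_linear)
 have eq: "blinfun_apply (Blinfun (D x)) = D x" for x by (rule bounded_linear_Blinfun_apply[OF bl])
 show "C1_vector_field \<phi>" unfolding C1_vector_field_def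
 proof (intro exI[of _ "%x. Blinfun (D x)"] conjI allI)
 show "(\<phi> has_derivative blinfun_apply (Blinfun (D x))) (at x)" for x using has_C1D(1)[OF D] eq by simp
 show "continuous_on UNIV (%x. Blinfun (D x))"
  by (rule continuous_on_blinfun_componentwise) (simp add: eq has_C1D(2)[OF D])
 qed
qed

lemma divergence_eq:
 assumes "has_C1 \<phi> D" shows "divergence \<phi> x = (\<Sum>i\<in>UNIV. D x (axis i 1) $ i)"
proof -
 have "D x = frechet_derivative \<phi> (at x)" by (rule frechet_derivative_at[OF has_C1D(1)[OF assms]])
 thus ?thesis by (simp add: divergence_def trace_def jacobian_def matrix_def)
qed

lemma divergence_continuous:
 assumes "has_C1 \<phi> D" shows "continuous_on S (divergence \<phi>)"
proof -
 have "continuous_on UNIV (%x. \<Sum>i\<in>UNIV. D x (axis i 1) $ i)"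
 by (intro continuous_intros has_C1D(2)[OF assms])
 thus ?thesis unfolding divergence_eq[OF assms, abs_def] by (rule continuous_on_subset) simp
qed

lemma has_C1_add: "has_C1 f D ==> has_C1 g E ==> has_C1 (%x. f x + g x) (%x h. D x h + E x h)"
 by (auto simp: has_C1_def intro!: has_derivative_add continuous_intros)

lemma has_C1_diff: "has_C1 f D ==> has_C1 g E ==> has_C1 (%x. f x - g x) (%x h. D x h - E x h)"
 by (auto simp: has_C1_def intro!: has_derivative_diff continuous_intros)

lemma has_C1_const: "has_C1 (%x. c) (%x h. 0)"
 by (auto simp: has_C1_def)

lemma has_C1_scaleR: "has_C1 f D ==> has_C1 g E ==> has_C1 (%x. f x *\<^sub>R g x) (%x h. f x *\<^sub>R E x h + D x h *\<^sub>R g x)"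
 unfolding has_C1_def[of "%x. f x *\<^sub>R g x"]
 by (intro conjI allI has_derivative_scaleR has_C1D(1) continuous_on_add continuous_on_scaleR has_C1D(2) has_C1_continuous)

lemma has_C1_compose_real:
 assumes f: "has_C1 f D" and T: "!!s. (T has_real_derivative T' s) (at s)" and T': "continuous_on UNIV T'"
 shows "has_C1 (%x. T (f x)) (%x h. T' (f x) * D x h)"
 unfolding has_C1_def
proof (intro conjI allI)
 show "((%x. T (f x)) has_derivative (%h. T' (f x) * D x h)) (at x)" for x
 by (rule has_derivative_compose[OF has_C1D(1)[OF f], of T "%h. T' (f x) * h"])
  (use T in \<open>simp add: has_field_derivative_def\<close>)
 show "continuous_on UNIV (%x. T' (f x) * D x h)" for h
 by (intro continuous_intros has_C1D(2)[OF f] continuous_on_compose2[OF T' has_C1_continuous[OF f]]) auto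
qed

lemma divergence_scaleR:
 assumes f: "has_C1 f D" and \<phi>: "has_C1 \<phi> E"
 shows "divergence (%x. f x *\<^sub>R \<phi> x) x = f x * divergence \<phi> x + (\<Sum>i\<in>UNIV. D x (axis i 1) * \<phi> x $ i)"
 unfolding divergence_eq[OF has_C1_scaleR[OF f \<phi>]] divergence_eq[OF \<phi>]
 by (simp add: sum.distrib sum_distrib_left)

lemma divergence_add:
 assumes f: "has_C1 \<psi> D" and \<phi>: "has_C1 \<phi> E"
 shows "divergence (%x. \<psi> x + \<phi> x) x = divergence \<psi> x + divergence \<phi> x"
 unfolding divergence_eq[OF has_C1_add[OF f \<phi>]] divergence_eq[OF \<phi>] divergence_eq[OF f]
 by (simp add: sum.distrib)

lemma has_C1_zero_on_open:
 assumes f: "has_C1 f D" and U: "open U" "x : U" "!!y. y : U ==> f y = 0"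
 shows "D x h = 0"
proof -
 have "((%y. 0) has_derivative (%h. 0)) (at x)" by simp
 hence "(f has_derivative (%h. 0)) (at x)"
 by (rule has_derivative_transform_within_open[OF _ U(1,2)]) (simp add: U(3))
 hence "D x = (%h. 0)" using has_C1D(1)[OF f] has_derivative_unique by blast
 thus ?thesis by simp
qed

lemma divergence_zero_on_open:
 assumes f: "has_C1 f D" and U: "open U" "x : U" "!!y. y : U ==> f y = 0"
 shows "divergence f x = 0"
 unfolding divergence_eq[OF f] using has_C1_zero_on_open[OF assms] by simp

lemma continuous_bounded_support:
 fixes f :: "real^'n => 'b::{euclidean_space}"
 assumes f: "continuous_on UNIV f" and z: "!!x. norm x > r ==> f x = 0"
 shows "\<exists>C\<ge>0. \<forall>x. norm (f x) <= C" and "L1 f" and "uniformly_continuous_on UNIV f"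
proof -
 have "compact (f ` cball 0 r)" by (intro compact_continuous_image continuous_on_subset[OF f]) auto
 hence "bounded (f ` cball 0 r)" by (rule compact_imp_bounded)
 then obtain C where C: "!!x. x : cball 0 r ==> norm (f x) <= C" unfolding bounded_iff by blast
 have "norm (f x) <= max C 0" for x using C[of x] z[of x] by (cases "norm x <= r") auto
 thus "\<exists>C\<ge>0. \<forall>x. norm (f x) <= C" by (intro exI[of _ "max C 0"]) auto
 have "L1 (%x. indicator (cball 0 r) x *\<^sub>R f x)"
 by (rule borel_integrable_compact) (auto intro: continuous_on_subset[OF f])
 also have "(%x. indicator (cball 0 r) x *\<^sub>R f x) = f" using z by (auto simp: indicator_def)
 finally show "L1 f" .
 \<comment> \<open>Radius increased by 1: two points at distance below 1 lie either both in this
   ball or both outside the ball of radius \<open>r\<close>, where \<open>f\<close>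
   vanishes.\<close>
 have uc: "uniformly_continuous_on (cball 0 (r + 1)) f"
 by (intro compact_uniformly_continuous continuous_on_subset[OF f]) auto
 show "uniformly_continuous_on UNIV f" unfolding uniformly_continuous_on_def
 proof (intro allI impI)
 fix e :: real assume e: "e > 0"
 obtain d where d: "d > 0" "!!x x'. x : cball 0 (r+1) ==> x' : cball 0 (r+1) ==> dist x' x < d ==> dist (f x') (f x) < e"
  using uc e unfolding uniformly_continuous_on_def by metis
 show "\<exists>d>0. \<forall>x\<in>UNIV. \<forall>x'\<in>UNIV. dist x' x < d --> dist (f x') (f x) < e"
 proof (intro exI[of _ "min d 1"] conjI ballI impI)
  fix x x' :: "real^'n" assume dd: "dist x' x < min d 1"
  have t: "norm x <= norm x' + dist x' x" "norm x' <= norm x + dist x' x"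
  using norm_triangle_ineq2[of x x'] norm_triangle_ineq2[of x' x] by (auto simp: dist_norm norm_minus_commute)
  consider "norm x <= r + 1 & norm x' <= r + 1" | "norm x > r & norm x' > r" using t dd by fastforce
  thus "dist (f x') (f x) < e"
  proof cases
  case 1 thus ?thesis using d(2)[of x x'] dd by simp
  next
  case 2 thus ?thesis using z[of x] z[of x'] e by simp
  qed
 qed (use d in auto)
 qed
qed

text \<open>By translation invariance every difference quotient has integral zero. The quotients are
  bounded by the mean value theorem and vanish outside the ball of radius \<open>r + norm h\<close>,
  so dominated convergence applies.\<close>

lemma integral_directional_derivative_zero:
 fixes f :: "real^'n => real"
 assumes f: "has_C1 f D" and z: "!!x. norm x > r ==> f x = 0"
 shows "(LINT x|lborel. D x h) = 0"
proof -
 have op: "open {x::real^'n. norm x > r}" by (intro open_Collect_less continuous_intros)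
 have Dz: "D x h = 0" if "norm x > r" for x
 by (rule has_C1_zero_on_open[OF f op]) (use that z in auto)
 obtain C where C: "C >= 0" "!!x. \<bar>D x h\<bar> <= C" using continuous_bounded_support(1)[OF has_C1D(2)[OF f] Dz] by force
 define r' where "r' = r + norm h"
 have fi: "L1 f" by (rule continuous_bounded_support(2)[OF has_C1_continuous[OF f] z])
 have fm [measurable]: "f : borel_fun" using fi by auto
 have Dm [measurable]: "(%x. D x h) : borel_fun" by (intro borel_measurable_continuous_onI has_C1D(2)[OF f])
 define F where "F n x = (f ((1 / real (Suc n)) *\<^sub>R h + x) - f x) * real (Suc n)" for n x
 have F0: "(LINT x|lborel. F n x) = 0" for n
 proof -
 have i: "L1 (%x. f ((1 / real (Suc n)) *\<^sub>R h + x))" using integrable_shift[of f "(1 / real (Suc n)) *\<^sub>R h"] fi by simp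
 show ?thesis unfolding F_def using i fi integral_shift[of f "(1 / real (Suc n)) *\<^sub>R h"] by simp
 qed
 have Fm [measurable]: "F n : borel_fun" for n unfolding F_def by measurable
 have "(%n. LINT x|lborel. F n x) \<longlonglongrightarrow> (LINT x|lborel. D x h)"
 proof (rule integral_dominated_convergence)
 show "(%x. D x h) : borel_measurable lborel" "!!n. F n : borel_measurable lborel" by simp_all
 show "L1 (%x. indicator (cball (0::real^'n) r') x *\<^sub>R C)"
  by (rule borel_integrable_compact) auto
 show "AE x in lborel. (%n. F n x) \<longlonglongrightarrow> D x h"
 proof (rule AE_I2)
  fix x
  have bl: "bounded_linear (D x)" using has_C1D(1)[OF f] by (rule has_derivative_bounded_linear)
  have "((%t::real. x + t *\<^sub>R h) has_derivative (%t. t *\<^sub>R h)) (at 0)" by (auto intro!: derivative_eq_intros)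
  moreover have "(f has_derivative D x) (at (x + 0 *\<^sub>R h))" using has_C1D(1)[OF f] by simp
  ultimately have "((%t. f (x + t *\<^sub>R h)) has_derivative (%t. D x (t *\<^sub>R h))) (at 0)"
  by (rule has_derivative_compose)
  hence "((%t. f (x + t *\<^sub>R h)) has_real_derivative D x h) (at 0)"
  using bl by (simp add: has_field_derivative_def linear_simps mult_commute_abs)
  hence "((%t. (f (x + t *\<^sub>R h) - f x) / t) \<longlongrightarrow> D x h) (at 0)" by (simp add: DERIV_def)
  moreover have "filterlim (%n. 1 / real (Suc n)) (at 0) sequentially"
  unfolding filterlim_at using LIMSEQ_Suc[OF lim_1_over_n] by auto
  ultimately have "(%n. (f (x + (1 / real (Suc n)) *\<^sub>R h) - f x) / (1 / real (Suc n))) \<longlonglongrightarrow> D x h"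
  by (rule filterlim_compose)
  thus "(%n. F n x) \<longlonglongrightarrow> D x h" by (simp add: F_def add.commute)
 qed
 fix n
 show "AE x in lborel. norm (F n x) <= indicator (cball 0 r') x *\<^sub>R C"
 proof (rule AE_I2)
  fix x
  define t where "t = 1 / real (Suc n)"
  have t: "0 < t" "t <= 1" by (auto simp: t_def)
  show "norm (F n x) <= indicator (cball 0 r') x *\<^sub>R C"
  proof (cases "norm x <= r'")
  case True
  have D1: "((%s. f (x + s *\<^sub>R h)) has_real_derivative D (x + s *\<^sub>R h) h) (at s)" for s :: real
  proof -
   have bl: "bounded_linear (D (x + s *\<^sub>R h))" using has_C1D(1)[OF f] by (rule has_derivative_bounded_linear)
   have "((%t::real. x + t *\<^sub>R h) has_derivative (%t. t *\<^sub>R h)) (at s)" by (auto intro!: derivative_eq_intros)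
   hence "((%t. f (x + t *\<^sub>R h)) has_derivative (%t. D (x + s *\<^sub>R h) (t *\<^sub>R h))) (at s)"
   by (rule has_derivative_compose[OF _ has_C1D(1)[OF f]])
   thus ?thesis using bl by (simp add: has_field_derivative_def linear_simps mult_commute_abs)
  qed
  obtain s where "f (x + t *\<^sub>R h) - f (x + 0 *\<^sub>R h) = (t - 0) * D (x + s *\<^sub>R h) h"
   using MVT2[OF t(1), of "%s. f (x + s *\<^sub>R h)" "%s. D (x + s *\<^sub>R h) h"] D1 by blast
  hence "\<bar>f (t *\<^sub>R h + x) - f x\<bar> <= t * C" using C t by (simp add: abs_mult add.commute)
  hence "\<bar>f (t *\<^sub>R h + x) - f x\<bar> * real (Suc n) <= t * C * real (Suc n)" by (intro mult_right_mono) auto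
  also have "... = C" by (simp add: t_def)
  finally show ?thesis using True by (simp add: F_def t_def abs_mult)
  next
  case False
  have "norm x <= norm (t *\<^sub>R h + x) + norm (t *\<^sub>R h)" by (metis add_diff_cancel_left' norm_triangle_ineq4)
  moreover have "norm (t *\<^sub>R h) <= norm h" using t by (simp add: mult_left_le_one_le)
  ultimately have "norm (t *\<^sub>R h + x) > r" "norm x > r" using False norm_ge_zero[of h] unfolding r'_def by linarith+
  thus ?thesis using z False by (simp add: F_def t_def)
  qed
 qed
 qed
 thus ?thesis using F0 by (simp add: LIMSEQ_const_iff)
qed

lemma integral_divergence_zero:
 fixes \<phi> :: "real^'n => real^'n"
 assumes f: "has_C1 \<phi> D" and z: "!!x. norm x > r ==> \<phi> x = 0"
 shows "(LINT x|lborel. divergence \<phi> x) = 0"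
proof -
 have c: "has_C1 (%x. \<phi> x $ i) (%x h. D x h $ i)" for i
 using f by (auto simp: has_C1_def intro!: continuous_intros bounded_linear.has_derivative[OF bounded_linear_vec_nth])
 have op: "open {x::real^'n. norm x > r}" by (intro open_Collect_less continuous_intros)
 have Dz: "D x h $ i = 0" if "norm x > r" for x h i
 by (rule has_C1_zero_on_open[OF c op]) (use that z in auto)
 have "L1 (%x. D x h $ i)" for h i
 by (rule continuous_bounded_support(2)[OF has_C1D(2)[OF c] Dz])
 hence "(LINT x|lborel. divergence \<phi> x) = (\<Sum>i\<in>UNIV. LINT x|lborel. D x (axis i 1) $ i)"
 unfolding divergence_eq[OF f] by simp
 also have "... = 0"
 proof (intro sum.neutral ballI)
 fix i show "(LINT x|lborel. D x (axis i 1) $ i) = 0"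
  by (rule integral_directional_derivative_zero[OF c, of r]) (simp add: z)
 qed
 finally show ?thesis .
qed

section \<open>Mollifiers and differentiation of convolutions\<close>

definition mollifier :: "real => (real^'n => real) => (real^'n => real^'n) => real => bool" where
 "mollifier \<delta> k g L \<longleftrightarrow> \<delta> > 0 & L >= 0 & (\<forall>x. k x >= 0) & (\<forall>x. k x <= L) & (\<forall>x. k (- x) = k x) & (\<forall>x. norm x >= \<delta> --> k x = 0) &
  (LINT x|lborel. k x) = 1 & (\<forall>x. (k has_derivative (%h. g x \<bullet> h)) (at x)) &
  (\<forall>x y. norm (g x - g y) <= L * norm (x - y)) & (\<forall>x. g (- x) = - g x) & (\<forall>x. norm x >= \<delta> --> g x = 0) &
  (\<forall>x. norm (g x) <= L)"

lemma mollifierD: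
 assumes "mollifier \<delta> k g L"
 shows "\<delta> > 0" "L >= 0" "k x >= 0" "k x <= L" "k (- x) = k x" "norm x >= \<delta> ==> k x = 0" "(LINT x|lborel. k x) = 1"
 "(k has_derivative (%h. g x \<bullet> h)) (at x)" "norm (g x - g y) <= L * norm (x - y)" "g (- x) = - g x"
 "norm x >= \<delta> ==> g x = 0" "norm (g x) <= L"
 using assms unfolding mollifier_def by auto

lemma mollifier_continuous:
 assumes "mollifier \<delta> k g L" shows "continuous_on S k" "continuous_on S g"
proof -
 show "continuous_on S k" using mollifierD(8)[OF assms]
 by (meson has_derivative_continuous continuous_at_imp_continuous_on)
 have "L-lipschitz_on S g" using mollifierD(2,9)[OF assms] by (intro lipschitz_onI) (auto simp: dist_norm)
 thus "continuous_on S g" by (rule lipschitz_on_continuous_on)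
qed

lemma mollifier_meas:
 assumes "mollifier \<delta> k g L" shows "k : borel_fun" "g : borel_fun"
 using mollifier_continuous[OF assms] by (auto intro: borel_measurable_continuous_onI)

lemma mollifier_integrable:
 assumes "mollifier \<delta> k g L" shows "L1 k"
 by (rule continuous_bounded_support(2)[OF mollifier_continuous(1)[OF assms], of \<delta>]) (auto intro: mollifierD(6)[OF assms])

lemma mollifier_nn_integral:
 assumes "mollifier \<delta> k g L" shows "(\<integral>\<^sup>+x. ennreal (k x) \<partial>lborel) = 1"
 using nn_integral_eq_integral[OF mollifier_integrable[OF assms]] mollifierD(3,7)[OF assms] by simp

lemma DERIV_max_square: "((%t. (max 0 t)\<^sup>2) has_real_derivative 2 * max 0 x) (at (x::real))"
proof -
 have "(%t::real. (max 0 t)\<^sup>2) = (%t. t\<^sup>2 / 2 + t * \<bar>t\<bar> / 2)" by (auto simp: max_def power2_eq_square)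
 moreover have "((%t. t\<^sup>2 / 2 + t * \<bar>t\<bar> / 2) has_real_derivative x + \<bar>x\<bar>) (at x)"
 by (intro DERIV_add DERIV_half_abs_square) (auto intro!: derivative_eq_intros)
 moreover have "x + \<bar>x\<bar> = 2 * max 0 x" by (simp add: max_def)
 ultimately show ?thesis by simp
qed

text \<open>A multiple of the square of max(0, 1 - |x|^2 / \<delta>^2). The square makes the kernel
  C1 with Lipschitz gradient, and that is enough: first-order Taylor expansions with quadratic
  remainder are all that is used.\<close>

lemma mollifier_exists:
 assumes \<delta>: "\<delta> > 0" obtains k :: "real^'n => real" and g L where "mollifier \<delta> k g L"
proof -
 define m where "m x = max 0 (1 - x \<bullet> x / \<delta>\<^sup>2)" for x :: "real^'n"
 define B where "B x = (m x)\<^sup>2" for x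
 have mc: "continuous_on UNIV m" unfolding m_def using \<delta> by (intro continuous_intros) auto
 have m0: "m x = 0" if "norm x >= \<delta>" for x
 proof -
 have "\<delta>\<^sup>2 <= (norm x)\<^sup>2" using that \<delta> by (intro power_mono) auto
 thus ?thesis using \<delta> by (simp add: m_def dot_square_norm max_def)
 qed
 have m1: "0 <= m x" "m x <= 1" for x by (auto simp: m_def)
 have Bi: "L1 B"
 by (rule continuous_bounded_support(2)[of _ \<delta>]) (auto simp: B_def m0 intro!: continuous_intros mc)
 have mpos: "m x > 0" if "norm x < \<delta>" for x
 proof -
 have "(norm x)\<^sup>2 < \<delta>\<^sup>2" using that by (intro power_strict_mono) auto
 hence "(norm x)\<^sup>2 / \<delta>\<^sup>2 < 1" using \<delta> by simp
 thus ?thesis by (simp add: m_def dot_square_norm)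
 qed
 have Bnn: "0 <= (LINT x|lborel. B x)" by (intro integral_nonneg_AE) (simp add: B_def)
 have "(LINT x|lborel. B x) ~= 0"
 proof
 assume "(LINT x|lborel. B x) = 0"
 hence "AE x in lborel. B x = 0" using Bi by (subst (asm) integral_nonneg_eq_0_iff_AE) (auto simp: B_def)
 hence "AE x in lborel. x ~: ball (0::real^'n) \<delta>"
 proof eventually_elim
  fix x assume "B x = 0" thus "x ~: ball 0 \<delta>" using mpos[of x] by (auto simp: B_def)
 qed
 hence "AE x in lebesgue. x ~: ball (0::real^'n) \<delta>" by (rule AE_completion)
 hence "negligible (ball (0::real^'n) \<delta>)" by (simp add: negligible_iff_null_sets AE_iff_null_sets)
 thus False using open_not_negligible[of "ball (0::real^'n) \<delta>"] \<delta> by simp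
 qed
 hence I: "(LINT x|lborel. B x) > 0" using Bnn by simp
 define c where "c = 1 / (LINT x|lborel. B x)"
 have c: "c > 0" using I by (simp add: c_def)
 define k where "k x = c * B x" for x
 define g where "g x = (- 4 * c / \<delta>\<^sup>2 * m x) *\<^sub>R x" for x
 \<comment> \<open>One constant for three bounds: of the kernel, of the Lipschitz constant of its
   gradient, and of the gradient itself.\<close>
 define L where "L = max c (max (12 * c / \<delta>\<^sup>2) (4 * c / \<delta>))"
 \<comment> \<open>The 3 is 1 + 2: one from \<open>m x \<le> 1\<close>, and two from the slope of
   \<open>m\<close>, which is at most 2 / \<delta> on the ball of radius \<delta>, times
   \<open>norm y \<le> \<delta>\<close>.\<close>
 have lip0: "norm (m x *\<^sub>R x - m y *\<^sub>R y) <= 3 * norm (x - y)" if y: "norm y <= \<delta>" for x y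
 proof -
 have eq: "m x *\<^sub>R x - m y *\<^sub>R y = m x *\<^sub>R (x - y) + (m x - m y) *\<^sub>R y" by (simp add: algebra_simps)
 have 1: "norm (m x *\<^sub>R (x - y)) <= norm (x - y)" using m1 by (simp add: mult_left_le_one_le)
 have nd: "\<bar>norm x - norm y\<bar> <= norm (x - y)" by (rule norm_triangle_ineq3)
 show ?thesis
 proof (cases "norm x <= \<delta>")
  case True
  have "m x = 1 - (norm x)\<^sup>2 / \<delta>\<^sup>2" "m y = 1 - (norm y)\<^sup>2 / \<delta>\<^sup>2"
  using True y \<delta> by (auto simp: m_def dot_square_norm max_def divide_le_eq_1 power_mono)
  hence "m x - m y = - ((norm x - norm y) * (norm x + norm y) / \<delta>\<^sup>2)"
  by (simp add: power2_eq_square algebra_simps diff_divide_distrib)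
  hence "\<bar>m x - m y\<bar> = \<bar>(norm x - norm y) * (norm x + norm y)\<bar> / \<delta>\<^sup>2"
  by (simp add: abs_divide)
  also have "... <= norm (x - y) * (2 * \<delta>) / \<delta>\<^sup>2"
  unfolding abs_mult using True y nd by (intro divide_right_mono mult_mono) auto
  also have "... = 2 * norm (x - y) / \<delta>" using \<delta> by (simp add: power2_eq_square)
  finally have "\<bar>m x - m y\<bar> * norm y <= 2 * norm (x - y) / \<delta> * \<delta>" using y \<delta> by (intro mult_mono) auto
  hence "norm ((m x - m y) *\<^sub>R y) <= 2 * norm (x - y)" using \<delta> by simp
  thus ?thesis unfolding eq using 1 norm_triangle_ineq[of "m x *\<^sub>R (x - y)" "(m x - m y) *\<^sub>R y"] by linarith
 next
  case False
  hence mx: "m x = 0" by (intro m0) simp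
  have "m y = 1 - (norm y)\<^sup>2 / \<delta>\<^sup>2"
  using y \<delta> by (auto simp: m_def dot_square_norm max_def divide_le_eq_1 power_mono)
  also have "... = (\<delta> - norm y) * (\<delta> + norm y) / \<delta>\<^sup>2"
  using \<delta> by (simp add: field_simps power2_eq_square)
  also have "... <= norm (x - y) * (2 * \<delta>) / \<delta>\<^sup>2"
  using False y nd \<delta> by (intro divide_right_mono mult_mono) (auto intro: add_nonneg_nonneg)
  also have "... = 2 * norm (x - y) / \<delta>" using \<delta> by (simp add: power2_eq_square)
  finally have "m y * norm y <= 2 * norm (x - y) / \<delta> * \<delta>" using y \<delta> m1 by (intro mult_mono) auto
  hence "m y * norm y <= 2 * norm (x - y)" using \<delta> by simp
  hence "m y * norm y <= 3 * norm (x - y)" using norm_ge_zero[of "x - y"] by linarith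
  thus ?thesis using mx m1[of y] by simp
 qed
 qed
 have lip: "norm (m x *\<^sub>R x - m y *\<^sub>R y) <= 3 * norm (x - y)" for x y
 proof (cases "norm y <= \<delta> \<or> norm x <= \<delta>")
 case True thus ?thesis using lip0[of y x] lip0[of x y] by (auto simp: norm_minus_commute)
 next
 case False thus ?thesis using m0[of x] m0[of y] by simp
 qed
 have "mollifier \<delta> k g L"
 unfolding mollifier_def
 proof (intro conjI allI impI)
 show "L >= 0" using c by (auto simp: L_def)
 fix x
 show "k x >= 0" using c by (simp add: k_def B_def)
 have "B x <= 1" unfolding B_def using m1[of x] by (intro power_le_one) auto
 hence "k x <= c" using c by (simp add: k_def)
 thus "k x <= L" by (simp add: L_def)
 show "k (- x) = k x" by (simp add: k_def B_def m_def)
 show "g (- x) = - g x" by (simp add: g_def m_def)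
 show "norm x >= \<delta> ==> k x = 0" by (simp add: k_def B_def m0)
 show "norm x >= \<delta> ==> g x = 0" by (simp add: g_def m0)
 show "(LINT x|lborel. k x) = 1" unfolding k_def using I by (simp add: c_def)
 show "norm (g x) <= L"
 proof (cases "norm x <= \<delta>")
  case True
  have "norm (g x) = 4 * c / \<delta>\<^sup>2 * (m x * norm x)" using c m1 by (simp add: g_def)
  also have "... <= 4 * c / \<delta>\<^sup>2 * (1 * \<delta>)" using True c m1 \<delta> by (intro mult_left_mono mult_mono) auto
  also have "... = 4 * c / \<delta>" using \<delta> by (simp add: power2_eq_square)
  finally show ?thesis by (simp add: L_def)
 next
  case False thus ?thesis using m0 \<open>L >= 0\<close> by (simp add: g_def)
 qed
 have "((%x. 1 - x \<bullet> x / \<delta>\<^sup>2) has_derivative (%h. - (2 * (x \<bullet> h)) / \<delta>\<^sup>2)) (at x)"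
 proof -
  have "((%x. 1 - (1 / \<delta>\<^sup>2) * (x \<bullet> x)) has_derivative (%h. 0 - (1 / \<delta>\<^sup>2) * (x \<bullet> h + h \<bullet> x))) (at x)"
  by (intro has_derivative_diff has_derivative_const has_derivative_mult_right has_derivative_inner has_derivative_ident)
  thus ?thesis by (simp add: inner_commute)
 qed
 from has_derivative_compose[OF this, of "%t. (max 0 t)\<^sup>2" "%h. 2 * max 0 (1 - x \<bullet> x / \<delta>\<^sup>2) * h"]
 have "(B has_derivative (%h. 2 * m x * (- (2 * (x \<bullet> h)) / \<delta>\<^sup>2))) (at x)"
  using DERIV_max_square unfolding has_field_derivative_def B_def m_def by auto
 from has_derivative_mult_right[OF this, of c]
 show "(k has_derivative (%h. g x \<bullet> h)) (at x)"
  unfolding k_def g_def by (simp add: algebra_simps)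
 fix y
 have "g x - g y = (- 4 * c / \<delta>\<^sup>2) *\<^sub>R (m x *\<^sub>R x - m y *\<^sub>R y)" by (simp add: g_def algebra_simps)
 hence "norm (g x - g y) = 4 * c / \<delta>\<^sup>2 * norm (m x *\<^sub>R x - m y *\<^sub>R y)" using c by simp
 also have "... <= 4 * c / \<delta>\<^sup>2 * (3 * norm (x - y))" using c by (intro mult_left_mono lip) auto
 also have "... = 12 * c / \<delta>\<^sup>2 * norm (x - y)" by simp
 also have "... <= L * norm (x - y)" by (intro mult_right_mono) (auto simp: L_def)
 finally show "norm (g x - g y) <= L * norm (x - y)" .
 qed (use \<delta> in auto)
 thus ?thesis using that by blast
qed

definition conv :: "(real^'n => real) => (real^'n => 'b::euclidean_space) => real^'n => 'b" where
 "conv k w x = (LINT y|lborel. k (x - y) *\<^sub>R w y)"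

lemma integrable_bounded_scaleR:
 fixes w :: "real^'n => 'b::euclidean_space" and s :: "real^'n => real"
 assumes w: "L1 w" and s: "s : borel_fun" "!!y. \<bar>s y\<bar> <= C"
 shows "L1 (%y. s y *\<^sub>R w y)"
proof (rule Bochner_Integration.integrable_bound[OF integrable_scaleR_right[OF w, of C]])
 show "(%y. s y *\<^sub>R w y) : borel_measurable lborel" using w s by auto
 show "AE x in lborel. norm (s x *\<^sub>R w x) <= norm (C *\<^sub>R w x)"
 proof (rule AE_I2)
 fix x
 have "\<bar>s x\<bar> <= \<bar>C\<bar>" using s(2)[of x] by linarith
 thus "norm (s x *\<^sub>R w x) <= norm (C *\<^sub>R w x)" by (simp add: mult_right_mono)
 qed
qed

context
 fixes \<delta> :: real and k :: "real^'n => real" and g L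
 assumes mol: "mollifier \<delta> k g L"
begin

lemma moll_taylor: "\<bar>k y - k x - g x \<bullet> (y - x)\<bar> <= L * (norm (y - x))\<^sup>2"
proof -
 define f where "f z = k z - g x \<bullet> z" for z
 have "norm (f y - f x) <= (L * norm (y - x)) * norm (y - x)"
 proof (rule differentiable_bound[of "cball x (norm (y - x))"])
 fix z assume z: "z : cball x (norm (y - x))"
 have "(f has_derivative (%h. g z \<bullet> h - g x \<bullet> h)) (at z)"
  unfolding f_def by (intro derivative_intros mollifierD(8)[OF mol])
 thus "(f has_derivative (%h. (g z - g x) \<bullet> h)) (at z within cball x (norm (y - x)))"
  by (simp add: inner_diff_left has_derivative_at_withinI)
 have "onorm (%h. (g z - g x) \<bullet> h) <= norm (g z - g x)"
  by (intro onorm_bound) (auto simp: Cauchy_Schwarz_ineq2)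
 also have "... <= L * norm (z - x)" by (rule mollifierD(9)[OF mol])
 also have "... <= L * norm (y - x)" using z mollifierD(2)[OF mol] by (intro mult_left_mono) (auto simp: dist_norm norm_minus_commute)
 finally show "onorm (%h. (g z - g x) \<bullet> h) <= L * norm (y - x)" .
 qed (auto simp: dist_norm norm_minus_commute)
 moreover have "f y - f x = k y - k x - g x \<bullet> (y - x)" by (simp add: f_def inner_diff_right)
 ultimately show ?thesis by (simp add: power2_eq_square mult.assoc)
qed

lemma conv_integrable:
 fixes w :: "real^'n => 'b::euclidean_space"
 assumes w: "L1 w"
 shows "L1 (%y. k (x - y) *\<^sub>R w y)" "L1 (%y. (g (x - y) \<bullet> h) *\<^sub>R w y)"
proof -
 note [measurable] = mollifier_meas[OF mol]
 show "L1 (%y. k (x - y) *\<^sub>R w y)"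
 by (rule integrable_bounded_scaleR[OF w, of _ L]) (use mollifierD(3,4)[OF mol] in auto)
 show "L1 (%y. (g (x - y) \<bullet> h) *\<^sub>R w y)"
 proof (rule integrable_bounded_scaleR[OF w, of _ "L * norm h"])
 fix y
 have "\<bar>g (x - y) \<bullet> h\<bar> <= norm (g (x - y)) * norm h" by (rule Cauchy_Schwarz_ineq2)
 also have "... <= L * norm h" by (intro mult_right_mono mollifierD(12)[OF mol]) auto
 finally show "\<bar>g (x - y) \<bullet> h\<bar> <= L * norm h" .
 qed measurable
qed

lemma norm_integral_scaleR_le:
 fixes w :: "real^'n => 'b::euclidean_space" and s :: "real^'n => real"
 assumes w: "L1 w" and s: "s : borel_fun" "!!y. \<bar>s y\<bar> <= C"
 shows "norm (LINT y|lborel. s y *\<^sub>R w y) <= C * (LINT y|lborel. norm (w y))"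
proof -
 have "norm (LINT y|lborel. s y *\<^sub>R w y) <= (LINT y|lborel. norm (s y *\<^sub>R w y))" by (rule integral_norm_bound)
 also have "... <= (LINT y|lborel. C * norm (w y))"
 proof (rule integral_mono)
 show "L1 (%y. norm (s y *\<^sub>R w y))" by (rule integrable_norm[OF integrable_bounded_scaleR[OF w s]])
 qed (use w s(2) in \<open>auto intro!: mult_right_mono\<close>)
 finally show ?thesis using w by simp
qed

text \<open>The quadratic Taylor remainder of the kernel is uniform; integrated against |w| it is
  the remainder of the convolution, so no limit theorem is needed to differentiate under the
  integral. For the same reason the derivative is Lipschitz in \<open>x\<close>.\<close>

lemma conv_has_C1:
 fixes w :: "real^'n => 'b::euclidean_space"
 assumes w: "L1 w"
 shows "has_C1 (conv k w) (%x h. LINT y|lborel. (g (x - y) \<bullet> h) *\<^sub>R w y)"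
proof -
 note [measurable] = mollifier_meas[OF mol]
 define D where "D x h = (LINT y|lborel. (g (x - y) \<bullet> h) *\<^sub>R w y)" for x h
 define W where "W = (LINT y|lborel. norm (w y))"
 have W: "W >= 0" by (simp add: W_def)
 note L0 = mollifierD(2)[OF mol]
 have Dlip: "norm (D x h - D x' h) <= L * norm (x - x') * norm h * W" for x x' h
 proof -
 have "D x h - D x' h = (LINT y|lborel. ((g (x - y) - g (x' - y)) \<bullet> h) *\<^sub>R w y)"
  unfolding D_def using conv_integrable(2)[OF w] by (simp add: inner_diff_left scaleR_diff_left)
 also have "norm ... <= L * norm (x - x') * norm h * W"
  unfolding W_def
 proof (rule norm_integral_scaleR_le[OF w])
  fix y
  have "\<bar>(g (x - y) - g (x' - y)) \<bullet> h\<bar> <= norm (g (x - y) - g (x' - y)) * norm h" by (rule Cauchy_Schwarz_ineq2)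
  also have "... <= L * norm ((x - y) - (x' - y)) * norm h" by (intro mult_right_mono mollifierD(9)[OF mol]) auto
  finally show "\<bar>(g (x - y) - g (x' - y)) \<bullet> h\<bar> <= L * norm (x - x') * norm h" by simp
 qed measurable
 finally show ?thesis .
 qed
 have bl: "bounded_linear (D x)" for x
 proof (rule bounded_linear_intro[of _ "L * W"])
 show "D x (h + h') = D x h + D x h'" for h h'
  unfolding D_def using conv_integrable(2)[OF w] by (simp add: inner_add_right scaleR_add_left)
 show "D x (r *\<^sub>R h) = r *\<^sub>R D x h" for r h
  unfolding D_def by (simp flip: scaleR_scaleR)
 show "norm (D x h) <= norm h * (L * W)" for h
 proof -
  have "norm (D x h) <= (L * norm h) * W" unfolding D_def W_def
  proof (rule norm_integral_scaleR_le[OF w])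
  fix y
  have "\<bar>g (x - y) \<bullet> h\<bar> <= norm (g (x - y)) * norm h" by (rule Cauchy_Schwarz_ineq2)
  also have "... <= L * norm h" by (intro mult_right_mono mollifierD(12)[OF mol]) auto
  finally show "\<bar>g (x - y) \<bullet> h\<bar> <= L * norm h" .
  qed measurable
  thus ?thesis by (simp add: mult.commute mult.left_commute)
 qed
 qed
 have der: "(conv k w has_derivative D x) (at x)" for x
 unfolding has_derivative_at_alt
 proof (intro conjI allI impI bl)
 fix e :: real assume e: "e > 0"
 define d where "d = e / (L * W + 1)"
 have LW: "L * W >= 0" using L0 W by simp
 have d: "d > 0" using e LW by (simp add: d_def)
 show "\<exists>d>0. \<forall>y. norm (y - x) < d --> norm (conv k w y - conv k w x - D x (y - x)) <= e * norm (y - x)"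
 proof (intro exI[of _ d] conjI d allI impI)
  fix y assume y: "norm (y - x) < d"
  have "conv k w y - conv k w x - D x (y - x) = (LINT z|lborel. (k (y - z) - k (x - z) - g (x - z) \<bullet> (y - x)) *\<^sub>R w z)"
  unfolding conv_def D_def using conv_integrable[OF w] by (simp add: scaleR_diff_left)
  also have "norm ... <= L * (norm (y - x))\<^sup>2 * W"
  unfolding W_def
  proof (rule norm_integral_scaleR_le[OF w])
  show "\<bar>k (y - z) - k (x - z) - g (x - z) \<bullet> (y - x)\<bar> <= L * (norm (y - x))\<^sup>2" for z
   using moll_taylor[of "y - z" "x - z"] by simp
  qed measurable
  also have "... = (L * W * norm (y - x)) * norm (y - x)" by (simp add: power2_eq_square)
  also have "... <= e * norm (y - x)"
  proof (rule mult_right_mono)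
  have "L * W * norm (y - x) <= L * W * d" using y LW by (intro mult_left_mono) auto
  also have "... <= (L * W + 1) * d" using d by (intro mult_right_mono) auto
  also have "... = e" using LW by (simp add: d_def)
  finally show "L * W * norm (y - x) <= e" .
  qed simp
  finally show "norm (conv k w y - conv k w x - D x (y - x)) <= e * norm (y - x)" .
 qed
 qed
 have "continuous_on UNIV (%x. D x h)" for h
 proof (rule lipschitz_on_continuous_on)
 show "(L * norm h * W)-lipschitz_on UNIV (%x. D x h)"
  using Dlip L0 W by (intro lipschitz_onI) (auto simp: dist_norm algebra_simps)
 qed
 with der show ?thesis unfolding has_C1_def D_def by blast
qed

end

section \<open>Approximation in L^q by mollification\<close>

lemma powr_abs_continuous:
 fixes c :: "'a::topological_space => real"
 assumes "q > 1" "continuous_on S c" shows "continuous_on S (%x. \<bar>c x\<bar> powr q)"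
 using assms by (intro continuous_on_powr' continuous_intros) auto

lemma Lp_continuous:
 fixes c :: "real^'n => real"
 assumes q: "q > 1" and c: "continuous_on UNIV c" "!!x. norm x > r ==> c x = 0"
 shows "c : Lp q lborel"
proof -
 have "L1 (%x. \<bar>c x\<bar> powr q)"
 by (rule continuous_bounded_support(2)[OF powr_abs_continuous[OF q c(1)], of r]) (simp add: c(2))
 thus ?thesis using c(1) by (auto simp: Lp_def intro: borel_measurable_continuous_onI)
qed

text \<open>Values are truncated at height \<open>m\<close> first. Continuous functions converging
  almost everywhere, truncated at the same height and multiplied by a cutoff, then converge in L^q
  by domination.\<close>

lemma Lp_approx_continuous:
 fixes w :: "real^'n => real"
 assumes q: "q > 1" and w: "w : Lp q lborel" and z: "!!x. norm x > r ==> w x = 0" and \<eta>: "\<eta> > 0"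
 obtains c where "continuous_on UNIV c" "!!x. norm x > r + 1 ==> c x = 0" "Lpow q lborel (%x. w x - c x) < \<eta>"
proof -
 have wm [measurable]: "w : borel_fun" using w by (simp add: Lp_def)
 define \<eta>' where "\<eta>' = \<eta> / (4 * 2 powr q)"
 have \<eta>': "\<eta>' > 0" using \<eta> by (simp add: \<eta>'_def)
 define T where "T m x = max (- real m) (min (real m) (w x))" for m x
 have Tm [measurable]: "T m : borel_fun" for m unfolding T_def by measurable
 have "(%m. LINT x|lborel. \<bar>w x - T m x\<bar> powr q) \<longlonglongrightarrow> (LINT x|(lborel :: (real^'n) measure). 0)"
 proof (rule integral_dominated_convergence)
 show "L1 (%x. \<bar>w x\<bar> powr q)" using w by (simp add: Lp_def)
 show "AE x in lborel. (%m. \<bar>w x - T m x\<bar> powr q) \<longlonglongrightarrow> 0"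
 proof (rule AE_I2)
  fix x
  obtain m0 :: nat where m0: "\<bar>w x\<bar> <= real m0" using real_arch_simple by blast
  have "\<forall>\<^sub>F m in sequentially. \<bar>w x - T m x\<bar> powr q = 0"
  unfolding eventually_sequentially
  proof (intro exI allI impI)
  fix m assume "m >= m0"
  hence "\<bar>w x\<bar> <= real m" using m0 by simp
  hence "T m x = w x" unfolding T_def by linarith
  thus "\<bar>w x - T m x\<bar> powr q = 0" by simp
  qed
  thus "(%m. \<bar>w x - T m x\<bar> powr q) \<longlonglongrightarrow> 0" by (simp add: tendsto_eventually)
 qed
 fix m
 show "AE x in lborel. norm (\<bar>w x - T m x\<bar> powr q) <= \<bar>w x\<bar> powr q"
 proof (rule AE_I2)
  fix x
  have "\<bar>w x - T m x\<bar> <= \<bar>w x\<bar>" unfolding T_def by linarith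
  thus "norm (\<bar>w x - T m x\<bar> powr q) <= \<bar>w x\<bar> powr q" using q by (simp add: powr_mono2)
 qed
 qed measurable
 hence "(%m. Lpow q lborel (%x. w x - T m x)) \<longlonglongrightarrow> 0" by (simp add: Lpow_def)
 hence "\<forall>\<^sub>F m in sequentially. Lpow q lborel (%x. w x - T m x) < \<eta>'" using \<eta>' by (rule order_tendstoD(2))
 then obtain m where m: "Lpow q lborel (%x. w x - T m x) < \<eta>'" by (auto simp: eventually_sequentially)
 have TL: "T m : Lp q lborel"
 proof -
 have "L1 (%x. \<bar>T m x\<bar> powr q)"
 proof (rule Bochner_Integration.integrable_bound[OF Lp_integrable[OF w]])
  show "AE x in lborel. norm (\<bar>T m x\<bar> powr q) <= norm (\<bar>w x\<bar> powr q)"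
  proof (rule AE_I2)
  fix x
  have "\<bar>T m x\<bar> <= \<bar>w x\<bar>" unfolding T_def by linarith
  thus "norm (\<bar>T m x\<bar> powr q) <= norm (\<bar>w x\<bar> powr q)" using q by (simp add: powr_mono2)
  qed
 qed measurable
 thus ?thesis by (simp add: Lp_def)
 qed
 \<comment> \<open>This notion of measurability supplies continuous functions converging to
   \<open>w\<close> off a negligible set.\<close>
 have "w measurable_on UNIV"
 by (intro lebesgue_measurable_imp_measurable_on measurable_completion) simp_all
 then obtain N g where N: "negligible N" and gc: "!!n. continuous_on UNIV (g n)"
 and gl: "!!x. x ~: N ==> (%n. g n x) \<longlonglongrightarrow> w x" unfolding measurable_on_def by auto
 have AEN: "AE x in lborel. x ~: N"
 using AE_not_in[of N lebesgue] N AE_completion_iff[of "%x. x ~: N" lborel] by (simp add: negligible_iff_null_sets)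
 define \<zeta> where "\<zeta> x = max 0 (min 1 (r + 1 - norm x))" for x :: "real^'n"
 have \<zeta>: "0 <= \<zeta> x" "\<zeta> x <= 1" "norm x <= r ==> \<zeta> x = 1" "norm x > r + 1 ==> \<zeta> x = 0" for x
 by (auto simp: \<zeta>_def)
 define c where "c n x = \<zeta> x * max (- real m) (min (real m) (g n x))" for n x
 have cc: "continuous_on UNIV (c n)" for n unfolding c_def \<zeta>_def by (intro continuous_intros gc)
 have cm [measurable]: "c n : borel_fun" for n by (rule borel_measurable_continuous_onI[OF cc])
 have cz: "c n x = 0" if "norm x > r + 1" for n x using that \<zeta>(4) by (simp add: c_def)
 have cL: "c n : Lp q lborel" for n by (rule Lp_continuous[OF q cc cz])
 have cb: "\<bar>c n x\<bar> <= real m" for n x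
 proof -
 have "\<bar>c n x\<bar> <= 1 * real m" unfolding c_def abs_mult using \<zeta>[of x] by (intro mult_mono) auto
 thus ?thesis by simp
 qed
 have "(%n. LINT x|lborel. \<bar>T m x - c n x\<bar> powr q) \<longlonglongrightarrow> (LINT x|(lborel :: (real^'n) measure). 0)"
 proof (rule integral_dominated_convergence)
 show "L1 (%x. indicator (cball (0::real^'n) (r + 1)) x *\<^sub>R (2 * real m) powr q)"
  by (rule borel_integrable_compact) auto
 show "AE x in lborel. (%n. \<bar>T m x - c n x\<bar> powr q) \<longlonglongrightarrow> 0"
  using AEN
 proof eventually_elim
  fix x assume "x ~: N"
  hence l: "(%n. g n x) \<longlonglongrightarrow> w x" by (rule gl)
  have "(%n. c n x) \<longlonglongrightarrow> \<zeta> x * T m x" unfolding c_def T_def by (intro tendsto_intros l)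
  also have "\<zeta> x * T m x = T m x" using \<zeta>(3)[of x] z[of x] by (cases "norm x <= r") (auto simp: T_def)
  finally have "(%n. \<bar>T m x - c n x\<bar> powr q) \<longlonglongrightarrow> \<bar>T m x - T m x\<bar> powr q"
  using q by (intro tendsto_powr' tendsto_rabs tendsto_diff tendsto_const) auto
  thus "(%n. \<bar>T m x - c n x\<bar> powr q) \<longlonglongrightarrow> 0" using q by simp
 qed
 fix n
 show "AE x in lborel. norm (\<bar>T m x - c n x\<bar> powr q) <= indicator (cball (0::real^'n) (r + 1)) x *\<^sub>R (2 * real m) powr q"
 proof (rule AE_I2)
  fix x
  show "norm (\<bar>T m x - c n x\<bar> powr q) <= indicator (cball (0::real^'n) (r + 1)) x *\<^sub>R (2 * real m) powr q"
  proof (cases "norm x <= r + 1")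
  case True
  have "\<bar>T m x\<bar> <= real m" unfolding T_def by linarith
  hence "\<bar>T m x - c n x\<bar> <= 2 * real m" using cb[of n x] by linarith
  hence "\<bar>T m x - c n x\<bar> powr q <= (2 * real m) powr q" using q by (intro powr_mono2) auto
  thus ?thesis using True by simp
  next
  case False
  hence "T m x = 0" "c n x = 0" using z[of x] cz[of x n] by (auto simp: T_def)
  thus ?thesis by simp
  qed
 qed
 qed measurable
 hence "(%n. Lpow q lborel (%x. T m x - c n x)) \<longlonglongrightarrow> 0" by (simp add: Lpow_def)
 hence "\<forall>\<^sub>F n in sequentially. Lpow q lborel (%x. T m x - c n x) < \<eta>'" using \<eta>' by (rule order_tendstoD(2))
 then obtain n where n: "Lpow q lborel (%x. T m x - c n x) < \<eta>'" by (auto simp: eventually_sequentially)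
 have "Lpow q lborel (%x. w x - c n x) <= 2 powr q * (Lpow q lborel (%x. w x - T m x) + Lpow q lborel (%x. T m x - c n x))"
 by (rule Lpow_triangle[OF q w TL cL])
 also have "... <= 2 powr q * (\<eta>' + \<eta>')" using m n by (intro mult_left_mono) auto
 also have "... < \<eta>" using \<eta> by (simp add: \<eta>'_def)
 finally show ?thesis using that[OF cc cz] by blast
qed

lemma Lp_shift:
 fixes w :: "real^'n => real"
 assumes w: "w : Lp q lborel"
 shows "(%x. w (z + x)) : Lp q lborel" "Lpow q lborel (%x. w (z + x)) = Lpow q lborel w"
proof -
 have m [measurable]: "w : borel_fun" using w by (simp add: Lp_def)
 show "(%x. w (z + x)) : Lp q lborel" using w integrable_shift[of "%x. \<bar>w x\<bar> powr q" z] by (simp add: Lp_def)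
 show "Lpow q lborel (%x. w (z + x)) = Lpow q lborel w" unfolding Lpow_def using integral_shift[of "%x. \<bar>w x\<bar> powr q" z] by simp
qed

text \<open>Through a uniformly continuous approximation of bounded support. The triangle inequality
  is used twice, each time at the cost of \<open>2 powr q\<close>; hence the square of this factor
  in \<eta>'.\<close>

lemma Lp_translation_continuous:
 fixes w :: "real^'n => real"
 assumes q: "q > 1" and w: "w : Lp q lborel" and z: "!!x. norm x > r ==> w x = 0" and \<eta>: "\<eta> > 0"
 obtains d where "d > 0" "!!z. norm z < d ==> Lpow q lborel (%x. w (z + x) - w x) < \<eta>"
proof -
 define \<eta>' where "\<eta>' = \<eta> / (4 * 2 powr q * 2 powr q)"
 have \<eta>': "\<eta>' > 0" using \<eta> by (simp add: \<eta>'_def)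
 obtain c where c: "continuous_on UNIV c" "!!x. norm x > r + 1 ==> c x = 0" "Lpow q lborel (%x. w x - c x) < \<eta>'"
 using Lp_approx_continuous[OF q w z \<eta>'] by blast
 have cL: "c : Lp q lborel" by (rule Lp_continuous[OF q c(1,2)])
 have uc: "uniformly_continuous_on UNIV c" by (rule continuous_bounded_support(3)[OF c(1,2)])
 define V where "V = measure lborel (cball (0::real^'n) (r + 2)) + 1"
 have V: "V > 0" by (simp add: V_def add_nonneg_pos)
 define e where "e = (\<eta>' / V) powr (1 / q)"
 have e: "e > 0" using \<eta>' V by (simp add: e_def)
 have eq: "e powr q = \<eta>' / V" using q \<eta>' V by (simp add: e_def powr_powr)
 obtain d where d: "d > 0" "!!x x'. dist x' x < d ==> dist (c x') (c x) < e"
 using uc e unfolding uniformly_continuous_on_def by blast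
 show ?thesis
 proof (rule that[of "min d 1"])
 fix y :: "real^'n" assume y: "norm y < min d 1"
 have cs: "(%x. c (y + x)) : Lp q lborel" by (rule Lp_shift[OF cL])
 have ws: "(%x. w (y + x)) : Lp q lborel" by (rule Lp_shift[OF w])
 have ib: "L1 (%x. indicator (cball (0::real^'n) (r + 2)) x *\<^sub>R (\<eta>' / V))"
  by (rule borel_integrable_compact) auto
 have "Lpow q lborel (%x. c (y + x) - c x) <= (LINT x|lborel. indicator (cball (0::real^'n) (r + 2)) x *\<^sub>R (\<eta>' / V))"
  unfolding Lpow_def
 proof (rule integral_mono[OF Lp_integrable[OF Lp_diff[OF q cs cL]] ib])
  fix x
  show "\<bar>c (y + x) - c x\<bar> powr q <= indicator (cball (0::real^'n) (r + 2)) x *\<^sub>R (\<eta>' / V)"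
  proof (cases "norm x <= r + 2")
  case True
  have "\<bar>c (y + x) - c x\<bar> <= e" using d(2)[of "y + x" x] y by (simp add: dist_norm)
  hence "\<bar>c (y + x) - c x\<bar> powr q <= e powr q" using q by (intro powr_mono2) auto
  thus ?thesis using True eq by simp
  next
  case False
  have "norm x <= norm (y + x) + norm y" by (metis add_diff_cancel_left' norm_triangle_ineq4)
  hence "norm (y + x) > r + 1" "norm x > r + 1" using False y by auto
  thus ?thesis using c(2) \<eta>' V by (simp add: indicator_def)
  qed
 qed
 also have "... = measure lborel (cball (0::real^'n) (r + 2)) * (\<eta>' / V)" by simp
 also have "... <= V * (\<eta>' / V)" using \<eta>' V by (intro mult_right_mono) (auto simp: V_def)
 also have "... = \<eta>'" using V by simp
 finally have 2: "Lpow q lborel (%x. c (y + x) - c x) <= \<eta>'" .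
 have 1: "Lpow q lborel (%x. w (y + x) - c (y + x)) < \<eta>'"
  using Lp_shift(2)[OF Lp_diff[OF q w cL], of y] c(3) by simp
 have 3: "Lpow q lborel (%x. c x - w x) < \<eta>'" using c(3) Lpow_diff_commute[of q lborel w c] by simp
 have 4: "Lpow q lborel (%x. w (y + x) - c x) <= 2 powr q * (\<eta>' + \<eta>')"
  by (rule order_trans[OF Lpow_triangle[OF q ws cs cL]]) (use 1 2 in \<open>intro mult_left_mono add_mono; simp\<close>)
 have p1: "(1::real) <= 2 powr q" using q by (simp add: ge_one_powr_ge_zero)
 have "Lpow q lborel (%x. w (y + x) - w x) <= 2 powr q * (2 powr q * (\<eta>' + \<eta>') + Lpow q lborel (%x. c x - w x))"
  by (rule order_trans[OF Lpow_triangle[OF q ws cL w]]) (use 4 in \<open>intro mult_left_mono add_mono; simp\<close>)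
 also have "... < 2 powr q * (2 powr q * (\<eta>' + \<eta>') + 2 powr q * \<eta>')"
 proof -
  have "\<eta>' <= 2 powr q * \<eta>'" using p1 \<eta>' by simp
  thus ?thesis by (intro mult_strict_left_mono add_strict_left_mono order_less_le_trans[OF 3]) auto
 qed
 also have "... < \<eta>" using \<eta> by (simp add: \<eta>'_def field_simps)
 finally show "Lpow q lborel (%x. w (y + x) - w x) < \<eta>" .
 qed (use d in auto)
qed

lemma integrable_of_Lp_bounded_support:
 fixes w :: "real^'n => real"
 assumes q: "q > 1" and w: "w : Lp q lborel" and z: "!!x. x ~: B ==> w x = 0" and B: "B : sets borel" "bounded B"
 shows "L1 w"
 and "\<eta> > 0 ==> (LINT x|lborel. \<bar>w x\<bar>) <= \<eta> * measure lborel B + \<eta> powr (1 - q) * Lpow q lborel w"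
proof -
 have wm [measurable]: "w : borel_fun" using w by (simp add: Lp_def)
 have Bf: "emeasure lborel B < \<infinity>" using B by (intro emeasure_bounded_finite)
 have i: "L1 (%x. \<eta> * indicator B x + \<eta> powr (1 - q) * \<bar>w x\<bar> powr q)" for \<eta>
 using B(1) Bf Lp_integrable[OF w] by (intro Bochner_Integration.integrable_add integrable_mult_right) auto
 have le: "\<bar>w x\<bar> <= \<eta> * indicator B x + \<eta> powr (1 - q) * \<bar>w x\<bar> powr q" if "\<eta> > 0" for \<eta> x
 using abs_le_powr[OF q that, of "w x"] z[of x] by (cases "x : B") auto
 show wi: "L1 w"
 by (rule Bochner_Integration.integrable_bound[OF i[of 1]]) (use le[of 1] in \<open>auto intro!: AE_I2 order_trans[OF _ abs_ge_self]\<close>)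
 assume \<eta>: "\<eta> > 0"
 have "(LINT x|lborel. \<bar>w x\<bar>) <= (LINT x|lborel. \<eta> * indicator B x + \<eta> powr (1 - q) * \<bar>w x\<bar> powr q)"
 using wi i le[OF \<eta>] by (intro integral_mono) auto
 also have "... = \<eta> * measure lborel B + \<eta> powr (1 - q) * Lpow q lborel w"
 using B(1) Bf Lp_integrable[OF w] by (simp add: Lpow_def)
 finally show "(LINT x|lborel. \<bar>w x\<bar>) <= \<eta> * measure lborel B + \<eta> powr (1 - q) * Lpow q lborel w" .
qed

lemma conv_diff_eq:
 fixes w :: "real^'n => 'b::euclidean_space"
 assumes mol: "mollifier \<delta> k g L" and w: "L1 w"
 shows "L1 (%z. k z *\<^sub>R (w (z + x) - w x))"
 and "conv k w x - w x = (LINT z|lborel. k z *\<^sub>R (w (z + x) - w x))"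
proof -
 note [measurable] = mollifier_meas[OF mol]
 have wm [measurable]: "w : borel_fun" using w by auto
 note i1 = conv_integrable(1)[OF mol w, of x]
 have eq: "k (x - (x + z)) = k z" for z using mollifierD(5)[OF mol, of z] by simp
 have i2: "L1 (%z. k z *\<^sub>R w (z + x))"
 using integrable_shift[of "%y. k (x - y) *\<^sub>R w y" x] i1 eq by (simp add: add.commute)
 have i3: "L1 (%z. k z *\<^sub>R w x)"
 using mollifier_integrable[OF mol] by (rule integrable_scaleR_left)
 have "conv k w x = (LINT z|lborel. k z *\<^sub>R w (z + x))"
 unfolding conv_def using integral_shift[of "%y. k (x - y) *\<^sub>R w y" x] i1 eq by (simp add: add.commute)
 moreover have "w x = (LINT z|lborel. k z *\<^sub>R w x)"
 using mollifierD(7)[OF mol] mollifier_integrable[OF mol] by simp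
 ultimately show "conv k w x - w x = (LINT z|lborel. k z *\<^sub>R (w (z + x) - w x))"
 using i2 i3 by (simp add: scaleR_diff_right)
 show "L1 (%z. k z *\<^sub>R (w (z + x) - w x))" using i2 i3 by (simp add: scaleR_diff_right)
qed

text \<open>Jensen's inequality for the probability density \<open>k\<close>: integrate the
  supporting line of the power at the mean \<open>s\<close>. The right-hand side may be
  infinite.\<close>

lemma mollifier_jensen:
 assumes mol: "mollifier \<delta> k g L" and q: "q > 1" and d: "d : borel_fun" "!!z. d z >= 0"
 and i: "L1 (%z. k z * d z)"
 shows "ennreal ((LINT z|lborel. k z * d z) powr q) <= (\<integral>\<^sup>+z. ennreal (k z * d z powr q) \<partial>lborel)"
proof (cases "(\<integral>\<^sup>+z. ennreal (k z * d z powr q) \<partial>lborel) = \<infinity>")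
 case True thus ?thesis by simp
next
 case False
 note [measurable] = mollifier_meas[OF mol] d(1)
 note k0 = mollifierD(3)[OF mol]
 note ki = mollifier_integrable[OF mol]
 define s where "s = (LINT z|lborel. k z * d z)"
 have s: "s >= 0" unfolding s_def using k0 d by (intro integral_nonneg_AE) auto
 have iq: "L1 (%z. k z * d z powr q)"
 using False k0 by (intro integrableI_nonneg) (auto simp: less_top)
 have "s powr q = (LINT z|lborel. k z * (s powr q + q * s powr (q - 1) * (d z - s)))"
 proof -
 have "(LINT z|lborel. k z * (s powr q + q * s powr (q - 1) * (d z - s))) =
  (LINT z|lborel. (s powr q - q * s powr (q - 1) * s) * k z + q * s powr (q - 1) * (k z * d z))"
  by (rule Bochner_Integration.integral_cong[OF refl]) (simp add: algebra_simps)
 also have "... = (s powr q - q * s powr (q - 1) * s) * 1 + q * s powr (q - 1) * s"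
  using i ki mollifierD(7)[OF mol] by (simp add: s_def)
 finally show ?thesis by simp
 qed
 also have "... <= (LINT z|lborel. k z * d z powr q)"
 proof (rule integral_mono[OF _ iq])
 have "L1 (%z. (s powr q - q * s powr (q - 1) * s) * k z + q * s powr (q - 1) * (k z * d z))" using i ki by auto
 also have "(%z. (s powr q - q * s powr (q - 1) * s) * k z + q * s powr (q - 1) * (k z * d z)) =
  (%z. k z * (s powr q + q * s powr (q - 1) * (d z - s)))" by (auto simp: algebra_simps)
 finally show "L1 (%z. k z * (s powr q + q * s powr (q - 1) * (d z - s)))" .
 show "k z * (s powr q + q * s powr (q - 1) * (d z - s)) <= k z * d z powr q" for z
  by (intro mult_left_mono powr_tangent q d s k0)
 qed
 finally have "ennreal (s powr q) <= ennreal (LINT z|lborel. k z * d z powr q)" by (rule ennreal_leI)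
 also have "... = (\<integral>\<^sup>+z. ennreal (k z * d z powr q) \<partial>lborel)"
 using iq k0 by (intro nn_integral_eq_integral[symmetric]) auto
 finally show ?thesis by (simp add: s_def)
qed

lemma conv_meas:
 fixes w :: "real^'n => 'b::euclidean_space"
 assumes mol: "mollifier \<delta> k g L" and w: "L1 w"
 shows "conv k w : borel_fun"
 by (rule borel_measurable_continuous_onI[OF has_C1_continuous[OF conv_has_C1[OF mol w]]])

text \<open>\<open>d\<close> does not depend on the kernel, so several conditions on the radius can
  be collected before a kernel is chosen. Jensen and Fubini reduce the claim to continuity of
  translations by vectors shorter than \<delta>.\<close>

theorem conv_tendsto_Lp:
 fixes w :: "real^'n => real"
 assumes q: "q > 1" and w: "w : Lp q lborel" and z: "!!x. norm x > r ==> w x = 0" and \<eta>: "\<eta> > 0"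
 obtains d where "d > 0" "!!\<delta> k g L. mollifier \<delta> k g L ==> \<delta> < d ==>
  (%x. conv k w x - w x) : Lp q lborel & Lpow q lborel (%x. conv k w x - w x) <= \<eta>"
proof -
 obtain d where d: "d > 0" "!!z. norm z < d ==> Lpow q lborel (%x. w (z + x) - w x) < \<eta>"
 using Lp_translation_continuous[OF q w z \<eta>] by blast
 have wm [measurable]: "w : borel_fun" using w by (simp add: Lp_def)
 have wi: "L1 w"
 by (rule integrable_of_Lp_bounded_support(1)[OF q w, of "cball 0 r"]) (auto simp: z)
 show ?thesis
 proof (rule that[OF d(1)])
 fix \<delta> and k :: "real^'n => real" and g L assume mol: "mollifier \<delta> k g L" and \<delta>: "\<delta> < d"
 note [measurable] = mollifier_meas[OF mol]
 note k0 = mollifierD(3)[OF mol]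
 have cm [measurable]: "conv k w : borel_fun" by (rule conv_meas[OF mol wi])
 have "(\<integral>\<^sup>+x. ennreal (\<bar>conv k w x - w x\<bar> powr q) \<partial>lborel) <= (\<integral>\<^sup>+x. \<integral>\<^sup>+z. ennreal (k z * \<bar>w (z + x) - w x\<bar> powr q) \<partial>lborel \<partial>lborel)"
 proof (rule nn_integral_mono)
  fix x
  have i: "L1 (%z. k z * (w (z + x) - w x))" using conv_diff_eq(1)[OF mol wi, of x] by simp
  have i': "L1 (%z. k z * \<bar>w (z + x) - w x\<bar>)"
  using integrable_abs[OF i] k0 by (simp add: abs_mult)
  have "\<bar>conv k w x - w x\<bar> <= (LINT z|lborel. k z * \<bar>w (z + x) - w x\<bar>)"
  using integral_abs_bound[of lborel "%z. k z * (w (z + x) - w x)"] conv_diff_eq(2)[OF mol wi, of x] k0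
  by (simp add: abs_mult)
  hence "ennreal (\<bar>conv k w x - w x\<bar> powr q) <= ennreal ((LINT z|lborel. k z * \<bar>w (z + x) - w x\<bar>) powr q)"
  using q by (intro ennreal_leI powr_mono2) auto
  also have "... <= (\<integral>\<^sup>+z. ennreal (k z * \<bar>w (z + x) - w x\<bar> powr q) \<partial>lborel)"
  by (rule mollifier_jensen[OF mol q _ _ i']) auto
  finally show "ennreal (\<bar>conv k w x - w x\<bar> powr q) <= (\<integral>\<^sup>+z. ennreal (k z * \<bar>w (z + x) - w x\<bar> powr q) \<partial>lborel)" .
 qed
 also have "... = (\<integral>\<^sup>+z. \<integral>\<^sup>+x. ennreal (k z * \<bar>w (z + x) - w x\<bar> powr q) \<partial>lborel \<partial>lborel)"
  by (rule lborel_pair.Fubini') measurable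
 also have "... <= (\<integral>\<^sup>+z. ennreal (k z) * ennreal \<eta> \<partial>lborel)"
 proof (rule nn_integral_mono)
  fix y
  have "(\<integral>\<^sup>+x. ennreal (k y * \<bar>w (y + x) - w x\<bar> powr q) \<partial>lborel) = ennreal (k y) * (\<integral>\<^sup>+x. ennreal (\<bar>w (y + x) - w x\<bar> powr q) \<partial>lborel)"
  using k0 by (simp add: ennreal_mult nn_integral_cmult)
  also have "... = ennreal (k y) * ennreal (Lpow q lborel (%x. w (y + x) - w x))"
  by (simp add: nn_integral_Lp[OF Lp_diff[OF q Lp_shift(1)[OF w] w]])
  also have "... <= ennreal (k y) * ennreal \<eta>"
  proof (cases "norm y < \<delta>")
  case True
  thus ?thesis using d(2)[of y] \<delta> by (intro mult_left_mono ennreal_leI) auto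
  next
  case False
  thus ?thesis using mollifierD(6)[OF mol, of y] by simp
  qed
  finally show "(\<integral>\<^sup>+x. ennreal (k y * \<bar>w (y + x) - w x\<bar> powr q) \<partial>lborel) <= ennreal (k y) * ennreal \<eta>" .
 qed
 also have "... = ennreal \<eta>" by (simp add: nn_integral_multc mollifier_nn_integral[OF mol])
 finally have le: "(\<integral>\<^sup>+x. ennreal (\<bar>conv k w x - w x\<bar> powr q) \<partial>lborel) <= ennreal \<eta>" .
 hence "(\<integral>\<^sup>+x. ennreal (\<bar>conv k w x - w x\<bar> powr q) \<partial>lborel) < \<infinity>" by (simp add: order_le_less_trans)
 hence L: "(%x. conv k w x - w x) : Lp q lborel" unfolding Lp_iff_nn by simp
 have "Lpow q lborel (%x. conv k w x - w x) <= \<eta>" using le nn_integral_Lp[OF L] \<eta> by (simp add: ennreal_le_iff)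
 thus "(%x. conv k w x - w x) : Lp q lborel & Lpow q lborel (%x. conv k w x - w x) <= \<eta>" using L by simp
 qed
qed

lemma conv_support:
 fixes w :: "real^'n => 'b::euclidean_space"
 assumes mol: "mollifier \<delta> k g L" and z: "!!y. dist x y < \<delta> ==> w y = 0"
 shows "conv k w x = 0"
proof -
 have "k (x - y) *\<^sub>R w y = 0" for y using z[of y] mollifierD(6)[OF mol, of "x - y"] by (cases "dist x y < \<delta>") (auto simp: dist_norm)
 hence "conv k w x = (LINT y|(lborel :: (real^'n) measure). 0)"
 unfolding conv_def by (intro Bochner_Integration.integral_cong refl)
 thus ?thesis by simp
qed

corollary conv_tendsto_L1:
 fixes w :: "real^'n => real"
 assumes q: "q > 1" and w: "w : Lp q lborel" and z: "!!x. norm x > r ==> w x = 0" and \<eta>: "\<eta> > 0"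
 obtains d where "d > 0" "!!\<delta> k g L. mollifier \<delta> k g L ==> \<delta> < d ==>
  L1 (%x. conv k w x - w x) & (LINT x|lborel. \<bar>conv k w x - w x\<bar>) <= \<eta>"
proof -
 define B where "B = cball (0::real^'n) (r + 1)"
 define V where "V = measure lborel B + 1"
 have V: "V > 0" by (simp add: V_def add_nonneg_pos)
 define \<eta>1 where "\<eta>1 = \<eta> / (2 * V)"
 have \<eta>1: "\<eta>1 > 0" using \<eta> V by (simp add: \<eta>1_def)
 define \<eta>2 where "\<eta>2 = \<eta> / (2 * \<eta>1 powr (1 - q))"
 have \<eta>2: "\<eta>2 > 0" using \<eta> \<eta>1 by (simp add: \<eta>2_def)
 obtain d where d: "d > 0" "!!\<delta> k g L. mollifier \<delta> k g L ==> \<delta> < d ==>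
  (%x. conv k w x - w x) : Lp q lborel & Lpow q lborel (%x. conv k w x - w x) <= \<eta>2"
 using conv_tendsto_Lp[OF q w z \<eta>2] by blast
 show ?thesis
 proof (rule that[of "min d 1"])
 fix \<delta> and k :: "real^'n => real" and g L assume mol: "mollifier \<delta> k g L" and \<delta>: "\<delta> < min d 1"
 have L: "(%x. conv k w x - w x) : Lp q lborel" "Lpow q lborel (%x. conv k w x - w x) <= \<eta>2"
  using d(2)[OF mol] \<delta> by auto
 have z': "conv k w x - w x = 0" if "x ~: B" for x
 proof -
  have x: "norm x > r + 1" using that by (simp add: B_def)
  have "conv k w x = 0"
  proof (rule conv_support[OF mol])
  fix y assume "dist x y < \<delta>"
  hence "norm y > r" using x \<delta> norm_triangle_ineq2[of x y] by (simp add: dist_norm)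
  thus "w y = 0" by (rule z)
  qed
  thus ?thesis using z[of x] x by simp
 qed
 have "(LINT x|lborel. \<bar>conv k w x - w x\<bar>) <= \<eta>1 * measure lborel B + \<eta>1 powr (1 - q) * Lpow q lborel (%x. conv k w x - w x)"
  by (rule integrable_of_Lp_bounded_support(2)[OF q L(1) z' _ _ \<eta>1]) (auto simp: B_def)
 also have "... <= \<eta>1 * V + \<eta>1 powr (1 - q) * \<eta>2"
  using L(2) \<eta>1 by (intro add_mono mult_left_mono) (auto simp: V_def)
 also have "... = \<eta>" using V \<eta>1 by (simp add: \<eta>2_def) (simp add: \<eta>1_def)
 finally show "L1 (%x. conv k w x - w x) & (LINT x|lborel. \<bar>conv k w x - w x\<bar>) <= \<eta>"
  using integrable_of_Lp_bounded_support(1)[OF q L(1), of B] z' by (auto simp: B_def)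
 qed (use d in auto)
qed

section \<open>Closed neighbourhoods, test fields and the total variation\<close>

definition nbhd :: "'a::metric_space set => real => 'a set" where
 "nbhd K r = (\<Union>x\<in>K. cball x r)"

lemma mem_nbhd: "z : nbhd K r \<longleftrightarrow> (\<exists>x\<in>K. dist x z <= r)"
 by (auto simp: nbhd_def)

lemma nbhd_step: "y : nbhd K r ==> dist y z <= s ==> z : nbhd K (r + s)"
 unfolding mem_nbhd by (meson add_mono dist_triangle order_trans)

lemma nbhd_mono: "r <= s ==> nbhd K r <= nbhd K s"
 by (force simp: mem_nbhd)

lemma nbhd_subset: "r >= 0 ==> K <= nbhd K r"
 by (force simp: mem_nbhd)

lemma compact_nbhd:
 fixes K :: "'a::euclidean_space set"
 assumes "compact K" shows "compact (nbhd K r)"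
proof -
 have "nbhd K r = {x + y |x y. x : K & y : cball 0 r}"
 proof (intro set_eqI iffI)
 fix z assume "z : nbhd K r"
 then obtain x where "x : K" "dist x z <= r" by (auto simp: mem_nbhd)
 hence "z = x + (z - x) & x : K & z - x : cball 0 r" by (simp add: dist_norm norm_minus_commute)
 thus "z : {x + y |x y. x : K & y : cball 0 r}" by blast
 next
 fix z assume "z : {x + y |x y. x : K & y : cball 0 r}"
 then obtain x y where xy: "z = x + y" "x : K" "norm y <= r" by auto
 have "dist x z = norm y" by (simp add: xy(1) dist_norm)
 thus "z : nbhd K r" using xy unfolding mem_nbhd by (intro bexI[of _ x]) simp_all
 qed
 thus ?thesis using compact_sums[OF assms compact_cball[of "0::'a" r]] by simp
qed

lemma nbhd_subset_open:
 fixes K :: "'a::euclidean_space set"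
 assumes "compact K" "open S" "K <= S" obtains d where "d > 0" "nbhd K d <= S"
 using compact_subset_open_imp_cball_epsilon_subset[OF assms] unfolding nbhd_def by blast

lemma test_fieldD:
 assumes "\<phi> : test_fields S"
 obtains D K where "has_C1 \<phi> D" "compact K" "K <= S" "!!x. x ~: K ==> \<phi> x = 0" "!!x. norm (\<phi> x) <= 1"
proof -
 have "C1_vector_field \<phi>" using assms by (simp add: test_fields_def)
 then obtain D where D: "has_C1 \<phi> D" using C1_vector_field_iff by blast
 show ?thesis
 proof (rule that[OF D, of "closure {x. \<phi> x ~= 0}"])
 show "\<phi> x = 0" if "x ~: closure {x. \<phi> x ~= 0}" for x using that closure_subset[of "{x. \<phi> x ~= 0}"] by blast
 qed (use assms in \<open>auto simp: test_fields_def\<close>)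
qed

lemma test_fieldI:
 assumes D: "has_C1 \<phi> D" and K: "compact K" "K <= S" and z: "!!x. x ~: K ==> \<phi> x = 0" and n: "!!x. norm (\<phi> x) <= 1"
 shows "\<phi> : test_fields S"
proof -
 have "closure {x. \<phi> x ~= 0} <= K" using z K(1) by (intro closure_minimal compact_imp_closed) auto
 moreover have "compact (closure {x. \<phi> x ~= 0})"
 by (rule compact_Int_closed[OF K(1) closed_closure, of "{x. \<phi> x ~= 0}", THEN back_subst[of compact]])
  (use calculation in auto)
 moreover have "C1_vector_field \<phi>" using D C1_vector_field_iff by blast
 ultimately show ?thesis using K n by (auto simp: test_fields_def)
qed

lemma test_fields_mono: "S <= S' ==> test_fields S <= test_fields S'"
 by (auto simp: test_fields_def)

lemma zero_test_field: "(%x. 0) : test_fields S"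
 by (rule test_fieldI[OF has_C1_const, of "{}"]) auto

lemma divergence_off_support:
 assumes "has_C1 \<phi> D" "compact K" "!!x. x ~: K ==> \<phi> x = 0" "x ~: K"
 shows "divergence \<phi> x = 0"
 by (rule divergence_zero_on_open[OF assms(1), of "- K"]) (use assms compact_imp_closed in auto)

lemma compact_norm_bound:
 fixes K :: "'a::real_normed_vector set"
 assumes "compact K" obtains r where "r > 0" "!!x. norm x > r ==> x ~: K"
proof -
 obtain r where "r > 0" "\<forall>x\<in>K. norm x <= r" using compact_imp_bounded[OF assms] bounded_pos by blast
 thus ?thesis using that[of r] by force
qed

text \<open>Integrates over the whole space: the divergence of a test field vanishes off its
  support, so the set on which the variation is taken does not appear.\<close>

definition pairing :: "(real^'n => real) => (real^'n => real^'n) => real" where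
 "pairing u \<phi> = (LINT x|lborel. u x * divergence \<phi> x)"

lemma total_variation_lborel:
 fixes u :: "real^'n => real"
 assumes S: "open S" and u [measurable]: "u : borel_fun"
 shows "total_variation S u = (SUP \<phi>\<in>test_fields S. ennreal (pairing u \<phi>))"
 unfolding total_variation_def
proof (rule SUP_cong[OF refl])
 fix \<phi> assume "\<phi> : test_fields S"
 then obtain D K where \<phi>: "has_C1 \<phi> D" "compact K" "K <= S" "!!x. x ~: K ==> \<phi> x = 0" by (rule test_fieldD) blast
 have [measurable]: "divergence \<phi> : borel_fun"
 by (rule borel_measurable_continuous_onI[OF divergence_continuous[OF \<phi>(1)]])
 have [measurable]: "S : sets borel" using S by simp
 have "(LINT x|lebesgue_on S. u x * divergence \<phi> x) = (LINT x|lebesgue. indicator S x *\<^sub>R (u x * divergence \<phi> x))"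
 using S by (intro integral_restrict_space) auto
 also have "... = (LINT x|lborel. indicator S x *\<^sub>R (u x * divergence \<phi> x))" by (rule integral_completion) measurable
 also have "... = pairing u \<phi>" unfolding pairing_def
 using divergence_off_support[OF \<phi>(1,2,4)] \<phi>(3) by (intro Bochner_Integration.integral_cong refl) (auto simp: indicator_def)
 finally show "ennreal (LINT x|lebesgue_on S. u x * divergence \<phi> x) = ennreal (pairing u \<phi>)" by simp
qed

lemma Lp_times_continuous:
 fixes u \<psi> :: "real^'n => real"
 assumes q: "q > 1" and u: "u : Lp q lborel" and \<psi>: "continuous_on UNIV \<psi>" "!!x. norm x > r ==> \<psi> x = 0"
 shows "L1 (%x. u x * \<psi> x)"
proof -
 have [measurable]: "u : borel_fun" "\<psi> : borel_fun"
 using u \<psi>(1) by (auto simp: Lp_def intro: borel_measurable_continuous_onI)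
 have i: "L1 \<psi>" by (rule continuous_bounded_support(2)[OF \<psi>])
 obtain C where C: "!!x. \<bar>\<psi> x\<bar> <= C" using continuous_bounded_support(1)[OF \<psi>] by auto
 have "L1 (%x. \<bar>\<psi> x\<bar> + C * \<bar>u x\<bar> powr q)" using i Lp_integrable[OF u] by auto
 thus ?thesis
 proof (rule Bochner_Integration.integrable_bound)
 show "AE x in lborel. norm (u x * \<psi> x) <= norm (\<bar>\<psi> x\<bar> + C * \<bar>u x\<bar> powr q)"
 proof (rule AE_I2)
  fix x
  have "\<bar>u x\<bar> <= 1 + \<bar>u x\<bar> powr q" using abs_le_powr[OF q, of 1 "u x"] by simp
  hence "\<bar>u x\<bar> * \<bar>\<psi> x\<bar> <= (1 + \<bar>u x\<bar> powr q) * \<bar>\<psi> x\<bar>" by (rule mult_right_mono) simp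
  also have "... <= \<bar>\<psi> x\<bar> + C * \<bar>u x\<bar> powr q" using mult_right_mono[OF C[of x], of "\<bar>u x\<bar> powr q"] by (simp add: algebra_simps)
  finally show "norm (u x * \<psi> x) <= norm (\<bar>\<psi> x\<bar> + C * \<bar>u x\<bar> powr q)" by (simp add: abs_mult)
 qed
 qed measurable
qed

lemma Lp_times_divergence:
 assumes q: "q > 1" and u: "u : Lp q lborel" and \<phi>: "has_C1 \<phi> D" "compact K" "!!x. x ~: K ==> \<phi> x = 0"
 shows "L1 (%x. u x * divergence \<phi> x)"
proof -
 obtain r where r: "!!x. norm x > r ==> x ~: K" using compact_norm_bound[OF \<phi>(2)] by blast
 show ?thesis by (rule Lp_times_continuous[OF q u divergence_continuous[OF \<phi>(1)], of r])
  (use divergence_off_support[OF \<phi>] r in auto)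
qed

lemma Lp_indicator:
 fixes u :: "real^'n => real"
 assumes u: "u : Lp q lborel" and B [measurable]: "B : sets borel"
 shows "(%x. indicator B x * u x) : Lp q lborel" "Lpow q lborel (%x. indicator B x * u x) <= Lpow q lborel u"
proof -
 have [measurable]: "u : borel_fun" using u by (simp add: Lp_def)
 have le: "\<bar>indicator B x * u x\<bar> powr q <= \<bar>u x\<bar> powr q" for x by (auto simp: indicator_def)
 have i: "L1 (%x. \<bar>indicator B x * u x\<bar> powr q)"
 by (rule Bochner_Integration.integrable_bound[OF Lp_integrable[OF u]]) (use le in auto)
 show "(%x. indicator B x * u x) : Lp q lborel" using i by (simp add: Lp_def)
 show "Lpow q lborel (%x. indicator B x * u x) <= Lpow q lborel u"
 unfolding Lpow_def by (rule integral_mono[OF i Lp_integrable[OF u] le])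
qed

lemma total_variation_mono:
 assumes "open S" "open S'" "S <= S'" "u : borel_fun"
 shows "total_variation S u <= total_variation S' u"
 unfolding total_variation_lborel[OF assms(1,4)] total_variation_lborel[OF assms(2,4)]
 by (rule SUP_subset_mono[OF test_fields_mono[OF assms(3)]]) simp

lemma pairing_add:
 assumes q: "q > 1" and u: "u : Lp q lborel" and \<phi>: "\<phi> : test_fields A" and \<psi>: "\<psi> : test_fields B"
 shows "pairing u (%x. \<phi> x + \<psi> x) = pairing u \<phi> + pairing u \<psi>"
proof -
 obtain D K where 1: "has_C1 \<phi> D" "compact K" "!!x. x ~: K ==> \<phi> x = 0" using \<phi> by (rule test_fieldD) blast
 obtain E L where 2: "has_C1 \<psi> E" "compact L" "!!x. x ~: L ==> \<psi> x = 0" using \<psi> by (rule test_fieldD) blast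
 show ?thesis unfolding pairing_def divergence_add[OF 1(1) 2(1)] distrib_left
 by (intro Bochner_Integration.integral_add Lp_times_divergence[OF q u 1] Lp_times_divergence[OF q u 2])
qed

lemma test_field_add:
 assumes \<phi>: "\<phi> : test_fields A" and \<psi>: "\<psi> : test_fields B" and d: "A \<inter> B = {}" and AB: "A <= S" "B <= S"
 shows "(%x. \<phi> x + \<psi> x) : test_fields S"
proof -
 obtain D K where 1: "has_C1 \<phi> D" "compact K" "K <= A" "!!x. x ~: K ==> \<phi> x = 0" "!!x. norm (\<phi> x) <= 1" using \<phi> by (rule test_fieldD) blast
 obtain E L where 2: "has_C1 \<psi> E" "compact L" "L <= B" "!!x. x ~: L ==> \<psi> x = 0" "!!x. norm (\<psi> x) <= 1" using \<psi> by (rule test_fieldD) blast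
 show ?thesis
 proof (rule test_fieldI[OF has_C1_add[OF 1(1) 2(1)], of "K \<union> L"])
 show "norm (\<phi> x + \<psi> x) <= 1" for x
 proof -
  have "x : K ==> x ~: L" using 1(3) 2(3) d by blast
  thus ?thesis using 1(4,5)[of x] 2(4,5)[of x] by (cases "x : K") auto
 qed
 qed (use 1 2 AB in auto)
qed

lemma SUP_add_le_ennreal:
 fixes f :: "'i => ennreal"
 assumes "I ~= {}" "!!i. i : I ==> f i + c <= t" shows "(SUP i\<in>I. f i) + c <= t"
proof (cases "c = top")
 case True
 thus ?thesis using assms by auto
next
 case False
 thus ?thesis using assms by (subst ennreal_SUP_add_left[symmetric]) (auto intro: SUP_least)
qed

text \<open>Two admissible fields supported in disjoint sets add up to an admissible field, because
  at each point at most one of them is nonzero. A nonpositive pairing counts as 0, and its field is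
  dropped.\<close>

lemma total_variation_disjoint:
 fixes u :: "real^'n => real"
 assumes q: "q > 1" and u: "u : Lp q lborel" and o: "open A" "open B" "open S" and d: "A \<inter> B = {}" and AB: "A <= S" "B <= S"
 shows "total_variation A u + total_variation B u <= total_variation S u"
proof -
 have um: "u : borel_fun" using u by (simp add: Lp_def)
 have one: "ennreal (pairing u \<phi>) + ennreal (pairing u \<psi>) <= total_variation S u"
 if \<phi>: "\<phi> : test_fields A" and \<psi>: "\<psi> : test_fields B" for \<phi> \<psi>
 proof -
 have up: "ennreal (pairing u \<xi>) <= total_variation S u" if "\<xi> : test_fields S" for \<xi>
  unfolding total_variation_lborel[OF o(3) um] using that by (rule SUP_upper)
 consider "pairing u \<phi> <= 0" | "pairing u \<psi> <= 0" | "pairing u \<phi> >= 0" "pairing u \<psi> >= 0" by linarith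
 thus ?thesis
 proof cases
  case 1 thus ?thesis using up[of \<psi>] \<psi> test_fields_mono[OF AB(2)] by (auto simp: ennreal_neg)
 next
  case 2 thus ?thesis using up[of \<phi>] \<phi> test_fields_mono[OF AB(1)] by (auto simp: ennreal_neg)
 next
  case 3
  thus ?thesis using up[OF test_field_add[OF \<phi> \<psi> d AB]] pairing_add[OF q u \<phi> \<psi>] by simp
 qed
 qed
 have ne: "test_fields C ~= {}" for C :: "(real^'n) set" using zero_test_field by blast
 have "ennreal (pairing u \<phi>) + total_variation B u <= total_variation S u" if "\<phi> : test_fields A" for \<phi>
 unfolding total_variation_lborel[OF o(2) um] using one[OF that]
 by (subst add.commute, intro SUP_add_le_ennreal ne) (simp add: add.commute)
 thus ?thesis unfolding total_variation_lborel[OF o(1) um] by (intro SUP_add_le_ennreal ne)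
qed

lemma total_variation_sum:
 fixes u :: "real^'n => real"
 assumes q: "q > 1" and u: "u : Lp q lborel" and fin: "finite \<G>" and o: "!!Q. Q : \<G> ==> open Q"
 and d: "pairwise disjnt \<G>" and S: "open S" "!!Q. Q : \<G> ==> Q <= S"
 shows "(\<Sum>Q\<in>\<G>. total_variation Q u) <= total_variation S u"
proof -
 have um: "u : borel_fun" using u by (simp add: Lp_def)
 have "(\<Sum>Q\<in>\<G>. total_variation Q u) <= total_variation (\<Union>\<G>) u"
 using fin o d
 proof (induction \<G> rule: finite_induct)
 case empty thus ?case by simp
 next
 case (insert Q \<G>)
 have "(\<Sum>Q\<in>insert Q \<G>. total_variation Q u) <= total_variation Q u + total_variation (\<Union>\<G>) u"
  using insert by (simp add: pairwise_insert add_left_mono)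
 also have "... <= total_variation (\<Union>(insert Q \<G>)) u"
 proof (rule total_variation_disjoint[OF q u])
  show "Q \<inter> \<Union>\<G> = {}" using insert by (auto simp: pairwise_insert disjnt_def)
 qed (use insert in auto)
 finally show ?case .
 qed
 also have "... <= total_variation S u" using o S um by (intro total_variation_mono) auto
 finally show ?thesis .
qed

section \<open>Moving a mollification between function and test field\<close>

lemma integrable_product:
 fixes a b :: "real^'n => real"
 assumes a: "L1 a" and b: "L1 b"
 shows "integrable (lborel \<Otimes>\<^sub>M lborel) (%p. a (fst p) * b (snd p))"
proof (rule lborel_pair.Fubini_integrable)
 have [measurable]: "a : borel_fun" "b : borel_fun" using a b by auto
 show "(%p. a (fst p) * b (snd p)) : borel_measurable (lborel \<Otimes>\<^sub>M lborel)" by measurable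
 show "L1 (%x. LINT y|lborel. norm (a (fst (x, y)) * b (snd (x, y))))"
 using a b by (simp add: abs_mult)
 show "AE x in lborel. L1 (%y. a (fst (x, y)) * b (snd (x, y)))" using b by simp
qed

lemma dominated_fubini:
 fixes f :: "real^'n => real^'n => real"
 assumes f: "(%p. f (fst p) (snd p)) : borel_measurable (lborel \<Otimes>\<^sub>M lborel)"
 and le: "!!x y. \<bar>f x y\<bar> <= a x * b y" and a: "L1 a" and b: "L1 b"
 shows "(LINT x|lborel. LINT y|lborel. f x y) = (LINT y|lborel. LINT x|lborel. f x y)"
proof (rule lborel_pair.Fubini_integral[symmetric])
 show "integrable (lborel \<Otimes>\<^sub>M lborel) (case_prod f)"
 proof (rule Bochner_Integration.integrable_bound[OF integrable_product[OF a b]])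
 show "case_prod f : borel_measurable (lborel \<Otimes>\<^sub>M lborel)" using f by (simp add: case_prod_beta')
 show "AE p in lborel \<Otimes>\<^sub>M lborel. norm (case_prod f p) <= norm (a (fst p) * b (snd p))"
  using le by (auto intro!: AE_I2 order_trans[OF _ abs_ge_self])
 qed
qed

text \<open>For \<open>g\<close> the gradient of a kernel \<open>k\<close>, this is the gradient of
  \<open>conv k w\<close>.\<close>

definition gconv :: "(real^'n => real^'n) => (real^'n => real) => real^'n => real^'n" where
 "gconv g w x = (LINT y|lborel. w y *\<^sub>R g (x - y))"

lemma pairing_cutoff:
 fixes v :: "real^'n => real" and \<phi> :: "real^'n => real^'n"
 assumes v: "has_C1 v (%x h. G x \<bullet> h)" and \<phi>: "has_C1 \<phi> D" "!!x. norm x > r ==> \<phi> x = 0"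
 shows "pairing v \<phi> = - (LINT x|lborel. G x \<bullet> \<phi> x)"
proof -
 have op: "open {x::real^'n. norm x > r}" by (intro open_Collect_less continuous_intros)
 have dz: "divergence \<phi> x = 0" if "norm x > r" for x
 by (rule divergence_zero_on_open[OF \<phi>(1) op]) (use that \<phi>(2) in auto)
 have div: "divergence (%x. v x *\<^sub>R \<phi> x) x = v x * divergence \<phi> x + G x \<bullet> \<phi> x" for x
 unfolding divergence_scaleR[OF v \<phi>(1)] by (simp add: inner_axis) (simp add: inner_vec_def)
 have "continuous_on UNIV (%x. \<chi> i. G x \<bullet> axis i 1)"
 by (intro continuous_on_vec_lambda has_C1D(2)[OF v])
 moreover have "(%x. \<chi> i. G x \<bullet> axis i 1) = G" by (auto simp: inner_axis vec_eq_iff)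
 ultimately have Gc: "continuous_on UNIV G" by (simp only:)
 have i1: "L1 (%x. v x * divergence \<phi> x)"
 by (rule continuous_bounded_support(2)[of _ r]) (auto simp: dz intro!: continuous_intros has_C1_continuous[OF v] divergence_continuous[OF \<phi>(1)])
 have i2: "L1 (%x. G x \<bullet> \<phi> x)"
 by (rule continuous_bounded_support(2)[of _ r]) (auto simp: \<phi>(2) intro!: continuous_intros Gc has_C1_continuous[OF \<phi>(1)])
 have "(LINT x|lborel. divergence (%x. v x *\<^sub>R \<phi> x) x) = 0"
 by (rule integral_divergence_zero[OF has_C1_scaleR[OF v \<phi>(1)], of r]) (simp add: \<phi>(2))
 thus ?thesis unfolding div pairing_def using i1 i2 by simp
qed

context
 fixes \<delta> :: real and k :: "real^'n => real" and g L
 assumes mol: "mollifier \<delta> k g L"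
begin

lemma gconv_integrable:
 assumes w: "L1 w" shows "L1 (%y. w y *\<^sub>R g (x - y))"
proof (rule Bochner_Integration.integrable_bound[OF integrable_mult_right[OF w, of L]])
 note [measurable] = mollifier_meas[OF mol]
 show "(%y. w y *\<^sub>R g (x - y)) : borel_measurable lborel" using w by measurable
 show "AE y in lborel. norm (w y *\<^sub>R g (x - y)) <= norm (L * w y)"
 proof (rule AE_I2)
 fix y show "norm (w y *\<^sub>R g (x - y)) <= norm (L * w y)"
  using mult_left_mono[OF mollifierD(12)[OF mol, of "x - y"], of "\<bar>w y\<bar>"] mollifierD(2)[OF mol]
  by (simp add: abs_mult mult.commute)
 qed
qed

lemma gconv_lipschitz:
 assumes w: "L1 w"
 shows "norm (gconv g w x - gconv g w x') <= L * (LINT y|lborel. \<bar>w y\<bar>) * norm (x - x')"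
proof -
 have "gconv g w x - gconv g w x' = (LINT y|lborel. w y *\<^sub>R g (x - y) - w y *\<^sub>R g (x' - y))"
 unfolding gconv_def using gconv_integrable[OF w] by simp
 also have "norm ... <= (LINT y|lborel. norm (w y *\<^sub>R g (x - y) - w y *\<^sub>R g (x' - y)))" by (rule integral_norm_bound)
 also have "... <= (LINT y|lborel. L * norm (x - x') * \<bar>w y\<bar>)"
 proof (rule integral_mono)
 show "L1 (%y. norm (w y *\<^sub>R g (x - y) - w y *\<^sub>R g (x' - y)))" using gconv_integrable[OF w] by (intro integrable_norm Bochner_Integration.integrable_diff)
 show "norm (w y *\<^sub>R g (x - y) - w y *\<^sub>R g (x' - y)) <= L * norm (x - x') * \<bar>w y\<bar>" for y
 proof -
  have "norm (w y *\<^sub>R g (x - y) - w y *\<^sub>R g (x' - y)) = \<bar>w y\<bar> * norm (g (x - y) - g (x' - y))" by (simp flip: scaleR_diff_right)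
  also have "... <= \<bar>w y\<bar> * (L * norm ((x - y) - (x' - y)))" by (intro mult_left_mono mollifierD(9)[OF mol]) auto
  finally show ?thesis by (simp add: mult.commute)
 qed
 qed (use w in auto)
 finally show ?thesis using w by (simp add: mult.commute mult.left_commute)
qed

lemma gconv_bound:
 assumes w: "L1 w"
 shows "norm (gconv g w x) <= L * (LINT y|lborel. \<bar>w y\<bar>)"
proof -
 have "norm (gconv g w x) <= (LINT y|lborel. norm (w y *\<^sub>R g (x - y)))" unfolding gconv_def by (rule integral_norm_bound)
 also have "... <= (LINT y|lborel. L * \<bar>w y\<bar>)"
 proof (rule integral_mono)
 show "L1 (%y. norm (w y *\<^sub>R g (x - y)))" by (rule integrable_norm[OF gconv_integrable[OF w]])
 fix y show "norm (w y *\<^sub>R g (x - y)) <= L * \<bar>w y\<bar>"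
  using mult_left_mono[OF mollifierD(12)[OF mol, of "x - y"], of "\<bar>w y\<bar>"] by (simp add: mult.commute)
 qed (use w in auto)
 finally show ?thesis using w by simp
qed

lemma gconv_continuous:
 assumes w: "L1 w" shows "continuous_on S (gconv g w)"
proof (rule lipschitz_on_continuous_on)
 show "(L * (LINT y|lborel. \<bar>w y\<bar>))-lipschitz_on S (gconv g w)"
 using gconv_lipschitz[OF w] mollifierD(2)[OF mol] by (intro lipschitz_onI) (auto simp: dist_norm)
qed

lemma conv_gradient:
 assumes w: "L1 w" shows "has_C1 (conv k w) (%x h. gconv g w x \<bullet> h)"
proof -
 have "(%x h. LINT y|lborel. (g (x - y) \<bullet> h) *\<^sub>R w y) = (%x h. gconv g w x \<bullet> h)"
 proof (intro ext)
 fix x h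
 have "(LINT y|lborel. (g (x - y) \<bullet> h) *\<^sub>R w y) = (LINT y|lborel. (w y *\<^sub>R g (x - y)) \<bullet> h)"
  by (intro Bochner_Integration.integral_cong refl) simp
 also have "... = gconv g w x \<bullet> h" unfolding gconv_def by (intro integral_inner_left gconv_integrable[OF w])
 finally show "(LINT y|lborel. (g (x - y) \<bullet> h) *\<^sub>R w y) = gconv g w x \<bullet> h" .
 qed
 thus ?thesis using conv_has_C1[OF mol w] by simp
qed

lemma conv_taylor:
 assumes w: "L1 w"
 shows "\<bar>conv k w y - conv k w x - gconv g w x \<bullet> (y - x)\<bar> <= L * (LINT y|lborel. \<bar>w y\<bar>) * (norm (y - x))\<^sup>2"
proof -
 define W where "W = (LINT y|lborel. \<bar>w y\<bar>)"
 have W: "W >= 0" by (simp add: W_def)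
 define f where "f z = conv k w z - gconv g w x \<bullet> z" for z
 have "norm (f y - f x) <= (L * W * norm (y - x)) * norm (y - x)"
 proof (rule differentiable_bound[of "cball x (norm (y - x))"])
 fix z assume z: "z : cball x (norm (y - x))"
 have "(f has_derivative (%h. gconv g w z \<bullet> h - gconv g w x \<bullet> h)) (at z)"
  unfolding f_def by (intro derivative_intros has_C1D(1)[OF conv_gradient[OF w]])
 thus "(f has_derivative (%h. (gconv g w z - gconv g w x) \<bullet> h)) (at z within cball x (norm (y - x)))"
  by (simp add: inner_diff_left has_derivative_at_withinI)
 have "onorm (%h. (gconv g w z - gconv g w x) \<bullet> h) <= norm (gconv g w z - gconv g w x)"
  by (intro onorm_bound) (auto simp: Cauchy_Schwarz_ineq2)
 also have "... <= L * W * norm (z - x)" unfolding W_def by (rule gconv_lipschitz[OF w])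
 also have "... <= L * W * norm (y - x)" using z mollifierD(2)[OF mol] W by (intro mult_left_mono) (auto simp: dist_norm norm_minus_commute)
 finally show "onorm (%h. (gconv g w z - gconv g w x) \<bullet> h) <= L * W * norm (y - x)" .
 qed (auto simp: dist_norm norm_minus_commute)
 moreover have "f y - f x = conv k w y - conv k w x - gconv g w x \<bullet> (y - x)" by (simp add: f_def inner_diff_right)
 ultimately show ?thesis by (simp add: W_def power2_eq_square mult.assoc)
qed

text \<open>The kernel is even, so convolution with it is self-adjoint; Fubini applies because the
  kernel is bounded.\<close>

lemma conv_swap:
 fixes w v :: "real^'n => real"
 assumes w: "L1 w" and v: "L1 v"
 shows "(LINT x|lborel. w x * conv k v x) = (LINT x|lborel. conv k w x * v x)"
proof -
 note [measurable] = mollifier_meas[OF mol]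
 have [measurable]: "w : borel_fun" "v : borel_fun" using w v by auto
 have "(LINT x|lborel. w x * conv k v x) = (LINT x|lborel. LINT y|lborel. w x * (k (x - y) * v y))"
 by (simp add: conv_def)
 also have "... = (LINT y|lborel. LINT x|lborel. w x * (k (x - y) * v y))"
 proof (rule dominated_fubini[of _ "%x. L * \<bar>w x\<bar>" "%y. \<bar>v y\<bar>"])
 show "\<bar>w x * (k (x - y) * v y)\<bar> <= L * \<bar>w x\<bar> * \<bar>v y\<bar>" for x y
  using mult_right_mono[OF mollifierD(4)[OF mol, of "x - y"], of "\<bar>w x\<bar> * \<bar>v y\<bar>"] mollifierD(3)[OF mol, of "x - y"]
  by (simp add: abs_mult mult.assoc mult.left_commute)
 show "(%p. w (fst p) * (k (fst p - snd p) * v (snd p))) : borel_measurable (lborel \<Otimes>\<^sub>M lborel)" by measurable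
 show "L1 (%x. L * \<bar>w x\<bar>)" "L1 (%y. \<bar>v y\<bar>)" using w v by simp_all
 qed
 also have "... = (LINT y|lborel. conv k w y * v y)"
 proof (intro Bochner_Integration.integral_cong refl)
 fix y
 have eq: "k (x - y) = k (y - x)" for x using mollifierD(5)[OF mol, of "x - y"] by simp
 have "(LINT x|lborel. w x * (k (x - y) * v y)) = (LINT x|lborel. (k (y - x) * w x) * v y)"
  by (intro Bochner_Integration.integral_cong refl) (simp add: eq)
 also have "... = conv k w y * v y" by (simp add: conv_def)
 finally show "(LINT x|lborel. w x * (k (x - y) * v y)) = conv k w y * v y" .
 qed
 finally show ?thesis .
qed

lemma divergence_conv:
 fixes p :: "real^'n => real^'n"
 assumes p: "L1 p"
 shows "divergence (conv k p) x = (LINT y|lborel. g (x - y) \<bullet> p y)"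
proof -
 have "divergence (conv k p) x = (\<Sum>i\<in>UNIV. (LINT y|lborel. (g (x - y) \<bullet> axis i 1) *\<^sub>R p y) $ i)"
 by (rule divergence_eq[OF conv_has_C1[OF mol p]])
 also have "... = (\<Sum>i\<in>UNIV. LINT y|lborel. g (x - y) $ i * p y $ i)"
 proof (rule sum.cong[OF refl])
 fix i
 have "(LINT y|lborel. (g (x - y) \<bullet> axis i 1) *\<^sub>R p y) $ i = (LINT y|lborel. ((g (x - y) \<bullet> axis i 1) *\<^sub>R p y) $ i)"
  by (rule integral_bounded_linear[OF bounded_linear_vec_nth conv_integrable(2)[OF mol p], symmetric])
 thus "(LINT y|lborel. (g (x - y) \<bullet> axis i 1) *\<^sub>R p y) $ i = (LINT y|lborel. g (x - y) $ i * p y $ i)"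
  by (simp add: inner_axis)
 qed
 also have "... = (LINT y|lborel. (\<Sum>i\<in>UNIV. g (x - y) $ i * p y $ i))"
 proof (rule Bochner_Integration.integral_sum[symmetric])
 fix i
 have "L1 (%y. ((g (x - y) \<bullet> axis i 1) *\<^sub>R p y) $ i)"
  by (rule integrable_bounded_linear[OF bounded_linear_vec_nth conv_integrable(2)[OF mol p]])
 thus "L1 (%y. g (x - y) $ i * p y $ i)" by (simp add: inner_axis)
 qed
 finally show ?thesis by (simp add: inner_vec_def)
qed

text \<open>Integrability of \<open>p\<close> suffices, so discontinuous direction fields are
  covered. The minus sign comes from \<open>g\<close> being odd.\<close>

lemma pairing_conv:
 fixes p :: "real^'n => real^'n"
 assumes w: "L1 w" and p: "L1 p"
 shows "pairing w (conv k p) = - (LINT y|lborel. gconv g w y \<bullet> p y)"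
proof -
 note [measurable] = mollifier_meas[OF mol]
 have [measurable]: "w : borel_fun" "p : borel_fun" using w p by auto
 have "pairing w (conv k p) = (LINT x|lborel. LINT y|lborel. w x * (g (x - y) \<bullet> p y))"
 unfolding pairing_def divergence_conv[OF p] by simp
 also have "... = (LINT y|lborel. LINT x|lborel. w x * (g (x - y) \<bullet> p y))"
 proof (rule dominated_fubini[of _ "%x. \<bar>w x\<bar>" "%y. L * norm (p y)"])
 show "\<bar>w x * (g (x - y) \<bullet> p y)\<bar> <= \<bar>w x\<bar> * (L * norm (p y))" for x y
 proof -
  have "\<bar>g (x - y) \<bullet> p y\<bar> <= norm (g (x - y)) * norm (p y)" by (rule Cauchy_Schwarz_ineq2)
  also have "... <= L * norm (p y)" by (intro mult_right_mono mollifierD(12)[OF mol]) auto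
  finally show ?thesis by (simp add: abs_mult mult_left_mono)
 qed
 show "(%z. w (fst z) * (g (fst z - snd z) \<bullet> p (snd z))) : borel_measurable (lborel \<Otimes>\<^sub>M lborel)" by measurable
 show "L1 (%x. \<bar>w x\<bar>)" "L1 (%y. L * norm (p y))" using w p by simp_all
 qed
 also have "... = (LINT y|lborel. - (gconv g w y \<bullet> p y))"
 proof (intro Bochner_Integration.integral_cong refl)
 fix y
 have eq: "g (x - y) = - g (y - x)" for x using mollifierD(10)[OF mol, of "y - x"] by simp
 have "(LINT x|lborel. w x * (g (x - y) \<bullet> p y)) = (LINT x|lborel. - ((w x *\<^sub>R g (y - x)) \<bullet> p y))"
  by (intro Bochner_Integration.integral_cong refl) (simp add: eq)
 also have "... = - (LINT x|lborel. (w x *\<^sub>R g (y - x)) \<bullet> p y)" by (rule Bochner_Integration.integral_minus)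
 also have "(LINT x|lborel. (w x *\<^sub>R g (y - x)) \<bullet> p y) = gconv g w y \<bullet> p y"
  unfolding gconv_def by (intro integral_inner_left gconv_integrable[OF w])
 finally show "(LINT x|lborel. w x * (g (x - y) \<bullet> p y)) = - (gconv g w y \<bullet> p y)" .
 qed
 finally show ?thesis by simp
qed

text \<open>
 The total variation controls the gradient of a mollification: the sign of that gradient,
 mollified once more, is an admissible test field.
\<close>

lemma gradient_le_total_variation:
 fixes u w :: "real^'n => real"
 assumes A: "compact A" and S: "open S" "nbhd A \<delta> <= S" and u: "u : borel_fun"
 and w: "L1 w" "!!x. x : nbhd A \<delta> ==> w x = u x"
 shows "ennreal (LINT x|lborel. indicator A x * norm (gconv g w x)) <= total_variation S u"
proof -
 note [measurable] = mollifier_meas[OF mol]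
 have Am [measurable]: "A : sets borel" by (intro borel_closed compact_imp_closed A)
 have Gm [measurable]: "gconv g w : borel_fun" by (rule borel_measurable_continuous_onI[OF gconv_continuous[OF w(1)]])
 define p where "p y = (- (indicator A y / norm (gconv g w y))) *\<^sub>R gconv g w y" for y
 have pm [measurable]: "p : borel_fun" unfolding p_def by measurable
 have pn: "norm (p y) <= indicator A y" for y
 by (cases "gconv g w y = 0") (simp_all add: p_def indicator_def)
 have Ai: "L1 (indicator A :: real^'n => real)"
 using emeasure_bounded_finite[OF compact_imp_bounded[OF A]] by (intro integrable_real_indicator) auto
 have p: "L1 p"
 proof (rule Bochner_Integration.integrable_bound[OF Ai])
 show "AE y in lborel. norm (p y) <= norm (indicator A y :: real)" by (rule AE_I2) (simp add: pn)
 qed simp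
 define \<phi> where "\<phi> = conv k p"
 have C1: "has_C1 \<phi> (%x h. LINT y|lborel. (g (x - y) \<bullet> h) *\<^sub>R p y)" unfolding \<phi>_def by (rule conv_has_C1[OF mol p])
 have cN: "compact (nbhd A \<delta>)" by (rule compact_nbhd[OF A])
 have z: "\<phi> x = 0" if "x ~: nbhd A \<delta>" for x
 unfolding \<phi>_def
 proof (rule conv_support[OF mol])
 fix y assume "dist x y < \<delta>"
 hence "y ~: A" using that by (auto simp: mem_nbhd dist_commute less_imp_le)
 thus "p y = 0" by (simp add: p_def)
 qed
 have n: "norm (\<phi> x) <= 1" for x
 proof -
 have "norm (\<phi> x) <= (LINT y|lborel. norm (k (x - y) *\<^sub>R p y))" unfolding \<phi>_def conv_def by (rule integral_norm_bound)
 also have "... <= (LINT y|lborel. k (x - y))"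
 proof (rule integral_mono)
  show "L1 (%y. norm (k (x - y) *\<^sub>R p y))" using conv_integrable(1)[OF mol p] by (rule integrable_norm)
  show "L1 (%y. k (x - y))" using integrable_reflect_shift[of k x] mollifier_integrable[OF mol] by simp
  fix y
  have "norm (p y) <= 1" using pn[of y] by (rule order_trans) (simp add: indicator_def)
  thus "norm (k (x - y) *\<^sub>R p y) <= k (x - y)" using mollifierD(3)[OF mol, of "x - y"] by (simp add: mult_left_le)
 qed
 also have "... = 1" using integral_reflect_shift[of k x] mollifierD(7)[OF mol] by simp
 finally show ?thesis .
 qed
 have t: "\<phi> : test_fields S" by (rule test_fieldI[OF C1 cN S(2) z n])
 have "pairing u \<phi> = pairing w \<phi>" unfolding pairing_def
 proof (intro Bochner_Integration.integral_cong refl)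
 fix x show "u x * divergence \<phi> x = w x * divergence \<phi> x"
  using w(2)[of x] divergence_off_support[OF C1 cN z, of x] by (cases "x : nbhd A \<delta>") auto
 qed
 also have "... = - (LINT y|lborel. gconv g w y \<bullet> p y)" unfolding \<phi>_def by (rule pairing_conv[OF w(1) p])
 also have "... = (LINT y|lborel. - (gconv g w y \<bullet> p y))" by simp
 also have "... = (LINT y|lborel. indicator A y * norm (gconv g w y))"
 proof (intro Bochner_Integration.integral_cong refl)
 fix y
 show "- (gconv g w y \<bullet> p y) = indicator A y * norm (gconv g w y)"
 proof -
  have "gconv g w y \<bullet> gconv g w y = norm (gconv g w y) * norm (gconv g w y)"
  by (simp only: dot_square_norm power2_eq_square)
  hence "gconv g w y \<bullet> p y = - (indicator A y / norm (gconv g w y)) * (norm (gconv g w y) * norm (gconv g w y))"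
  by (simp only: p_def inner_scaleR_right)
  thus ?thesis by (cases "norm (gconv g w y) = 0") auto
 qed
 qed
 finally have "ennreal (LINT x|lborel. indicator A x * norm (gconv g w x)) = ennreal (pairing u \<phi>)" by simp
 also have "... <= total_variation S u" unfolding total_variation_lborel[OF S(1) u] using t by (rule SUP_upper)
 finally show ?thesis .
qed

end

section \<open>A Poincare inequality on cubes\<close>

lemma segment_gradient_bound:
 fixes v :: "real^'n => real"
 assumes v: "has_C1 v (%x h. G x \<bullet> h)" and Gc: "continuous_on UNIV G" and z: "norm z <= d"
 shows "ennreal \<bar>v x - v (z + x)\<bar> <= (\<integral>\<^sup>+t. indicator {0..1} t * ennreal (norm (G (t *\<^sub>R z + x)) * d) \<partial>lborel)"
proof -
 have cont: "continuous_on {0..1} (%t::real. G (t *\<^sub>R z + x))"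
 by (intro continuous_on_compose2[OF Gc] continuous_intros) auto
 have "(LINT t|lborel. indicator {0..1} t *\<^sub>R (G (t *\<^sub>R z + x) \<bullet> z)) = v (1 *\<^sub>R z + x) - v (0 *\<^sub>R z + x)"
 proof (rule integral_FTC_atLeastAtMost)
 fix t :: real
 have "((%t. t *\<^sub>R z + x) has_derivative (%s. s *\<^sub>R z)) (at t within {0..1})" by (auto intro!: derivative_eq_intros)
 from has_derivative_compose[OF this has_C1D(1)[OF v]]
 show "((%t. v (t *\<^sub>R z + x)) has_vector_derivative G (t *\<^sub>R z + x) \<bullet> z) (at t within {0..1})"
  by (simp add: has_vector_derivative_def)
 next
 show "continuous_on {0..1} (%t::real. G (t *\<^sub>R z + x) \<bullet> z)" by (intro continuous_intros cont)
 qed simp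
 hence "\<bar>v x - v (z + x)\<bar> = norm (LINT t|lborel. indicator {0..1} t *\<^sub>R (G (t *\<^sub>R z + x) \<bullet> z))" by simp
 also have "... <= (LINT t|lborel. norm (indicator {0..1} t *\<^sub>R (G (t *\<^sub>R z + x) \<bullet> z)))" by (rule integral_norm_bound)
 also have "... <= (LINT t|lborel. indicator {0..1} t *\<^sub>R (norm (G (t *\<^sub>R z + x)) * d))"
 proof (rule integral_mono)
 show "L1 (%t. norm (indicator {0..1} t *\<^sub>R (G (t *\<^sub>R z + x) \<bullet> z)))"
  by (intro integrable_norm borel_integrable_compact continuous_intros cont) auto
 show i: "L1 (%t. indicator {0..1} t *\<^sub>R (norm (G (t *\<^sub>R z + x)) * d))"
  by (intro borel_integrable_compact continuous_intros cont) auto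
 fix t :: real
 have "\<bar>G (t *\<^sub>R z + x) \<bullet> z\<bar> <= norm (G (t *\<^sub>R z + x)) * norm z" by (rule Cauchy_Schwarz_ineq2)
 also have "... <= norm (G (t *\<^sub>R z + x)) * d" using z by (intro mult_left_mono) auto
 finally show "norm (indicator {0..1} t *\<^sub>R (G (t *\<^sub>R z + x) \<bullet> z)) <= indicator {0..1} t *\<^sub>R (norm (G (t *\<^sub>R z + x)) * d)"
  by (simp add: indicator_def)
 qed
 finally have "ennreal \<bar>v x - v (z + x)\<bar> <= ennreal (LINT t|lborel. indicator {0..1} t *\<^sub>R (norm (G (t *\<^sub>R z + x)) * d))" by (rule ennreal_leI)
 also have "... = (\<integral>\<^sup>+t. ennreal (indicator {0..1} t *\<^sub>R (norm (G (t *\<^sub>R z + x)) * d)) \<partial>lborel)"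
 proof (rule nn_integral_eq_integral[symmetric])
 show "L1 (%t. indicator {0..1} t *\<^sub>R (norm (G (t *\<^sub>R z + x)) * d))"
  by (intro borel_integrable_compact continuous_intros cont) auto
 have "d >= 0" using z norm_ge_zero order_trans by blast
 thus "AE t in lborel. 0 <= indicator {0..1} t *\<^sub>R (norm (G (t *\<^sub>R z + x)) * d)" by (intro AE_I2) simp
 qed
 also have "... = (\<integral>\<^sup>+t. indicator {0..1} t * ennreal (norm (G (t *\<^sub>R z + x)) * d) \<partial>lborel)"
 by (intro nn_integral_cong) (simp add: indicator_def)
 finally show ?thesis .
qed

text \<open>With y = x + z, each shift z costs at most \<open>d\<close> times the integral of the
  gradient over \<open>A\<close>: integrate along the segment, which stays in the convex set,
  exchange the integrals and translate back. Only shifts in the ball of radius \<open>d\<close>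
  occur, whence its volume.\<close>

lemma poincare_smooth:
 fixes v :: "real^'n => real"
 assumes v: "has_C1 v (%x h. G x \<bullet> h)" and Gc: "continuous_on UNIV G" and A: "compact A" "convex A"
 and d: "d >= 0" "!!x y. x : A ==> y : A ==> norm (x - y) <= d"
 shows "(\<integral>\<^sup>+x. \<integral>\<^sup>+y. indicator A x * indicator A y * ennreal \<bar>v x - v y\<bar> \<partial>lborel \<partial>lborel)
  <= emeasure lborel (cball (0::real^'n) d) * (ennreal d * (\<integral>\<^sup>+x. indicator A x * ennreal (norm (G x)) \<partial>lborel))"
proof -
 have [measurable]: "A : sets borel" by (intro borel_closed compact_imp_closed A)
 have [measurable]: "v : borel_fun" by (rule borel_measurable_continuous_onI[OF has_C1_continuous[OF v]])
 have [measurable]: "G : borel_fun" by (rule borel_measurable_continuous_onI[OF Gc])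
 define I where "I = (\<integral>\<^sup>+x. indicator A x * ennreal (norm (G x)) \<partial>lborel)"
 have "(\<integral>\<^sup>+x. \<integral>\<^sup>+y. indicator A x * indicator A y * ennreal \<bar>v x - v y\<bar> \<partial>lborel \<partial>lborel)
  = (\<integral>\<^sup>+x. \<integral>\<^sup>+z. indicator A x * indicator A (x + z) * ennreal \<bar>v x - v (x + z)\<bar> \<partial>lborel \<partial>lborel)"
 proof (rule nn_integral_cong)
 fix x
 show "(\<integral>\<^sup>+y. indicator A x * indicator A y * ennreal \<bar>v x - v y\<bar> \<partial>lborel) =
  (\<integral>\<^sup>+z. indicator A x * indicator A (x + z) * ennreal \<bar>v x - v (x + z)\<bar> \<partial>lborel)"
  by (rule nn_integral_lborel_shift[symmetric]) measurable
 qed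
 also have "... = (\<integral>\<^sup>+z. \<integral>\<^sup>+x. indicator A x * indicator A (x + z) * ennreal \<bar>v x - v (x + z)\<bar> \<partial>lborel \<partial>lborel)"
 by (rule lborel_pair.Fubini') measurable
 also have "... <= (\<integral>\<^sup>+z. indicator (cball (0::real^'n) d) z * (ennreal d * I) \<partial>lborel)"
 proof (rule nn_integral_mono)
 fix z :: "real^'n"
 show "(\<integral>\<^sup>+x. indicator A x * indicator A (x + z) * ennreal \<bar>v x - v (x + z)\<bar> \<partial>lborel) <= indicator (cball 0 d) z * (ennreal d * I)"
 proof (cases "norm z <= d")
  case False
  have "indicator A x * indicator A (x + z) * ennreal \<bar>v x - v (x + z)\<bar> = 0" for x
  proof -
  have "\<not> (x : A & x + z : A)" using d(2)[of "x + z" x] False by auto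
  thus ?thesis by (auto simp: indicator_def)
  qed
  hence "(\<integral>\<^sup>+x. indicator A x * indicator A (x + z) * ennreal \<bar>v x - v (x + z)\<bar> \<partial>lborel) = (\<integral>\<^sup>+x. 0 \<partial>(lborel :: (real^'n) measure))"
  by (intro nn_integral_cong)
  thus ?thesis by simp
 next
  case True
  have "(\<integral>\<^sup>+x. indicator A x * indicator A (x + z) * ennreal \<bar>v x - v (x + z)\<bar> \<partial>lborel)
   <= (\<integral>\<^sup>+x. \<integral>\<^sup>+t. indicator {0..1} t * (indicator A (t *\<^sub>R z + x) * ennreal (norm (G (t *\<^sub>R z + x))) * ennreal d) \<partial>lborel \<partial>lborel)"
  proof (rule nn_integral_mono)
  fix x
  show "indicator A x * indicator A (x + z) * ennreal \<bar>v x - v (x + z)\<bar> \<le>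
   (\<integral>\<^sup>+t. indicator {0..1} t * (indicator A (t *\<^sub>R z + x) * ennreal (norm (G (t *\<^sub>R z + x))) * ennreal d) \<partial>lborel)"
  proof (cases "x : A & x + z : A")
   case True
   have "indicator A x * indicator A (x + z) * ennreal \<bar>v x - v (x + z)\<bar> \<le>
    (\<integral>\<^sup>+t. indicator {0..1} t * ennreal (norm (G (t *\<^sub>R z + x)) * d) \<partial>lborel)"
   using segment_gradient_bound[OF v Gc \<open>norm z <= d\<close>, of x] True by (simp add: add.commute)
   also have "... <= (\<integral>\<^sup>+t. indicator {0..1} t * (indicator A (t *\<^sub>R z + x) * ennreal (norm (G (t *\<^sub>R z + x))) * ennreal d) \<partial>lborel)"
   proof (rule nn_integral_mono)
   fix t :: real
   have "t *\<^sub>R z + x : A" if "t : {0..1}"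
   proof -
    have "t *\<^sub>R z + x = (1 - t) *\<^sub>R x + t *\<^sub>R (x + z)" by (simp add: algebra_simps)
    thus ?thesis using convexD[OF A(2), of x "x + z" "1 - t" t] True that by simp
   qed
   thus "indicator {0..1} t * ennreal (norm (G (t *\<^sub>R z + x)) * d) \<le>
    indicator {0..1} t * (indicator A (t *\<^sub>R z + x) * ennreal (norm (G (t *\<^sub>R z + x))) * ennreal d)"
    using d(1) by (cases "t : {0..1}") (simp_all add: ennreal_mult)
   qed
   finally show ?thesis .
  next
   case False
   thus ?thesis by (auto simp: indicator_def)
  qed
  qed
  also have "... = (\<integral>\<^sup>+t. \<integral>\<^sup>+x. indicator {0..1} t * (indicator A (t *\<^sub>R z + x) * ennreal (norm (G (t *\<^sub>R z + x))) * ennreal d) \<partial>lborel \<partial>lborel)"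
  by (rule lborel_pair.Fubini'[symmetric]) measurable
  also have "... = (\<integral>\<^sup>+t. indicator {0..1::real} t * (I * ennreal d) \<partial>lborel)"
  proof (rule nn_integral_cong)
  fix t :: real
  have "(\<integral>\<^sup>+x. indicator {0..1} t * (indicator A (t *\<^sub>R z + x) * ennreal (norm (G (t *\<^sub>R z + x))) * ennreal d) \<partial>lborel)
   = (\<integral>\<^sup>+x. indicator {0..1} t * (indicator A x * ennreal (norm (G x)) * ennreal d) \<partial>lborel)"
   by (rule nn_integral_lborel_shift[of "%x. indicator {0..1} t * (indicator A x * ennreal (norm (G x)) * ennreal d)"]) measurable
  also have "... = indicator {0..1} t * (I * ennreal d)"
   unfolding I_def by (subst nn_integral_cmult, measurable) (subst nn_integral_multc, measurable)
  finally show "(\<integral>\<^sup>+x. indicator {0..1} t * (indicator A (t *\<^sub>R z + x) * ennreal (norm (G (t *\<^sub>R z + x))) * ennreal d) \<partial>lborel)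
   = indicator {0..1} t * (I * ennreal d)" .
  qed
  also have "... = I * ennreal d" by (simp add: nn_integral_multc)
  finally show ?thesis using True by (simp add: mult.commute)
 qed
 qed
 also have "... = emeasure lborel (cball (0::real^'n) d) * (ennreal d * I)"
 proof -
 have [measurable]: "cball (0::real^'n) d : sets borel" by (intro borel_closed closed_cball)
 show ?thesis by (subst nn_integral_multc, measurable)
 qed
 finally show ?thesis unfolding I_def .
qed

text \<open>\<open>u\<close> is mollified near \<open>A\<close>, where the gradient is controlled by
  the variation on the open set \<open>S\<close>. The smooth inequality then holds up to an L1 error
  that can be made arbitrarily small.\<close>

lemma poincare_compact:
 fixes u :: "real^'n => real"
 assumes q: "q > 1" and u: "u : Lp q lborel" and S: "open S" and A: "compact A" "convex A" "A <= S"
 and d: "d >= 0" "!!x y. x : A ==> y : A ==> norm (x - y) <= d"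
 shows "(\<integral>\<^sup>+x. \<integral>\<^sup>+y. indicator A x * indicator A y * ennreal \<bar>u x - u y\<bar> \<partial>lborel \<partial>lborel)
  <= emeasure lborel (cball (0::real^'n) d) * (ennreal d * total_variation S u)"
proof (rule ennreal_le_all_inverse)
 fix e :: real assume e: "e > 0"
 have Am [measurable]: "A : sets borel" by (intro borel_closed compact_imp_closed A)
 have um [measurable]: "u : borel_fun" using u by (simp add: Lp_def)
 have Af: "emeasure lborel A < \<infinity>" by (intro emeasure_bounded_finite compact_imp_bounded A)
 define V where "V = measure lborel A"
 have V: "emeasure lborel A = ennreal V" "V >= 0" using Af by (auto simp: V_def emeasure_eq_ennreal_measure less_top)
 \<comment> \<open>The mollification error occurs once for each of the two variables, each time
   multiplied by the volume \<open>V\<close> of \<open>A\<close>; the summand 1 avoids division by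
   zero.\<close>
 define \<eta> where "\<eta> = e / (2 * V + 1)"
 have \<eta>: "\<eta> > 0" using e V by (simp add: \<eta>_def add_nonneg_pos)
 obtain d0 where d0: "d0 > 0" "nbhd A d0 <= S" using nbhd_subset_open[OF A(1) S A(3)] by blast
 define B where "B = nbhd A d0"
 have Bc: "compact B" unfolding B_def by (rule compact_nbhd[OF A(1)])
 have Bm: "B : sets borel" by (intro borel_closed compact_imp_closed Bc)
 define w where "w x = indicator B x * u x" for x
 have w: "w : Lp q lborel" unfolding w_def by (rule Lp_indicator(1)[OF u Bm])
 obtain r where r: "!!x. norm x > r ==> x ~: B" using compact_norm_bound[OF Bc] by blast
 have wz: "w x = 0" if "norm x > r" for x using r[OF that] by (simp add: w_def)
 have wi: "L1 w"
 by (rule integrable_of_Lp_bounded_support(1)[OF q w _ Bm compact_imp_bounded[OF Bc]]) (simp add: w_def)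
 have wu: "w x = u x" if "x : B" for x using that by (simp add: w_def)
 obtain d1 where d1: "d1 > 0" "!!\<delta> k g L. mollifier \<delta> k g L ==> \<delta> < d1 ==>
  L1 (%x. conv k w x - w x) & (LINT x|lborel. \<bar>conv k w x - w x\<bar>) <= \<eta>"
 using conv_tendsto_L1[OF q w wz \<eta>] by blast
 define \<delta> where "\<delta> = min d0 d1 / 2"
 have \<delta>: "\<delta> > 0" "\<delta> < d0" "\<delta> < d1" using d0 d1 by (auto simp: \<delta>_def min_def)
 obtain k :: "real^'n => real" and g L where mol: "mollifier \<delta> k g L" using mollifier_exists[OF \<delta>(1)] by blast
 define v where "v = conv k w"
 have vC: "has_C1 v (%x h. gconv g w x \<bullet> h)" unfolding v_def by (rule conv_gradient[OF mol wi])
 have vm [measurable]: "v : borel_fun" by (rule borel_measurable_continuous_onI[OF has_C1_continuous[OF vC]])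
 have wm [measurable]: "w : borel_fun" using w by (simp add: Lp_def)
 have Gc: "continuous_on UNIV (gconv g w)" by (rule gconv_continuous[OF mol wi])
 have AB: "A <= B" unfolding B_def using d0 by (intro nbhd_subset) simp
 have err: "(\<integral>\<^sup>+x. ennreal \<bar>v x - w x\<bar> \<partial>lborel) <= ennreal \<eta>"
 proof -
 have "(\<integral>\<^sup>+x. ennreal \<bar>v x - w x\<bar> \<partial>lborel) = ennreal (LINT x|lborel. \<bar>v x - w x\<bar>)"
  unfolding v_def using d1(2)[OF mol \<delta>(3)] by (intro nn_integral_eq_integral integrable_abs) auto
 thus ?thesis unfolding v_def using d1(2)[OF mol \<delta>(3)] by (simp add: ennreal_leI)
 qed
 have G: "(\<integral>\<^sup>+x. indicator A x * ennreal (norm (gconv g w x)) \<partial>lborel) <= total_variation S u"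
 proof -
 have "L1 (%x. indicator A x *\<^sub>R norm (gconv g w x))"
  by (intro borel_integrable_compact A(1) continuous_intros continuous_on_subset[OF Gc]) auto
 hence i: "L1 (%x. indicator A x * norm (gconv g w x))" by simp
 have "(\<integral>\<^sup>+x. indicator A x * ennreal (norm (gconv g w x)) \<partial>lborel) = (\<integral>\<^sup>+x. ennreal (indicator A x * norm (gconv g w x)) \<partial>lborel)"
  by (intro nn_integral_cong) (simp add: indicator_def)
 also have "... = ennreal (LINT x|lborel. indicator A x * norm (gconv g w x))"
  using i by (intro nn_integral_eq_integral AE_I2) simp_all
 also have "... <= total_variation S u"
 proof (rule gradient_le_total_variation[OF mol A(1) S _ um wi])
  have "nbhd A \<delta> <= B" unfolding B_def using \<delta> by (intro nbhd_mono) simp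
  thus "nbhd A \<delta> <= S" "!!x. x : nbhd A \<delta> ==> w x = u x" using d0(2) wu by (auto simp: B_def)
 qed
 finally show ?thesis .
 qed
 have "(\<integral>\<^sup>+x. \<integral>\<^sup>+y. indicator A x * indicator A y * ennreal \<bar>u x - u y\<bar> \<partial>lborel \<partial>lborel)
 <= (\<integral>\<^sup>+x. \<integral>\<^sup>+y. indicator A x * indicator A y * ennreal \<bar>v x - v y\<bar> + (indicator A y * ennreal \<bar>v x - w x\<bar> + indicator A x * ennreal \<bar>v y - w y\<bar>) \<partial>lborel \<partial>lborel)"
 proof (intro nn_integral_mono)
 fix x y
 show "indicator A x * indicator A y * ennreal \<bar>u x - u y\<bar> \<le>
  indicator A x * indicator A y * ennreal \<bar>v x - v y\<bar> + (indicator A y * ennreal \<bar>v x - w x\<bar> + indicator A x * ennreal \<bar>v y - w y\<bar>)"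
 proof (cases "x : A & y : A")
  case True
  hence "u x = w x" "u y = w y" using wu AB by auto
  hence "\<bar>u x - u y\<bar> <= \<bar>v x - v y\<bar> + (\<bar>v x - w x\<bar> + \<bar>v y - w y\<bar>)" by linarith
  hence "ennreal \<bar>u x - u y\<bar> <= ennreal (\<bar>v x - v y\<bar> + (\<bar>v x - w x\<bar> + \<bar>v y - w y\<bar>))" by (rule ennreal_leI)
  thus ?thesis using True by simp
 next
  case False thus ?thesis by (auto simp: indicator_def)
 qed
 qed
 also have "... = (\<integral>\<^sup>+x. (\<integral>\<^sup>+y. indicator A x * indicator A y * ennreal \<bar>v x - v y\<bar> \<partial>lborel) +
  ((\<integral>\<^sup>+y. indicator A y * ennreal \<bar>v x - w x\<bar> \<partial>lborel) + (\<integral>\<^sup>+y. indicator A x * ennreal \<bar>v y - w y\<bar> \<partial>lborel)) \<partial>lborel)"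
 by (intro nn_integral_cong, subst nn_integral_add, measurable, subst nn_integral_add, measurable)
 also have "... = (\<integral>\<^sup>+x. \<integral>\<^sup>+y. indicator A x * indicator A y * ennreal \<bar>v x - v y\<bar> \<partial>lborel \<partial>lborel) +
  ((\<integral>\<^sup>+x. \<integral>\<^sup>+y. indicator A y * ennreal \<bar>v x - w x\<bar> \<partial>lborel \<partial>lborel) + (\<integral>\<^sup>+x. \<integral>\<^sup>+y. indicator A x * ennreal \<bar>v y - w y\<bar> \<partial>lborel \<partial>lborel))"
 by (subst nn_integral_add, measurable, subst nn_integral_add, measurable)
 also have "(\<integral>\<^sup>+x. \<integral>\<^sup>+y. indicator A y * ennreal \<bar>v x - w x\<bar> \<partial>lborel \<partial>lborel) = ennreal V * (\<integral>\<^sup>+x. ennreal \<bar>v x - w x\<bar> \<partial>lborel)"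
 by (simp add: nn_integral_multc nn_integral_cmult V)
 also have "(\<integral>\<^sup>+x. \<integral>\<^sup>+y. indicator A x * ennreal \<bar>v y - w y\<bar> \<partial>lborel \<partial>lborel) = ennreal V * (\<integral>\<^sup>+x. ennreal \<bar>v x - w x\<bar> \<partial>lborel)"
 by (simp add: nn_integral_multc nn_integral_cmult V)
 also have "(\<integral>\<^sup>+x. \<integral>\<^sup>+y. indicator A x * indicator A y * ennreal \<bar>v x - v y\<bar> \<partial>lborel \<partial>lborel) +
  (ennreal V * (\<integral>\<^sup>+x. ennreal \<bar>v x - w x\<bar> \<partial>lborel) + ennreal V * (\<integral>\<^sup>+x. ennreal \<bar>v x - w x\<bar> \<partial>lborel))
 <= emeasure lborel (cball (0::real^'n) d) * (ennreal d * total_variation S u) + (ennreal V * ennreal \<eta> + ennreal V * ennreal \<eta>)"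
 by (intro add_mono mult_left_mono err order_trans[OF poincare_smooth[OF vC Gc A(1,2) d]] G) auto
 also have "ennreal V * ennreal \<eta> + ennreal V * ennreal \<eta> <= ennreal e"
 proof -
 have "ennreal V * ennreal \<eta> + ennreal V * ennreal \<eta> = ennreal (2 * V * \<eta>)"
 proof -
  have "ennreal V * ennreal \<eta> = ennreal (V * \<eta>)" using V \<eta> by (intro ennreal_mult[symmetric]) auto
  moreover have "ennreal (V * \<eta>) + ennreal (V * \<eta>) = ennreal (V * \<eta> + V * \<eta>)" using V \<eta> by (intro ennreal_plus[symmetric]) auto
  ultimately show ?thesis by (simp only: mult_2 distrib_right)
 qed
 also have "... <= ennreal e"
 proof (rule ennreal_leI)
  have "2 * V * \<eta> <= (2 * V + 1) * \<eta>" using \<eta> by simp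
  also have "... = e" using V by (simp add: \<eta>_def)
  finally show "2 * V * \<eta> <= e" .
 qed
 finally show ?thesis .
 qed
 finally show "(\<integral>\<^sup>+x. \<integral>\<^sup>+y. indicator A x * indicator A y * ennreal \<bar>u x - u y\<bar> \<partial>lborel \<partial>lborel)
  <= emeasure lborel (cball (0::real^'n) d) * (ennreal d * total_variation S u) + ennreal e" by (simp add: add_left_mono)
qed

text \<open>The deviation of \<open>u x\<close> from the mean is at most the mean of |u x - u y|
  over y.\<close>

lemma mosc_le_double_integral:
 fixes u :: "real^'n => real"
 assumes Q: "Q : sets borel" "emeasure lborel Q = ennreal V" "V > 0" and u: "u : borel_fun"
 and i: "L1 (%x. indicator Q x * u x)"
 shows "ennreal (V * V * mosc Q u) <= (\<integral>\<^sup>+x. \<integral>\<^sup>+y. indicator Q x * indicator Q y * ennreal \<bar>u x - u y\<bar> \<partial>lborel \<partial>lborel)"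
proof -
 note [measurable] = Q(1) u
 have V: "measure lborel Q = V" using Q by (simp add: measure_def)
 define m where "m = average Q u"
 have Vm: "V * m = (LINT y|lborel. indicator Q y * u y)" using V Q(3) by (simp add: m_def average_lborel)
 have iQ: "L1 (indicator Q :: real^'n => real)" using Q by (intro integrable_real_indicator) auto
 have pt: "ennreal (V * (indicator Q x * \<bar>u x - m\<bar>)) <= (\<integral>\<^sup>+y. indicator Q x * indicator Q y * ennreal \<bar>u x - u y\<bar> \<partial>lborel)" for x
 proof (cases "x : Q")
 case True
 have ii: "L1 (%y. u x * indicator Q y - indicator Q y * u y)" using iQ i by auto
 have "V * (u x - m) = (LINT y|lborel. u x * indicator Q y - indicator Q y * u y)"
  using iQ i V Vm by (simp add: algebra_simps)
 moreover have "V * \<bar>u x - m\<bar> = \<bar>V * (u x - m)\<bar>" using Q(3) by (simp add: abs_mult)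
 ultimately have "V * \<bar>u x - m\<bar> = \<bar>LINT y|lborel. u x * indicator Q y - indicator Q y * u y\<bar>" by (simp only:)
 also have "... <= (LINT y|lborel. \<bar>u x * indicator Q y - indicator Q y * u y\<bar>)" by (rule integral_abs_bound)
 finally have "ennreal (V * \<bar>u x - m\<bar>) <= ennreal (LINT y|lborel. \<bar>u x * indicator Q y - indicator Q y * u y\<bar>)" by (rule ennreal_leI)
 also have "... = (\<integral>\<^sup>+y. ennreal \<bar>u x * indicator Q y - indicator Q y * u y\<bar> \<partial>lborel)"
  using ii by (intro nn_integral_eq_integral[symmetric] integrable_abs) auto
 also have "... = (\<integral>\<^sup>+y. indicator Q x * indicator Q y * ennreal \<bar>u x - u y\<bar> \<partial>lborel)"
  using True by (intro nn_integral_cong) (simp add: indicator_def)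
 finally show ?thesis using True by simp
 qed simp
 have ai: "L1 (%x. indicator Q x * \<bar>u x - m\<bar>)"
 proof (rule Bochner_Integration.integrable_bound)
 show "L1 (%x. \<bar>indicator Q x * u x\<bar> + \<bar>m\<bar> * indicator Q x)" using i iQ by auto
 show "AE x in lborel. norm (indicator Q x * \<bar>u x - m\<bar>) <= norm (\<bar>indicator Q x * u x\<bar> + \<bar>m\<bar> * indicator Q x)"
  by (rule AE_I2) (auto simp: indicator_def)
 qed measurable
 have "V * mosc Q u = (LINT x|lborel. indicator Q x * \<bar>u x - m\<bar>)"
 using V Q(3) by (simp add: mosc_def m_def[symmetric] average_lborel)
 hence "V * V * mosc Q u = (LINT x|lborel. V * (indicator Q x * \<bar>u x - m\<bar>))" by simp
 hence "ennreal (V * V * mosc Q u) = (\<integral>\<^sup>+x. ennreal (V * (indicator Q x * \<bar>u x - m\<bar>)) \<partial>lborel)"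
 using ai Q(3) by (simp only:) (rule nn_integral_eq_integral[symmetric], auto)
 also have "... <= (\<integral>\<^sup>+x. \<integral>\<^sup>+y. indicator Q x * indicator Q y * ennreal \<bar>u x - u y\<bar> \<partial>lborel \<partial>lborel)"
 by (intro nn_integral_mono pt)
 finally show ?thesis .
qed

text \<open>Side length \<open>3 * d\<close> leaves room for the closed ball inside the open cube. A
  crude volume bound is enough here.\<close>

lemma emeasure_cball_le:
 assumes "d > 0" shows "emeasure lborel (cball (0::real^'n) d) <= ennreal ((3 * d) ^ CARD('n))"
proof -
 have "cball (0::real^'n) d <= cube0 (3 * d)"
 proof
 fix z :: "real^'n" assume "z : cball 0 d"
 hence "\<bar>z $ i\<bar> <= d" for i using component_le_norm_cart[of z i] by simp
 moreover have "d < 3 * d / 2" using assms by simp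
 ultimately show "z : cube0 (3 * d)" unfolding mem_cube0 by (meson order_le_less_trans)
 qed
 hence "emeasure lborel (cball (0::real^'n) d) <= emeasure lborel (cube0 (3 * d) :: (real^'n) set)"
 by (intro emeasure_mono) auto
 thus ?thesis using assms by (simp add: emeasure_cube0)
qed

text \<open>With n the dimension and d = n \<epsilon>, this is (3 d)^n d divided by \<epsilon>^(n +
  1), hence free of \<epsilon>.\<close>

definition poincare_const :: "'n itself => real" where
 "poincare_const _ = real CARD('n) * (3 * real CARD('n)) ^ CARD('n)"

lemma poincare_const_nonneg: "poincare_const TYPE('n) >= 0"
 by (simp add: poincare_const_def)

text \<open>The compact version is applied to shrunken closed cubes exhausting the open cube, and
  Fatou's lemma passes to the limit. Only the variation inside the open cube enters, so that the
  bounds for disjoint cubes can be added.\<close>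

theorem poincare_cube:
 fixes u :: "real^'n => real"
 assumes q: "q > 1" and u: "u : Lp q lborel" and Q: "Q : cubes \<e>" and e: "\<e> > 0"
 shows "ennreal (\<e> ^ (CARD('n) - 1) * mosc Q u) <= ennreal (poincare_const TYPE('n)) * total_variation Q u"
proof -
 obtain c R where R: "orth R" and Qr: "Q = rcube c R \<e>" using Q cubes_rcube by blast
 have linR: "linear R" by (rule orthogonal_transformation_linear[OF R])
 have contR: "continuous_on T R" for T by (intro linear_continuous_on) (simp add: linear_conv_bounded_linear[symmetric] linR)
 have um [measurable]: "u : borel_fun" using u by (simp add: Lp_def)
 have oQ: "open Q" unfolding Qr by (rule rcube_open[OF R])
 have Qm [measurable]: "Q : sets borel" using oQ by simp
 define n where "n = real CARD('n)"
 have n1: "n >= 1" by (simp add: n_def Suc_leI)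
 define d where "d = n * \<e>"
 have d: "d > 0" using e n1 by (simp add: d_def)
 \<comment> \<open>Shrinking factors strictly below 1 that tend to 1.\<close>
 define s where "s j = real (Suc j) / real (Suc (Suc j))" for j
 have s: "0 < s j" "s j < 1" for j by (auto simp: s_def)
 have slim: "s \<longlonglongrightarrow> 1" unfolding s_def
 proof -
 have "(%j. 1 - 1 / real (Suc (Suc j))) \<longlonglongrightarrow> 1 - 0" by (intro tendsto_intros LIMSEQ_Suc[OF LIMSEQ_Suc[OF lim_1_over_n]])
 moreover have "(%j. 1 - 1 / real (Suc (Suc j))) = (%j. real (Suc j) / real (Suc (Suc j)))" by (auto simp: field_simps)
 ultimately show "(%j. real (Suc j) / real (Suc (Suc j))) \<longlonglongrightarrow> 1" by simp
 qed
 define C where "C = (cbox (\<chi> i. - \<e> / 2) (\<chi> i. \<e> / 2) :: (real^'n) set)"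
 have Cb: "\<bar>z $ i\<bar> <= \<e> / 2" if "z : C" for z i
 proof -
 have "- \<e> / 2 <= z $ i & z $ i <= \<e> / 2" using that by (simp add: C_def mem_box_cart)
 thus ?thesis by auto
 qed
 have C0: "cube0 \<e> <= C" unfolding C_def cube0_def by (rule box_subset_cbox)
 define A where "A j = (%z. c + R (s j *\<^sub>R z)) ` C" for j
 have Ac: "compact (A j)" for j unfolding A_def
 by (intro compact_continuous_image continuous_intros continuous_on_compose2[OF contR[of UNIV]]) (auto simp: C_def)
 have Av: "convex (A j)" for j
 proof -
 have "A j = (+) c ` (R ` ((*\<^sub>R) (s j) ` C))" by (auto simp: A_def image_image)
 thus ?thesis by (simp add: convex_translation convex_linear_image linR convex_scaling C_def)
 qed
 have AQ: "A j <= Q" for j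
 proof
 fix x assume "x : A j"
 then obtain z where z: "z : C" "x = c + R (s j *\<^sub>R z)" by (auto simp: A_def)
 have "s j *\<^sub>R z : cube0 \<e>" unfolding mem_cube0
 proof
  fix i
  have "\<bar>(s j *\<^sub>R z) $ i\<bar> = s j * \<bar>z $ i\<bar>" using s[of j] by (simp add: abs_mult)
  also have "... <= s j * (\<e> / 2)" using Cb[OF z(1), of i] s[of j] by (intro mult_left_mono) auto
  also have "... < 1 * (\<e> / 2)" using s[of j] e by (intro mult_strict_right_mono) auto
  finally show "\<bar>(s j *\<^sub>R z) $ i\<bar> < \<e> / 2" by simp
 qed
 thus "x : Q" unfolding Qr rcube_def z(2) by blast
 qed
 have Ad: "norm (x - y) <= d" if "x : A j" "y : A j" for x y j
 proof -
 have "norm (x - c) <= n * \<e> / 2" "norm (y - c) <= n * \<e> / 2"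
  using rcube_center_dist[OF R, of x c \<e>] rcube_center_dist[OF R, of y c \<e>] that AQ Qr by (auto simp: n_def)
 thus ?thesis using norm_triangle_ineq4[of "x - c" "y - c"] by (simp add: d_def)
 qed
 have ev: "\<forall>\<^sub>F j in sequentially. x : A j" if xQ: "x : Q" for x
 proof -
 obtain z where z: "z : cube0 \<e>" "x = c + R z" using xQ by (auto simp: Qr rcube_def)
 have "(%j. inverse (s j) *\<^sub>R z) \<longlonglongrightarrow> inverse 1 *\<^sub>R z" by (intro tendsto_intros slim) auto
 hence "\<forall>\<^sub>F j in sequentially. inverse (s j) *\<^sub>R z : cube0 \<e>"
  by (rule topological_tendstoD) (use z(1) in \<open>auto simp: cube0_def\<close>)
 thus ?thesis
 proof (rule eventually_mono)
  fix j assume "inverse (s j) *\<^sub>R z : cube0 \<e>"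
  moreover have "x = c + R (s j *\<^sub>R (inverse (s j) *\<^sub>R z))" using s[of j] z(2) by simp
  ultimately show "x : A j" unfolding A_def using C0 by blast
 qed
 qed
 have Am [measurable]: "A j : sets borel" for j by (intro borel_closed compact_imp_closed Ac)
 define b where "b = emeasure lborel (cball (0::real^'n) d) * (ennreal d * total_variation Q u)"
 have bd: "(\<integral>\<^sup>+x. \<integral>\<^sup>+y. indicator (A j) x * indicator (A j) y * ennreal \<bar>u x - u y\<bar> \<partial>lborel \<partial>lborel) <= b" for j
 unfolding b_def using d by (intro poincare_compact[OF q u oQ Ac Av AQ] Ad) auto
 have "(\<integral>\<^sup>+x. \<integral>\<^sup>+y. indicator Q x * indicator Q y * ennreal \<bar>u x - u y\<bar> \<partial>lborel \<partial>lborel)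
 <= (\<integral>\<^sup>+x. liminf (%j. \<integral>\<^sup>+y. indicator (A j) x * indicator (A j) y * ennreal \<bar>u x - u y\<bar> \<partial>lborel) \<partial>lborel)"
 proof (rule nn_integral_mono)
 fix x
 have "(\<integral>\<^sup>+y. indicator Q x * indicator Q y * ennreal \<bar>u x - u y\<bar> \<partial>lborel) \<le>
  (\<integral>\<^sup>+y. liminf (%j. indicator (A j) x * indicator (A j) y * ennreal \<bar>u x - u y\<bar>) \<partial>lborel)"
 proof (rule nn_integral_mono)
  fix y
  show "indicator Q x * indicator Q y * ennreal \<bar>u x - u y\<bar> <= liminf (%j. indicator (A j) x * indicator (A j) y * ennreal \<bar>u x - u y\<bar>)"
  proof (cases "x : Q & y : Q")
  case True
  have "\<forall>\<^sub>F j in sequentially. ennreal \<bar>u x - u y\<bar> <= indicator (A j) x * indicator (A j) y * ennreal \<bar>u x - u y\<bar>"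
   using ev[of x] ev[of y] True by (auto elim: eventually_elim2)
  from Liminf_mono[OF this] show ?thesis using True by (simp add: Liminf_const)
  qed (auto simp: indicator_def)
 qed
 also have "... <= liminf (%j. \<integral>\<^sup>+y. indicator (A j) x * indicator (A j) y * ennreal \<bar>u x - u y\<bar> \<partial>lborel)"
  by (rule nn_integral_liminf) measurable
 finally show "(\<integral>\<^sup>+y. indicator Q x * indicator Q y * ennreal \<bar>u x - u y\<bar> \<partial>lborel) \<le>
  liminf (%j. \<integral>\<^sup>+y. indicator (A j) x * indicator (A j) y * ennreal \<bar>u x - u y\<bar> \<partial>lborel)" .
 qed
 also have "... <= liminf (%j. \<integral>\<^sup>+x. \<integral>\<^sup>+y. indicator (A j) x * indicator (A j) y * ennreal \<bar>u x - u y\<bar> \<partial>lborel \<partial>lborel)"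
 by (rule nn_integral_liminf) measurable
 also have "... <= liminf (%j::nat. b)" by (intro Liminf_mono always_eventually allI bd)
 also have "... = b" by (simp add: Liminf_const)
 finally have dbl: "(\<integral>\<^sup>+x. \<integral>\<^sup>+y. indicator Q x * indicator Q y * ennreal \<bar>u x - u y\<bar> \<partial>lborel \<partial>lborel) <= b" .
 define V where "V = \<e> ^ CARD('n)"
 have V: "V > 0" "emeasure lborel Q = ennreal V" using e by (simp_all add: V_def Qr emeasure_rcube[OF R])
 have "L1 (%x. indicator Q x * u x)"
 by (rule integrable_of_Lp_bounded_support(1)[OF q Lp_indicator(1)[OF u Qm], of Q])
  (use rcube_bounded[OF R] Qr Qm in auto)
 from mosc_le_double_integral[OF Qm V(2,1) um this]
 have "ennreal (V * V * mosc Q u) <= b" using dbl by (rule order_trans)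
 also have "b <= ennreal ((3 * d) ^ CARD('n)) * (ennreal d * total_variation Q u)"
 unfolding b_def by (intro mult_right_mono emeasure_cball_le d) simp
 also have "... = ennreal ((3 * d) ^ CARD('n) * d) * total_variation Q u"
 using d by (simp add: ennreal_mult mult.assoc)
 finally have main: "ennreal (V * V * mosc Q u) <= ennreal ((3 * d) ^ CARD('n) * d) * total_variation Q u" .
 \<comment> \<open>Division by \<open>V * \<e>\<close> turns the factor \<open>V * V\<close> into
   \<open>V / \<e>\<close>, which is \<open>\<e> ^ (CARD('n) - 1)\<close>.\<close>
 define \<kappa> where "\<kappa> = 1 / (V * \<e>)"
 have \<kappa>: "\<kappa> > 0" using V e by (simp add: \<kappa>_def)
 have "CARD('n) = Suc (CARD('n) - 1)" by simp
 hence Ve: "V = \<e> * \<e> ^ (CARD('n) - 1)" unfolding V_def by (metis power_Suc)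
 have k1: "\<e> ^ (CARD('n) - 1) * mosc Q u = \<kappa> * (V * V * mosc Q u)" using e V unfolding \<kappa>_def by (subst (3) Ve) (simp add: field_simps)
 have k2: "\<kappa> * ((3 * d) ^ CARD('n) * d) = poincare_const TYPE('n)"
 using e by (simp add: \<kappa>_def d_def V_def power_mult_distrib poincare_const_def n_def field_simps)
 have "ennreal (\<e> ^ (CARD('n) - 1) * mosc Q u) = ennreal \<kappa> * ennreal (V * V * mosc Q u)"
 unfolding k1 using \<kappa> V by (intro ennreal_mult) auto
 also have "... <= ennreal \<kappa> * (ennreal ((3 * d) ^ CARD('n) * d) * total_variation Q u)" by (intro mult_left_mono main) simp
 also have "... = ennreal (\<kappa> * ((3 * d) ^ CARD('n) * d)) * total_variation Q u"
 using \<kappa> d by (simp add: ennreal_mult mult.assoc)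
 finally show ?thesis by (simp only: k2)
qed

section \<open>Truncation by a soft threshold does not increase the variation\<close>

lemma total_variation_compose:
 fixes u :: "real^'n => real"
 assumes q: "q > 1" and u: "u : Lp q lborel" and S: "open S"
 and T: "!!s. (T has_real_derivative T' s) (at s)" "continuous_on UNIV T'" "!!s. 0 <= T' s" "!!s. T' s <= 1"
 and Tu: "(%x. T (u x)) : Lp q lborel" and Tlip: "!!a b. \<bar>T a - T b\<bar> <= \<bar>a - b\<bar>"
 shows "total_variation S (%x. T (u x)) <= total_variation S u"
proof -
 have um [measurable]: "u : borel_fun" using u by (simp add: Lp_def)
 have Tm: "(%x. T (u x)) : borel_fun" using Tu by (simp add: Lp_def)
 have "ennreal (pairing (%x. T (u x)) \<phi>) <= total_variation S u" if \<phi>: "\<phi> : test_fields S" for \<phi>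
 proof (rule ennreal_le_all_inverse)
 fix e :: real assume e: "e > 0"
 obtain D K where K: "has_C1 \<phi> D" "compact K" "K <= S" "!!x. x ~: K ==> \<phi> x = 0" "!!x. norm (\<phi> x) <= 1"
  using \<phi> by (rule test_fieldD) blast
 obtain rK where rK: "!!x. norm x > rK ==> x ~: K" using compact_norm_bound[OF K(2)] by blast
 note dz = divergence_off_support[OF K(1,2,4)]
 have "\<exists>C\<ge>0. \<forall>x. norm (divergence \<phi> x) <= C"
  by (rule continuous_bounded_support(1)[OF divergence_continuous[OF K(1)], of rK]) (use dz rK in auto)
 then obtain C where C: "C >= 0" "!!x. \<bar>divergence \<phi> x\<bar> <= C" by auto
 define \<eta> where "\<eta> = e / (C + 1)"
 have \<eta>: "\<eta> > 0" using e C by (simp add: \<eta>_def)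
 obtain d0 where d0: "d0 > 0" "nbhd K d0 <= S" using nbhd_subset_open[OF K(2) S K(3)] by blast
 define B where "B = nbhd K d0"
 have Bc: "compact B" unfolding B_def by (rule compact_nbhd[OF K(2)])
 have Bm: "B : sets borel" by (intro borel_closed compact_imp_closed Bc)
 have KB: "K <= B" unfolding B_def using d0 by (intro nbhd_subset) simp
 define w where "w x = indicator B x * u x" for x
 have w: "w : Lp q lborel" unfolding w_def by (rule Lp_indicator(1)[OF u Bm])
 obtain r where r: "!!x. norm x > r ==> x ~: B" using compact_norm_bound[OF Bc] by blast
 have wz: "w x = 0" if "norm x > r" for x using r[OF that] by (simp add: w_def)
 have wi: "L1 w"
  by (rule integrable_of_Lp_bounded_support(1)[OF q w _ Bm compact_imp_bounded[OF Bc]]) (simp add: w_def)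
 have wu: "w x = u x" if "x : B" for x using that by (simp add: w_def)
 obtain d1 where d1: "d1 > 0" "!!\<delta> k g L. mollifier \<delta> k g L ==> \<delta> < d1 ==>
  L1 (%x. conv k w x - w x) & (LINT x|lborel. \<bar>conv k w x - w x\<bar>) <= \<eta>"
  using conv_tendsto_L1[OF q w wz \<eta>] by blast
 define \<delta> where "\<delta> = min d0 d1 / 2"
 have \<delta>: "\<delta> > 0" "\<delta> < d0" "\<delta> < d1" using d0 d1 by (auto simp: \<delta>_def min_def)
 obtain k :: "real^'n => real" and g L where mol: "mollifier \<delta> k g L" using mollifier_exists[OF \<delta>(1)] by blast
 define v where "v = conv k w"
 define G where "G = gconv g w"
 have vC: "has_C1 v (%x h. G x \<bullet> h)" unfolding v_def G_def by (rule conv_gradient[OF mol wi])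
 have vi: "L1 (%x. v x - w x)" "(LINT x|lborel. \<bar>v x - w x\<bar>) <= \<eta>"
  using d1(2)[OF mol \<delta>(3)] by (auto simp: v_def)
 have Gc: "continuous_on UNIV G" unfolding G_def by (rule gconv_continuous[OF mol wi])
 have TvC: "has_C1 (%x. T (v x)) (%x h. (T' (v x) *\<^sub>R G x) \<bullet> h)"
  using has_C1_compose_real[OF vC T(1,2)] by (simp add: mult.commute)
 have "L1 (%x. indicator K x *\<^sub>R norm (G x))"
  by (intro borel_integrable_compact K(2) continuous_intros continuous_on_subset[OF Gc]) auto
 hence iG: "L1 (%x. indicator K x * norm (G x))" by simp
 have i1: "L1 (%x. T (v x) * divergence \<phi> x)"
  by (rule continuous_bounded_support(2)[of _ rK])
   (use dz rK in \<open>auto intro!: continuous_intros has_C1_continuous[OF TvC] divergence_continuous[OF K(1)]\<close>)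
 have i2: "L1 (%x. T (u x) * divergence \<phi> x)" by (rule Lp_times_divergence[OF q Tu K(1,2,4)])
 \<comment> \<open>The chain rule is used for the mollification \<open>v\<close>, where it is
   classical; a slope of \<open>T\<close> between 0 and 1 keeps the gradient from growing.\<close>
 have p1: "pairing (%x. T (v x)) \<phi> <= (LINT x|lborel. indicator K x * norm (G x))"
 proof -
  have "pairing (%x. T (v x)) \<phi> = - (LINT x|lborel. (T' (v x) *\<^sub>R G x) \<bullet> \<phi> x)"
  by (rule pairing_cutoff[OF TvC K(1), of rK]) (use rK K(4) in auto)
  also have "... = (LINT x|lborel. - ((T' (v x) *\<^sub>R G x) \<bullet> \<phi> x))" by simp
  also have "... <= (LINT x|lborel. indicator K x * norm (G x))"
  proof (rule integral_mono[OF _ iG])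
  have "continuous_on UNIV (%x. T' (v x))" by (rule continuous_on_compose2[OF T(2) has_C1_continuous[OF vC]]) auto
  thus "L1 (%x. - ((T' (v x) *\<^sub>R G x) \<bullet> \<phi> x))"
   by (intro continuous_bounded_support(2)[of _ rK])
    (use rK K(4) in \<open>auto intro!: continuous_intros Gc has_C1_continuous[OF K(1)]\<close>)
  fix x
  show "- ((T' (v x) *\<^sub>R G x) \<bullet> \<phi> x) <= indicator K x * norm (G x)"
  proof (cases "x : K")
   case True
   have "- ((T' (v x) *\<^sub>R G x) \<bullet> \<phi> x) <= \<bar>(T' (v x) *\<^sub>R G x) \<bullet> \<phi> x\<bar>" by linarith
   also have "... <= norm (T' (v x) *\<^sub>R G x) * norm (\<phi> x)" by (rule Cauchy_Schwarz_ineq2)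
   also have "... <= (1 * norm (G x)) * 1" using T(3,4)[of "v x"] K(5)[of x] by (intro mult_mono) (auto intro!: mult_right_le_one_le mult_left_le_one_le)
   finally show ?thesis using True by simp
  next
   case False thus ?thesis using K(4) by simp
  qed
  qed
  finally show ?thesis .
 qed
 \<comment> \<open>On the support of \<phi> one has \<open>w = u\<close>, and since \<open>T\<close>
   does not increase distances, the L1 error of the mollification bounds the change of the
   pairing.\<close>
 have p2: "pairing (%x. T (u x)) \<phi> - pairing (%x. T (v x)) \<phi> <= C * \<eta>"
 proof -
  have "pairing (%x. T (u x)) \<phi> - pairing (%x. T (v x)) \<phi> = (LINT x|lborel. T (u x) * divergence \<phi> x - T (v x) * divergence \<phi> x)"
  unfolding pairing_def using i1 i2 by simp
  also have "... <= (LINT x|lborel. C * \<bar>v x - w x\<bar>)"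
  proof (rule integral_mono)
  show "L1 (%x. T (u x) * divergence \<phi> x - T (v x) * divergence \<phi> x)" using i1 i2 by simp
  show "L1 (%x. C * \<bar>v x - w x\<bar>)" using vi(1) by simp
  fix x
  show "T (u x) * divergence \<phi> x - T (v x) * divergence \<phi> x <= C * \<bar>v x - w x\<bar>"
  proof (cases "x : K")
   case True
   hence wx: "w x = u x" using KB wu by auto
   have "T (u x) * divergence \<phi> x - T (v x) * divergence \<phi> x <= \<bar>T (u x) - T (v x)\<bar> * \<bar>divergence \<phi> x\<bar>"
   unfolding left_diff_distrib[symmetric] abs_mult[symmetric] by linarith
   also have "... <= \<bar>u x - v x\<bar> * C" by (intro mult_mono Tlip C) auto
   finally show ?thesis by (simp add: wx abs_minus_commute mult.commute)
  next
   case False thus ?thesis using dz C by simp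
  qed
  qed
  also have "... <= C * \<eta>" using vi C by (simp add: mult_left_mono)
  finally show ?thesis .
 qed
 have "C * \<eta> <= (C + 1) * \<eta>" using \<eta> by simp
 also have "(C + 1) * \<eta> = e" using C by (simp add: \<eta>_def)
 finally have "pairing (%x. T (u x)) \<phi> <= (LINT x|lborel. indicator K x * norm (G x)) + e" using p1 p2 by linarith
 hence "ennreal (pairing (%x. T (u x)) \<phi>) <= ennreal ((LINT x|lborel. indicator K x * norm (G x)) + e)" by (rule ennreal_leI)
 also have "... <= ennreal (LINT x|lborel. indicator K x * norm (G x)) + ennreal e" by (rule ennreal_plus_le)
 also have "ennreal (LINT x|lborel. indicator K x * norm (G x)) <= total_variation S u"
  unfolding G_def
 proof (rule gradient_le_total_variation[OF mol K(2) S _ um wi])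
  have "nbhd K \<delta> <= B" unfolding B_def using \<delta> by (intro nbhd_mono) simp
  thus "nbhd K \<delta> <= S" "!!x. x : nbhd K \<delta> ==> w x = u x" using d0(2) wu by (auto simp: B_def)
 qed
 finally show "ennreal (pairing (%x. T (u x)) \<phi>) <= total_variation S u + ennreal e" by (simp add: add_right_mono)
 qed
 thus ?thesis unfolding total_variation_lborel[OF S Tm] by (rule SUP_least)
qed

text \<open>The derivative \<theta> is 0 on [-\<tau>, \<tau>], 1 beyond 2 \<tau>, and linear in
  between. Its primitive is C1, as the chain rule requires, unlike the usual piecewise linear
  threshold.\<close>

lemma soft_threshold_exists:
 assumes \<tau>: "\<tau> > (0::real)"
 obtains T T' where "!!s. (T has_real_derivative T' s) (at s)" "continuous_on UNIV T'" "!!s. 0 <= T' s" "!!s. T' s <= 1"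
 "!!s. \<bar>s\<bar> <= \<tau> ==> T s = 0" "!!s. \<bar>T s - s\<bar> <= 2 * \<tau>" "!!a b. \<bar>T a - T b\<bar> <= \<bar>a - b\<bar>"
proof -
 define \<theta> where "\<theta> s = min 1 (max 0 (\<bar>s\<bar> / \<tau> - 1))" for s
 have \<theta>c: "continuous_on UNIV \<theta>" unfolding \<theta>_def using \<tau> by (intro continuous_intros) auto
 obtain F where F: "!!x. (F has_real_derivative \<theta> x) (at x)" using antiderivative_exists_real[OF \<theta>c] by blast
 define T where "T s = F s - F 0" for s
 have T: "(T has_real_derivative \<theta> x) (at x)" for x
 proof -
 have "((%s. F s - F 0) has_real_derivative \<theta> x - 0) (at x)" by (intro DERIV_diff F DERIV_const)
 thus ?thesis unfolding T_def by simp
 qed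
 have T0: "T 0 = 0" by (simp add: T_def)
 have mvt: "\<exists>z>a. z < b & T b - T a = (b - a) * \<theta> z" if "a < b" for a b
 using MVT2[OF that, of T \<theta>] T by blast
 have lip: "\<bar>T a - T b\<bar> <= \<bar>a - b\<bar>" for a b
 proof -
 have *: "\<bar>T b - T a\<bar> <= b - a" if ab: "a < b" for a b
 proof -
  obtain z where z: "T b - T a = (b - a) * \<theta> z" using mvt[OF ab] by blast
  have "\<bar>T b - T a\<bar> = (b - a) * \<theta> z" unfolding z using ab by (simp add: abs_mult \<theta>_def)
  also have "... <= (b - a) * 1" using ab by (intro mult_left_mono) (auto simp: \<theta>_def)
  finally show ?thesis by simp
 qed
 show ?thesis using *[of a b] *[of b a] by (cases a b rule: linorder_cases) (auto simp: abs_minus_commute)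
 qed
 have zero: "T s = 0" if s: "\<bar>s\<bar> <= \<tau>" for s
 proof -
 consider "s = 0" | "s > 0" | "s < 0" by linarith
 thus ?thesis
 proof cases
  case 1 thus ?thesis by (simp add: T0)
 next
  case 2
  obtain z where z: "0 < z" "z < s" "T s - T 0 = (s - 0) * \<theta> z" using mvt[OF 2] by blast
  have "\<bar>z\<bar> <= \<tau>" using z s by linarith
  hence "\<bar>z\<bar> / \<tau> <= 1" using \<tau> by simp
  hence "\<theta> z = 0" by (simp add: \<theta>_def)
  thus ?thesis using z T0 by simp
 next
  case 3
  obtain z where z: "s < z" "z < 0" "T 0 - T s = (0 - s) * \<theta> z" using mvt[OF 3] by blast
  have "\<bar>z\<bar> <= \<tau>" using z s by linarith
  hence "\<bar>z\<bar> / \<tau> <= 1" using \<tau> by simp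
  hence "\<theta> z = 0" by (simp add: \<theta>_def)
  thus ?thesis using z T0 by simp
 qed
 qed
 have small: "\<bar>T s - s\<bar> <= 2 * \<tau>" if s: "\<bar>s\<bar> <= 2 * \<tau>" for s
 proof -
 consider "s = 0" | "s > 0" | "s < 0" by linarith
 thus ?thesis
 proof cases
  case 1 thus ?thesis using \<tau> by (simp add: T0)
 next
  case 2
  obtain z where z: "T s = s * \<theta> z" using mvt[OF 2] T0 by auto
  have "0 <= s * \<theta> z" "s * \<theta> z <= s" using 2 by (auto simp: \<theta>_def intro: mult_right_le_one_le)
  thus ?thesis using z s 2 by simp
 next
  case 3
  obtain z where z: "T s = s * \<theta> z" using mvt[OF 3] T0 by auto
  have "0 <= (- s) * \<theta> z" "(- s) * \<theta> z <= - s" using 3 by (auto simp: \<theta>_def mult_le_0_iff intro: mult_right_le_one_le)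
  thus ?thesis using z s 3 by simp
 qed
 qed
 have big: "\<bar>T s - s\<bar> <= 2 * \<tau>" for s
 proof -
 consider "\<bar>s\<bar> <= 2 * \<tau>" | "s > 2 * \<tau>" | "s < - (2 * \<tau>)" by linarith
 thus ?thesis
 proof cases
  case 1 thus ?thesis by (rule small)
 next
  case 2
  obtain z where z: "2 * \<tau> < z" "T s - T (2 * \<tau>) = (s - 2 * \<tau>) * \<theta> z" using mvt[OF 2] by blast
  have "z / \<tau> >= 2" using z \<tau> by (simp add: field_simps)
  hence "\<theta> z = 1" using z \<tau> by (simp add: \<theta>_def)
  thus ?thesis using z small[of "2 * \<tau>"] \<tau> by simp
 next
  case 3
  obtain z where z: "z < - (2 * \<tau>)" "T (- (2 * \<tau>)) - T s = (- (2 * \<tau>) - s) * \<theta> z" using mvt[OF 3] by blast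
  have "- z / \<tau> >= 2" using z \<tau> by (simp add: field_simps)
  hence "\<theta> z = 1" using z \<tau> by (simp add: \<theta>_def)
  thus ?thesis using z small[of "- (2 * \<tau>)"] \<tau> by simp
 qed
 qed
 show ?thesis
 by (rule that[OF T \<theta>c _ _ zero big lip]) (auto simp: \<theta>_def)
qed

text \<open>Where the threshold leaves a nonzero value, |u| exceeds \<tau> and is therefore at most
  a multiple of |u|^q; this gives integrability also on sets of infinite measure. Letting \<tau>
  tend to 0 recovers \<open>u\<close> in L^q by domination.\<close>

theorem integrable_truncation:
 fixes u :: "real^'n => real"
 assumes q: "q > 1" and u: "u : Lp q lborel" and S: "open S" and \<eta>: "\<eta> > 0"
 obtains v where "v : Lp q lborel" "L1 v" "total_variation S v <= total_variation S u"
 "Lpow q lborel (%x. v x - u x) < \<eta>"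
proof -
 have um [measurable]: "u : borel_fun" using u by (simp add: Lp_def)
 have "\<exists>T T'. (\<forall>s. (T has_real_derivative T' s) (at s)) & continuous_on UNIV T' & (\<forall>s. 0 <= T' s) & (\<forall>s. T' s <= 1) &
 (\<forall>s. \<bar>s\<bar> <= 1 / real (Suc j) --> T s = 0) & (\<forall>s. \<bar>T s - s\<bar> <= 2 * (1 / real (Suc j))) & (\<forall>a b. \<bar>T a - T b\<bar> <= \<bar>a - b\<bar>)" for j
 using soft_threshold_exists[of "1 / real (Suc j)"] by (metis of_nat_0_less_iff zero_less_Suc zero_less_divide_1_iff)
 then obtain T T' where T: "!!j s. (T j has_real_derivative T' j s) (at s)" "!!j. continuous_on UNIV (T' j)" "!!j s. 0 <= T' j s" "!!j s. T' j s <= 1"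
 "!!j s. \<bar>s\<bar> <= 1 / real (Suc j) ==> T j s = 0" "!!j s. \<bar>T j s - s\<bar> <= 2 * (1 / real (Suc j))" "!!j a b. \<bar>T j a - T j b\<bar> <= \<bar>a - b\<bar>"
 by metis
 have T0: "T j 0 = 0" for j by (rule T(5)) simp
 have Ta: "\<bar>T j s\<bar> <= \<bar>s\<bar>" for j s using T(7)[of j s 0] by (simp add: T0)
 have Tc: "continuous_on UNIV (T j)" for j using T(1) by (meson DERIV_continuous continuous_at_imp_continuous_on)
 have Tm [measurable]: "T j : borel_fun" for j by (rule borel_measurable_continuous_onI[OF Tc])
 have TL: "(%x. T j (u x)) : Lp q lborel" for j
 proof -
 have "L1 (%x. \<bar>T j (u x)\<bar> powr q)"
 proof (rule Bochner_Integration.integrable_bound[OF Lp_integrable[OF u]])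
  show "AE x in lborel. norm (\<bar>T j (u x)\<bar> powr q) <= norm (\<bar>u x\<bar> powr q)"
  by (rule AE_I2) (use q Ta in \<open>auto intro!: powr_mono2\<close>)
 qed measurable
 thus ?thesis by (simp add: Lp_def)
 qed
 have Ti: "L1 (%x. T j (u x))" for j
 proof (rule Bochner_Integration.integrable_bound[OF integrable_mult_right[OF Lp_integrable[OF u], of "(1 / real (Suc j)) powr (1 - q)"]])
 show "AE x in lborel. norm (T j (u x)) <= norm ((1 / real (Suc j)) powr (1 - q) * \<bar>u x\<bar> powr q)"
 proof (rule AE_I2)
  fix x
  define \<tau> where "\<tau> = 1 / real (Suc j)"
  have \<tau>: "\<tau> > 0" by (simp add: \<tau>_def)
  show "norm (T j (u x)) <= norm ((1 / real (Suc j)) powr (1 - q) * \<bar>u x\<bar> powr q)"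
  proof (cases "\<bar>u x\<bar> <= \<tau>")
  case True thus ?thesis using T(5) by (simp add: \<tau>_def)
  next
  case False
  hence "\<tau> powr (q - 1) <= \<bar>u x\<bar> powr (q - 1)" using q \<tau> by (intro powr_mono2) auto
  hence "1 <= \<tau> powr (1 - q) * \<bar>u x\<bar> powr (q - 1)"
   using \<tau> by (simp add: powr_minus_divide[of \<tau> "q - 1", simplified] pos_le_divide_eq)
  hence "\<bar>u x\<bar> * 1 <= \<bar>u x\<bar> * (\<tau> powr (1 - q) * \<bar>u x\<bar> powr (q - 1))" by (intro mult_left_mono) auto
  also have "... = \<tau> powr (1 - q) * \<bar>u x\<bar> powr q" using False \<tau> by (simp add: powr_diff)
  finally show ?thesis using Ta[of j "u x"] by (simp add: \<tau>_def)
  qed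
 qed
 qed measurable
 have "(%j. LINT x|lborel. \<bar>T j (u x) - u x\<bar> powr q) \<longlonglongrightarrow> (LINT x|(lborel :: (real^'n) measure). 0)"
 proof (rule integral_dominated_convergence)
 show "L1 (%x. (2::real) powr q * (\<bar>u x\<bar> powr q + \<bar>u x\<bar> powr q))" using Lp_integrable[OF u] by auto
 show "AE x in lborel. (%j. \<bar>T j (u x) - u x\<bar> powr q) \<longlonglongrightarrow> 0"
 proof (rule AE_I2)
  fix x
  have "(%j. \<bar>T j (u x) - u x\<bar>) \<longlonglongrightarrow> 0"
  proof (rule tendsto_sandwich[OF always_eventually always_eventually tendsto_const])
  show "(%j. 2 * (1 / real (Suc j))) \<longlonglongrightarrow> 0"
   using tendsto_mult[OF tendsto_const LIMSEQ_Suc[OF lim_1_over_n], of 2] by simp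
  qed (use T(6) in auto)
  hence "(%j. \<bar>T j (u x) - u x\<bar> powr q) \<longlonglongrightarrow> 0 powr q" using q by (intro tendsto_powr' tendsto_const) auto
  thus "(%j. \<bar>T j (u x) - u x\<bar> powr q) \<longlonglongrightarrow> 0" using q by simp
 qed
 fix j
 show "AE x in lborel. norm (\<bar>T j (u x) - u x\<bar> powr q) <= 2 powr q * (\<bar>u x\<bar> powr q + \<bar>u x\<bar> powr q)"
 proof (rule AE_I2)
  fix x
  have "\<bar>T j (u x) - u x\<bar> powr q <= 2 powr q * (\<bar>T j (u x)\<bar> powr q + \<bar>u x\<bar> powr q)"
  using powr_add_le[OF q, of "T j (u x)" "- u x"] by simp
  also have "... <= 2 powr q * (\<bar>u x\<bar> powr q + \<bar>u x\<bar> powr q)" using q Ta by (intro mult_left_mono add_mono powr_mono2) auto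
  finally show "norm (\<bar>T j (u x) - u x\<bar> powr q) <= 2 powr q * (\<bar>u x\<bar> powr q + \<bar>u x\<bar> powr q)" by simp
 qed
 qed measurable
 hence "(%j. Lpow q lborel (%x. T j (u x) - u x)) \<longlonglongrightarrow> 0" by (simp add: Lpow_def)
 hence "\<forall>\<^sub>F j in sequentially. Lpow q lborel (%x. T j (u x) - u x) < \<eta>" using \<eta> by (rule order_tendstoD(2))
 then obtain j where j: "Lpow q lborel (%x. T j (u x) - u x) < \<eta>" by (auto simp: eventually_sequentially)
 show ?thesis
 by (rule that[OF TL Ti total_variation_compose[OF q u S T(1-4) TL T(7)] j])
qed

section \<open>Gluing a mollification into a function\<close>

lemma conv_norm_le_1:
 fixes p :: "real^'n => 'b::euclidean_space"
 assumes mol: "mollifier \<delta> k g L" and p: "L1 p" "!!y. norm (p y) <= 1"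
 shows "norm (conv k p x) <= 1"
proof -
 have [measurable]: "k : borel_fun" by (rule mollifier_meas[OF mol])
 have "norm (conv k p x) <= (LINT y|lborel. norm (k (x - y) *\<^sub>R p y))" unfolding conv_def by (rule integral_norm_bound)
 also have "... <= (LINT y|lborel. k (x - y))"
 proof (rule integral_mono)
 show "L1 (%y. norm (k (x - y) *\<^sub>R p y))" using conv_integrable(1)[OF mol p(1)] by (rule integrable_norm)
 show "L1 (%y. k (x - y))" using integrable_reflect_shift[of k x] mollifier_integrable[OF mol] by simp
 fix y
 show "norm (k (x - y) *\<^sub>R p y) <= k (x - y)" using mollifierD(3)[OF mol, of "x - y"] p(2)[of y] by (simp add: mult_left_le)
 qed
 also have "... = 1" using integral_reflect_shift[of k x] mollifierD(7)[OF mol] by simp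
 finally show ?thesis .
qed

lemma conv_component:
 fixes p :: "real^'n => real^'n"
 assumes mol: "mollifier \<delta> k g L" and p: "L1 p"
 shows "conv k p x $ i = conv k (%y. p y $ i) x"
proof -
 have "conv k p x $ i = (LINT y|lborel. (k (x - y) *\<^sub>R p y) $ i)"
 unfolding conv_def by (rule integral_bounded_linear[OF bounded_linear_vec_nth conv_integrable(1)[OF mol p], symmetric])
 thus ?thesis by (simp add: conv_def)
qed

text \<open>The indicator of the neighbourhood of intermediate radius \<open>r + d / 2\<close>,
  mollified at radius \<open>d / 2\<close>, is still 1 up to distance \<open>r\<close> and vanishes
  beyond \<open>r + d\<close>.\<close>

lemma cutoff_exists:
 fixes K :: "(real^'n) set"
 assumes K: "compact K" and d: "d > 0" "r >= 0"
 obtains \<zeta> G where "has_C1 \<zeta> (%x h. G x \<bullet> h)" "continuous_on UNIV G" "!!x. 0 <= \<zeta> x" "!!x. \<zeta> x <= 1"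
 "!!x. x : nbhd K r ==> \<zeta> x = 1" "!!x. x ~: nbhd K (r + d) ==> \<zeta> x = 0"
proof -
 define N where "N = nbhd K (r + d / 2)"
 have Nc: "compact N" unfolding N_def by (rule compact_nbhd[OF K])
 have Nm [measurable]: "N : sets borel" by (intro borel_closed compact_imp_closed Nc)
 have w: "L1 (indicator N :: real^'n => real)"
 using emeasure_bounded_finite[OF compact_imp_bounded[OF Nc]] by (intro integrable_real_indicator) auto
 have d2: "d / 2 > 0" using d by simp
 obtain k :: "real^'n => real" and g L where mol: "mollifier (d/2) k g L" using mollifier_exists[OF d2] by blast
 define \<zeta> where "\<zeta> = conv k (indicator N :: real^'n => real)"
 show ?thesis
 proof (rule that[of \<zeta> "gconv g (indicator N)"])
 show "has_C1 \<zeta> (%x h. gconv g (indicator N) x \<bullet> h)" unfolding \<zeta>_def by (rule conv_gradient[OF mol w])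
 show "continuous_on UNIV (gconv g (indicator N))" by (rule gconv_continuous[OF mol w])
 fix x
 show "0 <= \<zeta> x" unfolding \<zeta>_def conv_def using mollifierD(3)[OF mol] by (intro integral_nonneg_AE AE_I2) simp
 have "norm (\<zeta> x) <= 1" unfolding \<zeta>_def by (rule conv_norm_le_1[OF mol w]) (simp add: indicator_def)
 thus "\<zeta> x <= 1" by simp
 show "\<zeta> x = 0" if "x ~: nbhd K (r + d)"
  unfolding \<zeta>_def
 proof (rule conv_support[OF mol])
  fix y assume "dist x y < d / 2"
  hence "dist y x <= d / 2" by (simp add: dist_commute)
  hence "y : N ==> x : nbhd K ((r + d / 2) + d / 2)" unfolding N_def by (rule nbhd_step[rotated])
  moreover have "(r + d / 2) + d / 2 = r + d" by simp
  ultimately have "y : N ==> x : nbhd K (r + d)" by (simp only:)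
  thus "indicator N y = (0::real)" using that by (auto simp: indicator_def)
 qed
 show "\<zeta> x = 1" if x: "x : nbhd K r"
 proof -
  have "k (x - y) *\<^sub>R indicator N y = k (x - y)" for y
  proof (cases "dist x y < d / 2")
  case True
  hence "y : N" unfolding N_def using nbhd_step[OF x, of y "d/2"] by simp
  thus ?thesis by simp
  next
  case False thus ?thesis using mollifierD(6)[OF mol, of "x - y"] by (simp add: dist_norm)
  qed
  hence "\<zeta> x = (LINT y|lborel. k (x - y))" unfolding \<zeta>_def conv_def by (simp only:)
  also have "... = 1" using integral_reflect_shift[of k x] mollifier_meas(1)[OF mol] mollifierD(7)[OF mol] by simp
  finally show ?thesis .
 qed
 qed
qed

text \<open>Mollifying \<zeta> u in place of \<open>u\<close> confines the change to the vicinity of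
  \<open>K\<close>. By duality the mollification is moved to the test field; the new contribution is
  a commutator with the gradient of \<zeta>, measured by \<open>\<eta>\<close>. The sets
  \<open>S - nbhd K d\<close> and \<open>S - K\<close> differ because mollified fields spread by
  \<delta> < d.\<close>

lemma total_variation_glue:
 fixes u \<zeta> :: "real^'n => real"
 assumes q: "q > 1" and u: "u : Lp q lborel" and S: "open S" and K: "compact K" and d: "0 < \<delta>" "\<delta> < d" and N: "nbhd K (5 * d) <= S"
 and \<zeta>: "has_C1 \<zeta> (%x h. G x \<bullet> h)" "continuous_on UNIV G" "!!x. 0 <= \<zeta> x" "!!x. \<zeta> x <= 1" "!!x. x ~: nbhd K (5 * d) ==> \<zeta> x = 0"
 and mol: "mollifier \<delta> k g L"
 and w: "!!x. w x = \<zeta> x * u x"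
 and err: "!!i. L1 (%x. conv k (%y. u y * G y $ i) x - u x * G x $ i) & (LINT x|lborel. \<bar>conv k (%y. u y * G y $ i) x - u x * G x $ i\<bar>) <= \<eta> i"
 shows "total_variation (S - nbhd K d) (%x. u x + (conv k w x - w x)) <= total_variation (S - K) u + ennreal (\<Sum>i\<in>UNIV. \<eta> i)"
proof -
 define N5 where "N5 = nbhd K (5 * d)"
 have N5c: "compact N5" unfolding N5_def by (rule compact_nbhd[OF K])
 have Nc: "compact (nbhd K d)" by (rule compact_nbhd[OF K])
 have oA: "open (S - nbhd K d)" by (intro open_Diff S compact_imp_closed Nc)
 have oB: "open (S - K)" by (intro open_Diff S compact_imp_closed K)
 have um [measurable]: "u : borel_fun" using u by (simp add: Lp_def)
 have \<zeta>z: "\<zeta> x = 0" if "x ~: N5" for x using \<zeta>(5) that by (simp add: N5_def)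
 obtain r5 where r5: "!!x. norm x > r5 ==> x ~: N5" using compact_norm_bound[OF N5c] by blast
 have \<zeta>c: "continuous_on UNIV \<zeta>" by (rule has_C1_continuous[OF \<zeta>(1)])
 have wi: "L1 w"
 using Lp_times_continuous[OF q u \<zeta>c, of r5] \<zeta>z r5 by (simp add: w mult.commute cong: Bochner_Integration.integrable_cong)
 have Gz: "G x $ i = 0" if "x ~: N5" for x i
 proof -
 have "G x \<bullet> axis i 1 = 0"
  by (rule has_C1_zero_on_open[OF \<zeta>(1), of "- N5"]) (use that \<zeta>z N5c compact_imp_closed in auto)
 thus ?thesis by (simp add: inner_axis)
 qed
 have Gc: "continuous_on UNIV (%x. G x $ i)" for i by (intro continuous_intros \<zeta>(2))
 have wi_i: "L1 (%x. u x * G x $ i)" for i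
 by (rule Lp_times_continuous[OF q u Gc, of r5]) (use Gz r5 in auto)
 have cm: "conv k w : borel_fun" by (rule conv_meas[OF mol wi])
 have wm: "w : borel_fun" using wi by auto
 have vm: "(%x. u x + (conv k w x - w x)) : borel_fun" using cm wm by measurable
 have "ennreal (pairing (%x. u x + (conv k w x - w x)) \<phi>) <= total_variation (S - K) u + ennreal (\<Sum>i\<in>UNIV. \<eta> i)"
 if t: "\<phi> : test_fields (S - nbhd K d)" for \<phi>
 proof -
 obtain D J where \<phi>: "has_C1 \<phi> D" "compact J" "J <= S - nbhd K d" "!!x. x ~: J ==> \<phi> x = 0" "!!x. norm (\<phi> x) <= 1"
  using t by (rule test_fieldD) blast
 obtain rJ where rJ: "!!x. norm x > rJ ==> x ~: J" using compact_norm_bound[OF \<phi>(2)] by blast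
 note dz = divergence_off_support[OF \<phi>(1,2,4)]
 have \<phi>c: "continuous_on UNIV \<phi>" by (rule has_C1_continuous[OF \<phi>(1)])
 have divc: "continuous_on UNIV (divergence \<phi>)" by (rule divergence_continuous[OF \<phi>(1)])
 have \<phi>i: "L1 \<phi>" by (rule continuous_bounded_support(2)[OF \<phi>c, of rJ]) (use \<phi>(4) rJ in auto)
 define \<xi> where "\<xi> = conv k \<phi>"
 have \<xi>C: "has_C1 \<xi> (%x h. LINT y|lborel. (g (x - y) \<bullet> h) *\<^sub>R \<phi> y)" unfolding \<xi>_def by (rule conv_has_C1[OF mol \<phi>i])
 have \<xi>c: "continuous_on UNIV \<xi>" by (rule has_C1_continuous[OF \<xi>C])
 have \<xi>z: "\<xi> x = 0" if "x ~: nbhd J \<delta>" for x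
  unfolding \<xi>_def
 proof (rule conv_support[OF mol])
  fix y assume "dist x y < \<delta>"
  hence "y ~: J" using that by (auto simp: mem_nbhd dist_commute less_imp_le)
  thus "\<phi> y = 0" by (rule \<phi>(4))
 qed
 have \<xi>n: "norm (\<xi> x) <= 1" for x unfolding \<xi>_def by (rule conv_norm_le_1[OF mol \<phi>i \<phi>(5)])
 have \<zeta>1: "has_C1 (%x. 1 - \<zeta> x) (%x h. 0 - G x \<bullet> h)" by (rule has_C1_diff[OF has_C1_const \<zeta>(1)])
 \<comment> \<open>A convex combination, so the norm stays at most 1. The support of \<xi> grows by
   at most \<delta>, so \<psi> still avoids \<open>K\<close>; the factor \<zeta> keeps it inside
   \<open>S\<close>.\<close>
 define \<psi> where "\<psi> x = (1 - \<zeta> x) *\<^sub>R \<phi> x + \<zeta> x *\<^sub>R \<xi> x" for x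
 note C1a = has_C1_scaleR[OF \<zeta>1 \<phi>(1)] and C1b = has_C1_scaleR[OF \<zeta>(1) \<xi>C]
 have \<psi>C: "\<exists>E. has_C1 \<psi> E" using has_C1_add[OF C1a C1b] unfolding \<psi>_def[abs_def] by blast
 then obtain E where \<psi>C: "has_C1 \<psi> E" by blast
 have div: "divergence \<psi> x = (1 - \<zeta> x) * divergence \<phi> x + \<zeta> x * divergence \<xi> x + (\<Sum>i\<in>UNIV. G x $ i * (\<xi> x $ i - \<phi> x $ i))" for x
 proof -
  have "divergence \<psi> x = divergence (%x. (1 - \<zeta> x) *\<^sub>R \<phi> x) x + divergence (%x. \<zeta> x *\<^sub>R \<xi> x) x"
  unfolding \<psi>_def[abs_def] by (rule divergence_add[OF C1a C1b])
  thus ?thesis unfolding divergence_scaleR[OF \<zeta>1 \<phi>(1)] divergence_scaleR[OF \<zeta>(1) \<xi>C]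
  by (simp add: inner_axis sum_subtractf sum_negf algebra_simps)
 qed
 define K' where "K' = J \<union> (nbhd J \<delta> \<inter> N5)"
 have K'c: "compact K'" unfolding K'_def using \<phi>(2) N5c compact_nbhd[OF \<phi>(2)] by (intro compact_Un compact_Int)
 have \<psi>t: "\<psi> : test_fields (S - K)"
 proof (rule test_fieldI[OF \<psi>C K'c])
  show "K' <= S - K"
  proof
  fix x assume x: "x : K'"
  have "x : S" using x \<phi>(3) N by (auto simp: K'_def N5_def)
  moreover have "x ~: K"
  proof
   assume xK: "x : K"
   obtain y where y: "y : J" "dist y x <= \<delta>" using x d by (auto simp: K'_def mem_nbhd)
   hence "y : nbhd K d" using xK d by (auto simp: mem_nbhd dist_commute intro!: bexI[of _ x])
   thus False using y \<phi>(3) by auto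
  qed
  ultimately show "x : S - K" by simp
  qed
  show "\<psi> x = 0" if "x ~: K'" for x
  proof -
  have "\<phi> x = 0" using that \<phi>(4) by (simp add: K'_def)
  moreover have "\<zeta> x = 0 \<or> \<xi> x = 0" using that \<zeta>z \<xi>z by (auto simp: K'_def)
  ultimately show ?thesis by (auto simp: \<psi>_def)
  qed
  show "norm (\<psi> x) <= 1" for x
  proof -
  have "norm (\<psi> x) <= norm ((1 - \<zeta> x) *\<^sub>R \<phi> x) + norm (\<zeta> x *\<^sub>R \<xi> x)" unfolding \<psi>_def by (rule norm_triangle_ineq)
  also have "... = (1 - \<zeta> x) * norm (\<phi> x) + \<zeta> x * norm (\<xi> x)" using \<zeta>(3,4)[of x] by simp
  also have "... <= (1 - \<zeta> x) * 1 + \<zeta> x * 1" using \<zeta>(3,4)[of x] \<phi>(5)[of x] \<xi>n[of x] by (intro add_mono mult_left_mono) auto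
  finally show ?thesis by simp
  qed
 qed
 obtain C where C: "!!x. \<bar>divergence \<phi> x\<bar> <= C"
  using continuous_bounded_support(1)[OF divc, of rJ] dz rJ by auto
 have i1: "L1 (%x. u x * divergence \<phi> x)" by (rule Lp_times_divergence[OF q u \<phi>(1,2,4)])
 have i2: "L1 (%x. w x * divergence \<phi> x)"
 proof -
  have "L1 (%x. u x * (\<zeta> x * divergence \<phi> x))"
  by (rule Lp_times_continuous[OF q u, of _ r5]) (use \<zeta>z r5 in \<open>auto intro!: continuous_intros \<zeta>c divc\<close>)
  thus ?thesis by (simp add: w mult_ac)
 qed
 have i3: "L1 (%x. conv k w x * divergence \<phi> x)"
  by (rule continuous_bounded_support(2)[of _ rJ])
   (use dz rJ in \<open>auto intro!: continuous_intros divc has_C1_continuous[OF conv_has_C1[OF mol wi]]\<close>)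
 have i4: "L1 (%x. w x * divergence \<xi> x)"
 proof -
  have "L1 (%x. u x * (\<zeta> x * divergence \<xi> x))"
  by (rule Lp_times_continuous[OF q u, of _ r5]) (use \<zeta>z r5 in \<open>auto intro!: continuous_intros \<zeta>c divergence_continuous[OF \<xi>C]\<close>)
  thus ?thesis by (simp add: w mult_ac)
 qed
 have i5: "L1 (%x. u x * G x $ i * \<xi> x $ i)" "L1 (%x. u x * G x $ i * \<phi> x $ i)" for i
 proof -
  have "L1 (%x. u x * (G x $ i * \<xi> x $ i))"
  by (rule Lp_times_continuous[OF q u, of _ r5]) (use Gz r5 in \<open>auto intro!: continuous_intros Gc \<xi>c\<close>)
  thus "L1 (%x. u x * G x $ i * \<xi> x $ i)" by (simp add: mult_ac)
  have "L1 (%x. u x * (G x $ i * \<phi> x $ i))"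
  by (rule Lp_times_continuous[OF q u, of _ r5]) (use Gz r5 in \<open>auto intro!: continuous_intros Gc \<phi>c\<close>)
  thus "L1 (%x. u x * G x $ i * \<phi> x $ i)" by (simp add: mult_ac)
 qed
 \<comment> \<open>Mollifying \<open>w\<close> is the same as mollifying the field against which it
   is tested.\<close>
 have A: "(LINT x|lborel. conv k w x * divergence \<phi> x) = (LINT x|lborel. w x * divergence \<xi> x)"
 proof -
  have "pairing (conv k w) \<phi> = - (LINT x|lborel. gconv g w x \<bullet> \<phi> x)"
  by (rule pairing_cutoff[OF conv_gradient[OF mol wi] \<phi>(1), of rJ]) (use rJ \<phi>(4) in auto)
  also have "... = pairing w \<xi>" unfolding \<xi>_def by (rule pairing_conv[OF mol wi \<phi>i, symmetric])
  finally show ?thesis by (simp add: pairing_def)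
 qed
 have pv: "pairing (%x. u x + (conv k w x - w x)) \<phi> = (LINT x|lborel. u x * divergence \<phi> x) + (LINT x|lborel. w x * divergence \<xi> x) - (LINT x|lborel. w x * divergence \<phi> x)"
 proof -
  have "pairing (%x. u x + (conv k w x - w x)) \<phi> = (LINT x|lborel. u x * divergence \<phi> x + conv k w x * divergence \<phi> x - w x * divergence \<phi> x)"
  unfolding pairing_def by (intro Bochner_Integration.integral_cong refl) (simp add: algebra_simps)
  thus ?thesis using i1 i2 i3 by (simp add: A)
 qed
 have pu: "pairing u \<psi> = (LINT x|lborel. u x * divergence \<phi> x) - (LINT x|lborel. w x * divergence \<phi> x) + (LINT x|lborel. w x * divergence \<xi> x)
  + (\<Sum>i\<in>UNIV. (LINT x|lborel. u x * G x $ i * \<xi> x $ i) - (LINT x|lborel. u x * G x $ i * \<phi> x $ i))"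
 proof -
  have "pairing u \<psi> = (LINT x|lborel. u x * divergence \<phi> x - w x * divergence \<phi> x + w x * divergence \<xi> x
   + (\<Sum>i\<in>UNIV. u x * G x $ i * \<xi> x $ i - u x * G x $ i * \<phi> x $ i))"
  unfolding pairing_def div by (intro Bochner_Integration.integral_cong refl) (simp add: w algebra_simps sum_distrib_left sum_subtractf)
  thus ?thesis using i1 i2 i4 i5 by simp
 qed
 \<comment> \<open>The commutator. By self-adjointness the difference between \<phi> and its
   mollification, tested with \<open>u x * G x $ i\<close>, becomes the mollification error of that
   product, which is small in L1.\<close>
 have diff: "(LINT x|lborel. u x * G x $ i * \<phi> x $ i) - (LINT x|lborel. u x * G x $ i * \<xi> x $ i) <= \<eta> i" for i
 proof -
  have \<phi>ii: "L1 (%x. \<phi> x $ i)" by (rule integrable_bounded_linear[OF bounded_linear_vec_nth \<phi>i])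
  have "(LINT x|lborel. u x * G x $ i * \<xi> x $ i) = (LINT x|lborel. (u x * G x $ i) * conv k (%y. \<phi> y $ i) x)"
  by (simp add: \<xi>_def conv_component[OF mol \<phi>i])
  also have "... = (LINT x|lborel. conv k (%y. u y * G y $ i) x * \<phi> x $ i)" by (rule conv_swap[OF mol wi_i \<phi>ii])
  finally have sw: "(LINT x|lborel. u x * G x $ i * \<xi> x $ i) = (LINT x|lborel. conv k (%y. u y * G y $ i) x * \<phi> x $ i)" .
  have ic: "L1 (%x. conv k (%y. u y * G y $ i) x * \<phi> x $ i)"
  by (rule continuous_bounded_support(2)[of _ rJ])
   (use \<phi>(4) rJ in \<open>auto intro!: continuous_intros \<phi>c has_C1_continuous[OF conv_has_C1[OF mol wi_i]]\<close>)
  have "(LINT x|lborel. u x * G x $ i * \<phi> x $ i) - (LINT x|lborel. u x * G x $ i * \<xi> x $ i) =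
  (LINT x|lborel. u x * G x $ i * \<phi> x $ i - conv k (%y. u y * G y $ i) x * \<phi> x $ i)"
  unfolding sw using i5 ic by simp
  also have "... <= (LINT x|lborel. \<bar>conv k (%y. u y * G y $ i) x - u x * G x $ i\<bar>)"
  proof (rule integral_mono)
  show "L1 (%x. u x * G x $ i * \<phi> x $ i - conv k (%y. u y * G y $ i) x * \<phi> x $ i)" using i5 ic by simp
  show "L1 (%x. \<bar>conv k (%y. u y * G y $ i) x - u x * G x $ i\<bar>)" using err by (intro integrable_abs) blast
  fix x
  have "u x * G x $ i * \<phi> x $ i - conv k (%y. u y * G y $ i) x * \<phi> x $ i <= \<bar>(u x * G x $ i - conv k (%y. u y * G y $ i) x) * \<phi> x $ i\<bar>"
   unfolding left_diff_distrib by linarith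
  also have "... <= \<bar>u x * G x $ i - conv k (%y. u y * G y $ i) x\<bar> * 1"
   unfolding abs_mult[of "u x * G x $ i - conv k (%y. u y * G y $ i) x"]
   using component_le_norm_cart[of "\<phi> x" i] \<phi>(5)[of x] by (intro mult_left_mono) auto
  finally show "u x * G x $ i * \<phi> x $ i - conv k (%y. u y * G y $ i) x * \<phi> x $ i <= \<bar>conv k (%y. u y * G y $ i) x - u x * G x $ i\<bar>"
   by (simp add: abs_minus_commute)
  qed
  also have "... <= \<eta> i" using err by blast
  finally show ?thesis .
 qed
 have "(\<Sum>i\<in>UNIV. (LINT x|lborel. u x * G x $ i * \<phi> x $ i) - (LINT x|lborel. u x * G x $ i * \<xi> x $ i)) <= (\<Sum>i\<in>UNIV. \<eta> i)"
  by (intro sum_mono diff)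
 hence "pairing (%x. u x + (conv k w x - w x)) \<phi> <= pairing u \<psi> + (\<Sum>i\<in>UNIV. \<eta> i)"
  unfolding pv pu by (simp add: sum_subtractf)
 hence "ennreal (pairing (%x. u x + (conv k w x - w x)) \<phi>) <= ennreal (pairing u \<psi> + (\<Sum>i\<in>UNIV. \<eta> i))" by (rule ennreal_leI)
 also have "... <= ennreal (pairing u \<psi>) + ennreal (\<Sum>i\<in>UNIV. \<eta> i)" by (rule ennreal_plus_le)
 also have "ennreal (pairing u \<psi>) <= total_variation (S - K) u"
  unfolding total_variation_lborel[OF oB um] using \<psi>t by (rule SUP_upper)
 finally show ?thesis by (simp add: add_right_mono)
 qed
 thus ?thesis unfolding total_variation_lborel[OF oA vm] by (rule SUP_least)
qed

section \<open>Upper bound: cubes in the smooth region and the recovery function\<close>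

lemma integrable_lebesgue_on_iff:
 fixes u :: "real^'n => real"
 assumes [measurable]: "Q : sets borel" "u : borel_fun"
 shows "integrable (lebesgue_on Q) u \<longleftrightarrow> L1 (%x. indicator Q x * u x)"
proof -
 have "integrable (lebesgue_on Q) u \<longleftrightarrow> integrable lebesgue (%x. indicator Q x *\<^sub>R u x)"
 by (rule integrable_restrict_space) simp
 also have "... \<longleftrightarrow> L1 (%x. indicator Q x *\<^sub>R u x)" by (rule integrable_completion) measurable
 finally show ?thesis by simp
qed

lemma integrable_bounded_on:
 fixes h :: "real^'n => real"
 assumes Q: "Q : sets borel" "bounded Q" and h: "h : borel_fun" "!!x. x : Q ==> \<bar>h x\<bar> <= C"
 shows "L1 (%x. indicator Q x * h x)"
proof -
 have "L1 (%x. indicator Q x *\<^sub>R h x)"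
 by (rule integrableI_bounded_set_indicator[where B=C])
  (use Q h emeasure_bounded_finite[OF Q(2)] in auto)
 thus ?thesis by simp
qed

lemma rcube_integral:
 fixes h :: "real^'n => real"
 assumes R: "orth R" and h: "h : borel_fun"
 shows "(LINT x|lborel. indicator (rcube c R \<e>) x * h x) = (LINT z|lborel. indicator (cube0 \<e>) z * h (c + R z))"
proof -
 note [measurable] = rcube_meas[OF R] h
 have "(LINT x|lborel. indicator (rcube c R \<e>) (c + R x) * h (c + R x)) = (LINT x|lborel. indicator (rcube c R \<e>) x * h x)"
 by (rule integral_rigid(1)[OF R]) measurable
 thus ?thesis by (simp add: rcube_indicator[OF R])
qed

lemma cube0_bounded: "bounded (cube0 \<e> :: (real^'n) set)"
 by (simp add: cube0_def)

lemma cube0_uminus: "- z : cube0 \<e> \<longleftrightarrow> z : cube0 \<e>"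
 by (simp add: mem_cube0)

lemma cube0_odd_integral:
 fixes h :: "real^'n => real"
 assumes h: "h : borel_fun" and odd: "!!z. h (- z) = - h z"
 shows "(LINT z|lborel. indicator (cube0 \<e>) z * h z) = 0"
proof -
 note [measurable] = h
 have "(LINT z|lborel. indicator (cube0 \<e>) (0 - z) * h (0 - z)) = (LINT z|lborel. indicator (cube0 \<e>) z * h z)"
 using integral_reflect_shift[of "%z. indicator (cube0 \<e>) z * h z" 0] by simp
 moreover have "indicator (cube0 \<e>) (0 - z) * h (0 - z) = - (indicator (cube0 \<e>) z * h z)" for z
 by (simp add: odd indicator_def cube0_uminus)
 ultimately show ?thesis by simp
qed

lemma orthogonal_pullback:
 fixes R :: "real^'n => real^'n"
 assumes R: "orth R"
 obtains p where "R p = G" "norm p = norm G" "!!z. G \<bullet> R z = p \<bullet> z"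
proof -
 obtain p where p: "R p = G" using orthogonal_transformation_surj[OF R] by (metis surjD)
 show ?thesis
 proof (rule that[OF p])
 show "norm p = norm G" using orthogonal_transformation_norm[OF R, of p] p by simp
 show "G \<bullet> R z = p \<bullet> z" for z using R p by (auto simp: orthogonal_transformation_def)
 qed
qed

lemma rcube_linear_integral:
 fixes G :: "real^'n"
 assumes R: "orth R" and e: "\<e> > 0"
 shows "(LINT x|lborel. indicator (rcube c R \<e>) x * (G \<bullet> (x - c))) = 0"
 and "(LINT x|lborel. indicator (rcube c R \<e>) x * \<bar>G \<bullet> (x - c)\<bar>) <= \<e> ^ CARD('n) * (\<e> * norm G / 4)"
proof -
 obtain p where p: "R p = G" "norm p = norm G" "!!z. G \<bullet> R z = p \<bullet> z" using orthogonal_pullback[OF R] by blast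
 have "(LINT x|lborel. indicator (rcube c R \<e>) x * (G \<bullet> (x - c))) = (LINT z|lborel. indicator (cube0 \<e>) z * (p \<bullet> z))"
 by (subst rcube_integral[OF R]) (simp_all add: p(3))
 also have "... = 0" by (rule cube0_odd_integral) auto
 finally show "(LINT x|lborel. indicator (rcube c R \<e>) x * (G \<bullet> (x - c))) = 0" .
 have "(LINT x|lborel. indicator (rcube c R \<e>) x * \<bar>G \<bullet> (x - c)\<bar>) = (LINT z|lborel. indicator (cube0 \<e>) z * \<bar>p \<bullet> z\<bar>)"
 by (subst rcube_integral[OF R]) (simp_all add: p(3))
 also have "... <= \<e> ^ CARD('n) * (\<e> * norm p / 4)" by (rule cube0_abs_inner_le[OF e])
 finally show "(LINT x|lborel. indicator (rcube c R \<e>) x * \<bar>G \<bullet> (x - c)\<bar>) <= \<e> ^ CARD('n) * (\<e> * norm G / 4)" by (simp add: p(2))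
qed

lemma conv_bound:
 fixes w :: "real^'n => real"
 assumes mol: "mollifier \<delta> k g L" and w: "L1 w"
 shows "\<bar>conv k w x\<bar> <= L * (LINT y|lborel. \<bar>w y\<bar>)"
proof -
 have [measurable]: "k : borel_fun" by (rule mollifier_meas[OF mol])
 have "norm (LINT y|lborel. k (x - y) *\<^sub>R w y) <= L * (LINT y|lborel. norm (w y))"
 by (rule norm_integral_scaleR_le[OF mol w]) (use mollifierD(3,4)[OF mol] in auto)
 thus ?thesis by (simp add: conv_def)
qed

lemma cube_taylor:
 fixes w :: "real^'n => real"
 assumes mol: "mollifier \<delta> k g L" and w: "L1 w" and R: "orth R" and x: "x : rcube c R \<e>"
 and M: "M = L * (LINT y|lborel. \<bar>w y\<bar>)"
 shows "\<bar>conv k w x - conv k w c - gconv g w c \<bullet> (x - c)\<bar> <= M * (real CARD('n) * \<e> / 2)\<^sup>2"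
 and "norm (gconv g w c - gconv g w x) <= M * (real CARD('n) * \<e> / 2)"
proof -
 have M0: "M >= 0" using mollifierD(2)[OF mol] by (simp add: M)
 have xc: "norm (x - c) <= real CARD('n) * \<e> / 2" by (rule rcube_center_dist[OF R x])
 have "\<bar>conv k w x - conv k w c - gconv g w c \<bullet> (x - c)\<bar> <= M * (norm (x - c))\<^sup>2" unfolding M by (rule conv_taylor[OF mol w])
 also have "... <= M * (real CARD('n) * \<e> / 2)\<^sup>2" using xc M0 by (intro mult_left_mono power_mono) auto
 finally show "\<bar>conv k w x - conv k w c - gconv g w c \<bullet> (x - c)\<bar> <= M * (real CARD('n) * \<e> / 2)\<^sup>2" .
 have "norm (gconv g w c - gconv g w x) <= M * norm (c - x)" unfolding M by (rule gconv_lipschitz[OF mol w])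
 also have "... <= M * (real CARD('n) * \<e> / 2)" using xc M0 by (intro mult_left_mono) (auto simp: norm_minus_commute)
 finally show "norm (gconv g w c - gconv g w x) <= M * (real CARD('n) * \<e> / 2)" .
qed

text \<open>The power of \<open>\<e>\<close> in front and the factor \<open>\<e>\<close> of the
  moment bound combine to the volume of the cube. A quarter of the volume times the gradient at the
  centre remains and is replaced by the integral of the gradient, at the cost of its Lipschitz
  constant. \<open>M\<close> bounds the function, the gradient, that constant and the Taylor
  remainder alike.\<close>

lemma smooth_cube_upper:
 fixes u w :: "real^'n => real"
 assumes mol: "mollifier \<delta> k g L" and w: "L1 w" and Q: "Q : cubes \<e>" and e: "\<e> > 0"
 and u: "u : borel_fun" "!!x. x : Q ==> u x = conv k w x" and M: "M = L * (LINT y|lborel. \<bar>w y\<bar>)"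
 shows "\<e> ^ (CARD('n) - 1) * mosc Q u <= 1/4 * (LINT x|lborel. indicator Q x * norm (gconv g w x)) + (real CARD('n))\<^sup>2 * M * \<e> * \<e> ^ CARD('n)"
proof -
 obtain c R where R: "orth R" and Qr: "Q = rcube c R \<e>" using Q cubes_rcube by blast
 note [measurable] = u(1)
 have Qm [measurable]: "Q : sets borel" unfolding Qr by (rule rcube_meas[OF R])
 have Qb: "bounded Q" unfolding Qr by (rule rcube_bounded[OF R])
 define n where "n = real CARD('n)"
 have n1: "n >= 1" by (simp add: n_def Suc_leI)
 define V where "V = \<e> ^ CARD('n)"
 have V: "V > 0" "measure lborel Q = V" using e by (simp_all add: V_def Qr measure_rcube[OF R])
 have M0: "M >= 0" using mollifierD(2)[OF mol] by (simp add: M)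
 define G where "G = gconv g w"
 have Gm [measurable]: "G : borel_fun" unfolding G_def by (rule borel_measurable_continuous_onI[OF gconv_continuous[OF mol w]])
 define l where "l x = G c \<bullet> (x - c)" for x
 have lm [measurable]: "l : borel_fun" unfolding l_def by measurable
 note QL = cube_lmeasurable(1,3)[OF Q e]
 have ui: "integrable (lebesgue_on Q) u"
 unfolding integrable_lebesgue_on_iff[OF Qm u(1)]
 by (rule integrable_bounded_on[OF Qm Qb u(1), of M]) (use conv_bound[OF mol w] u(2) M in auto)
 have lb: "\<bar>l x\<bar> <= norm (G c) * (n * \<e> / 2)" if "x : Q" for x
 proof -
 have "\<bar>l x\<bar> <= norm (G c) * norm (x - c)" unfolding l_def by (rule Cauchy_Schwarz_ineq2)
 also have "... <= norm (G c) * (n * \<e> / 2)" using rcube_center_dist[OF R, of x c \<e>] that by (intro mult_left_mono) (auto simp: Qr n_def)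
 finally show ?thesis .
 qed
 have li: "integrable (lebesgue_on Q) l"
 unfolding integrable_lebesgue_on_iff[OF Qm lm] by (rule integrable_bounded_on[OF Qm Qb lm lb])
 have l0: "average Q l = 0"
 unfolding average_lborel[OF Qm lm] using rcube_linear_integral(1)[OF R e, of c "G c"] by (simp add: l_def Qr)
 have la: "average Q (%x. \<bar>l x\<bar>) <= \<e> * norm (G c) / 4"
 proof -
 have "average Q (%x. \<bar>l x\<bar>) = (LINT x|lborel. indicator Q x * \<bar>l x\<bar>) / V"
  using V by (simp add: average_lborel)
 also have "... <= (V * (\<e> * norm (G c) / 4)) / V"
  using rcube_linear_integral(2)[OF R e, of c "G c"] V by (intro divide_right_mono) (auto simp: l_def Qr V_def)
 finally show ?thesis using V by simp
 qed
 have "mosc Q u <= average Q (%x. \<bar>l x\<bar>) + 2 * (M * (n * \<e> / 2)\<^sup>2)"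
 proof (rule mosc_affine_approx[OF QL ui li l0, of "conv k w c"])
 fix x assume x: "x : Q"
 thus "\<bar>u x - conv k w c - l x\<bar> <= M * (n * \<e> / 2)\<^sup>2"
  using cube_taylor(1)[OF mol w R, of x c \<e> M] M u(2)[OF x] by (simp add: Qr l_def G_def n_def)
 qed
 also have "... <= \<e> * norm (G c) / 4 + 2 * (M * (n * \<e> / 2)\<^sup>2)" using la by simp
 finally have m1: "mosc Q u <= \<e> * norm (G c) / 4 + 2 * (M * (n * \<e> / 2)\<^sup>2)" .
 have iG: "L1 (%x. indicator Q x * norm (G x))"
 proof (rule integrable_bounded_on[OF Qm Qb, of _ M])
 show "(%x. norm (G x)) : borel_fun" by measurable
 show "\<bar>norm (G x)\<bar> <= M" for x using gconv_bound[OF mol w, of x] M by (simp add: G_def)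
 qed
 have iQ: "L1 (indicator Q :: real^'n => real)"
 using emeasure_bounded_finite[OF Qb] by (intro integrable_real_indicator) auto
 have m2: "V * norm (G c) <= (LINT x|lborel. indicator Q x * norm (G x)) + V * (M * (n * \<e> / 2))"
 proof -
 have "V * norm (G c) = (LINT x|lborel. norm (G c) * indicator Q x)" using V(2) by simp
 also have "... <= (LINT x|lborel. indicator Q x * norm (G x) + (M * (n * \<e> / 2)) * indicator Q x)"
 proof (rule integral_mono)
  fix x
  show "norm (G c) * indicator Q x <= indicator Q x * norm (G x) + (M * (n * \<e> / 2)) * indicator Q x"
  proof (cases "x : Q")
  case True
  have "norm (G c) <= norm (G x) + norm (G c - G x)" using norm_triangle_sub by blast
  thus ?thesis using cube_taylor(2)[OF mol w R, of x c \<e> M] M True by (simp add: Qr G_def n_def)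
  qed simp
 qed (use iQ iG in auto)
 also have "... = (LINT x|lborel. indicator Q x * norm (G x)) + V * (M * (n * \<e> / 2))" using iQ iG V(2) by simp
 finally show ?thesis .
 qed
 have "CARD('n) = Suc (CARD('n) - 1)" by simp
 hence Ve: "\<e> ^ (CARD('n) - 1) * \<e> = V" unfolding V_def by (metis power_Suc mult.commute)
 have "\<e> ^ (CARD('n) - 1) * mosc Q u <= \<e> ^ (CARD('n) - 1) * (\<e> * norm (G c) / 4 + 2 * (M * (n * \<e> / 2)\<^sup>2))"
 using e by (intro mult_left_mono m1) auto
 also have "... = (\<e> ^ (CARD('n) - 1) * \<e>) * (norm (G c) / 4 + M * n\<^sup>2 * \<e> / 2)"
 by (simp add: power2_eq_square algebra_simps)
 also have "... = V * norm (G c) / 4 + V * (M * n\<^sup>2 * \<e> / 2)" unfolding Ve by (simp add: algebra_simps)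
 also have "... <= ((LINT x|lborel. indicator Q x * norm (G x)) + V * (M * (n * \<e> / 2))) / 4 + V * (M * n\<^sup>2 * \<e> / 2)"
 using m2 by (intro add_right_mono divide_right_mono) auto
 also have "... = 1/4 * (LINT x|lborel. indicator Q x * norm (G x)) + V * M * \<e> * (n / 8 + n\<^sup>2 / 2)" by (simp add: algebra_simps)
 also have "... <= 1/4 * (LINT x|lborel. indicator Q x * norm (G x)) + V * M * \<e> * n\<^sup>2"
 proof (intro add_left_mono mult_left_mono)
 have "n * 1 <= n * n" using n1 by (intro mult_left_mono) auto
 thus "n / 8 + n\<^sup>2 / 2 <= n\<^sup>2" using n1 unfolding power2_eq_square by linarith
 qed (use V M0 e in auto)
 finally show ?thesis by (simp add: G_def n_def V_def mult_ac)
qed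

lemma disjoint_family_integral_le:
 fixes h :: "real^'n => real"
 assumes fin: "finite \<G>" and d: "pairwise disjnt \<G>" and Q: "!!Q. Q : \<G> ==> Q : sets borel" "!!Q. Q : \<G> ==> Q <= A"
 and h: "!!x. h x >= 0" "L1 (%x. indicator A x * h x)" "h : borel_fun"
 shows "(\<Sum>Q\<in>\<G>. LINT x|lborel. indicator Q x * h x) <= (LINT x|lborel. indicator A x * h x)"
proof -
 note [measurable] = h(3)
 have i: "L1 (%x. indicator Q x * h x)" if "Q : \<G>" for Q
 proof (rule Bochner_Integration.integrable_bound[OF h(2)])
 show "(%x. indicator Q x * h x) : borel_measurable lborel" using Q(1)[OF that] by measurable
 show "AE x in lborel. norm (indicator Q x * h x) <= norm (indicator A x * h x)"
  using Q(2)[OF that] h(1) by (intro AE_I2) (auto simp: indicator_def)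
 qed
 have dj: "disjoint_family_on (%Q. Q) \<G>" using d by (auto simp: disjoint_family_on_def pairwise_def disjnt_def)
 have "(\<Sum>Q\<in>\<G>. LINT x|lborel. indicator Q x * h x) = (LINT x|lborel. (\<Sum>Q\<in>\<G>. indicator Q x * h x))"
 using i by (intro Bochner_Integration.integral_sum[symmetric])
 also have "... <= (LINT x|lborel. indicator A x * h x)"
 proof (rule integral_mono[OF _ h(2)])
 show "L1 (%x. \<Sum>Q\<in>\<G>. indicator Q x * h x)" using i by (intro Bochner_Integration.integrable_sum)
 fix x
 have "(\<Sum>Q\<in>\<G>. indicator Q x * h x) = indicator (\<Union>Q\<in>\<G>. Q) x * h x"
  unfolding sum_distrib_right[symmetric] indicator_UN_disjoint[OF fin dj] by (rule refl)
 also have "... <= indicator A x * h x" using Q(2) h(1) by (intro mult_right_mono) (auto simp: indicator_def)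
 finally show "(\<Sum>Q\<in>\<G>. indicator Q x * h x) <= indicator A x * h x" .
 qed
 finally show ?thesis .
qed

lemma finite_familiesD:
 assumes "\<G> : finite_families \<e> S"
 shows "finite \<G>" "!!Q. Q : \<G> ==> Q : cubes \<e>" "!!Q. Q : \<G> ==> Q <= S" "pairwise disjnt \<G>"
 using assms by (auto simp: finite_families_def cube_families_def)

lemma cube_diameter:
 assumes Q: "Q : cubes \<e>" and x: "x : Q" "y : (Q :: (real^'n) set)"
 shows "dist x y <= real CARD('n) * \<e>"
proof -
 obtain c R where R: "orth R" "Q = rcube c R \<e>" using Q cubes_rcube by blast
 have "norm (x - c) <= real CARD('n) * \<e> / 2" "norm (y - c) <= real CARD('n) * \<e> / 2"
 using rcube_center_dist[OF R(1)] x R(2) by auto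
 thus ?thesis using norm_triangle_ineq4[of "x - c" "y - c"] by (simp add: dist_norm)
qed

text \<open>The errors are proportional to the volumes of the cubes, so disjointness bounds their
  sum by the volume of \<open>A\<close>.\<close>

lemma cubes_near_smooth:
 fixes v w :: "real^'n => real"
 assumes mol: "mollifier \<delta> k g L" and w: "L1 w" and v: "v : borel_fun" "!!x. x : A ==> v x = conv k w x"
 and A: "compact A" and \<G>: "\<G> : finite_families \<e> A" and e: "\<e> > 0" and M: "M = L * (LINT y|lborel. \<bar>w y\<bar>)"
 shows "(\<Sum>Q\<in>\<G>. \<e> ^ (CARD('n) - 1) * mosc Q v) <= 1/4 * (LINT x|lborel. indicator A x * norm (gconv g w x)) + (real CARD('n))\<^sup>2 * M * \<e> * measure lborel A"
proof -
 note F = finite_familiesD[OF \<G>]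
 have Am: "A : sets borel" by (intro borel_closed compact_imp_closed A)
 have Qm: "Q : sets borel" if "Q : \<G>" for Q using cube_lmeasurable(4)[OF F(2)[OF that] e] by simp
 have M0: "M >= 0" using mollifierD(2)[OF mol] by (simp add: M)
 have Gc: "continuous_on UNIV (gconv g w)" by (rule gconv_continuous[OF mol w])
 have Gm [measurable]: "gconv g w : borel_fun" by (rule borel_measurable_continuous_onI[OF Gc])
 have iA: "L1 (%x. indicator A x * norm (gconv g w x))"
 by (rule integrable_bounded_on[OF Am compact_imp_bounded[OF A], of _ M]) (use gconv_bound[OF mol w] M in auto)
 have i1: "L1 (%x. indicator A x * (1::real))"
 by (rule integrable_bounded_on[OF Am compact_imp_bounded[OF A], of _ 1]) auto
 have V: "\<e> ^ CARD('n) = (LINT x|lborel. indicator Q x * (1::real))" if "Q : \<G>" for Q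
 using cube_lmeasurable(2)[OF F(2)[OF that] e] Qm[OF that] by (simp add: measure_lebesgue_lborel)
 have "(\<Sum>Q\<in>\<G>. \<e> ^ (CARD('n) - 1) * mosc Q v) <= (\<Sum>Q\<in>\<G>. 1/4 * (LINT x|lborel. indicator Q x * norm (gconv g w x)) + (real CARD('n))\<^sup>2 * M * \<e> * (LINT x|lborel. indicator Q x * (1::real)))"
 proof (rule sum_mono)
 fix Q assume Q: "Q : \<G>"
 show "\<e> ^ (CARD('n) - 1) * mosc Q v <= 1/4 * (LINT x|lborel. indicator Q x * norm (gconv g w x)) + (real CARD('n))\<^sup>2 * M * \<e> * (LINT x|lborel. indicator Q x * (1::real))"
  unfolding V[OF Q, symmetric] by (rule smooth_cube_upper[OF mol w F(2)[OF Q] e v(1) _ M]) (use v(2) F(3)[OF Q] in auto)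
 qed
 also have "... = 1/4 * (\<Sum>Q\<in>\<G>. LINT x|lborel. indicator Q x * norm (gconv g w x)) + (real CARD('n))\<^sup>2 * M * \<e> * (\<Sum>Q\<in>\<G>. LINT x|lborel. indicator Q x * (1::real))"
 by (simp only: sum.distrib sum_distrib_left)
 also have "... <= 1/4 * (LINT x|lborel. indicator A x * norm (gconv g w x)) + (real CARD('n))\<^sup>2 * M * \<e> * (LINT x|lborel. indicator A x * (1::real))"
 using M0 e by (intro add_mono mult_left_mono disjoint_family_integral_le[OF F(1,4) Qm F(3)] iA i1) auto
 also have "(LINT x|lborel. indicator A x * (1::real)) = measure lborel A" by simp
 finally show ?thesis .
qed

text \<open>\<open>v\<close> is chosen before \<open>\<e>\<close>. The cubes of a family are split
  according to whether they meet \<open>nbhd K d\<close>: those that do lie where \<open>v\<close>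
  is smooth, the others see only the variation away from \<open>K\<close>. That variation is made
  small relative to the Poincare constant, which therefore does not spoil the factor 1/4.\<close>

theorem recovery:
 fixes u :: "real^'n => real"
 assumes q: "q > 1" and u: "u : Lp q lborel" and S: "open S" and fin: "total_variation S u < \<infinity>" and \<eta>: "\<eta> > 0"
 obtains v where "v : Lp q lborel" "Lpow q lborel (%x. v x - u x) < \<eta>"
 "\<forall>\<^sub>F \<e> in at_right 0. K_fun \<e> S v <= ennreal (1/4) * total_variation S u + ennreal \<eta>"
proof -
 have um [measurable]: "u : borel_fun" using u by (simp add: Lp_def)
 define P where "P = poincare_const TYPE('n)"
 have P0: "P >= 0" unfolding P_def by (rule poincare_const_nonneg)
 \<comment> \<open>The variation of \<open>v\<close> outside will be at most
   \<open>2 * \<eta>1\<close>; multiplied by the Poincare constant this is at most \<eta> /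
   2.\<close>
 define \<eta>1 where "\<eta>1 = \<eta> / (4 * (P + 1))"
 have \<eta>1: "\<eta>1 > 0" using \<eta> P0 by (simp add: \<eta>1_def)
 obtain V where V: "total_variation S u = ennreal V" "V >= 0" using fin by (cases "total_variation S u") auto
 obtain \<phi>0 where \<phi>0: "\<phi>0 : test_fields S" "V - \<eta>1 < pairing u \<phi>0"
 proof (cases "V - \<eta>1 < 0")
 case True
 have "pairing u (%x. 0) = 0" unfolding pairing_def using divergence_eq[OF has_C1_const[of "0::real^'n"]] by simp
 thus ?thesis using that[OF zero_test_field] True by simp
 next
 case False
 have "ennreal (V - \<eta>1) < (SUP \<phi>\<in>test_fields S. ennreal (pairing u \<phi>))"
  unfolding total_variation_lborel[OF S um, symmetric] V(1) using False \<eta>1 by (simp add: ennreal_less_iff)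
 then obtain \<phi> where "\<phi> : test_fields S" "ennreal (V - \<eta>1) < ennreal (pairing u \<phi>)" unfolding less_SUP_iff by blast
 thus ?thesis using that False by (simp add: ennreal_less_iff)
 qed
 obtain D K where K: "has_C1 \<phi>0 D" "compact K" "K <= S" "!!x. x ~: K ==> \<phi>0 x = 0" "!!x. norm (\<phi>0 x) <= 1"
 using \<phi>0(1) by (rule test_fieldD) blast
 have oK: "open (S - K)" by (intro open_Diff S compact_imp_closed K)
 \<comment> \<open>A field supported off \<open>K\<close> can be added to the nearly optimal
   \<phi>0; if its pairing exceeded \<eta>1, the sum would exceed the total variation.\<close>
 have tail: "total_variation (S - K) u <= ennreal \<eta>1"
 unfolding total_variation_lborel[OF oK um]
 proof (rule SUP_least, rule ennreal_leI)
 fix \<psi> assume \<psi>: "\<psi> : test_fields (S - K)"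
 obtain D2 J where J: "has_C1 \<psi> D2" "compact J" "J <= S - K" "!!x. x ~: J ==> \<psi> x = 0" "!!x. norm (\<psi> x) <= 1"
  using \<psi> by (rule test_fieldD) blast
 have "(%x. \<phi>0 x + \<psi> x) : test_fields S"
 proof (rule test_fieldI[OF has_C1_add[OF K(1) J(1)], of "K \<union> J"])
  show "norm (\<phi>0 x + \<psi> x) <= 1" for x
  proof -
  have "x : K ==> x ~: J" using J(3) by blast
  thus ?thesis using K(4,5)[of x] J(4,5)[of x] by (cases "x : K") auto
  qed
 qed (use K J in auto)
 hence "ennreal (pairing u (%x. \<phi>0 x + \<psi> x)) <= ennreal V"
  unfolding V(1)[symmetric] total_variation_lborel[OF S um] by (rule SUP_upper)
 hence "pairing u \<phi>0 + pairing u \<psi> <= V" using pairing_add[OF q u \<phi>0(1) \<psi>] V(2) by (simp add: ennreal_le_iff)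
 thus "pairing u \<psi> <= \<eta>1" using \<phi>0(2) by simp
 qed
 obtain d0 where d0: "d0 > 0" "nbhd K d0 <= S" using nbhd_subset_open[OF K(2) S K(3)] by blast
 \<comment> \<open>Nested radii around \<open>K\<close>: a cube meeting radius d stays within 2 d,
   hence in \<open>A\<close> of radius 3 d; the \<delta>-neighbourhood of \<open>A\<close> stays
   within 4 d, where \<zeta> = 1; beyond 5 d, still inside \<open>S\<close>, \<zeta>
   vanishes.\<close>
 define d where "d = d0 / 5"
 have d: "d > 0" using d0 by (simp add: d_def)
 have N5: "nbhd K (5 * d) <= S" using d0 by (simp add: d_def)
 have d4: "4 * d + d = 5 * d" "4 * d >= 0" using d by simp_all
 obtain \<zeta> G where \<zeta>: "has_C1 \<zeta> (%x h. G x \<bullet> h)" "continuous_on UNIV G" "!!x. 0 <= \<zeta> x" "!!x. \<zeta> x <= 1"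
 "!!x. x : nbhd K (4 * d) ==> \<zeta> x = 1" "!!x. x ~: nbhd K (5 * d) ==> \<zeta> x = 0"
 using cutoff_exists[OF K(2) d d4(2)] unfolding d4(1) by blast
 define N5 where "N5 = nbhd K (5 * d)"
 have N5c: "compact N5" unfolding N5_def by (rule compact_nbhd[OF K(2)])
 have \<zeta>z: "\<zeta> x = 0" if "x ~: N5" for x using \<zeta>(6) that by (simp add: N5_def)
 obtain r5 where r5: "!!x. norm x > r5 ==> x ~: N5" using compact_norm_bound[OF N5c] by blast
 have \<zeta>c: "continuous_on UNIV \<zeta>" by (rule has_C1_continuous[OF \<zeta>(1)])
 have Gz: "G x $ i = 0" if "x ~: N5" for x i
 proof -
 have "G x \<bullet> axis i 1 = 0"
  by (rule has_C1_zero_on_open[OF \<zeta>(1), of "- N5"]) (use that \<zeta>z N5c compact_imp_closed in auto)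
 thus ?thesis by (simp add: inner_axis)
 qed
 have Gc: "continuous_on UNIV (%x. G x $ i)" for i by (intro continuous_intros \<zeta>(2))
 have LpM: "(%x. \<psi> x * u x) : Lp q lborel" if \<psi>: "continuous_on UNIV \<psi>" "!!x. x ~: N5 ==> \<psi> x = 0" for \<psi>
 proof -
 obtain C where C: "!!x. \<bar>\<psi> x\<bar> <= C" using continuous_bounded_support(1)[OF \<psi>(1), of r5] \<psi>(2) r5 by auto
 have [measurable]: "\<psi> : borel_fun" by (rule borel_measurable_continuous_onI[OF \<psi>(1)])
 have "L1 (%x. \<bar>\<psi> x * u x\<bar> powr q)"
 proof (rule Bochner_Integration.integrable_bound[OF Lp_integrable[OF Lp_cmult[OF u, of C]]])
  show "AE x in lborel. norm (\<bar>\<psi> x * u x\<bar> powr q) <= norm (\<bar>C * u x\<bar> powr q)"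
  proof (rule AE_I2)
  fix x
  have "\<bar>\<psi> x\<bar> <= \<bar>C\<bar>" using C[of x] by linarith
  hence "\<bar>\<psi> x * u x\<bar> <= \<bar>C * u x\<bar>" by (simp add: abs_mult mult_right_mono)
  thus "norm (\<bar>\<psi> x * u x\<bar> powr q) <= norm (\<bar>C * u x\<bar> powr q)" using q by (simp add: powr_mono2)
  qed
 qed measurable
 thus ?thesis by (simp add: Lp_def)
 qed
 define w where "w x = \<zeta> x * u x" for x
 have w: "w : Lp q lborel" unfolding w_def by (rule LpM[OF \<zeta>c \<zeta>z])
 have wz: "w x = 0" if "norm x > r5" for x using \<zeta>z r5[OF that] by (simp add: w_def)
 have N5m: "N5 : sets borel" by (intro borel_closed compact_imp_closed N5c)
 have wi: "L1 w"
 by (rule integrable_of_Lp_bounded_support(1)[OF q w _ N5m compact_imp_bounded[OF N5c]]) (simp add: w_def \<zeta>z)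
 have e2: "\<eta> / 2 > 0" using \<eta> by simp
 obtain d1 where d1: "d1 > 0" "!!\<delta> k g L. mollifier \<delta> k g L ==> \<delta> < d1 ==>
  (%x. conv k w x - w x) : Lp q lborel & Lpow q lborel (%x. conv k w x - w x) <= \<eta> / 2"
 using conv_tendsto_Lp[OF q w wz e2] by blast
 define \<eta>2 where "\<eta>2 = \<eta>1 / real CARD('n)"
 have \<eta>2: "\<eta>2 > 0" using \<eta>1 by (simp add: \<eta>2_def)
 \<comment> \<open>The admissible radius depends on the component of the gradient of \<zeta>; there
   are finitely many, so a minimum over them serves all.\<close>
 define good where "good i d \<longleftrightarrow> d > 0 & (\<forall>\<delta> k g L. mollifier \<delta> k g L --> \<delta> < d -->
  L1 (%x. conv k (%y. u y * G y $ i) x - u x * G x $ i) &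
  (LINT x|lborel. \<bar>conv k (%y. u y * G y $ i) x - u x * G x $ i\<bar>) <= \<eta>2)" for i d
 have "\<exists>d. good i d" for i
 proof -
 have wl: "(%x. u x * G x $ i) : Lp q lborel" using LpM[OF Gc Gz, of i] by (simp add: mult.commute)
 have wlz: "u x * G x $ i = 0" if "norm x > r5" for x using Gz r5[OF that] by simp
 show ?thesis
 proof (rule conv_tendsto_L1[OF q wl wlz \<eta>2])
  fix d' :: real assume "d' > 0" and d': "!!\<delta> k g L. mollifier \<delta> k g L ==> \<delta> < d' ==>
  L1 (%x. conv k (%y. u y * G y $ i) x - u x * G x $ i) &
  (LINT x|lborel. \<bar>conv k (%y. u y * G y $ i) x - u x * G x $ i\<bar>) <= \<eta>2"
  hence "good i d'" unfolding good_def by (intro conjI allI impI) (use d' in auto)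
  thus ?thesis by (rule exI)
 qed
 qed
 hence "\<forall>i. \<exists>d. good i d" by (rule allI)
 then obtain di where "\<forall>i. good i (di i)" using choice by blast
 hence di: "di i > 0" "mollifier \<delta> k g L ==> \<delta> < di i ==>
  L1 (%x. conv k (%y. u y * G y $ i) x - u x * G x $ i) &
  (LINT x|lborel. \<bar>conv k (%y. u y * G y $ i) x - u x * G x $ i\<bar>) <= \<eta>2" for i \<delta> k g L
 unfolding good_def by blast+
 define mi where "mi = Min (range di)"
 define \<delta> where "\<delta> = min d (min d1 mi) / 2"
 have mr: "mi > 0" "mi <= di i" for i using di(1) by (auto simp: mi_def)
 have "\<delta> > 0" using d d1(1) mr(1) by (simp add: \<delta>_def)
 moreover from this have "\<delta> < min d (min d1 mi)" unfolding \<delta>_def by linarith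
 ultimately have \<delta>: "\<delta> > 0" "\<delta> < d" "\<delta> < d1" "\<delta> < di i" for i
 using mr(2)[of i] by auto
 obtain k :: "real^'n => real" and g L where mol: "mollifier \<delta> k g L" using mollifier_exists[OF \<delta>(1)] by blast
 define v where "v x = u x + (conv k w x - w x)" for x
 have vL: "v : Lp q lborel" unfolding v_def using Lp_add[OF q u] d1(2)[OF mol \<delta>(3)] by blast
 have vm: "v : borel_fun" using vL by (simp add: Lp_def)
 have vu: "Lpow q lborel (%x. v x - u x) < \<eta>" using d1(2)[OF mol \<delta>(3)] \<eta> by (simp add: v_def)
 have TV: "total_variation (S - nbhd K d) v <= ennreal (2 * \<eta>1)"
 proof -
 have "total_variation (S - nbhd K d) v <= total_variation (S - K) u + ennreal (\<Sum>i\<in>(UNIV::'n set). \<eta>2)"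
  unfolding v_def[abs_def]
  by (rule total_variation_glue[OF q u S K(2) \<delta>(1,2) N5 \<zeta>(1-4) \<zeta>(6) mol]) (use di(2)[OF mol \<delta>(4)] in \<open>auto simp: w_def\<close>)
 also have "... <= ennreal \<eta>1 + ennreal \<eta>1" by (intro add_mono tail) (simp add: \<eta>2_def)
 also have "... = ennreal (2 * \<eta>1)" using \<eta>1 by (subst ennreal_plus[symmetric]) auto
 finally show ?thesis .
 qed
 define A where "A = nbhd K (3 * d)"
 have Ac: "compact A" unfolding A_def by (rule compact_nbhd[OF K(2)])
 have Am: "A : sets borel" by (intro borel_closed compact_imp_closed Ac)
 have A4: "nbhd A \<delta> <= nbhd K (4 * d)"
 proof
 fix x assume "x : nbhd A \<delta>"
 then obtain y where y: "y : A" "dist y x <= \<delta>" by (auto simp: mem_nbhd)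
 hence "x : nbhd K (3 * d + \<delta>)" unfolding A_def by (intro nbhd_step)
 moreover have "nbhd K (3 * d + \<delta>) <= nbhd K (4 * d)" using \<delta>(2) by (intro nbhd_mono) simp
 ultimately show "x : nbhd K (4 * d)" by blast
 qed
 have "nbhd K (4 * d) <= nbhd K (5 * d)" using d by (intro nbhd_mono) simp
 hence AS: "nbhd A \<delta> <= S" using A4 N5 by blast
 have wu: "w x = u x" if "x : nbhd K (4 * d)" for x using \<zeta>(5)[OF that] by (simp add: w_def)
 have AA: "A <= nbhd A \<delta>" using \<delta>(1) by (intro nbhd_subset) simp
 have vA: "v x = conv k w x" if "x : A" for x using wu AA A4 that by (auto simp: v_def)
 define I where "I = (LINT x|lborel. indicator A x * norm (gconv g w x))"
 have I0: "I >= 0" unfolding I_def by (intro integral_nonneg_AE AE_I2) simp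
 have I: "ennreal I <= total_variation S u" unfolding I_def
 by (rule gradient_le_total_variation[OF mol Ac S AS um wi]) (use wu A4 in auto)
 define M where "M = L * (LINT y|lborel. \<bar>w y\<bar>)"
 have M0: "M >= 0" using mollifierD(2)[OF mol] by (simp add: M_def)
 define C where "C = (real CARD('n))\<^sup>2 * M * measure lborel A"
 have C0: "C >= 0" using M0 by (simp add: C_def)
 \<comment> \<open>The first entry keeps the diameter of the cubes below d, the second keeps the
   Taylor error \<open>C * \<e>\<close> below \<eta> / 2.\<close>
 define e0 where "e0 = min (d / real CARD('n)) (\<eta> / (2 * (C + 1)))"
 have e0: "e0 > 0" using d \<eta> C0 by (simp add: e0_def)
 have "\<forall>\<^sub>F \<e> in at_right 0. K_fun \<e> S v <= ennreal (1/4) * total_variation S u + ennreal \<eta>"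
 unfolding eventually_at_right_field
 proof (intro exI[of _ e0] conjI e0 allI impI)
 fix \<e> :: real assume ep: "\<e> > 0" and ee: "\<e> < e0"
 have ne: "real CARD('n) * \<e> <= d" using ee by (simp add: e0_def field_simps)
 have Ce: "C * \<e> <= \<eta> / 2"
 proof -
  have "C * \<e> <= (C + 1) * (\<eta> / (2 * (C + 1)))" using ee ep C0 by (intro mult_mono) (auto simp: e0_def)
  also have "... = \<eta> / 2" using C0 by (simp add: field_simps)
  finally show ?thesis .
 qed
 let ?c = "\<e> ^ (CARD('n) - 1)"
 show "K_fun \<e> S v <= ennreal (1/4) * total_variation S u + ennreal \<eta>"
  unfolding K_fun_finite
 proof (rule SUP_least)
  fix \<G> :: "(real^'n) set set" assume \<G>: "\<G> : finite_families \<e> S"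
  note F = finite_familiesD[OF \<G>]
  define \<G>1 where "\<G>1 = {Q : \<G>. Q \<inter> nbhd K d ~= {}}"
  define \<G>2 where "\<G>2 = {Q : \<G>. Q \<inter> nbhd K d = {}}"
  have un: "\<G> = \<G>1 \<union> \<G>2" "\<G>1 \<inter> \<G>2 = {}" "finite \<G>1" "finite \<G>2" using F(1) by (auto simp: \<G>1_def \<G>2_def)
  have "Q <= A" if Q: "Q : \<G>1" for Q
  proof
  fix x assume x: "x : Q"
  obtain y where y: "y : Q" "y : nbhd K d" using Q by (auto simp: \<G>1_def)
  have "dist y x <= d" using cube_diameter[OF F(2) y(1) x] Q ne by (auto simp: \<G>1_def)
  hence "x : nbhd K (d + d)" by (rule nbhd_step[OF y(2)])
  moreover have "nbhd K (d + d) <= A" unfolding A_def using d by (intro nbhd_mono) simp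
  ultimately show "x : A" by blast
  qed
  hence G1: "\<G>1 : finite_families \<e> A" using \<G> un(3)
  by (auto simp: finite_families_def cube_families_def \<G>1_def intro: pairwise_subset)
  have s1: "(\<Sum>Q\<in>\<G>1. ?c * mosc Q v) <= 1/4 * I + \<eta> / 2"
  using cubes_near_smooth[OF mol wi vm vA Ac G1 ep M_def] Ce by (simp add: I_def C_def mult_ac)
  have s2: "(\<Sum>Q\<in>\<G>2. ennreal (?c * mosc Q v)) <= ennreal (\<eta> / 2)"
  proof -
  have "(\<Sum>Q\<in>\<G>2. ennreal (?c * mosc Q v)) <= (\<Sum>Q\<in>\<G>2. ennreal P * total_variation Q v)"
   unfolding P_def by (intro sum_mono poincare_cube[OF q vL F(2) ep]) (auto simp: \<G>2_def)
  also have "... = ennreal P * (\<Sum>Q\<in>\<G>2. total_variation Q v)" by (simp add: sum_distrib_left)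
  also have "... <= ennreal P * total_variation (S - nbhd K d) v"
  proof (rule mult_left_mono[OF total_variation_sum[OF q vL un(4)]])
   show "open Q" if "Q : \<G>2" for Q using cube_lmeasurable(4)[OF F(2) ep] that by (auto simp: \<G>2_def)
   show "pairwise disjnt \<G>2" using F(4) by (rule pairwise_subset) (auto simp: \<G>2_def)
   show "open (S - nbhd K d)" by (intro open_Diff S compact_imp_closed compact_nbhd K(2))
   show "Q <= S - nbhd K d" if "Q : \<G>2" for Q using that F(3) by (auto simp: \<G>2_def)
  qed simp
  also have "... <= ennreal P * ennreal (2 * \<eta>1)" by (intro mult_left_mono TV) simp
  also have "... = ennreal (P * (2 * \<eta>1))" using P0 \<eta>1 by (intro ennreal_mult[symmetric]) auto
  also have "... <= ennreal (\<eta> / 2)"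
  proof (rule ennreal_leI)
   have "P * (2 * \<eta>1) <= (P + 1) * (2 * \<eta>1)" using \<eta>1 by simp
   also have "... = \<eta> / 2" using P0 by (simp add: \<eta>1_def field_simps)
   finally show "P * (2 * \<eta>1) <= \<eta> / 2" .
  qed
  finally show ?thesis .
  qed
  have nn: "?c * mosc Q v >= 0" for Q using ep by simp
  have "ennreal ?c * (\<Sum>Q\<in>\<G>. ennreal (mosc Q v)) = (\<Sum>Q\<in>\<G>. ennreal (?c * mosc Q v))"
  using ep by (subst sum_distrib_left) (simp add: ennreal_mult)
  also have "... = (\<Sum>Q\<in>\<G>1. ennreal (?c * mosc Q v)) + (\<Sum>Q\<in>\<G>2. ennreal (?c * mosc Q v))"
  unfolding un(1) by (rule sum.union_disjoint[OF un(3,4,2)])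
  also have "(\<Sum>Q\<in>\<G>1. ennreal (?c * mosc Q v)) = ennreal (\<Sum>Q\<in>\<G>1. ?c * mosc Q v)" using nn by (intro sum_ennreal) auto
  also have "ennreal (\<Sum>Q\<in>\<G>1. ?c * mosc Q v) + (\<Sum>Q\<in>\<G>2. ennreal (?c * mosc Q v)) <= ennreal (1/4 * I + \<eta> / 2) + ennreal (\<eta> / 2)"
  by (intro add_mono ennreal_leI s1 s2)
  also have "... = ennreal (1/4) * ennreal I + ennreal \<eta>"
  proof -
  have "ennreal (1/4 * I + \<eta> / 2) + ennreal (\<eta> / 2) = ennreal (1/4 * I + \<eta>)"
   using I0 \<eta> by (subst ennreal_plus[symmetric]) auto
  also have "... = ennreal (1/4 * I) + ennreal \<eta>" using I0 \<eta> by (intro ennreal_plus) auto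
  also have "ennreal (1/4 * I) = ennreal (1/4) * ennreal I" using I0 by (intro ennreal_mult) auto
  finally show ?thesis .
  qed
  also have "... <= ennreal (1/4) * total_variation S u + ennreal \<eta>" by (intro add_right_mono mult_left_mono I) simp
  finally show "ennreal ?c * (\<Sum>Q\<in>\<G>. ennreal (mosc Q v)) <= ennreal (1/4) * total_variation S u + ennreal \<eta>" .
 qed
 qed
 thus ?thesis using that vL vu by blast
qed

section \<open>Tilings by rotated cubes\<close>

lemma mem_rcube:
 fixes c :: "real^'n"
 assumes R: "orth R"
 shows "x : rcube c R \<e> \<longleftrightarrow> (\<forall>i. \<bar>(x - c) \<bullet> R (axis i 1)\<bar> < \<e> / 2)"
proof -
 obtain z where z: "x - c = R z" using orthogonal_transformation_surj[OF R] by (metis surjD)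
 have "(x - c) \<bullet> R (axis i 1) = z $ i" for i using R by (simp add: z orthogonal_transformation_def inner_axis)
 moreover have "x : rcube c R \<e> \<longleftrightarrow> z : cube0 \<e>"
 proof -
 have "inj (%z. c + R z)" using orthogonal_transformation_inj[OF R] by (simp add: inj_on_def)
 from inj_image_mem_iff[OF this, of z "cube0 \<e>"] have "c + R z : rcube c R \<e> \<longleftrightarrow> z : cube0 \<e>" by (simp add: rcube_def)
 moreover have "x = c + R z" using z by (simp add: algebra_simps)
 ultimately show ?thesis by simp
 qed
 ultimately show ?thesis by (simp add: mem_cube0)
qed

text \<open>A point of the open set has positive distance from the complement, so the layers
  decrease to the empty set; their measures are finite and tend to 0.\<close>

lemma boundary_layer_measure:
 fixes P :: "(real^'n) set"
 assumes P: "open P" "bounded P" and \<eta>: "\<eta> > 0"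
 obtains r where "r > 0" "{x : P. infdist x (- P) <= r} : sets borel" "emeasure lborel {x : P. infdist x (- P) <= r} < ennreal \<eta>"
proof -
 define X where "X m = {x : P. infdist x (- P) <= inverse (real (Suc m))}" for m
 have [measurable]: "P : sets borel" using P(1) by simp
 have Xm: "X m : sets borel" for m
 proof -
 have "closed {x. infdist x (- P) <= inverse (real (Suc m))}" by (intro closed_Collect_le continuous_intros)
 hence "P \<inter> {x. infdist x (- P) <= inverse (real (Suc m))} : sets borel" by (intro sets.Int) auto
 moreover have "X m = P \<inter> {x. infdist x (- P) <= inverse (real (Suc m))}" by (auto simp: X_def)
 ultimately show ?thesis by simp
 qed
 have ne: "- P ~= {}" using P(2) not_bounded_UNIV by (metis Compl_empty_eq double_compl)
 have "(\<Inter>m. X m) = {}"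
 proof (rule ccontr)
 assume "(\<Inter>m. X m) ~= {}"
 then obtain x where x: "!!m. x : X m" by blast
 hence "x : P" "!!m. infdist x (- P) <= inverse (real (Suc m))" by (auto simp: X_def)
 moreover have "infdist x (- P) > 0"
  using \<open>x : P\<close> P(1) ne by (simp add: infdist_pos_not_in_closed closed_Compl)
 ultimately show False by (meson reals_Archimedean not_le)
 qed
 moreover have "decseq X"
 proof (rule decseq_SucI)
 fix m
 have "inverse (real (Suc (Suc m))) <= inverse (real (Suc m))" by (intro le_imp_inverse_le) auto
 thus "X (Suc m) <= X m" unfolding X_def using order_trans by blast
 qed
 moreover have "emeasure lborel (X m) ~= \<infinity>" for m
 proof -
 have "bounded (X m)" by (rule bounded_subset[OF P(2)]) (auto simp: X_def)
 thus ?thesis using emeasure_bounded_finite by (metis less_irrefl infinity_ennreal_def)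
 qed
 ultimately have "(%m. emeasure lborel (X m)) \<longlonglongrightarrow> 0"
 using Lim_emeasure_decseq[of X lborel] Xm by auto
 hence "eventually (%m. emeasure lborel (X m) < ennreal \<eta>) sequentially"
 by (rule order_tendstoD) (use \<eta> in simp)
 then obtain m where "emeasure lborel (X m) < ennreal \<eta>" by (auto simp: eventually_sequentially)
 thus ?thesis using Xm[of m] that[of "inverse (real (Suc m))"] by (simp add: X_def)
qed

lemma hyperplane_null_set:
 fixes a :: "real^'n"
 assumes "a ~= 0" shows "{x. a \<bullet> x = b} : null_sets lborel"
proof -
 have "{x. a \<bullet> x = b} : sets lborel" using closed_hyperplane[of a b] by simp
 thus ?thesis
 using negligible_hyperplane[of a b] assms by (auto simp: negligible_iff_null_sets null_sets_completion_iff)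
qed

text \<open>The cells of a rotated grid that lie in \<open>P\<close> are kept. A lost point off the
  cell faces belongs to a cell that leaves \<open>P\<close>, so it is closer to the complement than
  \<open>r\<close>: the loss is confined to a boundary layer.\<close>

lemma grid_tiling:
 fixes P :: "(real^'n) set"
 assumes P: "open P" "bounded P" and R: "orth R" and \<eta>: "\<eta> > 0"
 obtains e0 where "e0 > 0" "!!\<e>. \<e> > 0 ==> \<e> < e0 ==> \<exists>C. finite C &
  (\<forall>c\<in>C. rcube c R \<e> <= P) & pairwise disjnt ((%c. rcube c R \<e>) ` C) & measure lborel (P - (\<Union>c\<in>C. rcube c R \<e>)) < \<eta>"
proof -
 obtain r where r: "r > 0" "{x : P. infdist x (- P) <= r} : sets borel" "emeasure lborel {x : P. infdist x (- P) <= r} < ennreal \<eta>"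
 using boundary_layer_measure[OF P \<eta>] by blast
 define X where "X = {x : P. infdist x (- P) <= r}"
 define n where "n = real CARD('n)"
 have n: "n > 0" by (simp add: n_def)
 define b where "b i = R (axis i (1::real))" for i
 have bb: "b i \<bullet> b j = (if i = j then 1 else 0)" for i j
 using R by (simp add: b_def orthogonal_transformation_def inner_axis_axis)
 have b0: "b i ~= 0" for i using bb[of i i] by auto
 obtain Bd where Bd: "!!x. x : P ==> norm x <= Bd" using P(2) by (auto simp: bounded_iff)
 show ?thesis
 proof (rule that[of "r / n"])
 show "r / n > 0" using r n by simp
 fix \<e> :: real assume e: "\<e> > 0" "\<e> < r / n"
 have nr: "n * \<e> < r" using e n by (simp add: field_simps)
 define ctr where "ctr k = R (\<chi> i. \<e> * real_of_int (k i))" for k :: "'n => int"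
 have ctr: "ctr k \<bullet> b i = \<e> * real_of_int (k i)" for k i
  using R by (simp add: b_def ctr_def orthogonal_transformation_def inner_axis)
 define q where "q k = rcube (ctr k) R \<e>" for k
 have mq: "x : q k \<longleftrightarrow> (\<forall>i. \<bar>x \<bullet> b i - \<e> * real_of_int (k i)\<bar> < \<e> / 2)" for x k
  using mem_rcube[OF R, of x "ctr k" \<e>] ctr by (simp add: q_def b_def inner_diff_left)
 define I where "I = {k. q k <= P}"
 have "I <= PiE UNIV (%_. {- \<lceil>Bd / \<e>\<rceil> .. \<lceil>Bd / \<e>\<rceil>})"
 proof
  fix k assume k: "k : I"
  have "ctr k : q k" unfolding q_def by (rule rcube_center[OF R e(1)])
  hence nc: "norm (ctr k) <= Bd" using k Bd by (auto simp: I_def)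
  have "\<bar>real_of_int (k i)\<bar> <= Bd / \<e>" for i
  proof -
  have "\<bar>\<e> * real_of_int (k i)\<bar> <= norm (ctr k) * norm (b i)" unfolding ctr[symmetric] by (rule Cauchy_Schwarz_ineq2)
  also have "norm (b i) = 1" using bb[of i i] by (simp add: norm_eq_1)
  finally show ?thesis using nc e by (simp add: abs_mult field_simps)
  qed
  hence "\<bar>k i\<bar> <= \<lceil>Bd / \<e>\<rceil>" for i by (metis ceiling_mono ceiling_of_int of_int_abs)
  thus "k : PiE UNIV (%_. {- \<lceil>Bd / \<e>\<rceil> .. \<lceil>Bd / \<e>\<rceil>})" by (auto simp: abs_le_iff minus_le_iff)
 qed
 hence fI: "finite I" by (rule finite_subset) (intro finite_PiE; simp)
 have dj: "pairwise disjnt ((%c. rcube c R \<e>) ` ctr ` I)"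
 proof (rule pairwiseI)
  fix A B assume "A : (%c. rcube c R \<e>) ` ctr ` I" "B : (%c. rcube c R \<e>) ` ctr ` I" "A ~= B"
  then obtain k l where kl: "A = q k" "B = q l" "k ~= l" by (auto simp: q_def)
  then obtain i where i: "k i ~= l i" by auto
  show "disjnt A B" unfolding disjnt_iff
  proof (intro allI notI)
  fix x assume "x : A & x : B"
  hence "\<bar>x \<bullet> b i - \<e> * real_of_int (k i)\<bar> < \<e> / 2" "\<bar>x \<bullet> b i - \<e> * real_of_int (l i)\<bar> < \<e> / 2"
   by (auto simp: kl mq)
  hence "\<bar>\<e> * real_of_int (k i) - \<e> * real_of_int (l i)\<bar> < \<e>" by linarith
  hence "\<e> * \<bar>real_of_int (k i - l i)\<bar> < \<e> * 1" using e by (simp add: abs_mult flip: right_diff_distrib)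
  hence "\<bar>real_of_int (k i - l i)\<bar> < 1" using e by simp
  thus False using i by linarith
  qed
 qed
 \<comment> \<open>The faces of the cells: the centres have coordinates in integer multiples of
   \<open>\<e>\<close>, so the faces sit at half-integer multiples.\<close>
 define N where "N = (\<Union>i\<in>(UNIV::'n set). \<Union>m\<in>(UNIV::int set). {x. b i \<bullet> x = \<e> * (real_of_int m + 1/2)})"
 have N: "N : null_sets lborel" unfolding N_def
  by (intro null_sets_UN' countableI_type hyperplane_null_set b0)
 have cov: "P - (\<Union>c\<in>ctr ` I. rcube c R \<e>) <= X \<union> N"
 proof (rule subsetI, rule ccontr)
  fix x assume x: "x : P - (\<Union>c\<in>ctr ` I. rcube c R \<e>)" "x ~: X \<union> N"
  define k where "k i = round (x \<bullet> b i / \<e>)" for i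
  have "x : q k" unfolding mq
  proof
  fix i
  have "\<bar>real_of_int (k i) - x \<bullet> b i / \<e>\<bar> <= 1/2" unfolding k_def by (rule of_int_round_abs_le)
  moreover have "x \<bullet> b i / \<e> ~= real_of_int m + 1/2" for m
  proof
   assume "x \<bullet> b i / \<e> = real_of_int m + 1/2"
   hence "b i \<bullet> x = \<e> * (real_of_int m + 1/2)" using e by (simp add: field_simps inner_commute)
   thus False using x(2) by (auto simp: N_def)
  qed
  from this[of "k i"] this[of "k i - 1"]
  have "x \<bullet> b i / \<e> ~= real_of_int (k i) + 1/2" "x \<bullet> b i / \<e> ~= real_of_int (k i) - 1/2" by auto
  ultimately have "\<bar>x \<bullet> b i / \<e> - real_of_int (k i)\<bar> < 1/2" by linarith
  hence "\<e> * \<bar>x \<bullet> b i / \<e> - real_of_int (k i)\<bar> < \<e> * (1/2)" using e by (intro mult_strict_left_mono)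
  also have "\<e> * \<bar>x \<bullet> b i / \<e> - real_of_int (k i)\<bar> = \<bar>\<e> * (x \<bullet> b i / \<e> - real_of_int (k i))\<bar>" using e by (simp add: abs_mult)
  also have "\<e> * (x \<bullet> b i / \<e> - real_of_int (k i)) = x \<bullet> b i - \<e> * real_of_int (k i)" using e by (simp add: field_simps)
  finally show "\<bar>x \<bullet> b i - \<e> * real_of_int (k i)\<bar> < \<e> / 2" by simp
  qed
  moreover have "q k <= P"
  proof (rule subsetI, rule ccontr)
  fix y assume y: "y : q k" "y ~: P"
  have "q k : cubes \<e>" unfolding q_def cubes_rcube using R by blast
  hence "dist x y <= n * \<e>" unfolding n_def using \<open>x : q k\<close> y(1) by (rule cube_diameter)
  moreover have "infdist x (- P) <= dist x y" by (rule infdist_le) (use y in simp)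
  ultimately show False using x nr by (simp add: X_def)
  qed
  ultimately show False using x(1) by (auto simp: I_def q_def)
 qed
 have "emeasure lborel (P - (\<Union>c\<in>ctr ` I. rcube c R \<e>)) <= emeasure lborel (X \<union> N)"
  by (rule emeasure_mono[OF cov]) (use r(2) N in \<open>auto simp: X_def\<close>)
 also have "... = emeasure lborel X" using r(2) N by (intro emeasure_Un_null_set) (auto simp: X_def)
 also have "... < ennreal \<eta>" using r(3) by (simp add: X_def)
 finally have "measure lborel (P - (\<Union>c\<in>ctr ` I. rcube c R \<e>)) < \<eta>"
  using \<eta> by (cases "emeasure lborel (P - (\<Union>c\<in>ctr ` I. rcube c R \<e>))") (auto simp: measure_def ennreal_less_iff)
 thus "\<exists>C. finite C & (\<forall>c\<in>C. rcube c R \<e> <= P) & pairwise disjnt ((%c. rcube c R \<e>) ` C) & measure lborel (P - (\<Union>c\<in>C. rcube c R \<e>)) < \<eta>"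
  using fI dj by (intro exI[of _ "ctr ` I"]) (auto simp: I_def q_def)
 qed
qed

lemma direction_rotation:
 fixes p :: "real^'n"
 obtains R :: "real^'n => real^'n" where "orth R" "p = norm p *\<^sub>R R (axis i 1)"
proof (cases "p = 0")
 case True
 thus ?thesis using that[of "%x :: real^'n. x"] orthogonal_transformation_id by simp
next
 case False
 obtain R :: "real^'n => real^'n" where "orth R" "R (axis i 1) = p /\<^sub>R norm p"
 using orthogonal_transformation_exists[of "axis i 1" "p /\<^sub>R norm p"] False by auto
 thus ?thesis using False by (intro that[of R]) auto
qed

text \<open>Two scales. On coarse cubes of side \<sigma> the field varies by less than \<eta>;
  inside each, a fine grid is rotated so that its i-th edge is parallel to the field at the coarse
  centre. The coarse cubes are finitely many and fixed before \<open>\<e>\<close>, so the thresholds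
  of the fine grids have a positive minimum.\<close>

lemma adapted_tiling:
 fixes \<psi> :: "real^'n => real^'n"
 assumes \<psi>: "uniformly_continuous_on UNIV \<psi>" "!!x. norm (\<psi> x) <= 1" and U: "open U" "bounded U" and \<eta>: "\<eta> > 0"
 obtains e0 where "e0 > 0" "!!\<e>. \<e> > 0 ==> \<e> < e0 ==> \<exists>\<G>\<in>finite_families \<e> U.
  (\<forall>Q\<in>\<G>. \<exists>c (R :: real^'n => real^'n) \<rho>. orth R & Q = rcube c R \<e> & 0 <= \<rho> & \<rho> <= 1 & (\<forall>x\<in>Q. norm (\<psi> x - \<rho> *\<^sub>R R (axis i 1)) <= \<eta>)) &
  measure lborel (U - \<Union>\<G>) < \<eta>"
proof -
 obtain d where d: "d > 0" "!!x y. dist x y < d ==> norm (\<psi> x - \<psi> y) < \<eta>"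
 proof -
 obtain d where "d > 0" "\<forall>x y. dist y x < d --> dist (\<psi> y) (\<psi> x) < \<eta>"
  using \<psi>(1) \<eta> unfolding uniformly_continuous_on_def by auto
 thus ?thesis using that[of d] by (simp add: dist_norm)
 qed
 have id: "orth (%x::real^'n. x)" using orthogonal_transformation_id by simp
 have "\<eta> / 2 > 0" using \<eta> by simp
 from grid_tiling[OF U id this] obtain e1 where e1: "e1 > 0" "!!\<e>. \<e> > 0 ==> \<e> < e1 ==> \<exists>C. finite C &
  (\<forall>c\<in>C. rcube c (%x. x) \<e> <= U) & pairwise disjnt ((%c. rcube c (%x. x) \<e>) ` C) & measure lborel (U - (\<Union>c\<in>C. rcube c (%x. x) \<e>)) < \<eta> / 2" by blast
 define m where "m = min e1 (d / real CARD('n))"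
 define \<sigma> where "\<sigma> = m / 2"
 have m: "m > 0" "m <= e1" "m <= d / real CARD('n)" using e1(1) d(1) by (auto simp: m_def)
 hence \<sigma>: "\<sigma> > 0" and \<sigma>2: "\<sigma> < e1" "\<sigma> < d / real CARD('n)" unfolding \<sigma>_def by linarith+
 have nd: "real CARD('n) * \<sigma> < d" using \<sigma>2(2) by (simp add: field_simps)
 define p where "p c = rcube c (%x. x) \<sigma>" for c :: "real^'n"
 obtain C' where C': "finite C'" "!!c. c : C' ==> p c <= U" "pairwise disjnt (p ` C')" "measure lborel (U - (\<Union>c\<in>C'. p c)) < \<eta> / 2"
 using e1(2)[OF \<sigma> \<sigma>2(1)] unfolding p_def[symmetric] by blast
 \<comment> \<open>Distinctness is only known for cubes as sets, so the centres are thinned out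
   until \<open>p\<close> is injective; disjointness of distinct cubes then separates distinct
   centres.\<close>
 obtain C where CC: "C <= C'" "inj_on p C" "p ` C' = p ` C" using subset_image_inj[of "p ` C'" p C'] by auto
 have C: "finite C" "!!c. c : C ==> p c <= U" "pairwise disjnt (p ` C)" "measure lborel (U - (\<Union>c\<in>C. p c)) < \<eta> / 2"
 using C' CC finite_subset by auto
 have po: "open (p c)" "bounded (p c)" "c : p c" "p c : cubes \<sigma>" for c
 unfolding p_def using rcube_open[OF id] rcube_bounded[OF id] rcube_center[OF id \<sigma>] by auto (use id cubes_rcube in blast)
 \<comment> \<open>Each coarse cube may lose \<eta> / (2 N), in total at most \<eta> / 2; the
   summand 1 covers an empty \<open>C\<close>.\<close>
 define N where "N = real (card C) + 1"
 have N: "\<eta> / (2 * N) > 0" using \<eta> by (simp add: N_def add_pos_nonneg)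
 define good where "good c e \<longleftrightarrow> e > 0 & (\<exists>R :: real^'n => real^'n. orth R & \<psi> c = norm (\<psi> c) *\<^sub>R R (axis i 1) & (\<forall>\<e>. \<e> > 0 --> \<e> < e -->
  (\<exists>B. finite B & (\<forall>b\<in>B. rcube b R \<e> <= p c) & pairwise disjnt ((%b. rcube b R \<e>) ` B) & measure lborel (p c - (\<Union>b\<in>B. rcube b R \<e>)) < \<eta> / (2 * N))))" for c e
 have "\<exists>e. good c e" for c
 proof -
 obtain R :: "real^'n => real^'n" where R: "orth R" "\<psi> c = norm (\<psi> c) *\<^sub>R R (axis i 1)" by (rule direction_rotation[of "\<psi> c" i]) (erule (1) that)
 show ?thesis
 proof (rule grid_tiling[OF po(1,2) R(1) N, of c])
  fix e :: real assume "e > 0" "!!\<e>. \<e> > 0 ==> \<e> < e ==> \<exists>B. finite B & (\<forall>b\<in>B. rcube b R \<e> <= p c) &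
   pairwise disjnt ((%b. rcube b R \<e>) ` B) & measure lborel (p c - (\<Union>b\<in>B. rcube b R \<e>)) < \<eta> / (2 * N)"
  hence "good c e" unfolding good_def using R by (intro conjI exI[of _ R] allI impI) simp_all
  thus ?thesis by (rule exI)
 qed
 qed
 hence "\<forall>c. \<exists>e. good c e" by (rule allI)
 then obtain e where e: "\<forall>c. good c (e c)" using choice by blast
 show ?thesis
 proof (rule that[of "Min (insert 1 (e ` C))"])
 show "Min (insert 1 (e ` C)) > 0" using C(1) e by (auto simp: good_def)
 fix \<e> :: real assume ep: "\<e> > 0" "\<e> < Min (insert 1 (e ` C))"
 define packing where "packing c \<B> \<longleftrightarrow> finite \<B> & (\<forall>Q\<in>\<B>. Q <= p c) & pairwise disjnt \<B> & measure lborel (p c - \<Union>\<B>) < \<eta> / (2 * N) &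
  (\<forall>Q\<in>\<B>. \<exists>a (R :: real^'n => real^'n). orth R & Q = rcube a R \<e> & \<psi> c = norm (\<psi> c) *\<^sub>R R (axis i 1))" for c \<B>
 have "\<exists>\<B>. packing c \<B>" if c: "c : C" for c
 proof -
  have ec: "\<e> < e c" using ep(2) C(1) c by simp
  obtain R :: "real^'n => real^'n" where R: "orth R" "\<psi> c = norm (\<psi> c) *\<^sub>R R (axis i 1)" and B: "\<forall>\<e>. \<e> > 0 --> \<e> < e c -->
  (\<exists>B. finite B & (\<forall>b\<in>B. rcube b R \<e> <= p c) & pairwise disjnt ((%b. rcube b R \<e>) ` B) & measure lborel (p c - (\<Union>b\<in>B. rcube b R \<e>)) < \<eta> / (2 * N))"
  using e[rule_format, of c] unfolding good_def by (elim conjE exE) (erule (2) that)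
  from B[rule_format, OF ep(1) ec] obtain B where B: "finite B" "\<forall>b\<in>B. rcube b R \<e> <= p c" "pairwise disjnt ((%b. rcube b R \<e>) ` B)"
  "measure lborel (p c - (\<Union>b\<in>B. rcube b R \<e>)) < \<eta> / (2 * N)"
  by (elim conjE exE)
  have "packing c ((%b. rcube b R \<e>) ` B)" unfolding packing_def using B R
  by (intro conjI ballI) (simp, blast, simp, simp, blast)
  thus ?thesis by (rule exI)
 qed
 hence "\<forall>c\<in>C. \<exists>\<B>. packing c \<B>" by blast
 from bchoice[OF this] obtain \<B> where "\<forall>c\<in>C. packing c (\<B> c)" by (elim exE)
 hence \<B>: "c : C ==> finite (\<B> c)" "c : C ==> Q : \<B> c ==> Q <= p c" "c : C ==> pairwise disjnt (\<B> c)"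
  "c : C ==> measure lborel (p c - \<Union>(\<B> c)) < \<eta> / (2 * N)"
  "c : C ==> Q : \<B> c ==> \<exists>a (R :: real^'n => real^'n). orth R & Q = rcube a R \<e> & \<psi> c = norm (\<psi> c) *\<^sub>R R (axis i 1)" for c Q
  unfolding packing_def by simp_all
 define \<G> where "\<G> = (\<Union>c\<in>C. \<B> c)"
 have Qc: "Q : cubes \<e>" if "Q : \<G>" for Q using that \<B>(5) unfolding \<G>_def cubes_rcube by blast
 have "pairwise disjnt \<G>"
 proof (rule pairwiseI)
  fix A B assume AB: "A : \<G>" "B : \<G>" "A ~= B"
  then obtain a b where ab: "a : C" "A : \<B> a" "b : C" "B : \<B> b" by (auto simp: \<G>_def)
  show "disjnt A B"
  proof (cases "p a = p b")
  case True
  hence "a = b" using CC(2) ab by (auto simp: inj_on_def)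
  thus ?thesis using \<B>(3)[OF ab(1)] ab AB(3) by (auto simp: pairwise_def)
  next
  case False
  hence "disjnt (p a) (p b)" using C(3) ab by (auto simp: pairwise_def)
  thus ?thesis using \<B>(2)[OF ab(1,2)] \<B>(2)[OF ab(3,4)] by (auto simp: disjnt_def)
  qed
 qed
 moreover have "Q <= U" if "Q : \<G>" for Q using that \<B>(2) C(2) unfolding \<G>_def by blast
 moreover have fG: "finite \<G>" using C(1) \<B>(1) by (auto simp: \<G>_def)
 ultimately have fam: "\<G> : finite_families \<e> U" using Qc by (auto simp: finite_families_def cube_families_def)
 have Qo: "Q : sets borel" if "Q : \<G>" for Q using cube_lmeasurable(4)[OF Qc[OF that] ep(1)] by simp
 have fm: "X : fmeasurable lborel" if "X : sets borel" "X <= U" for X :: "(real^'n) set"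
  using emeasure_bounded_finite[OF bounded_subset[OF U(2) that(2)]] that(1) by (intro fmeasurableI) auto
 have UB: "\<Union>(\<B> c) : sets borel" if "c : C" for c using \<B>(1)[OF that] Qo that by (intro sets.finite_Union) (auto simp: \<G>_def)
 have m1: "U - (\<Union>c\<in>C. p c) : sets borel" using U(1) po(1) by (intro sets.Diff borel_open) auto
 have m2: "p c - \<Union>(\<B> c) : fmeasurable lborel" if "c : C" for c
  using UB[OF that] borel_open[OF po(1)] C(2)[OF that] by (intro fm sets.Diff) auto
 have m3: "(\<Union>c\<in>C. p c - \<Union>(\<B> c)) : fmeasurable lborel" using C(1) m2 by (intro fmeasurable.finite_UN) auto
 have "measure lborel (U - \<Union>\<G>) <= measure lborel ((U - (\<Union>c\<in>C. p c)) \<union> (\<Union>c\<in>C. p c - \<Union>(\<B> c)))"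
 proof (rule measure_mono_fmeasurable)
  show "U - \<Union>\<G> <= U - (\<Union>c\<in>C. p c) \<union> (\<Union>c\<in>C. p c - \<Union>(\<B> c))" by (auto simp: \<G>_def)
  show "U - \<Union>\<G> : sets lborel" using U(1) fG Qo by (auto intro!: sets.Diff sets.finite_Union)
 qed (use fm[OF m1] m3 in auto)
 also have "... <= measure lborel (U - (\<Union>c\<in>C. p c)) + measure lborel (\<Union>c\<in>C. p c - \<Union>(\<B> c))"
  using fm[OF m1] m3 by (intro measure_Un_le) (auto simp: fmeasurable_def)
 also have "measure lborel (\<Union>c\<in>C. p c - \<Union>(\<B> c)) <= (\<Sum>c\<in>C. measure lborel (p c - \<Union>(\<B> c)))"
  using C(1) m2 by (intro measure_UNION_le) (auto simp: fmeasurable_def)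
 also have "... <= (\<Sum>c\<in>C. \<eta> / (2 * N))" using \<B>(4) by (intro sum_mono) (auto intro: less_imp_le)
 also have "... <= \<eta> / 2" using \<eta> by (simp add: N_def field_simps)
 finally have "measure lborel (U - \<Union>\<G>) < \<eta>" using C(4) by simp
 moreover have "\<exists>c (R :: real^'n => real^'n) \<rho>. orth R & Q = rcube c R \<e> & 0 <= \<rho> & \<rho> <= 1 & (\<forall>x\<in>Q. norm (\<psi> x - \<rho> *\<^sub>R R (axis i 1)) <= \<eta>)" if Q: "Q : \<G>" for Q
 proof -
  obtain c where c: "c : C" "Q : \<B> c" using Q by (auto simp: \<G>_def)
  obtain a and R :: "real^'n => real^'n" where R: "orth R" "Q = rcube a R \<e>" "\<psi> c = norm (\<psi> c) *\<^sub>R R (axis i 1)" using \<B>(5)[OF c] by blast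
  have "norm (\<psi> x - norm (\<psi> c) *\<^sub>R R (axis i 1)) <= \<eta>" if "x : Q" for x
  proof -
  have "dist x c <= real CARD('n) * \<sigma>" using cube_diameter[OF po(4)[of c] _ po(3)] \<B>(2)[OF c] that by blast
  thus ?thesis using d(2)[of x c] nd R(3) by auto
  qed
  thus ?thesis using R \<psi>(2)[of c] norm_ge_zero[of "\<psi> c"] by blast
 qed
 ultimately show "\<exists>\<G>\<in>finite_families \<e> U. (\<forall>Q\<in>\<G>. \<exists>c (R :: real^'n => real^'n) \<rho>. orth R & Q = rcube c R \<e> & 0 <= \<rho> & \<rho> <= 1 & (\<forall>x\<in>Q. norm (\<psi> x - \<rho> *\<^sub>R R (axis i 1)) <= \<eta>)) & measure lborel (U - \<Union>\<G>) < \<eta>"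
  using fam by blast
 qed
qed

section \<open>Lower bound: testing the oscillation with signs\<close>

lemma cube0_inner_sgn:
 fixes p :: "real^'n"
 assumes e: "\<e> > 0"
 shows "(LINT z|lborel. indicator (cube0 \<e>) z * ((p \<bullet> z) * sgn (z $ i))) = p $ i * (\<e> ^ CARD('n) * (\<e> / 4))"
proof -
 \<comment> \<open>Flips every coordinate except the i-th. The part \<open>r\<close> of
   \<open>p\<close> orthogonal to the i-th axis gives an integrand that changes sign under
   \<open>T\<close>, so only the i-th component contributes.\<close>
 define T :: "real^'n => real^'n" where "T z = (\<chi> j. if j = i then z $ j else - z $ j)" for z
 have T: "orth T"
 unfolding orthogonal_transformation_def T_def linear_iff
 by (auto simp: vec_eq_iff inner_vec_def intro!: sum.cong)
 define r where "r = p - p $ i *\<^sub>R axis i 1"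
 have rT: "r \<bullet> T z = - (r \<bullet> z)" for z
 unfolding inner_vec_def sum_negf[symmetric] by (rule sum.cong) (auto simp: r_def T_def axis_def)
 have c0: "cube0 \<e> : sets borel" by (simp add: cube0_def)
 note i = integrable_bounded_on[OF c0 cube0_bounded]
 define h where "h z = indicator (cube0 \<e>) z * ((r \<bullet> z) * sgn (z $ i))" for z
 have [measurable]: "h : borel_fun" unfolding h_def using c0 by measurable
 have "T z : cube0 \<e> \<longleftrightarrow> z : cube0 \<e>" for z by (auto simp: mem_cube0 T_def)
 hence "h (0 + T z) = - h z" for z using rT[of z] by (simp add: h_def indicator_def T_def)
 hence "(LINT z|lborel. h z) = - (LINT z|lborel. h z)"
 using integral_rigid(1)[OF T, of h 0] by simp
 hence h0: "(LINT z|lborel. h z) = 0" by simp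
 have hi: "L1 h" unfolding h_def
 proof (rule i[of _ "norm r * (real CARD('n) * \<e> / 2)"])
 fix z :: "real^'n" assume z: "z : cube0 \<e>"
 have "\<bar>(r \<bullet> z) * sgn (z $ i)\<bar> <= \<bar>r \<bullet> z\<bar>" by (simp add: abs_mult sgn_if)
 also have "... <= norm r * norm z" by (rule Cauchy_Schwarz_ineq2)
 also have "... <= norm r * (real CARD('n) * \<e> / 2)" using norm_cube0[OF z] by (intro mult_left_mono) auto
 finally show "\<bar>(r \<bullet> z) * sgn (z $ i)\<bar> <= norm r * (real CARD('n) * \<e> / 2)" .
 qed measurable
 have ai: "L1 (%z. indicator (cube0 \<e>) z * \<bar>z $ i\<bar>)"
 by (rule i[of _ "\<e> / 2"]) (auto simp: mem_cube0 intro: less_imp_le)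
 have "(p \<bullet> z) * sgn (z $ i) = (r \<bullet> z) * sgn (z $ i) + p $ i * \<bar>z $ i\<bar>" for z
 by (simp add: r_def inner_diff_left inner_axis' algebra_simps abs_sgn)
 hence "(LINT z|lborel. indicator (cube0 \<e>) z * ((p \<bullet> z) * sgn (z $ i))) = (LINT z|lborel. h z + p $ i * (indicator (cube0 \<e>) z * \<bar>z $ i\<bar>))"
 by (intro Bochner_Integration.integral_cong) (auto simp: h_def algebra_simps)
 also have "... = p $ i * (\<e> ^ CARD('n) * (\<e> / 4))" using hi ai h0 by (simp add: cube0_abs_component[OF e])
 finally show ?thesis .
qed

text \<open>The sign of the coordinate along \<open>R (axis i 1)\<close>, weighted by \<rho>, is odd
  about the centre, hence of mean zero. Against the linear Taylor part it yields \<rho> times the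
  directional derivative at the centre, times the volume, times \<open>\<e> / 4\<close>; dividing by
  \<open>\<e>\<close> leaves the quarter. The weight \<rho> stands for the length of the field on
  the cube.\<close>

lemma dual_cube:
 fixes w :: "real^'n => real"
 assumes mol: "mollifier \<delta> k g L" and w: "L1 w" and R: "orth R" and e: "\<e> > 0"
 and \<rho>: "0 <= \<rho>" "\<rho> <= 1" and M: "M = L * (LINT y|lborel. \<bar>w y\<bar>)" and Q: "Q = rcube c R \<e>"
 obtains s :: "real^'n => real" where "s : borel_fun" "\<forall>x. \<bar>s x\<bar> <= 1" "(LINT x|lborel. indicator Q x * s x) = 0"
 "1/4 * (LINT x|lborel. indicator Q x * (gconv g w x \<bullet> (\<rho> *\<^sub>R R (axis i 1)))) <= inverse \<e> * (LINT x|lborel. indicator Q x * (s x * conv k w x)) + (real CARD('n))\<^sup>2 * M * \<e> * \<e> ^ CARD('n)"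
proof -
 define \<nu> where "\<nu> = R (axis i 1)"
 have n\<nu>: "norm \<nu> = 1" using R by (simp add: \<nu>_def orthogonal_transformation norm_axis_1)
 have R\<nu>: "\<nu> \<bullet> R z = z $ i" for z using R by (simp add: \<nu>_def orthogonal_transformation_def inner_axis')
 define s where "s x = \<rho> * sgn (\<nu> \<bullet> (x - c))" for x
 define n where "n = real CARD('n)"
 have n1: "n >= 1" by (simp add: n_def Suc_leI)
 define V where "V = \<e> ^ CARD('n)"
 have V: "V > 0" "measure lborel Q = V" using e by (simp_all add: V_def Q measure_rcube[OF R])
 have M0: "M >= 0" using mollifierD(2)[OF mol] by (simp add: M)
 define G where "G = gconv g w"
 have Gm [measurable]: "G : borel_fun" unfolding G_def by (rule borel_measurable_continuous_onI[OF gconv_continuous[OF mol w]])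
 have vm [measurable]: "conv k w : borel_fun" by (rule conv_meas[OF mol w])
 have sm [measurable]: "s : borel_fun" unfolding s_def by measurable
 have s1: "\<bar>s x\<bar> <= 1" for x using \<rho> by (auto simp: s_def abs_mult sgn_if)
 have Qm [measurable]: "Q : sets borel" unfolding Q by (rule rcube_meas[OF R])
 have Qb: "bounded Q" unfolding Q by (rule rcube_bounded[OF R])
 note ib = integrable_bounded_on[OF Qm Qb]
 have iQ: "L1 (indicator Q :: real^'n => real)" using ib[of "%_. 1" 1] by simp
 have s0: "(LINT x|lborel. indicator Q x * s x) = 0"
 proof -
 have "(LINT x|lborel. indicator Q x * s x) = (LINT z|lborel. indicator (cube0 \<e>) z * (\<rho> * sgn (z $ i)))"
  unfolding Q by (subst rcube_integral[OF R sm]) (simp add: s_def R\<nu>)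
 also have "... = 0" by (rule cube0_odd_integral) (auto simp: sgn_minus)
 finally show ?thesis .
 qed
 obtain p where p: "R p = G c" "norm p = norm (G c)" "!!z. G c \<bullet> R z = p \<bullet> z" using orthogonal_pullback[OF R] by blast
 have ps: "p $ i = G c \<bullet> \<nu>" using p(3)[of "axis i 1"] by (simp add: \<nu>_def inner_axis)
 define l where "l x = G c \<bullet> (x - c)" for x
 have lm [measurable]: "l : borel_fun" unfolding l_def by measurable
 have lb: "\<bar>l x\<bar> <= norm (G c) * (n * \<e> / 2)" if "x : Q" for x
 proof -
 have "\<bar>l x\<bar> <= norm (G c) * norm (x - c)" unfolding l_def by (rule Cauchy_Schwarz_ineq2)
 also have "... <= norm (G c) * (n * \<e> / 2)" using rcube_center_dist[OF R, of x c \<e>] that by (intro mult_left_mono) (auto simp: Q n_def)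
 finally show ?thesis .
 qed
 have ls: "(LINT x|lborel. indicator Q x * (s x * l x)) = \<rho> * ((G c \<bullet> \<nu>) * (V * (\<e> / 4)))"
 proof -
 have "(LINT x|lborel. indicator Q x * (s x * l x)) = (LINT z|lborel. \<rho> * (indicator (cube0 \<e>) z * ((p \<bullet> z) * sgn (z $ i))))"
  unfolding Q by (subst rcube_integral[OF R]) (auto simp: s_def l_def R\<nu> p(3) mult_ac)
 thus ?thesis by (simp add: cube0_inner_sgn[OF e] ps V_def)
 qed
 have mul: "\<bar>s x * y\<bar> <= C" if "\<bar>y\<bar> <= C" for x y C
 using mult_mono[OF s1[of x] that] by (simp add: abs_mult)
 have iv: "L1 (%x. indicator Q x * (s x * conv k w x))"
 by (rule ib[of _ M]) (use conv_bound[OF mol w] M mul in auto)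
 have si: "L1 (%x. indicator Q x * s x)" by (rule ib[OF sm s1])
 have il: "L1 (%x. indicator Q x * (s x * l x))" by (rule ib[of _ "norm (G c) * (n * \<e> / 2)"], measurable) (rule mul[OF lb])
 define T where "T = M * (n * \<e> / 2)\<^sup>2"
 have "\<rho> * ((G c \<bullet> \<nu>) * (V * (\<e> / 4))) - T * V = (LINT x|lborel. conv k w c * (indicator Q x * s x) + indicator Q x * (s x * l x) - T * indicator Q x)"
 using si il iQ V(2) by (simp add: s0 ls)
 also have "... <= (LINT x|lborel. indicator Q x * (s x * conv k w x))"
 proof (rule integral_mono)
 fix x
 show "conv k w c * (indicator Q x * s x) + indicator Q x * (s x * l x) - T * indicator Q x <= indicator Q x * (s x * conv k w x)"
 proof (cases "x : Q")
  case True
  have "\<bar>s x * (conv k w x - conv k w c - l x)\<bar> <= T"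
  by (rule mul) (use cube_taylor(1)[OF mol w R _ M, of x c \<e>] True in \<open>simp add: Q l_def G_def n_def T_def\<close>)
  thus ?thesis using True by (simp add: algebra_simps abs_le_iff)
 qed simp
 qed (use iv si il iQ in auto)
 finally have A: "\<rho> * ((G c \<bullet> \<nu>) * (V * (\<e> / 4))) - T * V <= (LINT x|lborel. indicator Q x * (s x * conv k w x))" .
 have G1: "\<bar>H \<bullet> (\<rho> *\<^sub>R \<nu>)\<bar> <= C" if "norm H <= C" for H C
 proof -
 have "norm H * norm (\<rho> *\<^sub>R \<nu>) <= C * 1" using that \<rho> n\<nu> by (intro mult_mono) (auto intro: order_trans[OF norm_ge_zero that])
 thus ?thesis using Cauchy_Schwarz_ineq2[of H "\<rho> *\<^sub>R \<nu>"] by simp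
 qed
 have iG: "L1 (%x. indicator Q x * (G x \<bullet> (\<rho> *\<^sub>R \<nu>)))"
 by (rule ib[of _ M], measurable) (rule G1, use gconv_bound[OF mol w] M in \<open>auto simp: G_def\<close>)
 have "(LINT x|lborel. indicator Q x * (G x \<bullet> (\<rho> *\<^sub>R \<nu>))) <= (LINT x|lborel. (\<rho> * (G c \<bullet> \<nu>) + M * (n * \<e> / 2)) * indicator Q x)"
 proof (rule integral_mono[OF iG])
 fix x
 show "indicator Q x * (G x \<bullet> (\<rho> *\<^sub>R \<nu>)) <= (\<rho> * (G c \<bullet> \<nu>) + M * (n * \<e> / 2)) * indicator Q x"
 proof (cases "x : Q")
  case True
  have "\<bar>(G c - G x) \<bullet> (\<rho> *\<^sub>R \<nu>)\<bar> <= M * (n * \<e> / 2)"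
  by (rule G1) (use cube_taylor(2)[OF mol w R _ M, of x c \<e>] True in \<open>simp add: Q G_def n_def\<close>)
  from abs_le_D1[OF this] abs_le_D2[OF this] show ?thesis using True by (simp add: inner_diff_left algebra_simps)
 qed simp
 qed (use iQ in auto)
 also have "... = (\<rho> * (G c \<bullet> \<nu>) + M * (n * \<e> / 2)) * V" using iQ V(2) by simp
 finally have "1/4 * (LINT x|lborel. indicator Q x * (G x \<bullet> (\<rho> *\<^sub>R \<nu>))) <= \<rho> * (G c \<bullet> \<nu>) * V / 4 + M * \<e> * V * (n / 8)" by (simp add: algebra_simps)
 also have "\<rho> * (G c \<bullet> \<nu>) * V / 4 <= inverse \<e> * (LINT x|lborel. indicator Q x * (s x * conv k w x)) + M * \<e> * V * (n\<^sup>2 / 4)"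
 proof -
 have "inverse \<e> * (\<rho> * ((G c \<bullet> \<nu>) * (V * (\<e> / 4))) - T * V) <= inverse \<e> * (LINT x|lborel. indicator Q x * (s x * conv k w x))"
  using A e by (intro mult_left_mono) auto
 moreover have "inverse \<e> * (\<rho> * ((G c \<bullet> \<nu>) * (V * (\<e> / 4))) - T * V) = \<rho> * (G c \<bullet> \<nu>) * V / 4 - M * \<e> * V * (n\<^sup>2 / 4)"
  using e by (simp add: T_def field_simps power2_eq_square)
 ultimately show ?thesis by linarith
 qed
 also have "inverse \<e> * (LINT x|lborel. indicator Q x * (s x * conv k w x)) + M * \<e> * V * (n\<^sup>2 / 4) + M * \<e> * V * (n / 8)
  <= inverse \<e> * (LINT x|lborel. indicator Q x * (s x * conv k w x)) + n\<^sup>2 * M * \<e> * V"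
 proof -
 have "n * 1 <= n * n" using n1 by (intro mult_left_mono) auto
 hence "n\<^sup>2 / 4 + n / 8 <= n\<^sup>2" using n1 unfolding power2_eq_square by linarith
 hence "M * \<e> * V * (n\<^sup>2 / 4 + n / 8) <= M * \<e> * V * n\<^sup>2" using M0 e V(1) by (intro mult_left_mono) auto
 thus ?thesis by (simp add: algebra_simps)
 qed
 finally show ?thesis by (intro that[OF sm _ s0]) (use s1 in \<open>simp_all add: G_def \<nu>_def n_def V_def\<close>)
qed

text \<open>The functional sees \<open>u\<close>, while the tests concern its mollification. Testing
  the mollification is an average, with density \<open>k\<close>, of testing \<open>w\<close> with
  translated signs on translated cubes. Each translated family is admissible in \<open>S\<close>, so
  every term of the average obeys the same bound.\<close>

lemma dual_family:
 fixes u w :: "real^'n => real"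
 assumes mol: "mollifier \<delta> k g L" and w: "L1 w" and u: "u : borel_fun"
 and uw: "!!x. x : nbhd A \<delta> ==> w x = u x" and A: "nbhd A \<delta> <= S" and \<G>: "\<G> : finite_families \<e> A" and e: "\<e> > 0"
 and s: "!!Q. Q : \<G> ==> s Q : borel_fun" "!!Q x. Q : \<G> ==> \<bar>s Q x\<bar> <= 1"
  "!!Q. Q : \<G> ==> (LINT x|lborel. indicator Q x * s Q x) = 0"
 and \<kappa>: "K_fun \<e> S u = ennreal \<kappa>" "\<kappa> >= 0"
 shows "(\<Sum>Q\<in>\<G>. inverse \<e> * (LINT x|lborel. indicator Q x * (s Q x * conv k w x))) <= \<kappa>"
proof -
 note F = finite_familiesD[OF \<G>]
 note [measurable] = mollifier_meas[OF mol] u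
 have wm [measurable]: "w : borel_fun" using w by simp
 have Qc: "\<exists>c R. orth R & Q = rcube c R \<e>" if "Q : \<G>" for Q using F(2)[OF that] cubes_rcube by blast
 have Qm: "Q : sets borel" "bounded Q" if "Q : \<G>" for Q using Qc[OF that] rcube_meas rcube_bounded by auto
 define H where "H x = (\<Sum>Q\<in>\<G>. indicator Q x * s Q x)" for x
 have Hm [measurable]: "H : borel_fun" unfolding H_def using s(1) Qm(1) by (intro borel_measurable_sum borel_measurable_times borel_measurable_indicator) auto
 have Qi: "L1 (%x. indicator Q x * s Q x)" if "Q : \<G>" for Q
 using that by (intro integrable_bounded_on[OF Qm s(1,2)])
 have Hi: "L1 H" unfolding H_def by (intro Bochner_Integration.integrable_sum Qi)
 have Hb: "\<bar>H x\<bar> <= real (card \<G>)" for x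
 proof -
 have "\<bar>H x\<bar> <= (\<Sum>Q\<in>\<G>. \<bar>indicator Q x * s Q x\<bar>)" unfolding H_def by (rule sum_abs)
 also have "... <= (\<Sum>Q\<in>\<G>. 1)" using s(2) by (intro sum_mono) (auto simp: indicator_def)
 finally show ?thesis by simp
 qed
 have dominated: "L1 (%x. a x * b x)" if "a : borel_fun" "L1 b" "!!x. \<bar>a x\<bar> <= C" for a b :: "real^'n => real" and C
 proof (rule Bochner_Integration.integrable_bound[of _ "%x. C * b x"])
 show "(%x. a x * b x) : borel_measurable lborel" using that(1) borel_measurable_integrable[OF that(2)] by measurable
 have "\<bar>a x\<bar> <= \<bar>C\<bar>" for x using that(3)[of x] by linarith
 thus "AE x in lborel. norm (a x * b x) <= norm (C * b x)" by (simp add: abs_mult mult_right_mono)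
 qed (use that in auto)
 \<comment> \<open>A shift shorter than \<delta> keeps the cubes inside
   \<open>nbhd A \<delta>\<close>, where \<open>w = u\<close> and which lies in \<open>S\<close>;
   the translated family competes in the supremum defining the value \<kappa>.\<close>
 have shifted: "(LINT y|lborel. H (y - z) * w y) <= \<e> * \<kappa>" if z: "norm z < \<delta>" for z
 proof -
 define \<G>' where "\<G>' = (%Q. (%x. z + x) ` Q) ` \<G>"
 have inj: "inj_on (%Q. (%x. z + x) ` Q) \<G>" by (intro inj_onI) (simp add: inj_image_eq_iff)
 have T: "(%x. z + x) ` Q : cubes \<e>" "(%x. z + x) ` Q <= nbhd A \<delta>" if Q: "Q : \<G>" for Q
 proof -
  obtain c R where R: "orth R" "Q = rcube c R \<e>" using Qc[OF Q] by blast
  show "(%x. z + x) ` Q : cubes \<e>" unfolding R(2) rcube_translate cubes_rcube using R(1) by blast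
  show "(%x. z + x) ` Q <= nbhd A \<delta>"
  proof (rule image_subsetI)
  fix x assume "x : Q"
  hence "x : A" "dist x (z + x) <= \<delta>" using F(3)[OF Q] z by (auto simp: dist_norm)
  thus "z + x : nbhd A \<delta>" unfolding mem_nbhd by (rule bexI[rotated])
  qed
 qed
 have "\<G>' : finite_families \<e> S"
 proof -
  have "pairwise disjnt \<G>'" unfolding \<G>'_def pairwise_image
  proof (rule pairwiseI, rule impI)
  fix P Q assume "P : \<G>" "Q : \<G>" "P ~= Q"
  hence "P \<inter> Q = {}" using F(4) by (simp add: pairwise_def disjnt_def)
  thus "disjnt ((%x. z + x) ` P) ((%x. z + x) ` Q)"
   unfolding disjnt_def by (subst image_Int[symmetric]) (auto intro: inj_onI)
  qed
  moreover have "P : cubes \<e>" "P <= S" if "P : \<G>'" for P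
  using T A that unfolding \<G>'_def by auto
  moreover have "finite \<G>'" using F(1) by (simp add: \<G>'_def)
  ultimately show ?thesis by (simp add: finite_families_def cube_families_def subsetI)
 qed
 hence "ennreal (\<e> ^ (CARD('n) - 1)) * (\<Sum>Q\<in>\<G>'. ennreal (mosc Q u)) <= ennreal \<kappa>"
  unfolding \<kappa>(1)[symmetric] K_fun_finite by (rule SUP_upper)
 also have "(\<Sum>Q\<in>\<G>'. ennreal (mosc Q u)) = ennreal (\<Sum>Q\<in>\<G>'. mosc Q u)" by (intro sum_ennreal mosc_nonneg)
 also have "ennreal (\<e> ^ (CARD('n) - 1)) * ... = ennreal (\<e> ^ (CARD('n) - 1) * (\<Sum>Q\<in>\<G>'. mosc Q u))"
  using e by (intro ennreal_mult[symmetric]) (auto intro: sum_nonneg mosc_nonneg)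
 finally have K: "\<e> ^ (CARD('n) - 1) * (\<Sum>Q\<in>\<G>'. mosc Q u) <= \<kappa>" using \<kappa>(2) by (simp add: ennreal_le_iff)
 have each: "(LINT y|lborel. (indicator Q (y - z) * s Q (y - z)) * w y) <= \<e> ^ CARD('n) * mosc ((%x. z + x) ` Q) u" if Q: "Q : \<G>" for Q
 proof -
  let ?Q = "(%x. z + x) ` Q"
  note L = cube_lmeasurable[OF T(1)[OF Q] e]
  have Qb [measurable]: "?Q : sets borel" using L(4) by simp
  have ind: "indicator ?Q y = (indicator Q (y - z) :: real)" for y by (auto simp: indicator_def image_iff intro!: bexI[of _ "y - z"])
  have sm [measurable]: "s Q : borel_fun" by (rule s(1)[OF Q])
  have iu: "indicator ?Q y * u y = indicator ?Q y * w y" for y using uw T(2)[OF Q] by (auto simp: indicator_def)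
  have ui: "integrable (lebesgue_on ?Q) u"
  unfolding integrable_lebesgue_on_iff[OF Qb u] iu by (rule dominated[OF _ w, of _ 1]) auto
  have "(LINT x|lebesgue_on ?Q. u x * s Q (x - z)) <= measure lebesgue ?Q * mosc ?Q u"
  proof (rule mosc_dual[OF L(1,3) ui])
  show "(%x. s Q (x - z)) : borel_measurable (lebesgue_on ?Q)"
   by (rule measurable_restrict_space1, rule measurable_completion) measurable
  have "(LINT x|lebesgue_on ?Q. s Q (x - z)) = (LINT x|lborel. indicator ?Q x * s Q (x - z))"
   using average_lborel[of ?Q "%x. s Q (x - z)"] L(2,3) e by (simp add: average_def measure_lebesgue_lborel)
  also have "... = (LINT x|lborel. indicator Q x * s Q x)"
  proof -
   have "(%x. indicator Q x * s Q x) : borel_fun" using Qm(1)[OF Q] by measurable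
   from integral_shift[OF this, of "- z"] show ?thesis unfolding ind by simp
  qed
  finally show "(LINT x|lebesgue_on ?Q. s Q (x - z)) = 0" using s(3)[OF Q] by simp
  qed (use s(2)[OF Q] in auto)
  moreover have "(LINT x|lebesgue_on ?Q. u x * s Q (x - z)) = (LINT x|lborel. indicator ?Q x * (u x * s Q (x - z)))"
  using average_lborel[of ?Q "%x. u x * s Q (x - z)"] L(2,3) e by (simp add: average_def measure_lebesgue_lborel)
  moreover have "indicator ?Q x * (u x * s Q (x - z)) = (indicator Q (x - z) * s Q (x - z)) * w x" for x
  using iu[of x] by (auto simp: ind)
  ultimately show ?thesis using L(2) by simp
 qed
 have "(LINT y|lborel. H (y - z) * w y) = (LINT y|lborel. (\<Sum>Q\<in>\<G>. (indicator Q (y - z) * s Q (y - z)) * w y))"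
  by (simp add: H_def sum_distrib_right)
 also have "... = (\<Sum>Q\<in>\<G>. LINT y|lborel. (indicator Q (y - z) * s Q (y - z)) * w y)"
 proof (rule Bochner_Integration.integral_sum)
  fix Q assume Q: "Q : \<G>"
  note [measurable] = s(1)[OF Q] Qm(1)[OF Q]
  show "L1 (%y. (indicator Q (y - z) * s Q (y - z)) * w y)"
  by (rule dominated[OF _ w, of _ 1], measurable) (use s(2)[OF Q] in \<open>auto simp: indicator_def\<close>)
 qed
 also have "... <= (\<Sum>Q\<in>\<G>. \<e> ^ CARD('n) * mosc ((%x. z + x) ` Q) u)" by (rule sum_mono) (rule each)
 also have "... = \<e> ^ CARD('n) * (\<Sum>Q\<in>\<G>'. mosc Q u)" unfolding \<G>'_def by (simp add: sum.reindex[OF inj] sum_distrib_left)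
 also have "... = \<e> * (\<e> ^ (CARD('n) - 1) * (\<Sum>Q\<in>\<G>'. mosc Q u))"
  by (subst power_eq_if[of \<e> "CARD('n)"]) simp
 also have "... <= \<e> * \<kappa>" using K e by (intro mult_left_mono) auto
 finally show ?thesis .
 qed
 \<comment> \<open>The shift becomes the variable of integration, as Fubini will need it.\<close>
 have cH: "conv k H y = (LINT z|lborel. k z * H (y - z))" for y
 proof -
 have "conv k H y = (LINT x|lborel. k (y - x) * H (y - (y - x)))" by (simp add: conv_def)
 also have "... = (LINT z|lborel. k z * H (y - z))"
  using integral_reflect_shift[of "%z. k z * H (y - z)" y] by simp
 finally show ?thesis .
 qed
 have "(\<Sum>Q\<in>\<G>. LINT x|lborel. indicator Q x * (s Q x * conv k w x)) = (LINT x|lborel. (\<Sum>Q\<in>\<G>. indicator Q x * (s Q x * conv k w x)))"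
 proof (rule Bochner_Integration.integral_sum[symmetric])
 fix Q assume Q: "Q : \<G>"
 have "L1 (%x. conv k w x * (indicator Q x * s Q x))"
  by (rule dominated[OF conv_meas[OF mol w] Qi[OF Q] conv_bound[OF mol w]])
 thus "L1 (%x. indicator Q x * (s Q x * conv k w x))" by (simp add: mult_ac)
 qed
 also have "... = (LINT x|lborel. conv k w x * H x)" by (simp add: H_def sum_distrib_left mult_ac)
 also have "... = (LINT y|lborel. w y * conv k H y)" by (rule conv_swap[OF mol w Hi, symmetric])
 also have "... = (LINT y|lborel. LINT z|lborel. w y * (k z * H (y - z)))" by (simp add: cH)
 also have "... = (LINT z|lborel. LINT y|lborel. w y * (k z * H (y - z)))"
 proof (rule dominated_fubini[of _ "%y. real (card \<G>) * \<bar>w y\<bar>" k])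
 show "\<bar>w y * (k z * H (y - z))\<bar> <= (real (card \<G>) * \<bar>w y\<bar>) * k z" for y z
 proof -
  have "(\<bar>w y\<bar> * k z) * \<bar>H (y - z)\<bar> <= (\<bar>w y\<bar> * k z) * real (card \<G>)"
  using Hb mollifierD(3)[OF mol] by (intro mult_left_mono) auto
  thus ?thesis using mollifierD(3)[OF mol, of z] by (simp add: abs_mult mult_ac)
 qed
 qed (use w mollifier_integrable[OF mol] in \<open>measurable, auto\<close>)
 also have "... = (LINT z|lborel. k z * (LINT y|lborel. H (y - z) * w y))"
 proof (rule Bochner_Integration.integral_cong)
 fix z
 have eq: "w y * (k z * H (y - z)) = k z * (H (y - z) * w y)" for y by simp
 show "(LINT y|lborel. w y * (k z * H (y - z))) = k z * (LINT y|lborel. H (y - z) * w y)" unfolding eq by simp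
 qed simp
 also have "... <= (LINT z|lborel. k z * (\<e> * \<kappa>))"
 proof (rule integral_mono')
 show "L1 (%z. k z * (\<e> * \<kappa>))" using mollifier_integrable[OF mol] by simp
 fix z
 show "k z * (LINT y|lborel. H (y - z) * w y) <= k z * (\<e> * \<kappa>)"
  using shifted[of z] mollifierD(3,6)[OF mol, of z] by (cases "norm z < \<delta>") (auto intro: mult_left_mono)
 show "0 <= k z * (\<e> * \<kappa>)" using mollifierD(3)[OF mol, of z] e \<kappa>(2) by simp
 qed
 also have "... = \<e> * \<kappa>" using mollifierD(7)[OF mol] by simp
 finally have "inverse \<e> * (\<Sum>Q\<in>\<G>. LINT x|lborel. indicator Q x * (s Q x * conv k w x)) <= inverse \<e> * (\<e> * \<kappa>)"
 using e by (intro mult_left_mono) auto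
 moreover have "inverse \<e> * (\<e> * \<kappa>) = \<kappa>" using e by simp
 ultimately show ?thesis by (simp add: sum_distrib_left)
qed

text \<open>All constants are fixed before \<open>u\<close>: the kernel and the tiling depend only
  on \<phi>, and the estimates see \<open>u\<close> only through its bound \<open>b\<close>. Without
  the bound the error terms could not be made small uniformly.\<close>

theorem lower_bound:
 fixes \<phi> :: "real^'n => real^'n"
 assumes q: "q > 1" and S: "open S" and \<phi>: "\<phi> : test_fields S" and \<eta>: "\<eta> > 0"
 shows "\<forall>\<^sub>F \<e> in at_right 0. \<forall>u\<in>Lp q lborel. Lpow q lborel u <= b --> ennreal (1/4 * pairing u \<phi>) <= K_fun \<e> S u + ennreal \<eta>"
proof -
 obtain D K where K: "has_C1 \<phi> D" "compact K" "K <= S" "!!x. x ~: K ==> \<phi> x = 0" "!!x. norm (\<phi> x) <= 1"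
 using \<phi> by (rule test_fieldD) blast
 obtain d0 where d0: "d0 > 0" "nbhd K d0 <= S" using nbhd_subset_open[OF K(2) S K(3)] by blast
 \<comment> \<open>The tiles lie within distance d of \<open>K\<close>. Moved by less than \<delta>
   <= d they stay in \<open>B\<close>, which lies in \<open>S\<close> and on which the truncated
   function \<open>w\<close> agrees with \<open>u\<close>.\<close>
 define d where "d = d0 / 3"
 have d: "d > 0" "d + 2 * d = d0" using d0 by (simp_all add: d_def)
 define A where "A = nbhd K d"
 have Ac: "compact A" unfolding A_def by (rule compact_nbhd[OF K(2)])
 define B where "B = nbhd K (d + 2 * d)"
 have Bc: "compact B" unfolding B_def by (rule compact_nbhd[OF K(2)])
 have Bm: "B : sets borel" by (intro borel_closed compact_imp_closed Bc)
 have BS: "B <= S" using d0 d by (simp add: B_def)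
 have KB: "K <= B" unfolding B_def using d by (intro nbhd_subset) simp
 obtain r0 where r0: "!!x. norm x > r0 ==> x ~: K" using compact_norm_bound[OF K(2)] by blast
 \<comment> \<open>Bounds the L1 norm of \<open>u\<close> on \<open>B\<close> for every
   \<open>u\<close> in question: \<open>abs_le_powr\<close> with \<eta> = 1 gives the measure of
   \<open>B\<close> plus \<open>b\<close>.\<close>
 define W where "W = measure lborel B + \<bar>b\<bar> + 1"
 have W: "W > 0" by (simp add: W_def add_nonneg_pos)
 define \<psi> where "\<psi> x = divergence \<phi> x" for x
 have \<psi>c: "continuous_on UNIV \<psi>" unfolding \<psi>_def by (rule divergence_continuous[OF K(1)])
 have \<psi>0: "\<psi> x = 0" if "x ~: K" for x unfolding \<psi>_def by (rule divergence_off_support[OF K(1,2,4) that])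
 have \<psi>r: "\<psi> x = 0" if "norm x > r0" for x using \<psi>0 r0[OF that] by blast
 have \<psi>b: "\<exists>C\<ge>0. \<forall>x. norm (\<psi> x) <= C" "L1 \<psi>" "uniformly_continuous_on UNIV \<psi>"
 by (rule continuous_bounded_support[OF \<psi>c \<psi>r], assumption)+
 obtain C where C: "!!x. norm (\<psi> x) <= C" using \<psi>b(1) by blast
 define \<eta>1 where "\<eta>1 = \<eta> / W"
 have \<eta>1: "\<eta>1 > 0" using \<eta> W by (simp add: \<eta>1_def)
 obtain d1 where d1: "d1 > 0" "!!x y. dist y x < d1 ==> \<bar>\<psi> y - \<psi> x\<bar> < \<eta>1"
 proof -
 obtain d1 where "d1 > 0" "\<forall>x y. dist y x < d1 --> dist (\<psi> y) (\<psi> x) < \<eta>1"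
  using \<psi>b(3) \<eta>1 unfolding uniformly_continuous_on_def by auto
 thus ?thesis using that[of d1] by (simp add: dist_norm)
 qed
 define \<delta> where "\<delta> = min d d1"
 have \<delta>: "\<delta> > 0" "\<delta> <= d" "\<delta> <= d1" using d d1(1) by (auto simp: \<delta>_def)
 obtain k :: "real^'n => real" and g L where mol: "mollifier \<delta> k g L" using mollifier_exists[OF \<delta>(1)] by blast
 have AB: "nbhd A \<delta> <= B"
 proof
 fix x assume "x : nbhd A \<delta>"
 then obtain y where y: "y : A" "dist y x <= \<delta>" by (auto simp: mem_nbhd)
 have "dist y x <= 2 * d" using y(2) \<delta>(2) d(1) by linarith
 with y(1) show "x : B" unfolding A_def B_def by (rule nbhd_step)
 qed
 define U where "U = interior A"
 have U: "open U" "bounded U" "U <= A"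
 using bounded_subset[OF compact_imp_bounded[OF Ac] interior_subset] interior_subset[of A] by (auto simp: U_def)
 have KU: "K <= U" unfolding U_def
 proof
 fix x assume "x : K"
 hence "ball x d <= A" unfolding A_def by (force simp: mem_nbhd)
 thus "x : interior A" using d(1) by (intro interiorI[of "ball x d"]) auto
 qed
 define V where "V = measure lborel U"
 have V: "V >= 0" by (simp add: V_def)
 \<comment> \<open>With the kernel fixed, one bound for the gradients of all the mollifications and
   for their Lipschitz constants.\<close>
 define M where "M = L * W"
 have M: "M >= 0" using mollifierD(2)[OF mol] W by (simp add: M_def)
 define \<eta>2 where "\<eta>2 = \<eta> / (M * (1 + V) + 1)"
 have MV: "M * (1 + V) + 1 > 0" using M V by (simp add: add_nonneg_pos)
 have \<eta>2: "\<eta>2 > 0" "M * \<eta>2 * (1 + V) <= \<eta>"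
 proof -
 show "\<eta>2 > 0" using \<eta> MV by (simp add: \<eta>2_def)
 have "\<eta> * (M * (1 + V)) <= \<eta> * (M * (1 + V) + 1)" using \<eta> by (intro mult_left_mono) auto
 thus "M * \<eta>2 * (1 + V) <= \<eta>" using MV by (simp add: \<eta>2_def field_simps)
 qed
 \<comment> \<open>The tiling is adapted to the negative field, because integration by parts turns
   the pairing with \<phi> into minus the integral of G \<bullet> \<phi>.\<close>
 have uc: "uniformly_continuous_on UNIV (%x. - \<phi> x)"
 by (rule continuous_bounded_support(3)[of _ r0]) (use K(4) r0 has_C1_continuous[OF K(1)] in \<open>auto intro: continuous_on_minus\<close>)
 have n1: "norm (- \<phi> x) <= 1" for x using K(5) by simp
 fix i0 :: 'n
 show ?thesis
 proof (rule adapted_tiling[OF uc n1 U(1,2) \<eta>2(1), of i0])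
 fix e0 :: real
 assume e0: "e0 > 0" "!!\<e>. \<e> > 0 ==> \<e> < e0 ==> \<exists>\<G>\<in>finite_families \<e> U.
  (\<forall>Q\<in>\<G>. \<exists>c (R :: real^'n => real^'n) \<rho>. orth R & Q = rcube c R \<e> & 0 <= \<rho> & \<rho> <= 1 & (\<forall>x\<in>Q. norm (- \<phi> x - \<rho> *\<^sub>R R (axis i0 1)) <= \<eta>2)) &
  measure lborel (U - \<Union>\<G>) < \<eta>2"
 define c1 where "c1 = (real CARD('n))\<^sup>2 * M * V"
 have c1: "c1 >= 0" using M V by (simp add: c1_def)
 define e1 where "e1 = min e0 (\<eta> / (2 * (c1 + 1)))"
 have e1: "e1 > 0" using e0(1) \<eta> c1 by (simp add: e1_def)
 show ?thesis unfolding eventually_at_right_field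
 proof (intro exI[of _ e1] conjI e1 allI impI ballI)
 fix \<e> :: real and u :: "real^'n => real"
 assume ep: "\<e> > 0" "\<e> < e1" and u: "u : Lp q lborel" and ub: "Lpow q lborel u <= b"
 have um [measurable]: "u : borel_fun" using u by (simp add: Lp_def)
 show "ennreal (1/4 * pairing u \<phi>) <= K_fun \<e> S u + ennreal \<eta>"
 proof (cases "K_fun \<e> S u")
  case top
  thus ?thesis by simp
 next
  case (real \<kappa>)
  define w where "w x = indicator B x * u x" for x
  have wL: "w : Lp q lborel" unfolding w_def by (rule Lp_indicator[OF u Bm])
  have wz: "w x = 0" if "x ~: B" for x using that by (simp add: w_def)
  have wi: "L1 w" by (rule integrable_of_Lp_bounded_support(1)[OF q wL wz Bm compact_imp_bounded[OF Bc]])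
  have wb: "(LINT x|lborel. \<bar>w x\<bar>) <= W"
  proof -
  have "(LINT x|lborel. \<bar>w x\<bar>) <= 1 * measure lborel B + 1 powr (1 - q) * Lpow q lborel w"
   by (rule integrable_of_Lp_bounded_support(2)[OF q wL wz Bm compact_imp_bounded[OF Bc]]) simp_all
  also have "Lpow q lborel w <= Lpow q lborel u" unfolding Lpow_def
  proof (rule integral_mono)
   fix x show "\<bar>w x\<bar> powr q <= \<bar>u x\<bar> powr q" by (simp add: w_def indicator_def)
  qed (use wL u in \<open>simp_all add: Lp_def\<close>)
  finally show ?thesis using ub by (simp add: W_def)
  qed
  define M' where "M' = L * (LINT y|lborel. \<bar>w y\<bar>)"
  have M': "0 <= M'" "M' <= M" unfolding M'_def M_def using mollifierD(2)[OF mol] wb by (auto intro: mult_left_mono)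
  define G where "G = gconv g w"
  have Gm [measurable]: "G : borel_fun" unfolding G_def by (rule borel_measurable_continuous_onI[OF gconv_continuous[OF mol wi]])
  have \<phi>m [measurable]: "\<phi> : borel_fun" by (rule borel_measurable_continuous_onI[OF has_C1_continuous[OF K(1)]])
  have Gb: "norm (G x) <= M" for x using gconv_bound[OF mol wi, of x] M' by (simp add: G_def M'_def)
  have GH: "\<bar>G x \<bullet> h\<bar> <= M * C" if "norm h <= C" for x h C
  using Cauchy_Schwarz_ineq2[of "G x" h] mult_mono[OF Gb that M norm_ge_zero] by (rule order_trans)
  \<comment> \<open>The divergence of \<phi> is uniformly continuous, so it changes by at most
    \<eta>1 under mollification. Self-adjointness then lets \<open>w\<close> be replaced by its
    mollification in the pairing, at a cost governed by \<open>W\<close>.\<close>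
  have close: "\<bar>conv k \<psi> x - \<psi> x\<bar> <= \<eta>1" for x
  proof -
  note i = conv_diff_eq(1)[OF mol \<psi>b(2), of x]
  have "norm (LINT z|lborel. k z *\<^sub>R (\<psi> (z + x) - \<psi> x)) <= (LINT z|lborel. norm (k z *\<^sub>R (\<psi> (z + x) - \<psi> x)))"
   by (rule integral_norm_bound)
  also have "... <= (LINT z|lborel. k z * \<eta>1)"
  proof (rule integral_mono[OF integrable_norm[OF i]])
   show "L1 (%z. k z * \<eta>1)" using mollifier_integrable[OF mol] by simp
   fix z
   show "norm (k z *\<^sub>R (\<psi> (z + x) - \<psi> x)) <= k z * \<eta>1"
   proof (cases "norm z < \<delta>")
   case True
   hence "\<bar>\<psi> (z + x) - \<psi> x\<bar> <= \<eta>1" using d1(2)[of "z + x" x] \<delta>(3) by (simp add: dist_norm less_imp_le)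
   thus ?thesis using mollifierD(3)[OF mol, of z] by (simp add: abs_mult mult_left_mono)
   qed (use mollifierD(6)[OF mol, of z] in simp)
  qed
  finally show ?thesis using conv_diff_eq(2)[OF mol \<psi>b(2), of x] mollifierD(7)[OF mol] by simp
  qed
  have p1: "pairing u \<phi> <= - (LINT x|lborel. G x \<bullet> \<phi> x) + \<eta>"
  proof -
  have \<psi>i: "L1 \<psi>" by (rule \<psi>b(2))
  have [measurable]: "\<psi> : borel_fun" by (rule borel_measurable_continuous_onI[OF \<psi>c])
  have i1: "L1 (%x. w x * \<psi> x)"
   by (rule Bochner_Integration.integrable_bound[of _ "%x. C * w x"])
    (use wi C in \<open>auto simp: abs_mult mult.commute intro!: mult_right_mono AE_I2 intro: order_trans[OF _ abs_ge_self]\<close>)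
  have i2: "L1 (%x. w x * conv k \<psi> x)"
  proof (rule Bochner_Integration.integrable_bound[of _ "%x. (L * (LINT y|lborel. \<bar>\<psi> y\<bar>)) * w x"])
   have [measurable]: "conv k \<psi> : borel_fun" by (rule conv_meas[OF mol \<psi>i])
   show "(%x. w x * conv k \<psi> x) : borel_measurable lborel" using wi by measurable
   show "AE x in lborel. norm (w x * conv k \<psi> x) <= norm (L * (LINT y|lborel. \<bar>\<psi> y\<bar>) * w x)"
   using conv_bound[OF mol \<psi>i] mollifierD(2)[OF mol] by (intro AE_I2) (auto simp: abs_mult mult.commute[of _ "\<bar>w _\<bar>"] intro!: mult_left_mono intro: order_trans[OF _ abs_ge_self])
  qed (use wi in auto)
  have "pairing u \<phi> = (LINT x|lborel. w x * \<psi> x)" unfolding pairing_def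
   by (intro Bochner_Integration.integral_cong) (use \<psi>0 KB in \<open>auto simp: \<psi>_def w_def indicator_def\<close>)
  also have "... <= (LINT x|lborel. w x * conv k \<psi> x + \<eta>1 * \<bar>w x\<bar>)"
  proof (rule integral_mono)
   fix x
   have "\<bar>w x * (\<psi> x - conv k \<psi> x)\<bar> <= \<bar>w x\<bar> * \<eta>1" unfolding abs_mult
   using close[of x] by (intro mult_left_mono) (auto simp: abs_minus_commute)
   thus "w x * \<psi> x <= w x * conv k \<psi> x + \<eta>1 * \<bar>w x\<bar>" by (simp add: algebra_simps abs_le_iff)
  qed (use i1 i2 wi in auto)
  also have "... = (LINT x|lborel. w x * conv k \<psi> x) + \<eta>1 * (LINT x|lborel. \<bar>w x\<bar>)" using i2 wi by simp
  also have "(LINT x|lborel. w x * conv k \<psi> x) = pairing (conv k w) \<phi>"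
   unfolding conv_swap[OF mol wi \<psi>i] by (simp add: pairing_def \<psi>_def)
  also have "... = - (LINT x|lborel. G x \<bullet> \<phi> x)" unfolding G_def
   by (rule pairing_cutoff[OF conv_gradient[OF mol wi] K(1), of r0]) (use K(4) r0 in blast)
  also have "\<eta>1 * (LINT x|lborel. \<bar>w x\<bar>) <= \<eta>1 * W" using wb \<eta>1 by (intro mult_left_mono) auto
  also have "\<eta>1 * W = \<eta>" using W by (simp add: \<eta>1_def)
  finally show ?thesis by simp
  qed
  have "\<e> < e0" using ep(2) by (simp add: e1_def)
  from e0(2)[OF ep(1) this] obtain \<G> where \<G>: "\<G> : finite_families \<e> U" and tile: "\<forall>Q\<in>\<G>. \<exists>c (R :: real^'n => real^'n) \<rho>. orth R & Q = rcube c R \<e> & 0 <= \<rho> & \<rho> <= 1 & (\<forall>x\<in>Q. norm (- \<phi> x - \<rho> *\<^sub>R R (axis i0 1)) <= \<eta>2)"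
  and rest: "measure lborel (U - \<Union>\<G>) < \<eta>2" by (elim bexE conjE)
  note F = finite_familiesD[OF \<G>]
  have "Q <= A" if "Q : \<G>" for Q using F(3)[OF that] U(3) by (rule subset_trans)
  hence GA: "\<G> : finite_families \<e> A" using \<G> by (simp add: finite_families_def cube_families_def)
  have Qm: "Q : sets borel" "bounded Q" if "Q : \<G>" for Q
  using cube_lmeasurable(4)[OF F(2)[OF that] ep(1)] bounded_subset[OF U(2) F(3)[OF that]] by auto
  define good where "good Q s \<longleftrightarrow> s : borel_fun & (\<forall>x. \<bar>s x\<bar> <= 1) & (LINT x|lborel. indicator Q x * s x) = 0 &
  - (1/4 * (LINT x|lborel. indicator Q x * (G x \<bullet> \<phi> x))) <= inverse \<e> * (LINT x|lborel. indicator Q x * (s x * conv k w x)) + ((real CARD('n))\<^sup>2 * M * \<e> + M * \<eta>2 / 4) * measure lborel Q" for Q and s :: "real^'n => real"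
  have "\<exists>s. good Q s" if Q: "Q : \<G>" for Q
  proof -
  obtain c and R :: "real^'n => real^'n" and \<rho> where R: "orth R" "Q = rcube c R \<e>" "0 <= \<rho>" "\<rho> <= 1" "\<forall>x\<in>Q. norm (- \<phi> x - \<rho> *\<^sub>R R (axis i0 1)) <= \<eta>2"
   using bspec[OF tile Q] by (elim conjE exE) (erule (4) that)
  have mQ: "measure lborel Q = \<e> ^ CARD('n)" unfolding R(2) by (rule measure_rcube[OF R(1) ep(1)])
  note ib = integrable_bounded_on[OF Qm[OF Q]]
  have iQ: "L1 (indicator Q :: real^'n => real)" using ib[of "%_. 1" 1] by simp
  have i1: "L1 (%x. indicator Q x * (G x \<bullet> \<phi> x))"
   by (rule ib[of _ "M * 1"], measurable) (rule GH[OF K(5)])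
  have i2: "L1 (%x. indicator Q x * (G x \<bullet> (\<rho> *\<^sub>R R (axis i0 1))))"
   by (rule ib, measurable) (rule GH[OF order_refl])
  obtain s where s: "s : borel_fun" "\<forall>x. \<bar>s x\<bar> <= 1" "(LINT x|lborel. indicator Q x * s x) = 0"
   "1/4 * (LINT x|lborel. indicator Q x * (gconv g w x \<bullet> (\<rho> *\<^sub>R R (axis i0 1)))) <= inverse \<e> * (LINT x|lborel. indicator Q x * (s x * conv k w x)) + (real CARD('n))\<^sup>2 * M' * \<e> * \<e> ^ CARD('n)"
   by (rule dual_cube[OF mol wi R(1) ep(1) R(3,4) M'_def R(2), of i0]) (erule (3) that)
  have "- (LINT x|lborel. indicator Q x * (G x \<bullet> \<phi> x)) = (LINT x|lborel. - (indicator Q x * (G x \<bullet> \<phi> x)))" by simp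
  also have "... <= (LINT x|lborel. indicator Q x * (G x \<bullet> (\<rho> *\<^sub>R R (axis i0 1))) + M * \<eta>2 * indicator Q x)"
  proof (rule integral_mono)
   fix x
   show "- (indicator Q x * (G x \<bullet> \<phi> x)) <= indicator Q x * (G x \<bullet> (\<rho> *\<^sub>R R (axis i0 1))) + M * \<eta>2 * indicator Q x"
   proof (cases "x : Q")
   case True
   from GH[OF bspec[OF R(5) True], of x] have "\<bar>G x \<bullet> (- \<phi> x) - G x \<bullet> (\<rho> *\<^sub>R R (axis i0 1))\<bar> <= M * \<eta>2" unfolding inner_diff_right .
   hence "- (G x \<bullet> \<phi> x) <= G x \<bullet> (\<rho> *\<^sub>R R (axis i0 1)) + M * \<eta>2" by (simp only: inner_minus_right abs_le_iff) linarith
   thus ?thesis using True by simp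
   qed simp
  qed (use i1 i2 iQ in auto)
  also have "... = (LINT x|lborel. indicator Q x * (G x \<bullet> (\<rho> *\<^sub>R R (axis i0 1)))) + M * \<eta>2 * measure lborel Q" using i2 iQ by simp
  finally have "- (1/4 * (LINT x|lborel. indicator Q x * (G x \<bullet> \<phi> x))) <= 1/4 * (LINT x|lborel. indicator Q x * (G x \<bullet> (\<rho> *\<^sub>R R (axis i0 1)))) + M * \<eta>2 / 4 * measure lborel Q" by simp
  moreover have "(real CARD('n))\<^sup>2 * M' * \<e> * \<e> ^ CARD('n) <= (real CARD('n))\<^sup>2 * M * \<e> * measure lborel Q"
   unfolding mQ using M' ep by (intro mult_right_mono mult_left_mono) auto
  ultimately have "good Q s" using s unfolding good_def G_def by (simp add: algebra_simps)
  thus ?thesis by (rule exI[of "good Q" s])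
  qed
  hence "\<forall>Q\<in>\<G>. \<exists>s. good Q s" by blast
  from bchoice[OF this] obtain s where "\<forall>Q\<in>\<G>. good Q (s Q)" by (elim exE)
  hence s: "Q : \<G> ==> s Q : borel_fun" "Q : \<G> ==> \<bar>s Q x\<bar> <= 1"
  "Q : \<G> ==> (LINT x|lborel. indicator Q x * s Q x) = 0"
  "Q : \<G> ==> - (1/4 * (LINT x|lborel. indicator Q x * (G x \<bullet> \<phi> x))) <= inverse \<e> * (LINT x|lborel. indicator Q x * (s Q x * conv k w x)) + ((real CARD('n))\<^sup>2 * M * \<e> + M * \<eta>2 / 4) * measure lborel Q" for Q x
  unfolding good_def by simp_all
  have dual: "(\<Sum>Q\<in>\<G>. inverse \<e> * (LINT x|lborel. indicator Q x * (s Q x * conv k w x))) <= \<kappa>"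
  by (rule dual_family[OF mol wi um _ _ GA ep(1) s(1-3) real(2,1)]) (use AB BS in \<open>auto simp: w_def\<close>)
  \<comment> \<open>On the part missed by the cubes the gradient is merely bounded by
    \<open>M\<close>; the small measure of this part makes up for it.\<close>
  define X where "X = U - \<Union>\<G>"
  have Xm [measurable]: "X : sets borel" using F(1) Qm(1) U(1) by (auto simp: X_def intro!: sets.Diff sets.finite_Union)
  have Xb: "bounded X" by (rule bounded_subset[OF U(2)]) (auto simp: X_def)
  have Um [measurable]: "U : sets borel" using U(1) by simp
  have iX: "L1 (indicator X :: real^'n => real)" using integrable_bounded_on[OF Xm Xb, of "%_. 1" 1] by simp
  have iU: "L1 (%x. indicator U x * (1::real))" by (rule integrable_bounded_on[OF Um U(2), of "%_. 1" 1]) auto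
  have iQ: "L1 (%x. indicator Q x * (G x \<bullet> \<phi> x))" if "Q : \<G>" for Q
  by (rule integrable_bounded_on[OF Qm[OF that], of _ "M * 1"], measurable) (rule GH[OF K(5)])
  have iU': "L1 (%x. indicator U x * (G x \<bullet> \<phi> x))"
  by (rule integrable_bounded_on[OF Um U(2), of _ "M * 1"], measurable) (rule GH[OF K(5)])
  have \<phi>U: "G x \<bullet> \<phi> x = indicator U x * (G x \<bullet> \<phi> x)" for x using K(4) KU by (cases "x : K") auto
  have dj: "disjoint_family_on (%Q. Q) \<G>" using F(4) by (auto simp: disjoint_family_on_def pairwise_def disjnt_def)
  have "- (LINT x|lborel. G x \<bullet> \<phi> x) = (LINT x|lborel. - (indicator U x * (G x \<bullet> \<phi> x)))" by (subst \<phi>U) simp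
  also have "... <= (LINT x|lborel. M * indicator X x + (\<Sum>Q\<in>\<G>. - (indicator Q x * (G x \<bullet> \<phi> x))))"
  proof (rule integral_mono)
  fix x
  have "(\<Sum>Q\<in>\<G>. - (indicator Q x * (G x \<bullet> \<phi> x))) = - (indicator (\<Union>Q\<in>\<G>. Q) x * (G x \<bullet> \<phi> x))"
   unfolding sum_negf sum_distrib_right[symmetric] indicator_UN_disjoint[OF F(1) dj] by (rule refl)
  moreover have "- (G x \<bullet> \<phi> x) <= M" using GH[OF K(5), of x x] by simp
  ultimately show "- (indicator U x * (G x \<bullet> \<phi> x)) <= M * indicator X x + (\<Sum>Q\<in>\<G>. - (indicator Q x * (G x \<bullet> \<phi> x)))"
   using F(3) M by (auto simp: X_def indicator_def)
  qed (use iU' iX iQ in auto)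
  also have "... = M * measure lborel X + (\<Sum>Q\<in>\<G>. - (LINT x|lborel. indicator Q x * (G x \<bullet> \<phi> x)))"
  using iX iQ by (subst Bochner_Integration.integral_add) (auto simp: Bochner_Integration.integral_sum)
  finally have "- (1/4 * (LINT x|lborel. G x \<bullet> \<phi> x)) <= M * measure lborel X / 4 + (\<Sum>Q\<in>\<G>. - (1/4 * (LINT x|lborel. indicator Q x * (G x \<bullet> \<phi> x))))"
  by (simp add: sum_negf sum_divide_distrib[symmetric])
  also have "(\<Sum>Q\<in>\<G>. - (1/4 * (LINT x|lborel. indicator Q x * (G x \<bullet> \<phi> x)))) <= (\<Sum>Q\<in>\<G>. inverse \<e> * (LINT x|lborel. indicator Q x * (s Q x * conv k w x)) + ((real CARD('n))\<^sup>2 * M * \<e> + M * \<eta>2 / 4) * measure lborel Q)"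
  by (rule sum_mono) (rule s(4))
  also have "... = (\<Sum>Q\<in>\<G>. inverse \<e> * (LINT x|lborel. indicator Q x * (s Q x * conv k w x))) + ((real CARD('n))\<^sup>2 * M * \<e> + M * \<eta>2 / 4) * (\<Sum>Q\<in>\<G>. measure lborel Q)"
  by (simp only: sum.distrib sum_distrib_left)
  also have "... <= \<kappa> + ((real CARD('n))\<^sup>2 * M * \<e> + M * \<eta>2 / 4) * V"
  proof (intro add_mono dual mult_left_mono)
  have "(\<Sum>Q\<in>\<G>. LINT x|lborel. indicator Q x * (1::real)) <= (LINT x|lborel. indicator U x * (1::real))"
   by (rule disjoint_family_integral_le[OF F(1,4) Qm(1) F(3) _ iU]) auto
  thus "(\<Sum>Q\<in>\<G>. measure lborel Q) <= V" using Qm(1) Um by (simp add: V_def)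
  qed (use M ep \<eta>2(1) in auto)
  also have "M * measure lborel X / 4 <= M * \<eta>2 / 4" using rest M by (intro divide_right_mono mult_left_mono) (auto simp: X_def)
  finally have "- (1/4 * (LINT x|lborel. G x \<bullet> \<phi> x)) <= \<kappa> + c1 * \<e> + M * \<eta>2 * (1 + V) / 4"
  by (simp add: c1_def algebra_simps add_divide_distrib)
  also have "c1 * \<e> <= \<eta> / 2"
  proof -
  have "c1 * \<e> <= (c1 + 1) * (\<eta> / (2 * (c1 + 1)))" using ep c1 by (intro mult_mono) (auto simp: e1_def)
  also have "... = \<eta> / 2" using c1 by (simp add: field_simps)
  finally show ?thesis .
  qed
  \<comment> \<open>The error budget: \<eta> / 4 from the mollification, \<eta> / 2 from the Taylor
    terms \<open>c1 * \<e>\<close>, and \<eta> / 4 from the deviation of the field on the tiles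
    together with the uncovered part.\<close>
  finally have "1/4 * pairing u \<phi> <= \<kappa> + \<eta>" using p1 \<eta>2(2) by simp
  hence "ennreal (1/4 * pairing u \<phi>) <= ennreal (\<kappa> + \<eta>)" by (rule ennreal_leI)
  thus ?thesis using real \<eta> by simp
 qed
 qed
qed
qed

section \<open>From functions on the domain to Borel functions on the whole space\<close>

lemma integral_lebesgue_on:
 fixes h :: "real^'n => real"
 assumes [measurable]: "S : sets borel" "h : borel_fun"
 shows "(LINT x|lebesgue_on S. h x) = (LINT x|lborel. indicator S x * h x)"
proof -
 have "(LINT x|lebesgue_on S. h x) = (LINT x|lebesgue. indicator S x *\<^sub>R h x)"
 by (subst integral_restrict_space) auto
 thus ?thesis by (simp add: integral_completion)
qed

lemma Lp_restrict:
 fixes w :: "real^'n => real"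
 assumes S: "S : sets borel" and w: "w : Lp q lborel"
 shows "w : Lp q (lebesgue_on S)" "Lpow q (lebesgue_on S) w <= Lpow q lborel w"
proof -
 have wm [measurable]: "w : borel_fun" using w by (simp add: Lp_def)
 have pm: "(%x. \<bar>w x\<bar> powr q) : borel_fun" by measurable
 have i: "L1 (%x. indicator S x * \<bar>w x\<bar> powr q)"
 by (rule Bochner_Integration.integrable_bound[OF Lp_integrable[OF w]]) (use S in \<open>auto simp: indicator_def\<close>)
 have "w : borel_measurable (lebesgue_on S)"
 by (rule measurable_restrict_space1, rule measurable_completion) simp
 thus "w : Lp q (lebesgue_on S)" using i integrable_lebesgue_on_iff[OF S pm] by (simp add: Lp_def)
 show "Lpow q (lebesgue_on S) w <= Lpow q lborel w"
 unfolding Lpow_def integral_lebesgue_on[OF S pm]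
 by (rule integral_mono[OF i Lp_integrable[OF w]]) (simp add: indicator_def)
qed

text \<open>The problem is posed for functions on \<open>S\<close> modulo null sets, the estimates
  concern Borel functions on the whole space. The representative is extended by 0, so that no norm
  is gained outside.\<close>

lemma borel_representative:
 fixes u :: "real^'n => real"
 assumes S: "S : sets borel" and q: "q > 1" and u: "u : Lp q (lebesgue_on S)"
 obtains v where "v : Lp q lborel" "AE x in lebesgue_on S. v x = u x" "Lpow q lborel v = Lpow q (lebesgue_on S) u"
proof -
 have um: "u : borel_measurable (lebesgue_on S)" using u by (simp add: Lp_def)
 hence "(%x. indicator S x *\<^sub>R u x) : borel_measurable lebesgue"
 using S by (subst (asm) borel_measurable_restrict_space_iff) auto
 from completion_ex_borel_measurable_real[OF this] obtain g where g [measurable]: "g : borel_measurable lborel"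
 and ae: "AE x in lborel. indicator S x *\<^sub>R u x = g x" by auto
 define v where "v x = indicator S x * g x" for x
 have vm [measurable]: "v : borel_fun" unfolding v_def using S g by measurable
 have "AE x in lebesgue. x : S --> v x = u x"
 using AE_completion[OF ae] by (rule AE_mp) (auto simp: v_def intro!: AE_I2)
 hence AE: "AE x in lebesgue_on S. v x = u x" using S by (simp add: AE_restrict_space_iff)
 have "integrable (lebesgue_on S) (%x. \<bar>v x\<bar> powr q) \<longleftrightarrow> integrable (lebesgue_on S) (%x. \<bar>u x\<bar> powr q)"
 proof (rule integrable_cong_AE)
 show "(%x. \<bar>v x\<bar> powr q) : borel_measurable (lebesgue_on S)"
  by (rule measurable_restrict_space1, rule measurable_completion) simp
 show "(%x. \<bar>u x\<bar> powr q) : borel_measurable (lebesgue_on S)" using um by measurable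
 show "AE x in lebesgue_on S. \<bar>v x\<bar> powr q = \<bar>u x\<bar> powr q" using AE by (rule AE_mp) simp
 qed
 hence i: "integrable (lebesgue_on S) (%x. \<bar>v x\<bar> powr q)" using u by (simp add: Lp_def)
 have pm: "(%x. \<bar>v x\<bar> powr q) : borel_fun" by measurable
 have vS: "indicator S x * \<bar>v x\<bar> powr q = \<bar>v x\<bar> powr q" for x by (simp add: v_def indicator_def)
 have "v : Lp q lborel" using i integrable_lebesgue_on_iff[OF S pm] by (simp add: Lp_def vS)
 moreover have "Lpow q lborel v = Lpow q (lebesgue_on S) v" unfolding Lpow_def integral_lebesgue_on[OF S pm] vS ..
 moreover have "Lpow q (lebesgue_on S) v = Lpow q (lebesgue_on S) u" unfolding Lpow_def
 proof (rule integral_cong_AE)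
 show "(%x. \<bar>v x\<bar> powr q) : borel_measurable (lebesgue_on S)"
  by (rule measurable_restrict_space1, rule measurable_completion) simp
 show "(%x. \<bar>u x\<bar> powr q) : borel_measurable (lebesgue_on S)" using um by measurable
 show "AE x in lebesgue_on S. \<bar>v x\<bar> powr q = \<bar>u x\<bar> powr q" using AE by (rule AE_mp) simp
 qed
 ultimately show ?thesis using AE by (intro that[of v]) auto
qed

text \<open>The factor 1/4 is included so that the supremum over the test fields is the first term
  of \<open>F_lim\<close>.\<close>

definition Jtest :: "(real^'n) set => (real^'n => real^'n) => (real^'n => real) => real" where
 "Jtest S \<phi> u = 1/4 * (LINT x|lebesgue_on S. u x * divergence \<phi> x)"

lemma sup_lin_total_variation: "sup_lin (Jtest S) (test_fields S) u = ennreal (1/4) * total_variation S u"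
 unfolding sup_lin_def Jtest_def total_variation_def SUP_mult_left_ennreal
 by (intro SUP_cong refl ennreal_mult') simp

lemma Jtest_borel:
 assumes S: "open S" and q: "q > 1" and u: "u : Lp q lborel" and \<phi>: "\<phi> : test_fields S"
 shows "integrable (lebesgue_on S) (%x. u x * divergence \<phi> x)" "Jtest S \<phi> u = 1/4 * pairing u \<phi>"
proof -
 obtain D K where K: "has_C1 \<phi> D" "compact K" "K <= S" "!!x. x ~: K ==> \<phi> x = 0" using \<phi> by (rule test_fieldD) blast
 have [measurable]: "u : borel_fun" using u by (simp add: Lp_def)
 have [measurable]: "divergence \<phi> : borel_fun" by (rule borel_measurable_continuous_onI[OF divergence_continuous[OF K(1)]])
 have Sm: "S : sets borel" using S by simp
 have m: "(%x. u x * divergence \<phi> x) : borel_fun" by measurable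
 have eq: "indicator S x * (u x * divergence \<phi> x) = u x * divergence \<phi> x" for x
 using divergence_off_support[OF K(1,2,4), of x] K(3) by (auto simp: indicator_def)
 show "integrable (lebesgue_on S) (%x. u x * divergence \<phi> x)"
 unfolding integrable_lebesgue_on_iff[OF Sm m] eq by (rule Lp_times_divergence[OF q u K(1,2,4)])
 show "Jtest S \<phi> u = 1/4 * pairing u \<phi>" unfolding Jtest_def pairing_def integral_lebesgue_on[OF Sm m] eq ..
qed

lemma Jtest_cong:
 assumes S: "open S" and q: "q > 1" and u: "u : Lp q (lebesgue_on S)" and v: "v : Lp q lborel" and AE: "AE x in lebesgue_on S. v x = u x"
 and \<phi>: "\<phi> : test_fields S"
 shows "integrable (lebesgue_on S) (%x. u x * divergence \<phi> x)" "Jtest S \<phi> v = Jtest S \<phi> u"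
proof -
 obtain D K where K: "has_C1 \<phi> D" using \<phi> by (rule test_fieldD) blast
 have Sm: "S : sets borel" using S by simp
 have [measurable]: "divergence \<phi> : borel_measurable (lebesgue_on S)"
 by (rule measurable_restrict_space1, rule measurable_completion) (simp add: borel_measurable_continuous_onI[OF divergence_continuous[OF K]])
 have [measurable]: "u : borel_measurable (lebesgue_on S)" "v : borel_measurable (lebesgue_on S)"
 using u Lp_restrict(1)[OF Sm v] by (auto simp: Lp_def)
 have m: "(%x. v x * divergence \<phi> x) : borel_measurable (lebesgue_on S)" "(%x. u x * divergence \<phi> x) : borel_measurable (lebesgue_on S)"
 "AE x in lebesgue_on S. v x * divergence \<phi> x = u x * divergence \<phi> x" using AE by auto
 show "integrable (lebesgue_on S) (%x. u x * divergence \<phi> x)"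
 using integrable_cong_AE[OF m] Jtest_borel(1)[OF S q v \<phi>] by simp
 show "Jtest S \<phi> v = Jtest S \<phi> u" unfolding Jtest_def integral_cong_AE[OF m] ..
qed

text \<open>For a linear functional, smallness near 0 yields continuity. On the compact support of
  the field the L1 size is at most \<open>a * V\<close> plus \<open>b\<close> times the q-th power,
  and both summands are controlled by \<open>a\<close>.\<close>

lemma Jtest_small:
 assumes S: "open S" and q: "q > 1" and \<phi>: "\<phi> : test_fields S" and \<eta>: "\<eta> > 0"
 shows "\<exists>\<delta>>0. \<forall>w\<in>Lp q (lebesgue_on S). Lpow q (lebesgue_on S) w < \<delta> --> \<bar>Jtest S \<phi> w\<bar> <= \<eta>"
proof -
 obtain D K where K: "has_C1 \<phi> D" "compact K" "K <= S" "!!x. x ~: K ==> \<phi> x = 0" using \<phi> by (rule test_fieldD) blast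
 obtain r where r: "!!x. norm x > r ==> x ~: K" using compact_norm_bound[OF K(2)] by blast
 have dz: "divergence \<phi> x = 0" if "x ~: K" for x by (rule divergence_off_support[OF K(1,2,4) that])
 have dr: "divergence \<phi> x = 0" if "norm x > r" for x using dz r[OF that] by blast
 obtain C where C: "C >= 0" "!!x. norm (divergence \<phi> x) <= C"
 using continuous_bounded_support(1)[OF divergence_continuous[OF K(1)] dr] by blast
 have Sm: "S : sets borel" using S by simp
 have Km: "K : sets borel" by (intro borel_closed compact_imp_closed K(2))
 define V where "V = measure lborel K"
 define a where "a = \<eta> / ((C + 1) * (V + 1))"
 have V: "V >= 0" by (simp add: V_def)
 have a: "a > 0" using C V \<eta> by (simp add: a_def)
 define b where "b = a powr (1 - q)"
 have b: "b > 0" using a by (simp add: b_def)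
 show ?thesis
 proof (intro exI[of _ "a / b"] conjI ballI impI)
 show "a / b > 0" using a b by simp
 fix w assume w: "w : Lp q (lebesgue_on S)" and small: "Lpow q (lebesgue_on S) w < a / b"
 obtain v where v: "v : Lp q lborel" "AE x in lebesgue_on S. v x = w x" "Lpow q lborel v = Lpow q (lebesgue_on S) w"
  by (rule borel_representative[OF Sm q w])
 define z where "z x = indicator K x * v x" for x
 have zL: "z : Lp q lborel" unfolding z_def by (rule Lp_indicator[OF v(1) Km])
 have z0: "z x = 0" if "x ~: K" for x using that by (simp add: z_def)
 note I = integrable_of_Lp_bounded_support[OF q zL z0 Km compact_imp_bounded[OF K(2)]]
 have "Lpow q lborel z <= Lpow q lborel v" unfolding Lpow_def
  by (rule integral_mono[OF Lp_integrable[OF zL] Lp_integrable[OF v(1)]]) (simp add: z_def indicator_def)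
 hence "b * Lpow q lborel z <= b * (a / b)" using small v(3) b by (intro mult_left_mono) auto
 hence "b * Lpow q lborel z <= a" using b by simp
 moreover have "(LINT x|lborel. \<bar>z x\<bar>) <= a * V + b * Lpow q lborel z" unfolding V_def b_def by (rule I(2)[OF _ a])
 ultimately have zb: "(LINT x|lborel. \<bar>z x\<bar>) <= a * (V + 1)" by (simp add: algebra_simps)
 have "\<bar>pairing v \<phi>\<bar> <= (LINT x|lborel. \<bar>v x * divergence \<phi> x\<bar>)" unfolding pairing_def by (rule integral_abs_bound)
 also have "... <= (LINT x|lborel. C * \<bar>z x\<bar>)"
 proof (rule integral_mono)
  show "L1 (%x. \<bar>v x * divergence \<phi> x\<bar>)" by (rule integrable_abs[OF Lp_times_divergence[OF q v(1) K(1,2,4)]])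
  show "L1 (%x. C * \<bar>z x\<bar>)" using I(1) by simp
  show "\<bar>v x * divergence \<phi> x\<bar> <= C * \<bar>z x\<bar>" for x
  using mult_right_mono[OF C(2)[of x], of "\<bar>v x\<bar>"] dz[of x] by (cases "x : K") (simp_all add: z_def abs_mult mult.commute)
 qed
 also have "... <= C * (a * (V + 1))" using zb C(1) by (simp add: mult_left_mono)
 also have "... <= (C + 1) * (a * (V + 1))" using a V by (intro mult_right_mono) auto
 also have "... = \<eta>" using C V by (simp add: a_def)
 finally have "\<bar>pairing v \<phi>\<bar> <= \<eta>" .
 moreover have "Jtest S \<phi> w = 1/4 * pairing v \<phi>"
  using Jtest_cong(2)[OF S q w v(1,2) \<phi>] Jtest_borel(2)[OF S q v(1) \<phi>] by simp
 ultimately show "\<bar>Jtest S \<phi> w\<bar> <= \<eta>" using \<eta> by (simp add: abs_mult)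
 qed
qed

lemma Lpow_cong_AE:
 assumes q: "q > 1" and "v : Lp q M" "u : Lp q M" "w : Lp q M" and AE: "AE x in M. v x = u x"
 shows "Lpow q M (%x. w x - u x) = Lpow q M (%x. w x - v x)"
proof -
 have [measurable]: "u : borel_measurable M" "v : borel_measurable M" "w : borel_measurable M" using assms by (auto simp: Lp_def)
 show ?thesis unfolding Lpow_def
 proof (rule integral_cong_AE)
 show "AE x in M. \<bar>w x - u x\<bar> powr q = \<bar>w x - v x\<bar> powr q" using AE by (rule AE_mp) simp
 qed measurable
qed

text \<open>Lower semicontinuity along the constant sequence \<open>v\<close>, whose distance to
  \<open>u\<close> in L^q is 0.\<close>

lemma K_fun_cong_AE:
 fixes u v :: "real^'n => real"
 assumes q: "q > 1" and S: "S : sets lebesgue" and e: "\<e> > 0" and u: "u : Lp q (lebesgue_on S)" and v: "v : Lp q (lebesgue_on S)"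
 and AE: "AE x in lebesgue_on S. v x = u x"
 shows "K_fun \<e> S u <= K_fun \<e> S v"
proof -
 have "Lpow q (lebesgue_on S) (%x. v x - u x) = 0" using Lpow_cong_AE[OF q v u v AE] q by (simp add: Lpow_def)
 thus ?thesis using K_fun_lsc[OF q S e] u v unfolding seq_lsc_def
 by (auto dest!: spec[of _ "%_. v"] bspec[of _ _ u] simp: Liminf_const)
qed

text \<open>The abstract convergence result is applied with the linear functionals
  \<open>Jtest \<Omega>\<close>, indexed by the test fields, and the functionals
  \<open>K_fun\<close>. Its hypotheses are verified on Borel representatives, which share pairings
  and norms with the given functions.\<close>

theorem theorem1p3:
  fixes \<Omega> :: "(real^'n) set" and q \<Lambda> :: real and f :: "real^'n \<Rightarrow> real"
  assumes "open \<Omega>" and "q > 1" and "\<Lambda> > 0" and "f \<in> Lq q \<Omega>"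
  shows "(\<forall>\<epsilon>>0. \<exists>u. unique_minimizer \<Omega> (F_eps q \<Lambda> f \<epsilon> \<Omega>) (Lq q \<Omega>) u) \<and>
    (\<forall>u u\<^sub>0.
       (\<forall>\<epsilon>>0. unique_minimizer \<Omega> (F_eps q \<Lambda> f \<epsilon> \<Omega>) (Lq q \<Omega>) (u \<epsilon>)) \<longrightarrow>
       unique_minimizer \<Omega> (F_lim q \<Lambda> f \<Omega>) (Lq q \<Omega> \<inter> BV \<Omega>) u\<^sub>0 \<longrightarrow>
       ((\<lambda>\<epsilon>. Lq_norm q \<Omega> (\<lambda>x. u \<epsilon> x - u\<^sub>0 x)) \<longlongrightarrow> 0) (at_right 0) \<and>
       ((\<lambda>\<epsilon>. F_eps q \<Lambda> f \<epsilon> \<Omega> (u \<epsilon>)) \<longlongrightarrow> F_lim q \<Lambda> f \<Omega> u\<^sub>0) (at_right 0))"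
proof (rule conjI, intro allI impI)
 have Sb: "\<Omega> : sets borel" using assms(1) by simp
 have Sl: "\<Omega> : sets lebesgue" using Sb by auto
 show "\<exists>u. unique_minimizer \<Omega> (F_eps q \<Lambda> f \<e> \<Omega>) (Lq q \<Omega>) u" if "\<e> > 0" for \<e>
 by (rule F_eps_minimizer[OF Sl assms(2-4) that])
next
 have Sb: "\<Omega> : sets borel" using assms(1) by simp
 have Sl: "\<Omega> : sets lebesgue" using Sb by auto
 note S = assms(1) and q = assms(2)
 define M where "M = lebesgue_on \<Omega>"
 have fL: "f : Lp q M" using assms(4) by (simp add: Lq_Lp M_def)
 define T where "T = test_fields \<Omega>"
 have T0: "T ~= {}" unfolding T_def using zero_test_field by blast
 define X where "X = Lq q \<Omega> \<inter> BV \<Omega>"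
 have FE: "F_eps q \<Lambda> f \<e> \<Omega> v = K_fun \<e> \<Omega> v + fid q \<Lambda> M f v" for v \<e>
 by (simp add: F_eps_def fidelity_def fid_def M_def)
 have FL: "F_lim q \<Lambda> f \<Omega> v = sup_lin (Jtest \<Omega>) T v + fid q \<Lambda> M f v" for v
 by (simp add: F_lim_def fidelity_def fid_def M_def T_def sup_lin_total_variation)
 \<comment> \<open>The supremum depends on a function only up to null sets, as each pairing does; so
   the representative has the same variation on \<Omega>.\<close>
 have rep: "\<exists>v\<in>Lp q lborel. v : Lp q M & (AE x in M. v x = u x) & Lpow q lborel v = Lpow q M u & sup_lin (Jtest \<Omega>) T v = sup_lin (Jtest \<Omega>) T u"
 if u: "u : Lp q M" for u
 proof -
 obtain v where v: "v : Lp q lborel" "AE x in lebesgue_on \<Omega>. v x = u x" "Lpow q lborel v = Lpow q (lebesgue_on \<Omega>) u"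
  by (rule borel_representative[OF Sb q u[unfolded M_def]])
 have "sup_lin (Jtest \<Omega>) T v = sup_lin (Jtest \<Omega>) T u" unfolding sup_lin_def T_def
  using Jtest_cong(2)[OF S q u[unfolded M_def] v(1,2)] by (intro SUP_cong) auto
 thus ?thesis using v Lp_restrict(1)[OF Sb v(1)] unfolding M_def by blast
 qed
 have ji: "integrable M (%x. u x * divergence \<phi> x)" if u: "u : Lp q M" and \<phi>: "\<phi> : T" for u \<phi>
 proof -
 obtain v where v: "v : Lp q lborel" "AE x in lebesgue_on \<Omega>. v x = u x" using rep[OF u] unfolding M_def by blast
 show ?thesis unfolding M_def by (rule Jtest_cong(1)[OF S q u[unfolded M_def] v \<phi>[unfolded T_def]])
 qed
 have TV: "total_variation \<Omega> v < \<infinity> \<longleftrightarrow> sup_lin (Jtest \<Omega>) T v < \<infinity>" for v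
 unfolding T_def sup_lin_total_variation by (auto simp: ennreal_mult_less_top)
 have main: "((%\<e>. Lpow q M (%x. u \<e> x - u0 x)) \<longlongrightarrow> 0) (at_right 0) &
  ((%\<e>. K_fun \<e> \<Omega> (u \<e>) + fid q \<Lambda> M f (u \<e>)) \<longlongrightarrow> sup_lin (Jtest \<Omega>) T u0 + fid q \<Lambda> M f u0) (at_right 0)"
 if ue: "!!\<e>. \<e> > 0 ==> unique_minimizer \<Omega> (F_eps q \<Lambda> f \<e> \<Omega>) (Lq q \<Omega>) (u \<e>)"
  and u0: "unique_minimizer \<Omega> (F_lim q \<Lambda> f \<Omega>) X u0" for u :: "real => real^'n => real" and u0
 proof (rule minimizers_converge[OF q assms(3) fL T0])
 fix \<phi> u v assume \<phi>: "\<phi> : T" and u: "u : Lp q M" and v: "v : Lp q M"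
 have "Jtest \<Omega> \<phi> (%x. (u x + v x) / 2) = 1/4 * (LINT x|M. (u x * divergence \<phi> x) / 2 + (v x * divergence \<phi> x) / 2)"
  by (simp add: Jtest_def M_def algebra_simps add_divide_distrib)
 also have "... = (Jtest \<Omega> \<phi> u + Jtest \<Omega> \<phi> v) / 2"
  using ji[OF u \<phi>] ji[OF v \<phi>] by (simp add: Jtest_def M_def[symmetric] add_divide_distrib)
 finally show "Jtest \<Omega> \<phi> (%x. (u x + v x) / 2) = (Jtest \<Omega> \<phi> u + Jtest \<Omega> \<phi> v) / 2" .
 next
 fix \<phi> u and U :: "nat => real^'n => real"
 assume \<phi>: "\<phi> : T" and u: "u : Lp q M" and U: "!!k. U k : Lp q M" and lim: "(%k. Lpow q M (%x. U k x - u x)) \<longlonglongrightarrow> 0"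
 show "(%k. Jtest \<Omega> \<phi> (U k)) \<longlonglongrightarrow> Jtest \<Omega> \<phi> u"
 proof (rule LIMSEQ_I)
  fix r :: real assume "r > 0"
  hence r: "r / 2 > 0" by simp
  obtain \<delta> where \<delta>: "\<delta> > 0" "!!w. w : Lp q M ==> Lpow q M w < \<delta> ==> \<bar>Jtest \<Omega> \<phi> w\<bar> <= r / 2"
  using Jtest_small[OF S q \<phi>[unfolded T_def] r] unfolding M_def by blast
  obtain k0 where k0: "!!k. k >= k0 ==> Lpow q M (%x. U k x - u x) < \<delta>"
  using order_tendstoD(2)[OF lim \<delta>(1)] unfolding eventually_sequentially by blast
  have "norm (Jtest \<Omega> \<phi> (U k) - Jtest \<Omega> \<phi> u) < r" if "k >= k0" for k
  proof -
  have "Jtest \<Omega> \<phi> (U k) - Jtest \<Omega> \<phi> u = Jtest \<Omega> \<phi> (%x. U k x - u x)"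
   using ji[OF U \<phi>, of k] ji[OF u \<phi>] by (simp add: Jtest_def M_def[symmetric] left_diff_distrib)
  thus ?thesis using \<delta>(2)[OF Lp_diff[OF q U u] k0[OF that]] \<open>r > 0\<close> by simp
  qed
  thus "\<exists>n0. \<forall>k\<ge>n0. norm (Jtest \<Omega> \<phi> (U k) - Jtest \<Omega> \<phi> u) < r" by blast
 qed
 next
 fix \<phi> and R \<eta> :: real assume \<phi>: "\<phi> : T" and \<eta>: "\<eta> > 0"
 have pos: "\<forall>\<^sub>F \<e> in at_right (0::real). \<e> > 0" by (simp add: eventually_at_right_less)
 show "\<forall>\<^sub>F \<e> in at_right 0. \<forall>u\<in>Lp q M. Lpow q M u <= R --> ennreal (Jtest \<Omega> \<phi> u) <= K_fun \<e> \<Omega> u + ennreal \<eta>"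
  using lower_bound[OF q S \<phi>[unfolded T_def] \<eta>, of R] pos
 proof eventually_elim
  fix \<e> :: real
  assume lb: "\<forall>u\<in>Lp q lborel. Lpow q lborel u <= R --> ennreal (1/4 * pairing u \<phi>) <= K_fun \<e> \<Omega> u + ennreal \<eta>" and e: "\<e> > 0"
  show "\<forall>u\<in>Lp q M. Lpow q M u <= R --> ennreal (Jtest \<Omega> \<phi> u) <= K_fun \<e> \<Omega> u + ennreal \<eta>"
  proof (intro ballI impI)
  fix u assume u: "u : Lp q M" and R: "Lpow q M u <= R"
  obtain v where v: "v : Lp q lborel" "v : Lp q M" "AE x in M. v x = u x" "Lpow q lborel v = Lpow q M u" using rep[OF u] by blast
  have AE': "AE x in M. u x = v x" using v(3) by (rule AE_mp) simp
  have "ennreal (Jtest \<Omega> \<phi> u) = ennreal (1/4 * pairing v \<phi>)"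
   using Jtest_cong(2)[OF S q u[unfolded M_def] v(1) v(3)[unfolded M_def] \<phi>[unfolded T_def]] Jtest_borel(2)[OF S q v(1) \<phi>[unfolded T_def]] by simp
  also have "... <= K_fun \<e> \<Omega> v + ennreal \<eta>" using lb v R by simp
  also have "K_fun \<e> \<Omega> v <= K_fun \<e> \<Omega> u" using K_fun_cong_AE[OF q Sl e] v(2) u AE' unfolding M_def by blast
  finally show "ennreal (Jtest \<Omega> \<phi> u) <= K_fun \<e> \<Omega> u + ennreal \<eta>" by (simp add: add_right_mono)
  qed
 qed
 next
 fix u and \<eta> :: real assume u: "u : Lp q M" and fin: "sup_lin (Jtest \<Omega>) T u < \<infinity>" and \<eta>: "\<eta> > 0"
 obtain u' where u': "u' : Lp q lborel" "u' : Lp q M" "AE x in M. u' x = u x" "sup_lin (Jtest \<Omega>) T u' = sup_lin (Jtest \<Omega>) T u" using rep[OF u] by blast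
 have supeq: "sup_lin (Jtest \<Omega>) T u = ennreal (1/4) * total_variation \<Omega> u'"
  by (subst u'(4)[symmetric]) (simp add: T_def sup_lin_total_variation)
 have fin': "total_variation \<Omega> u' < \<infinity>" unfolding TV u'(4) by (rule fin)
 have close: "Lpow q M (%x. v x - u x) < \<eta>" if v: "v : Lp q lborel" "Lpow q lborel (%x. v x - u' x) < \<eta>" for v
 proof -
  have vM: "v : Lp q M" unfolding M_def by (rule Lp_restrict(1)[OF Sb v(1)])
  have "Lpow q M (%x. v x - u x) = Lpow q M (%x. v x - u' x)" by (rule Lpow_cong_AE[OF q u'(2) u vM u'(3)])
  also have "... <= Lpow q lborel (%x. v x - u' x)" unfolding M_def by (rule Lp_restrict(2)[OF Sb Lp_diff[OF q v(1) u'(1)]])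
  finally show ?thesis using v(2) by simp
 qed
 show "\<exists>v\<in>Lp q M. Lpow q M (%x. v x - u x) < \<eta> & (\<forall>\<^sub>F \<e> in at_right 0. K_fun \<e> \<Omega> v <= sup_lin (Jtest \<Omega>) T u + ennreal \<eta>)"
 proof (rule recovery[OF q u'(1) S fin' \<eta>])
  fix v assume v: "v : Lp q lborel" "Lpow q lborel (%x. v x - u' x) < \<eta>"
  "\<forall>\<^sub>F \<e> in at_right 0. K_fun \<e> \<Omega> v <= ennreal (1/4) * total_variation \<Omega> u' + ennreal \<eta>"
  show ?thesis
  proof (intro bexI[of _ v] conjI close[OF v(1,2)])
  show "\<forall>\<^sub>F \<e> in at_right 0. K_fun \<e> \<Omega> v <= sup_lin (Jtest \<Omega>) T u + ennreal \<eta>"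
   using v(3) unfolding supeq .
  qed (simp add: M_def Lp_restrict(1)[OF Sb v(1)])
 qed
 show "\<exists>v\<in>X. Lpow q M (%x. v x - u x) < \<eta> & sup_lin (Jtest \<Omega>) T v <= sup_lin (Jtest \<Omega>) T u"
 proof (rule integrable_truncation[OF q u'(1) S \<eta>])
  fix v assume v: "v : Lp q lborel" "L1 v" "total_variation \<Omega> v <= total_variation \<Omega> u'" "Lpow q lborel (%x. v x - u' x) < \<eta>"
  have vm: "v : borel_fun" using v(1) by (simp add: Lp_def)
  have "integrable (lebesgue_on \<Omega>) v" unfolding integrable_lebesgue_on_iff[OF Sb vm]
  by (rule Bochner_Integration.integrable_bound[OF v(2)]) (use Sb vm in \<open>auto simp: indicator_def\<close>)
  hence "v : X" using Lp_restrict(1)[OF Sb v(1)] v(3) fin' by (simp add: X_def BV_def Lq_Lp order_le_less_trans)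
  moreover have "sup_lin (Jtest \<Omega>) T v <= sup_lin (Jtest \<Omega>) T u"
  using v(3) unfolding supeq by (simp add: T_def sup_lin_total_variation mult_left_mono)
  ultimately show ?thesis using close[OF v(1,4)] by blast
 qed
 next
 show "X <= Lp q M" by (auto simp: X_def Lq_Lp M_def)
 show "K_fun \<e> \<Omega> (%x. 0) = 0" if "\<e> > 0" for \<e> by (rule K_fun_zero[OF that])
 show "u \<e> : Lp q M" if "\<e> > 0" for \<e> using ue[OF that] by (simp add: unique_minimizer_def is_arg_min_def Lq_Lp M_def)
 show "K_fun \<e> \<Omega> (u \<e>) + fid q \<Lambda> M f (u \<e>) <= K_fun \<e> \<Omega> v + fid q \<Lambda> M f v" if "\<e> > 0" "v : Lp q M" for \<e> v
  using ue[OF that(1)] that(2) unfolding FE[symmetric] by (auto simp: unique_minimizer_def is_arg_min_def Lq_Lp M_def not_less)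
 show uX: "u0 : X" using u0 by (simp add: unique_minimizer_def is_arg_min_def)
 show "sup_lin (Jtest \<Omega>) T u0 < \<infinity>" using uX unfolding TV[symmetric] by (simp add: X_def BV_def)
 show "sup_lin (Jtest \<Omega>) T u0 + fid q \<Lambda> M f u0 <= sup_lin (Jtest \<Omega>) T v + fid q \<Lambda> M f v" if "v : X" for v
  using u0 that unfolding FL[symmetric] by (auto simp: unique_minimizer_def is_arg_min_def not_less)
 qed
 show "\<forall>u u\<^sub>0. (\<forall>\<e>>0. unique_minimizer \<Omega> (F_eps q \<Lambda> f \<e> \<Omega>) (Lq q \<Omega>) (u \<e>)) -->
  unique_minimizer \<Omega> (F_lim q \<Lambda> f \<Omega>) (Lq q \<Omega> \<inter> BV \<Omega>) u\<^sub>0 -->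
  ((%\<e>. Lq_norm q \<Omega> (%x. u \<e> x - u\<^sub>0 x)) \<longlongrightarrow> 0) (at_right 0) &
  ((%\<e>. F_eps q \<Lambda> f \<e> \<Omega> (u \<e>)) \<longlongrightarrow> F_lim q \<Lambda> f \<Omega> u\<^sub>0) (at_right 0)"
 proof (intro allI impI)
 fix u u0
 assume a: "\<forall>\<e>>0. unique_minimizer \<Omega> (F_eps q \<Lambda> f \<e> \<Omega>) (Lq q \<Omega>) (u \<e>)" "unique_minimizer \<Omega> (F_lim q \<Lambda> f \<Omega>) (Lq q \<Omega> \<inter> BV \<Omega>) u0"
 have "((%\<e>. Lpow q M (%x. u \<e> x - u0 x)) \<longlongrightarrow> 0) (at_right 0) &
  ((%\<e>. K_fun \<e> \<Omega> (u \<e>) + fid q \<Lambda> M f (u \<e>)) \<longlongrightarrow> sup_lin (Jtest \<Omega>) T u0 + fid q \<Lambda> M f u0) (at_right 0)"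
  by (rule main) (use a in \<open>auto simp: X_def\<close>)
 \<comment> \<open>The abstract result concerns the q-th power of the norm; the root is taken
   here.\<close>
 moreover from this have "((%\<e>. Lpow q M (%x. u \<e> x - u0 x) powr (1 / q)) \<longlongrightarrow> 0) (at_right 0)"
  by (intro tendsto_zero_powrI[of _ _ _ "1 / q"]) (use q in auto)
 ultimately show "((%\<e>. Lq_norm q \<Omega> (%x. u \<e> x - u0 x)) \<longlongrightarrow> 0) (at_right 0) &
  ((%\<e>. F_eps q \<Lambda> f \<e> \<Omega> (u \<e>)) \<longlongrightarrow> F_lim q \<Lambda> f \<Omega> u0) (at_right 0)"
  unfolding FE FL by (simp add: Lq_norm_def Lpow_def M_def)
 qed
qed

end
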